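(* Consider the overdamped Langevin equation $d\mathbf q_t=\mathbf b(\mathbf q_t)\,dt+\boldsymbol\sigma\,d\mathbf B_t$ in $\mathbb R^d$, where $\mathbf b\in C^\infty(\mathbb R^d;\mathbb R^d)$, with initial probability density function $\rho_0(\mathbf q)>0$ (i.e. $\mathbf q_0\sim\rho_0$, independent of $\mathbf B$). Suppose that $\boldsymbol\sigma\in\mathbb R^{d\times d}$ is constant and nonsingular, and that: (a) (local Lipschitz continuity) for any $n\in\mathbb Z^+$ there exists $K_n>0$ such that $|\mathbf b(\mathbf x)-\mathbf b(\mathbf y)|\le K_n|\mathbf x-\mathbf y|$ for all $\mathbf x,\mathbf y$ with $|\mathbf x|,|\mathbf y|\le n$; (b) (monotone condition) there exists $C>0$ such that $\mathbf x^T\mathbf b(\mathbf x)\le C(1+|\mathbf x|^2)$ for any $\mathbf x\in\mathbb R^d$. Then the following are equivalent: (i) (Reversibility) the stochastic process $(\mathbf q_t)_{t\ge0}$ is reversible; (ii) (Symmetry) for arbitrary $\varphi_1,\varphi_2\in C_b^\infty(\mathbb R^d)$, $$\int_{\mathbb R^d}(\mathcal L\varphi_1)(\mathbf q)\varphi_2(\mathbf q)\rho_0(\mathbf q)\,d\mathbf q=\int_{\mathbb R^d}(\mathcal L\varphi_2)(\mathbf q)\varphi_1(\mathbf q)\rho_0(\mathbf q)\,d\mathbf q;$$ (iii) (Zero flux) the probability flux is zero for all $t\ge0$, i.e. $\mathbf j(\rho(\cdot,t))=0$ for all $t\ge 0$; (iv) (Potential condition) there exists $U:\mathbb R^d\to\mathbb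 R$ such that $-\nabla U(\mathbf q)=2(\boldsymbol\sigma\boldsymbol\sigma^T)^{-1}\mathbf b(\mathbf q)$ and $\rho_0(\mathbf q)=\frac1Z e^{-U(\mathbf q)}$ with $Z=\int_{\mathbb R^d}e^{-U(\mathbf q)}\,d\mathbf q<\infty$.
   Context: $\mathbf B_t$ is a $d$-dimensional standard Brownian motion. The generator is $\mathcal L f=\mathbf b\cdot\nabla f+\frac12(\boldsymbol\sigma\boldsymbol\sigma^T):\nabla^2 f$. The density of $\mathbf q_t$ is $\rho(\cdot,t)$; it solves the Fokker–Planck equation $\partial_t\rho=\mathcal L^*\rho:=-\nabla\cdot(\rho\mathbf b)+\frac12\nabla^2:(\rho\boldsymbol\sigma\boldsymbol\sigma^T)$ with $\rho(\cdot,0)=\rho_0$. The probability flux is $\mathbf j(\rho):=-\frac12\nabla\cdot(\rho\boldsymbol\sigma\boldsymbol\sigma^T)+\rho\mathbf b$, so that $\partial_t\rho+\nabla\cdot\mathbf j(\rho)=0$. $C_b^\infty(\mathbb R^d)$ denotes bounded smooth functions (with bounded derivatives). A process $\{X_t\in\mathbb R^d,t\ge0\}$ is stationary if for all $\tau,t_1,\dots,t_n\in\mathbb R^+$, $n\in\mathbb Z^+$ and Borel sets $\mathcal B_j\subset\mathbb R^d$, $\mathbb P(X_{t_j}\in\mathcal B_j,1\le j\le n)=\mathbb P(X_{t_j+\tau}\in\mathcal B_j,1\le j\le n)$. A process is reversible if it is stationary and, for any $T>0$, the time-reversed process $X^*_t:=X_{T-t}$, $0\le t\le T$, has the same finite-dimensional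 distributions as $(X_t)_{0\le t\le T}$ (all components of $\mathbf q$ are even variables, so no sign changes occur under time reversal).
   Formalization: In (ii) the identity is required only for those φ1, φ2 for which both integrals exist (for unbounded b they may diverge even when (iv) holds), and in (iv) the equality ρ0 = e^{-U}/Z is required almost everywhere, since a density is determined only up to null sets. *)

theory Defs
  imports "HOL-Probability.Probability"
begin

section \<open>Differential operators on \<open>\<real>\<^sup>d\<close>\<close>

definition partial :: "'d \<Rightarrow> (real^'d \<Rightarrow> 'b::real_normed_vector) \<Rightarrow> real^'d \<Rightarrow> 'b" where
  "partial i f x = frechet_derivative f (at x) (axis i 1)"

definition grad :: "(real^'d \<Rightarrow> real) \<Rightarrow> real^'d \<Rightarrow> real^'d" where
  "grad f x = (\<chi> i. partial i f x)"

primrec iter_partial :: "'d list \<Rightarrow> (real^'d \<Rightarrow> 'b::real_normed_vector) \<Rightarrow> real^'d \<Rightarrow> 'b" where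
  "iter_partial [] f = f"
| "iter_partial (i # is) f = partial i (iter_partial is f)"

text \<open>Differentiability of all iterated partial derivatives also makes them all continuous,
  so this is the usual class \<open>C\<^sup>\<infinity>\<close>.\<close>

definition C_inf :: "(real^'d \<Rightarrow> 'b::real_normed_vector) \<Rightarrow> bool" where
  "C_inf f \<longleftrightarrow> (\<forall>is x. iter_partial is f differentiable (at x))"

text \<open>Boundedness for the empty list is boundedness of the function itself.\<close>

definition C_b_inf :: "(real^'d \<Rightarrow> 'b::real_normed_vector) \<Rightarrow> bool" where
  "C_b_inf f \<longleftrightarrow> C_inf f \<and> (\<forall>is. bounded (range (iter_partial is f)))"

definition generator ::
  "(real^'d \<Rightarrow> real^'d) \<Rightarrow> real^'d^'d \<Rightarrow> (real^'d \<Rightarrow> real) \<Rightarrow> real^'d \<Rightarrow> real" where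
  "generator b \<sigma> f x =
     b x \<bullet> grad f x +
     1/2 * (\<Sum>i\<in>UNIV. \<Sum>k\<in>UNIV. (\<sigma> ** transpose \<sigma>) $ i $ k * partial i (partial k f) x)"

text \<open>\<open>prob_flux b \<sigma> \<rho>\<close> is
  \<open>- 1/2 \<nabla> \<cdot> (\<rho> \<sigma> \<sigma>\<^sup>T) + \<rho> b\<close>, the divergence of a matrix field being
  taken row by row (the matrix is symmetric).\<close>

definition prob_flux ::
  "(real^'d \<Rightarrow> real^'d) \<Rightarrow> real^'d^'d \<Rightarrow> (real^'d \<Rightarrow> real) \<Rightarrow> real^'d \<Rightarrow> real^'d" where
  "prob_flux b \<sigma> \<rho> x =
     - (1/2) *\<^sub>R (\<chi> i. \<Sum>k\<in>UNIV. partial k (\<lambda>y. \<rho> y * (\<sigma> ** transpose \<sigma>) $ i $ k) x)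
     + \<rho> x *\<^sub>R b x"


section \<open>Brownian motion and the overdamped Langevin equation\<close>

text \<open>Processes are functions \<open>real \<Rightarrow> 'w \<Rightarrow> real^'d\<close>; only their values at times
  \<open>t \<ge> 0\<close> matter.\<close>

locale brownian_motion = prob_space M for M :: "'w measure" +
  fixes B :: "real \<Rightarrow> 'w \<Rightarrow> real^'d"
  assumes measurable_B: "\<And>t. 0 \<le> t \<Longrightarrow> B t \<in> borel_measurable M"
    and start_B: "AE \<omega> in M. B 0 \<omega> = 0"
    and indep_increments_B:
      "\<And>(n::nat) (t::nat \<Rightarrow> real). 0 \<le> t 0 \<Longrightarrow> (\<forall>i<n. t i \<le> t (Suc i)) \<Longrightarrow>
        indep_vars (\<lambda>_. borel) (\<lambda>i \<omega>. B (t (Suc i)) \<omega> - B (t i) \<omega>) {..<n}"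
    and gaussian_increments_B:
      "\<And>s t. 0 \<le> s \<Longrightarrow> s < t \<Longrightarrow>
        distributed M lborel (\<lambda>\<omega>. B t \<omega> - B s \<omega>)
          (\<lambda>x. ennreal (\<Prod>i\<in>UNIV. normal_density 0 (sqrt (t - s)) (x $ i)))"
    and continuous_B: "AE \<omega> in M. continuous_on {0..} (\<lambda>t. B t \<omega>)"

text \<open>The sigma-algebra generated by a process indexed by \<open>[0, \<infinity>)\<close>.\<close>

definition process_algebra :: "'w measure \<Rightarrow> (real \<Rightarrow> 'w \<Rightarrow> real^'d) \<Rightarrow> 'w measure" where
  "process_algebra M X =
     vimage_algebra (space M) (\<lambda>\<omega>. \<lambda>t\<in>{0..}. X t \<omega>) (Pi\<^sub>M {0..} (\<lambda>_. borel))"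

text \<open>Real densities must be required to be nonnegative, since \<open>ennreal\<close> truncates negative
  values to \<open>0\<close>.\<close>

definition has_density :: "'w measure \<Rightarrow> ('w \<Rightarrow> real^'d) \<Rightarrow> (real^'d \<Rightarrow> real) \<Rightarrow> bool" where
  "has_density M X f \<longleftrightarrow> (\<forall>x. 0 \<le> f x) \<and> distributed M lborel X (\<lambda>x. ennreal (f x))"

text \<open>Solutions of \<open>dq = b(q) dt + \<sigma> dB\<close> with \<open>q\<^sub>0\<close> independent of \<open>B\<close>. As
  \<open>\<sigma>\<close> is constant, the stochastic integral is \<open>\<sigma> B\<^sub>t\<close>.\<close>

definition langevin_solution ::
  "'w measure \<Rightarrow> (real \<Rightarrow> 'w \<Rightarrow> real^'d) \<Rightarrow> (real^'d \<Rightarrow> real^'d) \<Rightarrow> real^'d^'d \<Rightarrow>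
   (real \<Rightarrow> 'w \<Rightarrow> real^'d) \<Rightarrow> bool" where
  "langevin_solution M B b \<sigma> q \<longleftrightarrow>
     (\<forall>t\<ge>0. q t \<in> borel_measurable M) \<and>
     prob_space.indep_set M
       (sets (vimage_algebra (space M) (q 0) borel)) (sets (process_algebra M B)) \<and>
     (AE \<omega> in M. continuous_on {0..} (\<lambda>t. q t \<omega>)) \<and>
     (AE \<omega> in M. \<forall>t\<ge>0.
        q t \<omega> = q 0 \<omega> + integral {0..t} (\<lambda>s. b (q s \<omega>)) + \<sigma> *v B t \<omega>)"


section \<open>Stationarity and reversibility\<close>

definition stationary :: "'w measure \<Rightarrow> (real \<Rightarrow> 'w \<Rightarrow> real^'d) \<Rightarrow> bool" where
  "stationary M X \<longleftrightarrow>
     (\<forall>\<tau>\<ge>0. \<forall>n\<ge>1. \<forall>(t::nat \<Rightarrow> real) (S::nat \<Rightarrow> (real^'d) set).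
        (\<forall>j\<in>{1..n}. 0 \<le> t j \<and> S j \<in> sets borel) \<longrightarrow>
        measure M {\<omega>\<in>space M. \<forall>j\<in>{1..n}. X (t j) \<omega> \<in> S j} =
        measure M {\<omega>\<in>space M. \<forall>j\<in>{1..n}. X (t j + \<tau>) \<omega> \<in> S j})"

definition reversible :: "'w measure \<Rightarrow> (real \<Rightarrow> 'w \<Rightarrow> real^'d) \<Rightarrow> bool" where
  "reversible M X \<longleftrightarrow>
     stationary M X \<and>
     (\<forall>T>0. \<forall>n\<ge>1. \<forall>(t::nat \<Rightarrow> real) (S::nat \<Rightarrow> (real^'d) set).
        (\<forall>j\<in>{1..n}. 0 \<le> t j \<and> t j \<le> T \<and> S j \<in> sets borel) \<longrightarrow>
        measure M {\<omega>\<in>space M. \<forall>j\<in>{1..n}. X (T - t j) \<omega> \<in> S j} =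
        measure M {\<omega>\<in>space M. \<forall>j\<in>{1..n}. X (t j) \<omega> \<in> S j})"


section \<open>Symmetry, zero flux and the potential condition\<close>

text \<open>The drift may be unbounded, so for arbitrary \<open>C_b_inf\<close> functions the two integrals need
  not exist, even for a reversible process: take \<open>d = 1\<close>, \<open>\<sigma> = 1\<close>,
  \<open>\<rho>\<^sub>0\<close> proportional to \<open>(2 + sin (x^2)) / (1 + x^2)\<close>,
  \<open>b = (ln \<rho>\<^sub>0)' / 2\<close>, \<open>\<phi>\<^sub>1 = sin\<close>, and \<open>\<phi>\<^sub>2\<close> a
  smooth transition from \<open>0\<close> to \<open>1\<close>: the first integrand is not integrable, while the
  second one is, in general with nonzero integral. The identity is therefore stated
  for all pairs for which both integrals exist; this comprises all pairs with one function
  of compact support and the other one arbitrary.\<close>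

definition symmetric_wrt ::
  "(real^'d \<Rightarrow> real^'d) \<Rightarrow> real^'d^'d \<Rightarrow> (real^'d \<Rightarrow> real) \<Rightarrow> bool" where
  "symmetric_wrt b \<sigma> \<rho>0 \<longleftrightarrow>
     (\<forall>\<phi>1 \<phi>2. C_b_inf \<phi>1 \<and> C_b_inf \<phi>2 \<and>
        integrable lborel (\<lambda>x. generator b \<sigma> \<phi>1 x * \<phi>2 x * \<rho>0 x) \<and>
        integrable lborel (\<lambda>x. generator b \<sigma> \<phi>2 x * \<phi>1 x * \<rho>0 x) \<longrightarrow>
        (\<integral>x. generator b \<sigma> \<phi>1 x * \<phi>2 x * \<rho>0 x \<partial>lborel) =
        (\<integral>x. generator b \<sigma> \<phi>2 x * \<phi>1 x * \<rho>0 x \<partial>lborel))"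

text \<open>A density is determined only almost everywhere, and the flux of \<open>\<rho>(\<cdot>, t)\<close> refers to
  its differentiable version, which is unique because differentiable functions that agree almost
  everywhere are equal.\<close>

definition zero_flux ::
  "'w measure \<Rightarrow> (real^'d \<Rightarrow> real^'d) \<Rightarrow> real^'d^'d \<Rightarrow> (real \<Rightarrow> 'w \<Rightarrow> real^'d) \<Rightarrow> bool" where
  "zero_flux M b \<sigma> q \<longleftrightarrow>
     (\<exists>\<rho>::real^'d \<Rightarrow> real \<Rightarrow> real. \<forall>t\<ge>0.
        has_density M (q t) (\<lambda>x. \<rho> x t) \<and>
        (\<forall>x. (\<lambda>y. \<rho> y t) differentiable (at x)) \<and>
        (\<forall>x. prob_flux b \<sigma> (\<lambda>y. \<rho> y t) x = 0))"

text \<open>For the same reason, the density \<open>\<rho>\<^sub>0\<close> is identified with the Gibbs density almost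
  everywhere; if \<open>\<rho>\<^sub>0\<close> is continuous, this is equality at every point.\<close>

definition potential_condition ::
  "(real^'d \<Rightarrow> real^'d) \<Rightarrow> real^'d^'d \<Rightarrow> (real^'d \<Rightarrow> real) \<Rightarrow> bool" where
  "potential_condition b \<sigma> \<rho>0 \<longleftrightarrow>
     (\<exists>U::real^'d \<Rightarrow> real.
        (\<forall>x. U differentiable (at x)) \<and>
        (\<forall>x. - grad U x = 2 *\<^sub>R (matrix_inv (\<sigma> ** transpose \<sigma>) *v b x)) \<and>
        integrable lborel (\<lambda>x. exp (- U x)) \<and>
        (AE x in lborel. \<rho>0 x = 1 / (\<integral>y. exp (- U y) \<partial>lborel) * exp (- U x)))"

end

(* The proof runs through the weak zero-flux equation
     int (2 b_i phi + (sigma sigma^T grad phi)_i) rho_0 = 0   for all test functions phi.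
   Given it, radial test functions show that v = 2 (sigma sigma^T)^{-1} b is curl free, so v = - grad U
   by integration along rays, and rho_0 e^U has weak gradient zero, hence is constant almost everywhere.
   Symmetry implies the equation by testing against sin and cos of the coordinates, and a pointwise zero
   flux is the linear equation grad rho_0 = rho_0 v.
   Reversibility implies it because E F(q_0, q_t) = 0 for the antisymmetric function
     F(x, y) = (y_i - x_i) (phi(x) + phi(y))   (coordinates clipped),
   while the left-hand side is t times the weak expression up to o(t): a dyadic chaining bound makes the
   event that B is not small on [0, t] have probability O(t^2), so no Ito formula is needed.
   Conversely, for the Gibbs density the law of the Euler scheme has an explicit density, whose ratio to
   its time reversal consists of trapezoidal errors and tends to 1; since the noise is additive, the
   scheme converges pathwise, and reversibility passes to the limit. *)

theory Submission
  imports Defs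
begin

section \<open>Smooth functions\<close>

text \<open>The drift is controlled only on bounded sets and no moments of the process are
  available, so estimates live on balls: test functions have compact support or are clipped, and
  paths leaving a ball are handled by compactness of a continuous path. The curl vanishes because
  testing with \<open>v $ l * \<phi>\<close> and with \<open>partial k \<phi>\<close> writes the
  integral of \<open>partial k v $ l * \<phi>\<close> against the density by terms symmetric in k
  and l. In the reversed Euler scheme the Gaussian kernels contribute the mean of
  \<open>log_gradient\<close> at both ends of a step, paired with the step, while the Gibbs weights
  at the ends of the path telescope into increments of \<open>U\<close>; together this is the
  trapezoidal error for \<open>U\<close>, of third order in a step of size
  \<open>sqrt \<delta>\<close>, plus \<open>\<delta>\<close> times an increment of a smooth
  function. Over N steps this is of order T * sqrt (T / N), small without any cancellation between
  steps. A one-sided inequality suffices in the limit, as reversal is an involution, and two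
  reversals with different horizons compose to a time shift, which gives stationarity.\<close>

lemma partial_eqI: "(f has_derivative f') (at x) \<Longrightarrow> partial i f x = f' (axis i 1)"
  unfolding partial_def by (metis frechet_derivative_at)

lemma frechet_derivative_eq_partials:
  fixes f :: "real^'d \<Rightarrow> 'b::real_normed_vector"
  assumes "f differentiable (at x)"
  shows "frechet_derivative f (at x) h = (\<Sum>i\<in>UNIV. (h $ i) *\<^sub>R partial i f x)"
proof -
  interpret linear "frechet_derivative f (at x)"
    using assms by (rule linear_frechet_derivative)
  have "h = (\<Sum>i\<in>UNIV. (h $ i) *\<^sub>R axis i 1)"
    by (metis (no_types, lifting) basis_expansion scalar_mult_eq_scaleR sum.cong)
  then have "frechet_derivative f (at x) h = frechet_derivative f (at x) (\<Sum>i\<in>UNIV. (h $ i) *\<^sub>R axis i 1)"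
    by simp
  then show ?thesis by (simp add: sum scale partial_def)
qed

lemma has_derivative_partials:
  fixes f :: "real^'d \<Rightarrow> 'b::real_normed_vector"
  assumes "f differentiable (at x)"
  shows "(f has_derivative (\<lambda>h. \<Sum>i\<in>UNIV. (h $ i) *\<^sub>R partial i f x)) (at x)"
  using assms frechet_derivative_eq_partials[OF assms]
  by (metis (no_types, lifting) ext frechet_derivative_works)

lemma has_vector_derivative_line:
  fixes f :: "real^'d \<Rightarrow> 'b::real_normed_vector"
  assumes "f differentiable (at (x + s *\<^sub>R h))"
  shows "((\<lambda>s. f (x + s *\<^sub>R h)) has_vector_derivative
          (\<Sum>i\<in>UNIV. (h $ i) *\<^sub>R partial i f (x + s *\<^sub>R h))) (at s)"
proof -
  have "((\<lambda>s. x + s *\<^sub>R h) has_vector_derivative h) (at s)"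
    by (auto intro!: derivative_eq_intros)
  then have "((\<lambda>s. x + s *\<^sub>R h) has_derivative (\<lambda>r. r *\<^sub>R h)) (at s)"
    by (simp add: has_vector_derivative_def)
  from diff_chain_at[OF this has_derivative_partials[OF assms]]
  show ?thesis
    by (simp add: has_vector_derivative_def o_def scaleR_sum_right)
qed

lemma has_real_derivative_line:
  fixes f :: "real^'d \<Rightarrow> real"
  assumes "f differentiable (at (x + s *\<^sub>R h))"
  shows "((\<lambda>s. f (x + s *\<^sub>R h)) has_real_derivative
          (\<Sum>i\<in>UNIV. h $ i * partial i f (x + s *\<^sub>R h))) (at s)"
  using has_vector_derivative_line[OF assms]
  by (simp add: has_real_derivative_iff_has_vector_derivative)

lemma partial_const [simp]: "partial i (\<lambda>x. c) = (\<lambda>x. 0)"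
  by (rule ext, rule partial_eqI[where f' = "\<lambda>_. 0"]) auto

lemma partial_add:
  "f differentiable (at x) \<Longrightarrow> g differentiable (at x) \<Longrightarrow>
   partial i (\<lambda>x. f x + g x) x = partial i f x + partial i g x"
  by (subst partial_eqI[OF has_derivative_add]) (auto simp: frechet_derivative_works partial_def)

lemma partial_bounded_linear:
  "bounded_linear T \<Longrightarrow> f differentiable (at x) \<Longrightarrow>
   partial i (\<lambda>x. T (f x)) x = T (partial i f x)"
  by (subst partial_eqI[OF bounded_linear.has_derivative])
     (auto simp: frechet_derivative_works partial_def)

lemma partial_mult:
  fixes f g :: "real^'d \<Rightarrow> real"
  shows "f differentiable (at x) \<Longrightarrow> g differentiable (at x) \<Longrightarrow>
   partial i (\<lambda>x. f x * g x) x = partial i f x * g x + f x * partial i g x"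
  by (subst partial_eqI[OF has_derivative_mult]) (auto simp: frechet_derivative_works partial_def)

lemma partial_compose:
  fixes f :: "real^'d \<Rightarrow> real"
  assumes "f differentiable (at x)" "(g has_real_derivative g') (at (f x))"
  shows "partial i (\<lambda>x. g (f x)) x = g' * partial i f x"
proof -
  have "(f has_derivative frechet_derivative f (at x)) (at x)"
    using assms(1) by (simp add: frechet_derivative_works)
  from has_derivative_compose[OF this has_field_derivative_imp_has_derivative[OF assms(2)]]
  show ?thesis by (subst partial_eqI) (auto simp: partial_def)
qed

lemma partial_nth: "partial i (\<lambda>x. x $ k) x = (if i = k then 1 else 0)"
  by (subst partial_eqI[where f' = "\<lambda>h. h $ k"])
     (auto intro!: bounded_linear_imp_has_derivative bounded_linear_vec_nth simp: axis_def)

section \<open>Closure properties of smooth functions\<close>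

lemma iter_partial_append: "iter_partial (is @ [i]) f = iter_partial is (partial i f)"
  by (induction "is") auto

text \<open>The recursion peels off the innermost derivative: \<open>partial i f\<close> is again a
  function of the same kind, so closure under sums, products and composition is an induction on
  \<open>n\<close> with \<open>f\<close> generalised. An argument on index lists would need an
  iterated Leibniz formula.\<close>

fun ntimes_diff :: "nat \<Rightarrow> (real^'d \<Rightarrow> 'b::real_normed_vector) \<Rightarrow> bool" where
  "ntimes_diff 0 f = True"
| "ntimes_diff (Suc n) f = ((\<forall>x. f differentiable (at x)) \<and> (\<forall>i. ntimes_diff n (partial i f)))"

lemma ntimes_diff_iff:
  "ntimes_diff n f \<longleftrightarrow> (\<forall>is x. length is < n \<longrightarrow> iter_partial is f differentiable (at x))"
proof (induction n arbitrary: f)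
  case (Suc n)
  have "(\<forall>is x. length is < Suc n \<longrightarrow> iter_partial is f differentiable (at x)) \<longleftrightarrow>
    (\<forall>x. f differentiable (at x)) \<and>
    (\<forall>i is x. length is < n \<longrightarrow> iter_partial is (partial i f) differentiable (at x))"
    (is "?L \<longleftrightarrow> ?R")
  proof
    assume L: ?L
    show ?R
    proof (intro conjI allI impI)
      fix x show "f differentiable (at x)" using L[rule_format, of "[]" x] by simp
    next
      fix i "is" x assume "length (is :: 'a list) < n"
      then show "iter_partial is (partial i f) differentiable (at x)"
        using L[rule_format, of "is @ [i]" x] by (simp add: iter_partial_append)
    qed
  next
    assume R: ?R
    show ?L
    proof (intro allI impI)
      fix "is" :: "'a list" and x assume l: "length is < Suc n"
      show "iter_partial is f differentiable (at x)"
      proof (cases "is" rule: rev_cases)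
        case Nil then show ?thesis using R by simp
      next
        case (snoc js j) then show ?thesis using R l by (simp add: iter_partial_append)
      qed
    qed
  qed
  then show ?case by (simp only: ntimes_diff.simps Suc.IH)
qed auto

lemma C_inf_iff: "C_inf f \<longleftrightarrow> (\<forall>n. ntimes_diff n f)"
  unfolding C_inf_def ntimes_diff_iff by auto

lemma C_inf_differentiable: "C_inf f \<Longrightarrow> f differentiable (at x)"
  unfolding C_inf_def by (metis iter_partial.simps(1))

lemma C_inf_partial: "C_inf f \<Longrightarrow> C_inf (partial i f)"
  unfolding C_inf_iff by (metis ntimes_diff.simps(2))

lemma C_infI: "(\<And>x. f differentiable (at x)) \<Longrightarrow> (\<And>i. C_inf (partial i f)) \<Longrightarrow> C_inf f"
  unfolding C_inf_iff by (metis ntimes_diff.elims(3) ntimes_diff.simps(2))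

lemma C_inf_continuous: "C_inf f \<Longrightarrow> continuous_on S f"
  by (metis C_inf_differentiable continuous_at_imp_continuous_on differentiable_imp_continuous_within)

lemma ntimes_diff_Suc: "ntimes_diff (Suc n) f \<Longrightarrow> ntimes_diff n f"
  unfolding ntimes_diff_iff by auto

lemma ntimes_diff_SucI:
  "(\<And>x. f differentiable (at x)) \<Longrightarrow> (\<And>i. ntimes_diff n (partial i f)) \<Longrightarrow> ntimes_diff (Suc n) f"
  by simp

lemma ntimes_diff_SucD:
  assumes "ntimes_diff (Suc n) f"
  shows "f differentiable (at x)" "ntimes_diff n (partial i f)"
  using assms by simp_all

lemma ntimes_diff_const: "ntimes_diff n (\<lambda>x. c)"
  by (induction n arbitrary: c) auto

lemma ntimes_diff_add: "ntimes_diff n f \<Longrightarrow> ntimes_diff n g \<Longrightarrow> ntimes_diff n (\<lambda>x. f x + g x)"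
proof (induction n arbitrary: f g)
  case (Suc n)
  note D = ntimes_diff_SucD[OF Suc.prems(1)] ntimes_diff_SucD[OF Suc.prems(2)]
  have eq: "partial i (\<lambda>x. f x + g x) = (\<lambda>x. partial i f x + partial i g x)" for i
    by (intro ext partial_add D)
  show ?case
    by (rule ntimes_diff_SucI, intro differentiable_add D, unfold eq, intro Suc.IH D)
qed simp

lemma ntimes_diff_bounded_linear:
  assumes T: "bounded_linear T"
  shows "ntimes_diff n f \<Longrightarrow> ntimes_diff n (\<lambda>x. T (f x))"
proof (induction n arbitrary: f)
  case (Suc n)
  note D = ntimes_diff_SucD[OF Suc.prems(1)]
  have eq: "partial i (\<lambda>x. T (f x)) = (\<lambda>x. T (partial i f x))" for i
    by (intro ext partial_bounded_linear D T)
  have "(\<lambda>x. T (f x)) differentiable (at x)" for x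
    using D(1) by (metis T bounded_linear.has_derivative differentiable_def)
  then show ?case
    by (rule ntimes_diff_SucI, unfold eq, intro Suc.IH D)
qed simp

lemma ntimes_diff_mult:
  fixes f g :: "real^'d \<Rightarrow> real"
  shows "ntimes_diff n f \<Longrightarrow> ntimes_diff n g \<Longrightarrow> ntimes_diff n (\<lambda>x. f x * g x)"
proof (induction n arbitrary: f g)
  case (Suc n)
  note D = ntimes_diff_SucD[OF Suc.prems(1)] ntimes_diff_SucD[OF Suc.prems(2)]
  have eq: "partial i (\<lambda>x. f x * g x) = (\<lambda>x. partial i f x * g x + f x * partial i g x)" for i
    by (intro ext partial_mult D)
  \<comment> \<open>The product rule leaves one factor undifferentiated, so each factor is also
    needed at the lower order \<open>n\<close>.\<close>
  have fg: "ntimes_diff n f" "ntimes_diff n g"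
    using Suc.prems by (blast intro: ntimes_diff_Suc)+
  show ?case
  proof (rule ntimes_diff_SucI)
    show "(\<lambda>x. f x * g x) differentiable (at x)" for x
      by (rule differentiable_mult[OF D(1) D(3)])
    show "ntimes_diff n (partial i (\<lambda>x. f x * g x))" for i
      unfolding eq by (rule ntimes_diff_add[OF Suc.IH[OF D(2) fg(2)] Suc.IH[OF fg(1) D(4)]])
  qed
qed simp

text \<open>The sequence \<open>g\<close> lists a function of one variable and its successive derivatives.\<close>

lemma ntimes_diff_compose:
  fixes f :: "real^'d \<Rightarrow> real" and g :: "nat \<Rightarrow> real \<Rightarrow> real"
  assumes g: "\<And>k t. (g k has_real_derivative g (Suc k) t) (at t)"
  shows "ntimes_diff n f \<Longrightarrow> ntimes_diff n (\<lambda>x. g k (f x))"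
proof (induction n arbitrary: k)
  case (Suc n)
  note D = ntimes_diff_SucD[OF Suc.prems(1)]
  have eq: "partial i (\<lambda>x. g k (f x)) = (\<lambda>x. g (Suc k) (f x) * partial i f x)" for i
    by (intro ext partial_compose g D)
  have "(\<lambda>x. g k (f x)) differentiable (at x)" for x
    using differentiable_chain_at[OF D(1), of "g k"] g[of k]
    by (metis (no_types, lifting) ext comp_apply real_differentiable_def)
  then show ?case
    by (rule ntimes_diff_SucI, unfold eq,
        intro ntimes_diff_mult Suc.IH D Suc.prems[THEN ntimes_diff_Suc])
qed simp

lemma C_inf_const: "C_inf (\<lambda>x. c)"
  by (simp add: C_inf_iff ntimes_diff_const)

lemma C_inf_add: "C_inf f \<Longrightarrow> C_inf g \<Longrightarrow> C_inf (\<lambda>x. f x + g x)"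
  by (simp add: C_inf_iff ntimes_diff_add)

lemma C_inf_mult:
  fixes f g :: "real^'d \<Rightarrow> real"
  shows "C_inf f \<Longrightarrow> C_inf g \<Longrightarrow> C_inf (\<lambda>x. f x * g x)"
  by (simp add: C_inf_iff ntimes_diff_mult)

lemma C_inf_bounded_linear: "bounded_linear T \<Longrightarrow> C_inf f \<Longrightarrow> C_inf (\<lambda>x. T (f x))"
  by (simp add: C_inf_iff ntimes_diff_bounded_linear)

lemma C_inf_compose:
  fixes f :: "real^'d \<Rightarrow> real" and g :: "nat \<Rightarrow> real \<Rightarrow> real"
  shows "(\<And>k t. (g k has_real_derivative g (Suc k) t) (at t)) \<Longrightarrow> C_inf f \<Longrightarrow> C_inf (\<lambda>x. g k (f x))"
  by (simp add: C_inf_iff ntimes_diff_compose)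

lemma C_inf_minus: "C_inf f \<Longrightarrow> C_inf (\<lambda>x. - f x)"
  by (rule C_inf_bounded_linear[OF bounded_linear_minus[OF bounded_linear_ident]])

lemma C_inf_diff: "C_inf f \<Longrightarrow> C_inf g \<Longrightarrow> C_inf (\<lambda>x. f x - g x)"
  using C_inf_add[OF _ C_inf_minus] by fastforce

lemma C_inf_sum: "(\<And>i. i \<in> A \<Longrightarrow> C_inf (f i)) \<Longrightarrow> C_inf (\<lambda>x. \<Sum>i\<in>A. f i x)"
  by (induction A rule: infinite_finite_induct) (auto intro: C_inf_const C_inf_add)

lemma C_inf_prod:
  fixes f :: "'a \<Rightarrow> real^'d \<Rightarrow> real"
  shows "(\<And>i. i \<in> A \<Longrightarrow> C_inf (f i)) \<Longrightarrow> C_inf (\<lambda>x. \<Prod>i\<in>A. f i x)"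
  by (induction A rule: infinite_finite_induct) (auto intro: C_inf_const C_inf_mult)

lemma C_inf_nth: "C_inf f \<Longrightarrow> C_inf (\<lambda>x. f x $ i)"
  by (rule C_inf_bounded_linear[OF bounded_linear_vec_nth])

lemma C_inf_coordinate: "C_inf (\<lambda>x::real^'d. x $ i)"
  by (rule C_infI) (auto simp: partial_nth[abs_def] intro: C_inf_const
      bounded_linear_imp_differentiable bounded_linear_vec_nth)

lemma C_inf_exp:
  fixes f :: "real^'d \<Rightarrow> real"
  shows "C_inf f \<Longrightarrow> C_inf (\<lambda>x. exp (f x))"
  using C_inf_compose[where g = "\<lambda>_. exp"] by (auto intro!: derivative_eq_intros)

lemmas C_inf_intros =
  C_inf_const C_inf_add C_inf_mult C_inf_minus C_inf_diff C_inf_sum C_inf_prod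
  C_inf_nth C_inf_coordinate C_inf_exp C_inf_partial

section \<open>A flat function as the source of all cut-offs\<close>

lemma tendsto_poly_exp_minus: "((\<lambda>u. poly p u * exp (- u)) \<longlongrightarrow> 0) (at_top :: real filter)"
proof -
  have "((\<lambda>u. \<Sum>i\<le>degree p. coeff p i * (u ^ i / exp u)) \<longlongrightarrow> (\<Sum>i\<le>degree p. coeff p i * 0)) at_top"
    by (intro tendsto_intros tendsto_power_div_exp_0)
  then show ?thesis
    by (simp add: poly_altdef sum_distrib_right exp_minus divide_inverse mult.assoc)
qed

text \<open>With u = 1 / t, the derivative in t of p(u) exp(-u) is u^2 (p(u) - p'(u)) exp(-u), since
  du/dt = - u^2. The factor \<open>[:0, 0, 1:]\<close> is u^2.\<close>

primrec flat_poly :: "nat \<Rightarrow> real poly" where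
  "flat_poly 0 = 1"
| "flat_poly (Suc k) = [:0, 0, 1:] * (flat_poly k - pderiv (flat_poly k))"

text \<open>\<open>flat_exp k\<close> is the \<open>k\<close>-th derivative of the flat function that equals \<open>exp (- 1 / t)\<close> for
  positive \<open>t\<close> and vanishes elsewhere.\<close>

definition flat_exp :: "nat \<Rightarrow> real \<Rightarrow> real" where
  "flat_exp k t = (if t > 0 then poly (flat_poly k) (1 / t) * exp (- 1 / t) else 0)"

text \<open>Away from 0 the defining formula holds in a neighbourhood and can be differentiated. At
  0 the difference quotient is examined from both sides; from the right it is a polynomial in u = 1
  / h times exp(-u), with u tending to infinity.\<close>

lemma DERIV_flat: "(flat_exp k has_real_derivative flat_exp (Suc k) t) (at t)"
proof (cases "t = 0")
  case False
  show ?thesis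
  proof (cases "t > 0")
    case True
    have "((\<lambda>t. poly (flat_poly k) (1 / t) * exp (- 1 / t)) has_real_derivative flat_exp (Suc k) t) (at t)"
      using True
      by (auto intro!: derivative_eq_intros simp: flat_exp_def field_simps power2_eq_square)
    moreover have "eventually (\<lambda>x. x \<in> {0<..}) (nhds t)"
      using True by (intro eventually_nhds_in_open) auto
    then have "eventually (\<lambda>x. flat_exp k x = poly (flat_poly k) (1 / x) * exp (- 1 / x)) (nhds t)"
      by eventually_elim (simp add: flat_exp_def)
    ultimately show ?thesis by (subst DERIV_cong_ev[OF refl _ refl])
  next
    case False
    with \<open>t \<noteq> 0\<close> have t: "t < 0" by simp
    have "eventually (\<lambda>x. x \<in> {..<0}) (nhds t)"
      using t by (intro eventually_nhds_in_open) auto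
    then have "eventually (\<lambda>x. flat_exp k x = 0) (nhds t)"
      by eventually_elim (simp add: flat_exp_def)
    then have "(flat_exp k has_real_derivative 0) (at t)"
      by (subst DERIV_cong_ev[OF refl _ refl]) auto
    then show ?thesis using t by (simp add: flat_exp_def)
  qed
next
  case True
  have R: "((\<lambda>h. flat_exp k h / h) \<longlongrightarrow> 0) (at_right 0)"
  proof -
    \<comment> \<open>\<open>pCons 0\<close> multiplies the polynomial by u; this accounts for the
      division by h = 1 / u.\<close>
    have "((\<lambda>u. poly (pCons 0 (flat_poly k)) u * exp (- u)) \<longlongrightarrow> 0) at_top"
      by (rule tendsto_poly_exp_minus)
    then have "((\<lambda>h. poly (pCons 0 (flat_poly k)) (inverse h) * exp (- inverse h)) \<longlongrightarrow> 0) (at_right 0)"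
      by (rule filterlim_compose[OF _ filterlim_inverse_at_top_right])
    then show ?thesis
      by (rule Lim_transform_eventually)
         (auto simp: eventually_at_right_field flat_exp_def field_simps intro!: exI[of _ 1])
  qed
  have L: "((\<lambda>h. flat_exp k h / h) \<longlongrightarrow> 0) (at_left 0)"
    by (rule Lim_transform_eventually[OF tendsto_const])
       (auto simp: eventually_at_left_field flat_exp_def intro!: exI[of _ "-1"])
  have "((\<lambda>h. flat_exp k h / h) \<longlongrightarrow> 0) (at 0)"
    using L R by (simp add: filterlim_split_at_real)
  then have "(flat_exp k has_real_derivative 0) (at 0)"
    by (simp add: has_field_derivative_iff flat_exp_def)
  then show ?thesis using True by (simp add: flat_exp_def)
qed

lemma flat_0: "flat_exp 0 t = (if t > 0 then exp (- 1 / t) else 0)"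
  by (simp add: flat_exp_def)

lemma flat_bounds: "0 \<le> flat_exp 0 t" "flat_exp 0 t \<le> 1"
  by (auto simp: flat_0)

lemma flat_pos: "flat_exp 0 t > 0 \<longleftrightarrow> t > 0"
  by (simp add: flat_0)

lemma flat_nonpos: "t \<le> 0 \<Longrightarrow> flat_exp k t = 0"
  by (simp add: flat_exp_def)

lemma continuous_on_flat: "continuous_on S (flat_exp k)"
  using DERIV_flat[of k] DERIV_continuous continuous_at_imp_continuous_on by blast

lemma flat_mono: "s \<le> t \<Longrightarrow> flat_exp 0 s \<le> flat_exp 0 t"
  by (auto simp: flat_0 field_simps)

text \<open>A one-sided range is enough because the cut-offs insert arguments of the form 1 minus a
  square. Negative arguments give 0, and the rest is a compact interval.\<close>

lemma flat_bounded_above: "\<exists>C. \<forall>t\<le>1. \<bar>flat_exp k t\<bar> \<le> C"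
proof -
  have "compact (flat_exp k ` {0..1})"
    by (intro compact_continuous_image continuous_on_flat) auto
  then obtain C where C: "\<And>t. t \<in> {0..1} \<Longrightarrow> \<bar>flat_exp k t\<bar> \<le> C"
    by (metis bounded_iff compact_imp_bounded imageI real_norm_def)
  have "\<bar>flat_exp k t\<bar> \<le> C" if "t \<le> 1" for t
    using that C[of t] C[of 0] by (cases "t \<le> 0") (auto simp: flat_nonpos)
  then show ?thesis by blast
qed

lemma C_inf_flat: "C_inf f \<Longrightarrow> C_inf (\<lambda>x. flat_exp k (f x))" for f :: "real^'d \<Rightarrow> real"
  using C_inf_compose[of flat_exp] DERIV_flat by blast

lemma C_inf_norm_sq: "C_inf (\<lambda>x::real^'d. (norm (x - c))\<^sup>2)"
proof -
  have "(\<lambda>x::real^'d. (norm (x - c))\<^sup>2) = (\<lambda>x. \<Sum>i\<in>UNIV. (x $ i - c $ i) * (x $ i - c $ i))"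
    by (auto simp: power2_norm_eq_inner inner_vec_def)
  then show ?thesis by (simp add: C_inf_intros)
qed

section \<open>Bounds, Lipschitz constants and Taylor remainders\<close>

lemma partial_vanishing:
  fixes f :: "real^'d \<Rightarrow> 'b::real_normed_vector"
  assumes "\<And>x. norm x > R \<Longrightarrow> f x = 0" "norm x > R"
  shows "partial i f x = 0"
proof -
  have "((\<lambda>x. 0) has_derivative (\<lambda>h. 0)) (at x)" by simp
  moreover have "open {x::real^'d. norm x > R}"
    by (intro open_Collect_less continuous_intros)
  ultimately have "(f has_derivative (\<lambda>h. 0)) (at x)"
    by (rule has_derivative_transform_within_open) (use assms in auto)
  then show ?thesis by (rule partial_eqI)
qed

lemma C_inf_bounded_on_cball:
  fixes f :: "real^'d \<Rightarrow> 'b::real_normed_vector"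
  assumes "C_inf f"
  shows "\<exists>K\<ge>0. \<forall>x. norm x \<le> R \<longrightarrow> norm (f x) \<le> K"
proof -
  have "compact (f ` cball 0 R)"
    by (intro compact_continuous_image C_inf_continuous assms) auto
  then obtain K where "\<And>x. x \<in> cball 0 R \<Longrightarrow> norm (f x) \<le> K"
    by (metis bounded_iff compact_imp_bounded imageI)
  then show ?thesis by (intro exI[of _ "max 0 K"]) (auto simp: le_max_iff_disj)
qed

lemma C_inf_bounded_vanishing:
  fixes f :: "real^'d \<Rightarrow> 'b::real_normed_vector"
  assumes "C_inf f" "\<And>x. norm x > R \<Longrightarrow> f x = 0"
  shows "\<exists>K\<ge>0. \<forall>x. norm (f x) \<le> K"
  using C_inf_bounded_on_cball[OF assms(1), of R] assms(2)
  by (metis linorder_not_le norm_zero)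

lemma C_b_inf_vanishing:
  fixes f :: "real^'d \<Rightarrow> 'b::real_normed_vector"
  assumes "C_inf f" "\<And>x. norm x > R \<Longrightarrow> f x = 0"
  shows "C_b_inf f"
proof -
  have "C_inf (iter_partial is f) \<and> (\<forall>x. norm x > R \<longrightarrow> iter_partial is f x = 0)" for "is"
    by (induction "is") (use assms in \<open>auto intro: C_inf_partial partial_vanishing\<close>)
  then have "bounded (range (iter_partial is f))" for "is"
    using C_inf_bounded_vanishing[of "iter_partial is f" R] by (auto simp: bounded_iff)
  then show ?thesis using assms by (simp add: C_b_inf_def)
qed

lemma mvt_line:
  fixes f :: "real^'d \<Rightarrow> real"
  assumes "\<And>x. f differentiable (at x)"
  shows "\<exists>s. 0 < s \<and> s < 1 \<and> f (x + h) - f x = (\<Sum>i\<in>UNIV. h $ i * partial i f (x + s *\<^sub>R h))"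
  using MVT2[of 0 1 "\<lambda>s. f (x + s *\<^sub>R h)", OF zero_less_one has_real_derivative_line[OF assms]]
  by auto

lemma abs_sum_component_le:
  fixes h :: "real^'d"
  assumes "\<And>i. \<bar>c i\<bar> \<le> K"
  shows "\<bar>\<Sum>i\<in>UNIV. h $ i * c i\<bar> \<le> real CARD('d) * K * norm h"
proof -
  have "\<bar>\<Sum>i\<in>UNIV. h $ i * c i\<bar> \<le> (\<Sum>i\<in>(UNIV::'d set). norm h * K)"
    using component_le_norm_cart[of h] assms
    by (intro order_trans[OF sum_abs] sum_mono) (auto simp: abs_mult intro!: mult_mono)
  then show ?thesis by (simp add: mult_ac)
qed

lemma norm_segment_le:
  fixes x h :: "'a::real_normed_vector"
  assumes "norm x \<le> R" "norm (x + h) \<le> R" "0 \<le> s" "s \<le> 1"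
  shows "norm (x + s *\<^sub>R h) \<le> R"
proof -
  have "x + s *\<^sub>R h = (1 - s) *\<^sub>R x + s *\<^sub>R (x + h)"
    by (simp add: algebra_simps)
  also have "norm \<dots> \<le> (1 - s) * R + s * R"
    using assms by (intro order_trans[OF norm_triangle_ineq]) (auto intro!: add_mono mult_left_mono)
  finally show ?thesis by (simp add: algebra_simps)
qed

lemma C_inf_lipschitz_on_cball:
  fixes f :: "real^'d \<Rightarrow> real"
  assumes "C_inf f"
  shows "\<exists>L\<ge>0. \<forall>x h. norm x \<le> R \<longrightarrow> norm (x + h) \<le> R \<longrightarrow> \<bar>f (x + h) - f x\<bar> \<le> L * norm h"
proof -
  have "\<forall>i. \<exists>K\<ge>0. \<forall>x. norm x \<le> R \<longrightarrow> norm (partial i f x) \<le> K"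
    using C_inf_bounded_on_cball C_inf_partial assms by blast
  then obtain K where K: "\<And>i. K i \<ge> 0" "\<And>i x. norm x \<le> R \<Longrightarrow> \<bar>partial i f x\<bar> \<le> K i"
    by (metis real_norm_def)
  define L where "L = real CARD('d) * (\<Sum>i\<in>UNIV. K i)"
  have K': "\<bar>partial i f x\<bar> \<le> (\<Sum>i\<in>UNIV. K i)" if "norm x \<le> R" for i x
    by (rule order_trans[OF K(2)[OF that]], rule member_le_sum) (auto simp: K(1))
  have "\<bar>f (x + h) - f x\<bar> \<le> L * norm h" if "norm x \<le> R" "norm (x + h) \<le> R" for x h
  proof -
    obtain s where s: "0 < s" "s < 1"
      and eq: "f (x + h) - f x = (\<Sum>i\<in>UNIV. h $ i * partial i f (x + s *\<^sub>R h))"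
      using mvt_line[of f] C_inf_differentiable[OF assms] by blast
    show ?thesis unfolding eq L_def
      by (rule abs_sum_component_le) (use that s in \<open>auto intro!: K' norm_segment_le\<close>)
  qed
  moreover have "L \<ge> 0" unfolding L_def using K(1) by (simp add: sum_nonneg)
  ultimately show ?thesis by blast
qed

lemma C_inf_lipschitz_vanishing:
  fixes f :: "real^'d \<Rightarrow> real"
  assumes "C_inf f" "\<And>x. norm x > R \<Longrightarrow> f x = 0"
  shows "\<exists>L\<ge>0. \<forall>x h. \<bar>f (x + h) - f x\<bar> \<le> L * norm h"
proof -
  have "\<forall>i. \<exists>K\<ge>0. \<forall>x. norm (partial i f x) \<le> K"
    by (intro allI C_inf_bounded_vanishing[where R = R] C_inf_partial assms(1)
        partial_vanishing[where R = R]) (use assms(2) in auto)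
  then obtain K where K: "\<And>i. K i \<ge> 0" "\<And>i x. \<bar>partial i f x\<bar> \<le> K i"
    by (metis real_norm_def)
  have K': "\<bar>partial i f x\<bar> \<le> (\<Sum>i\<in>UNIV. K i)" for i x
    by (rule order_trans[OF K(2)], rule member_le_sum) (auto simp: K(1))
  have "\<bar>f (x + h) - f x\<bar> \<le> (real CARD('d) * (\<Sum>i\<in>UNIV. K i)) * norm h" for x h
  proof -
    obtain s where "f (x + h) - f x = (\<Sum>i\<in>UNIV. h $ i * partial i f (x + s *\<^sub>R h))"
      using mvt_line[OF C_inf_differentiable[OF assms(1)]] by blast
    then show ?thesis by (simp only:) (rule abs_sum_component_le[OF K'])
  qed
  moreover have "real CARD('d) * (\<Sum>i\<in>UNIV. K i) \<ge> 0" using K(1) by (simp add: sum_nonneg)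
  ultimately show ?thesis by blast
qed

text \<open>By the mean value theorem the remainder is \<open>h\<close> paired with a difference of
  gradients at distance at most \<open>norm h\<close>, and the gradient is itself Lipschitz.\<close>

lemma C_inf_taylor_vanishing:
  fixes f :: "real^'d \<Rightarrow> real"
  assumes "C_inf f" "\<And>x. norm x > R \<Longrightarrow> f x = 0"
  shows "\<exists>L\<ge>0. \<forall>x h. \<bar>f (x + h) - f x - (\<Sum>i\<in>UNIV. h $ i * partial i f x)\<bar> \<le> L * (norm h)\<^sup>2"
proof -
  have "\<forall>i. \<exists>L\<ge>0. \<forall>x h. \<bar>partial i f (x + h) - partial i f x\<bar> \<le> L * norm h"
    by (intro allI C_inf_lipschitz_vanishing[where R = R] C_inf_partial assms(1)
        partial_vanishing[where R = R]) (use assms(2) in auto)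
  then obtain K where K: "\<And>i. K i \<ge> 0" "\<And>i x h. \<bar>partial i f (x + h) - partial i f x\<bar> \<le> K i * norm h"
    by metis
  define S where "S = (\<Sum>i\<in>UNIV. K i)"
  have S: "S \<ge> 0" unfolding S_def using K(1) by (simp add: sum_nonneg)
  have K': "K i \<le> S" for i
    unfolding S_def using K(1) by (intro member_le_sum) auto
  have "\<bar>f (x + h) - f x - (\<Sum>i\<in>UNIV. h $ i * partial i f x)\<bar> \<le> (real CARD('d) * S) * (norm h)\<^sup>2" for x h
  proof -
    obtain s where s: "0 < s" "s < 1"
      and eq: "f (x + h) - f x = (\<Sum>i\<in>UNIV. h $ i * partial i f (x + s *\<^sub>R h))"
      using mvt_line[OF C_inf_differentiable[OF assms(1)]] by blast
    have "\<bar>partial i f (x + s *\<^sub>R h) - partial i f x\<bar> \<le> S * norm h" for i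
    proof -
      have "\<bar>partial i f (x + s *\<^sub>R h) - partial i f x\<bar> \<le> K i * norm (s *\<^sub>R h)" by (rule K)
      also have "\<dots> \<le> S * norm h"
        using s K' K(1) by (intro mult_mono) (auto simp: mult_left_le_one_le S)
      finally show ?thesis .
    qed
    from abs_sum_component_le[OF this, of h]
    show ?thesis unfolding eq by (simp add: sum_subtractf[symmetric] right_diff_distrib power2_eq_square mult_ac)
  qed
  moreover have "real CARD('d) * S \<ge> 0" using S by simp
  ultimately show ?thesis by blast
qed

text \<open>The remainder is governed by the oscillation of the second derivative, so a Lipschitz
  second derivative is as good as a third one here. For a line with direction \<open>h\<close> this
  oscillation is of order \<open>norm h ^ 3\<close>.\<close>

lemma trapezoid_error:
  fixes g g1 g2 :: "real \<Rightarrow> real"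
  assumes "\<And>s. (g has_real_derivative g1 s) (at s)" "\<And>s. (g1 has_real_derivative g2 s) (at s)"
    and M: "\<And>r s. r \<in> {0..1} \<Longrightarrow> s \<in> {0..1} \<Longrightarrow> \<bar>g2 r - g2 s\<bar> \<le> M"
  shows "\<bar>g 1 - g 0 - (g1 0 + g1 1) / 2\<bar> \<le> M"
proof -
  \<comment> \<open>The trapezoidal error on [0, s]. Its derivative contains g1 s - g1 0 - s * g2 s,
    and a second use of the mean value theorem turns this into s times a difference of values of
    g2.\<close>
  let ?G = "\<lambda>s. g s - g 0 - s / 2 * (g1 0 + g1 s)"
  have "(?G has_real_derivative ((g1 s - g1 0 - s * g2 s) / 2)) (at s)" for s
    by (auto intro!: derivative_eq_intros assms simp: field_simps)
  from MVT2[of 0 1 ?G, OF zero_less_one this]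
  obtain s where s: "0 < s" "s < 1" "?G 1 - ?G 0 = (g1 s - g1 0 - s * g2 s) / 2" by auto
  from MVT2[of 0 s g1 g2, OF s(1) assms(2)]
  obtain r where r: "0 < r" "r < s" "g1 s - g1 0 = s * g2 r" by auto
  have "\<bar>(g1 s - g1 0 - s * g2 s) / 2\<bar> = s * \<bar>g2 r - g2 s\<bar> / 2"
    using r s by (simp add: right_diff_distrib[symmetric] abs_mult)
  also have "\<dots> \<le> 1 * \<bar>g2 r - g2 s\<bar>"
    using s mult_right_mono[of s 2 "\<bar>g2 r - g2 s\<bar>"] by simp
  also have "\<dots> \<le> M" using M[of r s] r s by simp
  finally have "\<bar>?G 1 - ?G 0\<bar> \<le> M" unfolding s(3) .
  moreover have "?G 1 - ?G 0 = g 1 - g 0 - (g1 0 + g1 1) / 2" by simp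
  ultimately show ?thesis by metis
qed

text \<open>The third order is what matters: a step of the Euler scheme has size about
  \<open>sqrt \<delta>\<close>, so the errors of T / \<delta> steps add up to the order of
  \<open>sqrt \<delta>\<close>.\<close>

lemma C_inf_trapezoid:
  fixes U :: "real^'d \<Rightarrow> real"
  assumes "C_inf U"
  shows "\<exists>C\<ge>0. \<forall>x h. norm x \<le> R \<longrightarrow> norm (x + h) \<le> R \<longrightarrow>
    \<bar>U (x + h) - U x - (\<Sum>i\<in>UNIV. h $ i * (partial i U x + partial i U (x + h))) / 2\<bar> \<le> C * norm h ^ 3"
proof -
  have "\<forall>i j. \<exists>L\<ge>0. \<forall>x h. norm x \<le> R \<longrightarrow> norm (x + h) \<le> R \<longrightarrow>
      \<bar>partial i (partial j U) (x + h) - partial i (partial j U) x\<bar> \<le> L * norm h"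
    using C_inf_lipschitz_on_cball C_inf_partial assms by blast
  then obtain L where L: "\<And>i j. L i j \<ge> 0" "\<And>i j x h. norm x \<le> R \<Longrightarrow> norm (x + h) \<le> R \<Longrightarrow>
      \<bar>partial i (partial j U) (x + h) - partial i (partial j U) x\<bar> \<le> L i j * norm h"
    by metis
  define S where "S = (\<Sum>i\<in>UNIV. \<Sum>j\<in>UNIV. L i j)"
  have S: "S \<ge> 0" unfolding S_def using L(1) by (simp add: sum_nonneg)
  have LS: "L i j \<le> S" for i j
  proof -
    have "L i j \<le> (\<Sum>j\<in>UNIV. L i j)" using L(1) by (intro member_le_sum) auto
    also have "\<dots> \<le> S" unfolding S_def using L(1)
      by (intro member_le_sum[where f = "\<lambda>i. \<Sum>j\<in>UNIV. L i j"]) (auto intro: sum_nonneg)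
    finally show ?thesis .
  qed
  let ?C = "real CARD('d) * (real CARD('d) * S)"
  have "\<bar>U (x + h) - U x - (\<Sum>i\<in>UNIV. h $ i * (partial i U x + partial i U (x + h))) / 2\<bar>
      \<le> ?C * norm h ^ 3" if x: "norm x \<le> R" "norm (x + h) \<le> R" for x h
  proof -
    let ?g1 = "\<lambda>s. \<Sum>i\<in>UNIV. h $ i * partial i U (x + s *\<^sub>R h)"
    let ?g2 = "\<lambda>s. \<Sum>j\<in>UNIV. h $ j * (\<Sum>i\<in>UNIV. h $ i * partial i (partial j U) (x + s *\<^sub>R h))"
    have d1: "((\<lambda>s. U (x + s *\<^sub>R h)) has_real_derivative ?g1 s) (at s)" for s
      by (rule has_real_derivative_line[OF C_inf_differentiable[OF assms]])
    have d2: "(?g1 has_real_derivative ?g2 s) (at s)" for s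
      by (intro DERIV_sum DERIV_cmult has_real_derivative_line C_inf_differentiable C_inf_partial assms)
    have d3: "\<bar>?g2 r - ?g2 s\<bar> \<le> ?C * norm h ^ 3" if rs: "r \<in> {0..1}" "s \<in> {0..1}" for r s
    proof -
      have "\<bar>partial i (partial j U) (x + r *\<^sub>R h) - partial i (partial j U) (x + s *\<^sub>R h)\<bar> \<le> S * norm h" for i j
      proof -
        have eq: "x + s *\<^sub>R h + (r - s) *\<^sub>R h = x + r *\<^sub>R h" by (simp add: algebra_simps)
        have "\<bar>partial i (partial j U) (x + r *\<^sub>R h) - partial i (partial j U) (x + s *\<^sub>R h)\<bar>
            \<le> L i j * norm ((r - s) *\<^sub>R h)"
          using L(2)[of "x + s *\<^sub>R h" "(r - s) *\<^sub>R h" i j] norm_segment_le[OF x, of s]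
            norm_segment_le[OF x, of r] rs unfolding eq by simp
        also have "\<dots> \<le> S * norm h"
          using rs by (intro mult_mono LS S) (auto intro!: mult_left_le_one_le)
        finally show ?thesis .
      qed
      from abs_sum_component_le[OF this, of h]
      have "\<bar>(\<Sum>i\<in>UNIV. h $ i * partial i (partial j U) (x + r *\<^sub>R h)) -
          (\<Sum>i\<in>UNIV. h $ i * partial i (partial j U) (x + s *\<^sub>R h))\<bar>
          \<le> real CARD('d) * (S * norm h) * norm h" for j
        by (simp add: sum_subtractf[symmetric] right_diff_distrib)
      from abs_sum_component_le[OF this, of h]
      have "\<bar>?g2 r - ?g2 s\<bar> \<le> real CARD('d) * (real CARD('d) * (S * norm h) * norm h) * norm h"
        by (simp only: sum_subtractf[symmetric] right_diff_distrib[symmetric])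
      then show ?thesis by (simp add: power3_eq_cube mult_ac)
    qed
    from trapezoid_error[OF d1 d2 d3]
    show ?thesis by (simp add: sum.distrib[symmetric] distrib_left)
  qed
  moreover have "?C \<ge> 0" using S by simp
  ultimately show ?thesis by blast
qed

section \<open>Lebesgue measure and integration by parts\<close>

lemma nn_integral_lborel_reflect:
  fixes c :: "'a::euclidean_space"
  assumes [measurable]: "f \<in> borel_measurable borel"
  shows "(\<integral>\<^sup>+x. f (c - x) \<partial>lborel) = (\<integral>\<^sup>+x. f x \<partial>lborel)"
proof -
  have "lborel = distr lborel borel (\<lambda>x. c - x)"
    using lborel_affine[of "-1" c] by (simp add: density_1)
  then have "(\<integral>\<^sup>+x. f x \<partial>lborel) = (\<integral>\<^sup>+x. f x \<partial>distr lborel borel (\<lambda>x. c - x))"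
    by simp
  then show ?thesis by (simp add: nn_integral_distr)
qed

lemma nn_integral_lborel_translate:
  fixes c :: "'a::euclidean_space"
  assumes [measurable]: "f \<in> borel_measurable borel"
  shows "(\<integral>\<^sup>+x. f (c + x) \<partial>lborel) = (\<integral>\<^sup>+x. f x \<partial>lborel)"
proof -
  have "(\<integral>\<^sup>+x. f x \<partial>lborel) = (\<integral>\<^sup>+x. f x \<partial>distr lborel borel ((+) c))"
    by (simp add: lborel_distr_plus)
  then show ?thesis by (simp add: nn_integral_distr)
qed

lemma integral_lborel_translate:
  fixes c :: "'a::euclidean_space" and f :: "'a \<Rightarrow> real"
  assumes [measurable]: "f \<in> borel_measurable borel"
  shows "(\<integral>x. f (x + c) \<partial>lborel) = (\<integral>x. f x \<partial>lborel)"
proof -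
  have "(\<integral>x. f x \<partial>lborel) = (\<integral>x. f x \<partial>distr lborel borel ((+) c))"
    by (simp add: lborel_distr_plus)
  then show ?thesis by (simp add: integral_distr add.commute)
qed

lemma borel_measure_eqI_box:
  fixes N N' :: "'a::euclidean_space measure"
  assumes "sets N = sets borel" "sets N' = sets borel"
    and "\<And>l u. emeasure N (box l u) < \<infinity>"
    and eq: "\<And>l u. emeasure N (box l u) = emeasure N' (box l u)"
  shows "N = N'"
proof (rule measure_eqI_generator_eq)
  let ?E = "range (\<lambda>(a, b). box a b::'a set)"
  show "Int_stable ?E"
    by (auto simp: Int_stable_def box_Int_box)
  show "?E \<subseteq> Pow UNIV" "sets N = sigma_sets UNIV ?E" "sets N' = sigma_sets UNIV ?E"
    using assms by (simp_all add: borel_eq_box)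
  let ?A = "\<lambda>n::nat. box (- (real n *\<^sub>R One)) (real n *\<^sub>R One) :: 'a set"
  show "range ?A \<subseteq> ?E" "(\<Union>i. ?A i) = UNIV"
    unfolding UN_box_eq_UNIV by auto
  show "emeasure N (?A i) \<noteq> \<infinity>" for i using assms(3) by (simp add: less_top)
  show "emeasure N X = emeasure N' X" if "X \<in> ?E" for X
    using that eq by auto
qed

text \<open>By Fubini, \<open>N A * lborel C = lborel A * N C\<close> for all boxes \<open>A\<close> and \<open>C\<close>.\<close>

lemma translation_invariant_eq_scaled_lborel:
  fixes N :: "'a::euclidean_space measure"
  assumes sets_N [measurable_cong]: "sets N = sets borel"
    and fin: "\<And>l u. emeasure N (box l u) < \<infinity>"
    and inv: "\<And>l u c. emeasure N (box (l + c) (u + c)) = emeasure N (box l u)"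
  shows "N = density lborel (\<lambda>_. emeasure N (box 0 One))"
proof -
  have space_N: "space N = UNIV" using sets_eq_imp_space_eq[OF sets_N] by simp
  interpret N: sigma_finite_measure N
  proof
    let ?A = "range (\<lambda>n::nat. box (- (real n *\<^sub>R One)) (real n *\<^sub>R One) :: 'a set)"
    show "\<exists>A. countable A \<and> A \<subseteq> sets N \<and> \<Union> A = space N \<and> (\<forall>a\<in>A. emeasure N a \<noteq> \<infinity>)"
      using fin UN_box_eq_UNIV by (intro exI[of _ ?A]) (auto simp: sets_N space_N less_top)
  qed
  interpret P: pair_sigma_finite N lborel ..
  have key: "emeasure N A * emeasure lborel C = emeasure lborel A * emeasure N C"
    if A: "A = box l u" and C: "C = box l' u'" for A C l u l' u'
  proof -
    have [measurable]: "A \<in> sets borel" "C \<in> sets borel" by (simp_all add: A C)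
    have sh: "emeasure N {x. x - c \<in> box p q} = emeasure N (box p q)" for c p q :: 'a
    proof -
      have "{x. x - c \<in> box p q} = box (p + c) (q + c)"
        by (auto simp: box_def inner_diff_left inner_add_left algebra_simps)
      then show ?thesis using inv by simp
    qed
    have nsh: "(\<integral>\<^sup>+x. indicator (box p q) (x - c) \<partial>N) = emeasure N (box p q)" for c p q :: 'a
    proof -
      have "(\<integral>\<^sup>+x. indicator (box p q) (x - c) \<partial>N) = (\<integral>\<^sup>+x. indicator {x. x - c \<in> box p q} x \<partial>N)"
        by (intro nn_integral_cong) (auto simp: indicator_def)
      also have "\<dots> = emeasure N {x. x - c \<in> box p q}"
        by (rule nn_integral_indicator) measurable
      finally show ?thesis using sh by simp
    qed
    have "emeasure N A * emeasure lborel C = (\<integral>\<^sup>+c. emeasure N A * indicator C c \<partial>lborel)"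
      by (simp add: nn_integral_cmult)
    also have "\<dots> = (\<integral>\<^sup>+c. (\<integral>\<^sup>+x. indicator A (x - c) * indicator C c \<partial>N) \<partial>lborel)"
      by (intro nn_integral_cong, subst nn_integral_multc) (auto simp: A nsh)
    also have "\<dots> = (\<integral>\<^sup>+x. (\<integral>\<^sup>+c. indicator A (x - c) * indicator C c \<partial>lborel) \<partial>N)"
      by (rule P.Fubini') measurable
    \<comment> \<open>Substituting x - c for c exchanges the roles of the two boxes; integrating in
      the other order then gives the product with \<open>A\<close> and \<open>C\<close>
      interchanged.\<close>
    also have "\<dots> = (\<integral>\<^sup>+x. (\<integral>\<^sup>+c. indicator A c * indicator C (x - c) \<partial>lborel) \<partial>N)"
    proof (rule nn_integral_cong)
      fix x
      show "(\<integral>\<^sup>+c. indicator A (x - c) * indicator C c \<partial>lborel) =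
        (\<integral>\<^sup>+c. indicator A c * indicator C (x - c) \<partial>lborel)"
        using nn_integral_lborel_reflect[of "\<lambda>c. indicator A c * indicator C (x - c)" x] by simp
    qed
    also have "\<dots> = (\<integral>\<^sup>+c. (\<integral>\<^sup>+x. indicator A c * indicator C (x - c) \<partial>N) \<partial>lborel)"
      by (rule P.Fubini'[symmetric]) measurable
    also have "\<dots> = (\<integral>\<^sup>+c. indicator A c * emeasure N C \<partial>lborel)"
      by (intro nn_integral_cong, subst nn_integral_cmult) (auto simp: C nsh)
    also have "\<dots> = emeasure lborel A * emeasure N C"
      by (simp add: nn_integral_multc)
    finally show ?thesis .
  qed
  \<comment> \<open>Choosing the unit box as the second box in \<open>key\<close> identifies the
    proportionality factor.\<close>
  have one: "emeasure lborel (box 0 One :: 'a set) = 1"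
    by (subst emeasure_lborel_box) (auto simp: inner_sum_left_Basis)
  show ?thesis
  proof (rule borel_measure_eqI_box)
    show "emeasure N (box l u) < \<infinity>" for l u by (rule fin)
    show "emeasure N (box l u) = emeasure (density lborel (\<lambda>_. emeasure N (box 0 One))) (box l u)" for l u
      using key[OF refl refl, of l u 0 One] one
      by (simp add: emeasure_density nn_integral_multc nn_integral_cmult)
        (simp add: mult.commute nn_integral_cmult)
  qed (auto simp: sets_N)
qed

section \<open>Integrals of derivatives of compactly supported functions\<close>

lemma integrable_bounded_mult:
  fixes f g :: "'a \<Rightarrow> real"
  assumes "integrable M g" "f \<in> borel_measurable M" "\<And>x. \<bar>f x\<bar> \<le> K"
  shows "integrable M (\<lambda>x. f x * g x)"
proof (rule Bochner_Integration.integrable_bound)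
  show "integrable M (\<lambda>x. K * g x)" using assms by simp
  have "\<bar>f x * g x\<bar> \<le> \<bar>K * g x\<bar>" for x
    using assms(3)[of x] by (auto simp: abs_mult intro!: mult_right_mono)
  then show "AE x in M. norm (f x * g x) \<le> norm (K * g x)" by simp
qed (use assms in simp)

lemma C_inf_borel_measurable:
  "C_inf f \<Longrightarrow> f \<in> borel_measurable borel" for f :: "real^'d \<Rightarrow> real"
  by (intro borel_measurable_continuous_onI C_inf_continuous)

lemma integrable_vanishing_mult:
  fixes f \<rho> :: "real^'d \<Rightarrow> real"
  assumes "C_inf f" "\<And>x. norm x > R \<Longrightarrow> f x = 0" "integrable lborel \<rho>"
  shows "integrable lborel (\<lambda>x. f x * \<rho> x)"
proof -
  obtain K where "\<And>x. \<bar>f x\<bar> \<le> K"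
    using C_inf_bounded_vanishing[OF assms(1,2)] by auto
  moreover have "f \<in> borel_measurable lborel" using C_inf_borel_measurable[OF assms(1)] by simp
  ultimately show ?thesis using assms(3) by (intro integrable_bounded_mult) auto
qed

lemma integrable_indicator_cball: "integrable lborel (indicator (cball (0::real^'d) R) :: _ \<Rightarrow> real)"
  using emeasure_lborel_cball_finite[of "0::real^'d" R] by (intro integrable_real_indicator) auto

lemma integrable_vanishing:
  fixes f :: "real^'d \<Rightarrow> real"
  assumes "C_inf f" "\<And>x. norm x > R \<Longrightarrow> f x = 0"
  shows "integrable lborel f"
proof -
  have eq: "(\<lambda>x. f x * indicator (cball 0 R) x) = f"
  proof
    show "f x * indicator (cball 0 R) x = f x" for x
      using assms(2)[of x] by (cases "norm x \<le> R") auto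
  qed
  show ?thesis
    using integrable_vanishing_mult[OF assms integrable_indicator_cball[of R]] unfolding eq by simp
qed

text \<open>Every difference quotient has integral 0 by translation invariance of Lebesgue measure,
  and the quotients converge dominatedly because \<open>g\<close> is Lipschitz. This replaces an
  iterated integration over the coordinate lines.\<close>

lemma integral_partial_zero:
  fixes g :: "real^'d \<Rightarrow> real"
  assumes "C_inf g" "\<And>x. norm x > R \<Longrightarrow> g x = 0"
  shows "(\<integral>x. partial i g x \<partial>lborel) = 0"
proof -
  let ?s = "\<lambda>n x. real (Suc n) * (g (x + (1 / real (Suc n)) *\<^sub>R axis i 1) - g x)"
  have [measurable]: "g \<in> borel_measurable borel" "partial i g \<in> borel_measurable borel"
    using assms(1) by (auto intro: C_inf_borel_measurable C_inf_partial)
  have int: "integrable lborel g" by (rule integrable_vanishing[OF assms])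
  obtain L where L: "L \<ge> 0" "\<And>x h. \<bar>g (x + h) - g x\<bar> \<le> L * norm h"
    using C_inf_lipschitz_vanishing[OF assms] by blast
  \<comment> \<open>The steps 1 / (n + 1) are at most 1, so all quotients vanish outside the ball of
    radius R + 1; inside it the Lipschitz constant dominates them.\<close>
  have "(\<lambda>n. \<integral>x. ?s n x \<partial>lborel) \<longlonglongrightarrow> (\<integral>x. partial i g x \<partial>lborel)"
  proof (rule integral_dominated_convergence[where w = "\<lambda>x. L * indicator (cball 0 (R + 1)) x"])
    show "integrable lborel (\<lambda>x. L * indicator (cball (0::real^'d) (R + 1)) x)"
      by (intro integrable_mult_right integrable_indicator_cball)
    show "AE x in lborel. (\<lambda>n. ?s n x) \<longlonglongrightarrow> partial i g x"
    proof (rule AE_I2)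
      fix x
      have "((\<lambda>s. g (x + s *\<^sub>R axis i 1)) has_real_derivative
          (\<Sum>j\<in>UNIV. axis i 1 $ j * partial j g (x + 0 *\<^sub>R axis i 1))) (at 0)"
        by (rule has_real_derivative_line) (simp add: C_inf_differentiable assms)
      moreover have "(\<Sum>j\<in>UNIV. axis i 1 $ j * partial j g (x + 0 *\<^sub>R axis i 1)) = partial i g x"
        by (simp add: axis_def if_distrib[where f = "\<lambda>c. c * _"] cong: if_cong)
      ultimately have D: "((\<lambda>h. (g (x + h *\<^sub>R axis i 1) - g x) / h) \<longlongrightarrow> partial i g x) (at 0)"
        by (simp add: has_field_derivative_iff)
      have "filterlim (\<lambda>n. 1 / real (Suc n)) (at 0) sequentially"
        using LIMSEQ_inverse_real_of_nat
        by (auto simp: filterlim_at inverse_eq_divide)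
      from filterlim_compose[OF D this]
      show "(\<lambda>n. ?s n x) \<longlonglongrightarrow> partial i g x" by (simp add: mult.commute)
    qed
    show "AE x in lborel. norm (?s n x) \<le> L * indicator (cball 0 (R + 1)) x" for n
    proof (rule AE_I2)
      fix x :: "real^'d"
      have le: "norm ((1 / real (Suc n)) *\<^sub>R (axis i 1 :: real^'d)) \<le> 1"
        by (simp add: norm_axis_1)
      show "norm (?s n x) \<le> L * indicator (cball 0 (R + 1)) x"
      proof (cases "norm x \<le> R + 1")
        case True
        have "\<bar>?s n x\<bar> \<le> real (Suc n) * (L * norm ((1 / real (Suc n)) *\<^sub>R (axis i 1 :: real^'d)))"
          unfolding abs_mult abs_of_nat by (intro mult_left_mono L) simp
        then show ?thesis using True by (simp add: norm_axis_1 del: of_nat_Suc)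
      next
        case False
        have "norm (x + (1 / real (Suc n)) *\<^sub>R axis i 1) > R"
        proof -
          have "norm x \<le> norm (x + (1 / real (Suc n)) *\<^sub>R axis i 1) + norm ((1 / real (Suc n)) *\<^sub>R (axis i 1 :: real^'d))"
            using norm_triangle_ineq4[of "x + c" c for c] by (simp only: add_diff_cancel_right')
          then show ?thesis using False le by linarith
        qed
        then show ?thesis using False assms(2) by simp
      qed
    qed
  qed measurable
  moreover have "(\<integral>x. ?s n x \<partial>lborel) = 0" for n
  proof -
    let ?c = "(1 / real (Suc n)) *\<^sub>R axis i 1 :: real^'d"
    have "integrable (distr lborel borel ((+) ?c)) g" using int by (simp add: lborel_distr_plus)
    then have "integrable lborel (\<lambda>x. g (x + ?c))"
      by (subst (asm) integrable_distr_eq) (auto simp: add.commute)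
    then show ?thesis
      using int integral_lborel_translate[of g ?c] by simp
  qed
  ultimately have "(\<lambda>n. 0) \<longlonglongrightarrow> (\<integral>x. partial i g x \<partial>lborel)" by (simp only:)
  then show ?thesis by (simp add: LIMSEQ_const_iff)
qed

text \<open>Nonempty open sets are not null. This extracts points from identities between densities,
  which are available only almost everywhere.\<close>

lemma AE_lborel_open_imp_ex:
  fixes S :: "(real^'d) set"
  assumes "AE x in lborel. P x" "open S" "S \<noteq> {}"
  shows "\<exists>x\<in>S. P x"
proof (rule ccontr)
  assume "\<not> (\<exists>x\<in>S. P x)"
  then have "AE x in lborel. x \<notin> S" using assms(1) by (auto elim: AE_mp)
  then have "S \<in> null_sets lborel" using assms(2) by (simp add: AE_iff_null_sets)
  then have "negligible S" by (simp add: negligible_iff_null_sets null_sets_completionI)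
  then show False using open_not_negligible assms by blast
qed

section \<open>Translates and radial bumps\<close>

lemma translate_differentiable:
  fixes f :: "real^'d \<Rightarrow> 'b::real_normed_vector"
  assumes "f differentiable (at (x + c))"
  shows "(\<lambda>y. f (y + c)) differentiable (at x)" "partial i (\<lambda>y. f (y + c)) x = partial i f (x + c)"
proof -
  have "((\<lambda>y. y + c) has_derivative (\<lambda>h. h)) (at x)"
    by (auto intro!: derivative_eq_intros)
  from diff_chain_at[OF this assms[unfolded frechet_derivative_works]]
  have D: "((\<lambda>y. f (y + c)) has_derivative frechet_derivative f (at (x + c))) (at x)"
    by (simp add: o_def)
  then show "(\<lambda>y. f (y + c)) differentiable (at x)" "partial i (\<lambda>y. f (y + c)) x = partial i f (x + c)"
    using partial_eqI[OF D] by (auto simp: differentiable_def partial_def)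
qed

lemma C_inf_translate: "C_inf f \<Longrightarrow> C_inf (\<lambda>y. f (y + c))"
  for f :: "real^'d \<Rightarrow> 'b::real_normed_vector"
proof -
  have "ntimes_diff n f \<Longrightarrow> ntimes_diff n (\<lambda>y. f (y + c))" for n
  proof (induction n arbitrary: f)
    case (Suc n)
    note D = ntimes_diff_SucD[OF Suc.prems]
    have eq: "partial i (\<lambda>y. f (y + c)) = (\<lambda>y. partial i f (y + c))" for i
      by (intro ext translate_differentiable D)
    show ?case
      by (rule ntimes_diff_SucI, rule translate_differentiable, rule D, unfold eq, rule Suc.IH, rule D)
  qed simp
  then show "C_inf f \<Longrightarrow> C_inf (\<lambda>y. f (y + c))" by (simp add: C_inf_iff)
qed

text \<open>The squared norm keeps the function smooth at the centre; for r > 0 it is positive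
  exactly on the open ball.\<close>

definition radial_bump :: "real^'d \<Rightarrow> real \<Rightarrow> real^'d \<Rightarrow> real" where
  "radial_bump c r y = flat_exp 0 (r\<^sup>2 - (norm (y - c))\<^sup>2)"

lemma C_inf_radial: "C_inf (\<lambda>y::real^'d. flat_exp k (r\<^sup>2 - (norm (y - c))\<^sup>2))"
  by (intro C_inf_flat C_inf_diff C_inf_const C_inf_norm_sq)

lemma radial_bump_pos: "r > 0 \<Longrightarrow> radial_bump c r y > 0 \<longleftrightarrow> y \<in> ball c r"
  by (simp add: radial_bump_def flat_pos dist_norm norm_minus_commute)
     (metis abs_norm_cancel abs_of_pos power2_less_imp_less power_strict_mono norm_ge_zero zero_less_numeral less_imp_le)

lemma radial_bump_nonneg: "radial_bump c r y \<ge> 0"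
  by (simp add: radial_bump_def flat_bounds)

lemma radial_bump_vanishing:
  assumes "r > 0" "norm y > norm c + r"
  shows "radial_bump c r y = 0"
proof -
  have "y \<notin> ball c r" using assms norm_triangle_ineq2[of y c] by (auto simp: dist_norm norm_minus_commute)
  then show ?thesis using radial_bump_pos[of r c y] assms radial_bump_nonneg[of c r y] by linarith
qed

lemma partial_radial:
  "partial i (\<lambda>y::real^'d. flat_exp k (r\<^sup>2 - (norm (y - c))\<^sup>2)) =
   (\<lambda>y. - 2 * (y $ i - c $ i) * flat_exp (Suc k) (r\<^sup>2 - (norm (y - c))\<^sup>2))"
proof
  fix x :: "real^'d"
  have D: "((\<lambda>y. r\<^sup>2 - (norm (y - c))\<^sup>2) has_derivative (\<lambda>h. - 2 * ((x - c) \<bullet> h))) (at x)"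
    unfolding power2_norm_eq_inner
    by (auto intro!: derivative_eq_intros simp: inner_commute)
  have "partial i (\<lambda>y. r\<^sup>2 - (norm (y - c))\<^sup>2) x = - 2 * (x $ i - c $ i)"
    by (subst partial_eqI[OF D]) (simp add: inner_axis)
  moreover have "(\<lambda>y. r\<^sup>2 - (norm (y - c))\<^sup>2) differentiable (at x)"
    using D by (auto simp: differentiable_def)
  ultimately show "partial i (\<lambda>y. flat_exp k (r\<^sup>2 - (norm (y - c))\<^sup>2)) x =
    - 2 * (x $ i - c $ i) * flat_exp (Suc k) (r\<^sup>2 - (norm (x - c))\<^sup>2)"
    by (subst partial_compose[OF _ DERIV_flat]) auto
qed

text \<open>For radial bumps, unlike for general test functions, the symmetry of the second
  derivatives can be read off.\<close>

lemma partial_radial_bump_commute: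
  fixes c :: "real^'d"
  shows "partial i (partial j (radial_bump c r)) x = partial j (partial i (radial_bump c r)) x"
proof -
  have rb: "radial_bump c r = (\<lambda>y. flat_exp 0 (r\<^sup>2 - (norm (y - c))\<^sup>2))"
    by (auto simp: radial_bump_def)
  have lin: "(\<lambda>y::real^'d. - 2 * (y $ k - c $ k)) differentiable (at x)" for k x
    by (intro C_inf_differentiable C_inf_intros)
  have plin: "partial l (\<lambda>y::real^'d. - 2 * (y $ k - c $ k)) x = (if l = k then - 2 else 0)" for k l
  proof -
    have "((\<lambda>y::real^'d. - 2 * (y $ k - c $ k)) has_derivative (\<lambda>h. - 2 * (h $ k))) (at x)"
      by (auto intro!: derivative_eq_intros bounded_linear_imp_has_derivative bounded_linear_vec_nth)
    from partial_eqI[OF this] show ?thesis by (simp add: axis_def)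
  qed
  have "partial k (partial l (radial_bump c r)) x =
    (if k = l then - 2 else 0) * flat_exp (Suc 0) (r\<^sup>2 - (norm (x - c))\<^sup>2) +
    - 2 * (x $ l - c $ l) * (- 2 * (x $ k - c $ k) * flat_exp (Suc (Suc 0)) (r\<^sup>2 - (norm (x - c))\<^sup>2))" for k l
    unfolding rb partial_radial
    by (subst partial_mult[OF lin C_inf_differentiable[OF C_inf_radial]]) (simp only: plin partial_radial)
  then show ?thesis by simp
qed

lemma partial_nth_commute:
  fixes v :: "real^'d \<Rightarrow> real^'e"
  assumes "v differentiable (at x)"
  shows "partial i (\<lambda>x. v x $ k) x = partial i v x $ k"
  by (rule partial_bounded_linear[OF bounded_linear_vec_nth assms])

text \<open>Poincare lemma on a star-shaped domain. Differentiating x \<bullet> v(t x) in direction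
  i gives, after the curl condition has exchanged two indices, the t-derivative of t v(t x) $ i,
  whose integral over [0, 1] is v(x) $ i.\<close>

lemma curl_free_has_potential:
  fixes v :: "real^'d \<Rightarrow> real^'d"
  assumes v: "C_inf v" and curl: "\<And>i j x. partial i v x $ j = partial j v x $ i"
  shows "\<exists>U. C_inf U \<and> (\<forall>i x. partial i U x = - v x $ i)"
proof -
  \<comment> \<open>\<open>G x t\<close> is the derivative in t of t v(t x). It is also the gradient
    in x of x \<bullet> v(t x), and this second reading is where \<open>curl\<close> enters.\<close>
  define G where "G x t = v (t *\<^sub>R x) + t *\<^sub>R (\<Sum>i\<in>UNIV. x $ i *\<^sub>R partial i v (t *\<^sub>R x))" for x t
  define U where "U x = - integral {0..1} (\<lambda>t. x \<bullet> v (t *\<^sub>R x))" for x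
  have cont: "continuous_on S v" "continuous_on S (partial i v)" for S i
    using v by (auto intro: C_inf_continuous C_inf_partial)
  have contG: "continuous_on (UNIV \<times> {0..1}) (\<lambda>(x, t). G x t)"
    unfolding G_def split_beta
    by (intro continuous_intros continuous_on_compose2[OF cont(1)[of UNIV]]
        continuous_on_compose2[OF cont(2)[of UNIV]]) auto
  have der: "((\<lambda>x. x \<bullet> v (t *\<^sub>R x)) has_derivative blinfun_apply (blinfun_inner_left (G x t))) (at x)" for x t
  proof -
    have "((\<lambda>x. t *\<^sub>R x) has_derivative (\<lambda>h. t *\<^sub>R h)) (at x)"
      by (auto intro!: derivative_eq_intros)
    from diff_chain_at[OF this has_derivative_partials[OF C_inf_differentiable[OF v]]]
    have "((\<lambda>x. v (t *\<^sub>R x)) has_derivative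
        (\<lambda>h. \<Sum>i\<in>UNIV. (t * h $ i) *\<^sub>R partial i v (t *\<^sub>R x))) (at x)"
      by (simp add: o_def)
    then have "((\<lambda>x. x \<bullet> v (t *\<^sub>R x)) has_derivative
        (\<lambda>h. x \<bullet> (\<Sum>i\<in>UNIV. (t * h $ i) *\<^sub>R partial i v (t *\<^sub>R x)) + h \<bullet> v (t *\<^sub>R x))) (at x)"
      by (rule has_derivative_inner[OF has_derivative_ident])
    moreover have "x \<bullet> (\<Sum>i\<in>UNIV. (t * h $ i) *\<^sub>R partial i v (t *\<^sub>R x)) + h \<bullet> v (t *\<^sub>R x) =
        blinfun_apply (blinfun_inner_left (G x t)) h" for h
    proof -
      have "x \<bullet> (\<Sum>i\<in>UNIV. (t * h $ i) *\<^sub>R partial i v (t *\<^sub>R x)) =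
        (\<Sum>i\<in>UNIV. \<Sum>j\<in>UNIV. t * h $ i * (x $ j * partial i v (t *\<^sub>R x) $ j))"
        unfolding inner_sum_right by (simp add: inner_vec_def sum_distrib_left mult_ac)
      also have "\<dots> = (\<Sum>i\<in>UNIV. \<Sum>j\<in>UNIV. t * h $ i * (x $ j * partial j v (t *\<^sub>R x) $ i))"
        by (simp only: curl)
      also have "\<dots> = h \<bullet> (t *\<^sub>R (\<Sum>i\<in>UNIV. x $ i *\<^sub>R partial i v (t *\<^sub>R x)))"
        by (simp add: inner_vec_def sum_distrib_left mult_ac)
      finally show ?thesis by (simp add: G_def inner_add_right inner_commute)
    qed
    ultimately show ?thesis by simp
  qed
  \<comment> \<open>Joint continuity of the derivative in (x, t) justifies differentiation under the
    integral sign.\<close>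
  have contB: "continuous_on (UNIV \<times> cbox 0 1) (\<lambda>(x, t). blinfun_inner_left (G x t))"
    using bounded_linear.continuous_on[OF bounded_linear_blinfun_inner_left contG]
    by (simp add: split_beta)
  have int: "(\<lambda>t. x \<bullet> v (t *\<^sub>R x)) integrable_on cbox 0 1" for x
    by (intro integrable_continuous continuous_intros continuous_on_compose2[OF cont(1)[of UNIV]]) auto
  have D: "(U has_derivative (\<lambda>h. - blinfun_apply (integral (cbox 0 1) (\<lambda>t. blinfun_inner_left (G x t))) h)) (at x)" for x
  proof -
    have "((\<lambda>x. integral (cbox 0 1) (\<lambda>t. x \<bullet> v (t *\<^sub>R x))) has_derivative
        blinfun_apply (integral (cbox 0 1) (\<lambda>t. blinfun_inner_left (G x t)))) (at x within UNIV)"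
      by (rule leibniz_rule[where fx = "\<lambda>x t. blinfun_inner_left (G x t)"]) (use der int contB in auto)
    from has_derivative_minus[OF this] show ?thesis by (simp add: U_def[abs_def])
  qed
  have "partial i U x = - v x $ i" for i x
  proof -
    have intB: "(\<lambda>t. blinfun_inner_left (G x t)) integrable_on cbox 0 1"
    proof (rule integrable_continuous)
      have "continuous_on (cbox 0 1) (\<lambda>t. (x, t))" by (intro continuous_intros)
      from continuous_on_compose2[OF contB this]
      show "continuous_on (cbox 0 1) (\<lambda>t. blinfun_inner_left (G x t))" by (simp add: image_subset_iff)
    qed
    have "partial i U x = - blinfun_apply (integral (cbox 0 1) (\<lambda>t. blinfun_inner_left (G x t))) (axis i 1)"
      by (rule partial_eqI[OF D])
    also have "blinfun_apply (integral (cbox 0 1) (\<lambda>t. blinfun_inner_left (G x t))) (axis i 1) =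
        integral (cbox 0 1) (\<lambda>t. blinfun_apply (blinfun_inner_left (G x t)) (axis i 1))"
      by (rule integral_linear[OF intB bounded_linear_apply_blinfun, unfolded o_def, symmetric])
    also have "\<dots> = integral {0..1} (\<lambda>t. G x t $ i)"
      by (simp add: inner_axis' inner_axis)
    also have "\<dots> = v x $ i"
    proof -
      have "((\<lambda>t. (t *\<^sub>R v (t *\<^sub>R x)) $ i) has_vector_derivative G x t $ i) (at t)" for t
      proof -
        have "((\<lambda>t. v (0 + t *\<^sub>R x)) has_vector_derivative (\<Sum>i\<in>UNIV. x $ i *\<^sub>R partial i v (0 + t *\<^sub>R x))) (at t)"
          by (rule has_vector_derivative_line[OF C_inf_differentiable[OF v]])
        then have "((\<lambda>t. t *\<^sub>R v (t *\<^sub>R x)) has_vector_derivative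
            (t *\<^sub>R (\<Sum>i\<in>UNIV. x $ i *\<^sub>R partial i v (t *\<^sub>R x)) + 1 *\<^sub>R v (t *\<^sub>R x))) (at t)"
          by (intro has_vector_derivative_scaleR) auto
        then have "((\<lambda>t. t *\<^sub>R v (t *\<^sub>R x)) has_vector_derivative G x t) (at t)"
          by (simp add: G_def add.commute)
        from bounded_linear.has_vector_derivative[OF bounded_linear_vec_nth this]
        show ?thesis .
      qed
      then have "((\<lambda>t. G x t $ i) has_integral ((1 *\<^sub>R v (1 *\<^sub>R x)) $ i - (0 *\<^sub>R v (0 *\<^sub>R x)) $ i)) {0..1}"
        by (intro fundamental_theorem_of_calculus) (auto intro: has_vector_derivative_at_within)
      then show ?thesis by (simp add: integral_unique)
    qed
    finally show ?thesis .
  qed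
  note pU = this
  have "C_inf U"
  proof (rule C_infI)
    show "U differentiable (at x)" for x using D unfolding differentiable_def by blast
    show "C_inf (partial i U)" for i
      unfolding pU[abs_def] by (intro C_inf_minus C_inf_nth v)
  qed
  with pU show ?thesis by blast
qed

text \<open>The space of test functions of distribution theory: smooth with compact support, of
  arbitrary sign and possibly zero.\<close>

definition smooth_bump :: "(real^'d \<Rightarrow> real) \<Rightarrow> bool" where
  "smooth_bump f \<longleftrightarrow> C_inf f \<and> (\<exists>R. \<forall>x. norm x > R \<longrightarrow> f x = 0)"

lemma smooth_bump_mult: "smooth_bump f \<Longrightarrow> C_inf g \<Longrightarrow> smooth_bump (\<lambda>x. g x * f x)"
  unfolding smooth_bump_def by (auto intro!: C_inf_mult)

lemma smooth_bump_cmult: "smooth_bump f \<Longrightarrow> smooth_bump (\<lambda>x. c * f x)"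
  by (rule smooth_bump_mult[where g = "\<lambda>_. c"]) (auto intro: C_inf_const)

lemma smooth_bump_partial: "smooth_bump f \<Longrightarrow> smooth_bump (partial i f)"
  unfolding smooth_bump_def by (meson C_inf_partial partial_vanishing)

lemma smooth_bump_add: "smooth_bump f \<Longrightarrow> smooth_bump g \<Longrightarrow> smooth_bump (\<lambda>x. f x + g x)"
  unfolding smooth_bump_def
proof (elim conjE exE, intro conjI)
  fix R R' assume "\<forall>x. R < norm x \<longrightarrow> f x = 0" "\<forall>x. R' < norm x \<longrightarrow> g x = 0"
  then show "\<exists>R. \<forall>x. R < norm x \<longrightarrow> f x + g x = 0" by (intro exI[of _ "max R R'"]) auto
qed (rule C_inf_add)

lemma smooth_bump_translate: "smooth_bump f \<Longrightarrow> smooth_bump (\<lambda>x. f (x + c))"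
  unfolding smooth_bump_def
proof (elim conjE exE, intro conjI)
  fix R assume R: "\<forall>x. R < norm x \<longrightarrow> f x = 0"
  have "f (x + c) = 0" if "norm x > R + norm c" for x
    using R that norm_triangle_ineq2[of x "- c"] by simp
  then show "\<exists>R. \<forall>x. R < norm x \<longrightarrow> f (x + c) = 0" by blast
qed (rule C_inf_translate)

lemma smooth_bump_C_inf: "smooth_bump f \<Longrightarrow> C_inf f"
  by (simp add: smooth_bump_def)

lemma smooth_bump_integrable_mult:
  "smooth_bump f \<Longrightarrow> integrable lborel \<rho> \<Longrightarrow> integrable lborel (\<lambda>x. f x * \<rho> x)"
  unfolding smooth_bump_def using integrable_vanishing_mult by blast

lemma smooth_bump_radial: "r > 0 \<Longrightarrow> smooth_bump (radial_bump c r)"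
  unfolding smooth_bump_def using C_inf_radial[of 0 r c] radial_bump_vanishing[of r c]
  by (auto simp: radial_bump_def[abs_def])

text \<open>Smooth minorants of the indicator of an open box that converge to it pointwise: inside
  the box each factor has the form exp(- 1 / (n a)) with a > 0. Translating the box translates the
  functions, which transfers translation invariance from test functions to boxes.\<close>

definition box_bump :: "real^'d \<Rightarrow> real^'d \<Rightarrow> nat \<Rightarrow> real^'d \<Rightarrow> real" where
  "box_bump l u n y = (\<Prod>i\<in>UNIV. flat_exp 0 (real n * (y $ i - l $ i)) * flat_exp 0 (real n * (u $ i - y $ i)))"

lemma smooth_bump_box:
  fixes l u :: "real^'d"
  shows "smooth_bump (box_bump l u n)"
  unfolding smooth_bump_def
proof (intro conjI)
  show "C_inf (box_bump l u n)"
    unfolding box_bump_def[abs_def] by (intro C_inf_intros C_inf_flat)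
  obtain R where R: "\<And>x. x \<in> cbox l u \<Longrightarrow> norm x \<le> R"
    using bounded_cbox[of l u] by (auto simp: bounded_iff)
  have "box_bump l u n y = 0" if "norm y > R" for y
  proof -
    have "y \<notin> cbox l u" using R that by force
    then obtain i where "y $ i < l $ i \<or> y $ i > u $ i"
      by (auto simp: mem_box_cart not_le)
    then have "flat_exp 0 (real n * (y $ i - l $ i)) * flat_exp 0 (real n * (u $ i - y $ i)) = 0"
      by (auto intro!: flat_nonpos simp: mult_nonneg_nonpos)
    then show ?thesis unfolding box_bump_def by (intro prod_zero) auto
  qed
  then show "\<exists>R. \<forall>x. R < norm x \<longrightarrow> box_bump l u n x = 0" by blast
qed

lemma box_bump_bounds: "0 \<le> box_bump l u n y" "box_bump l u n y \<le> indicator (box l u) y"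
proof -
  have f: "0 \<le> flat_exp 0 a * flat_exp 0 b" "flat_exp 0 a * flat_exp 0 b \<le> 1" for a b
    using flat_bounds[of a] flat_bounds[of b] by (auto intro: mult_le_one)
  show "0 \<le> box_bump l u n y" unfolding box_bump_def by (intro prod_nonneg f)
  show "box_bump l u n y \<le> indicator (box l u) y"
  proof (cases "y \<in> box l u")
    case True
    then show ?thesis unfolding box_bump_def using f by (simp add: prod_le_1)
  next
    case False
    then obtain i where "y $ i \<le> l $ i \<or> y $ i \<ge> u $ i"
      by (auto simp: mem_box_cart not_less)
    then have "flat_exp 0 (real n * (y $ i - l $ i)) * flat_exp 0 (real n * (u $ i - y $ i)) = 0"
      by (auto intro!: flat_nonpos simp: mult_nonneg_nonpos)
    then have "box_bump l u n y = 0" unfolding box_bump_def by (intro prod_zero) auto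
    then show ?thesis by simp
  qed
qed

lemma box_bump_tendsto: "(\<lambda>n. box_bump l u n y) \<longlonglongrightarrow> indicator (box l u) y"
proof (cases "y \<in> box l u")
  case True
  have *: "(\<lambda>n. flat_exp 0 (real n * a)) \<longlonglongrightarrow> 1" if "a > 0" for a
  proof -
    have "(\<lambda>n. exp (- (1 / a) * (1 / real n))) \<longlonglongrightarrow> exp (- (1 / a) * 0)"
      by (intro tendsto_intros lim_1_over_n)
    then have "(\<lambda>n. exp (- (1 / a) * (1 / real n))) \<longlonglongrightarrow> 1" by simp
    then show ?thesis
      by (rule Lim_transform_eventually)
         (use that in \<open>auto simp: flat_0 mult.commute intro!: eventually_sequentiallyI[of 1]\<close>)
  qed
  have "(\<lambda>n. box_bump l u n y) \<longlonglongrightarrow> (\<Prod>i\<in>(UNIV::'a set). 1 * 1)"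
    unfolding box_bump_def using True by (intro tendsto_prod tendsto_mult *) (auto simp: mem_box_cart)
  then show ?thesis using True by simp
next
  case False
  then have "box_bump l u n y = 0" for n
    using box_bump_bounds[of l u n y] by simp
  then show ?thesis using False by simp
qed

section \<open>Functions with vanishing weak gradient\<close>

lemma quadratic_increments_imp_const:
  fixes g :: "real \<Rightarrow> real"
  assumes "\<And>s. \<exists>C. \<forall>\<tau>. \<bar>\<tau>\<bar> \<le> 1 \<longrightarrow> \<bar>g (s + \<tau>) - g s\<bar> \<le> C * \<tau>\<^sup>2"
  shows "g a = g b"
proof -
  have "(g has_real_derivative 0) (at s)" for s
  proof -
    obtain C where C: "\<And>\<tau>. \<bar>\<tau>\<bar> \<le> 1 \<Longrightarrow> \<bar>g (s + \<tau>) - g s\<bar> \<le> C * \<tau>\<^sup>2"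
      using assms by blast
    have "((\<lambda>h. (g (s + h) - g s) / h) \<longlongrightarrow> 0) (at 0)"
    proof (rule Lim_null_comparison)
      show "((\<lambda>h. C * \<bar>h\<bar>) \<longlongrightarrow> 0) (at 0)"
        by (auto intro!: tendsto_eq_intros)
      show "\<forall>\<^sub>F h in at 0. norm ((g (s + h) - g s) / h) \<le> C * \<bar>h\<bar>"
        unfolding eventually_at
      proof (intro exI[of _ 1] conjI ballI impI)
        fix h :: real assume h: "h \<noteq> 0 \<and> dist h 0 < 1"
        then have "\<bar>g (s + h) - g s\<bar> \<le> C * \<bar>h\<bar> * \<bar>h\<bar>" using C[of h]
          by (simp add: power2_eq_square)
        then show "norm ((g (s + h) - g s) / h) \<le> C * \<bar>h\<bar>"
          using h by (simp add: field_simps)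
      qed simp
    qed
    then show ?thesis by (simp add: DERIV_def)
  qed
  then show ?thesis using DERIV_isconst_all[of g] by blast
qed

text \<open>Moving the test function by \<tau> c changes the integral by a linear term and a Taylor
  remainder. The linear term integrates to 0, being a combination of partial derivatives of a test
  function, and the remainder is quadratic in \<tau>; so the integral has derivative 0 in the
  shift.\<close>

lemma weak_gradient_zero_translate:
  fixes h :: "real^'d \<Rightarrow> real"
  assumes int: "\<And>\<theta>. smooth_bump \<theta> \<Longrightarrow> integrable lborel (\<lambda>x. \<theta> x * h x)"
    and nn: "\<And>x. h x \<ge> 0"
    and zero: "\<And>\<theta> i. smooth_bump \<theta> \<Longrightarrow> (\<integral>x. partial i \<theta> x * h x \<partial>lborel) = 0"
    and \<theta>: "smooth_bump \<theta>"
  shows "(\<integral>x. \<theta> (x + c) * h x \<partial>lborel) = (\<integral>x. \<theta> x * h x \<partial>lborel)"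
proof -
  define g where "g s = (\<integral>x. \<theta> (x + s *\<^sub>R c) * h x \<partial>lborel)" for s
  obtain R where R: "\<And>x. norm x > R \<Longrightarrow> \<theta> x = 0" and C\<theta>: "C_inf \<theta>"
    using \<theta> by (auto simp: smooth_bump_def)
  obtain L where L: "L \<ge> 0"
    "\<And>x h. \<bar>\<theta> (x + h) - \<theta> x - (\<Sum>i\<in>UNIV. h $ i * partial i \<theta> x)\<bar> \<le> L * (norm h)\<^sup>2"
    using C_inf_taylor_vanishing[OF C\<theta> R] by blast
  have "\<exists>C. \<forall>\<tau>. \<bar>\<tau>\<bar> \<le> 1 \<longrightarrow> \<bar>g (s + \<tau>) - g s\<bar> \<le> C * \<tau>\<^sup>2" for s
  proof -
    \<comment> \<open>For shifts s + \<tau> with |\<tau>| at most 1, the translated test functions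
      and their derivatives vanish beyond this radius.\<close>
    define r where "r = \<bar>R\<bar> + (\<bar>s\<bar> + 1) * norm c"
    have r: "r \<ge> 0" by (simp add: r_def)
    \<comment> \<open>\<open>h\<close> is known to be integrable only against test functions, so the
      remainder is dominated by a multiple of a test function that is at least \<open>m\<close> on
      the ball of radius \<open>r\<close>.\<close>
    define \<eta> where "\<eta> = radial_bump (0::real^'d) (r + 1)"
    define m where "m = flat_exp 0 ((r + 1)\<^sup>2 - r\<^sup>2)"
    have m: "m > 0" using r by (simp add: m_def flat_pos power2_eq_square algebra_simps)
    have \<eta>: "smooth_bump \<eta>" unfolding \<eta>_def using r by (intro smooth_bump_radial) simp
    have \<eta>m: "\<eta> x \<ge> m" if "norm x \<le> r" for x
      unfolding \<eta>_def radial_bump_def m_def using that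
      by (intro flat_mono) (simp add: power_mono)
    have \<eta>0: "\<eta> x \<ge> 0" for x unfolding \<eta>_def by (rule radial_bump_nonneg)
    define I where "I = (\<integral>x. \<eta> x * h x \<partial>lborel)"
    have "\<bar>g (s + \<tau>) - g s\<bar> \<le> (L * (norm c)\<^sup>2 / m * I) * \<tau>\<^sup>2" if \<tau>: "\<bar>\<tau>\<bar> \<le> 1" for \<tau>
    proof -
      let ?P = "\<lambda>x. \<Sum>i\<in>UNIV. (\<tau> *\<^sub>R c) $ i * (partial i \<theta> (x + s *\<^sub>R c) * h x)"
      let ?D = "\<lambda>x. \<theta> (x + (s + \<tau>) *\<^sub>R c) * h x - \<theta> (x + s *\<^sub>R c) * h x - ?P x"
      have i1: "integrable lborel (\<lambda>x. \<theta> (x + s *\<^sub>R c) * h x)" for s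
        by (intro int smooth_bump_translate \<theta>)
      have p: "partial i \<theta> (x + s *\<^sub>R c) = partial i (\<lambda>y. \<theta> (y + s *\<^sub>R c)) x" for i x
        by (rule translate_differentiable(2)[symmetric]) (rule C_inf_differentiable[OF C\<theta>])
      have i2: "integrable lborel (\<lambda>x. partial i \<theta> (x + s *\<^sub>R c) * h x)" for i
        unfolding p by (intro int smooth_bump_partial smooth_bump_translate \<theta>)
      have z: "(\<integral>x. ?P x \<partial>lborel) = 0"
        by (subst Bochner_Integration.integral_sum)
           (use i2 in \<open>auto simp: p intro!: sum.neutral zero smooth_bump_translate \<theta>\<close>)
      have i3: "integrable lborel ?P"
        using i2 by (intro Bochner_Integration.integrable_sum integrable_mult_right)
      have "g (s + \<tau>) - g s = (\<integral>x. ?D x \<partial>lborel)"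
        using i1 i3 z by (simp add: g_def)
      moreover have "\<bar>\<integral>x. ?D x \<partial>lborel\<bar> \<le> (\<integral>x. L * (norm (\<tau> *\<^sub>R c))\<^sup>2 / m * (\<eta> x * h x) \<partial>lborel)"
      proof (rule integral_abs_bound_integral)
        show "integrable lborel ?D" by (intro Bochner_Integration.integrable_diff i1 i3)
        show "integrable lborel (\<lambda>x. L * (norm (\<tau> *\<^sub>R c))\<^sup>2 / m * (\<eta> x * h x))"
          by (intro integrable_mult_right int \<eta>)
        fix x
        have D: "?D x = (\<theta> (x + s *\<^sub>R c + \<tau> *\<^sub>R c) - \<theta> (x + s *\<^sub>R c) -
            (\<Sum>i\<in>UNIV. (\<tau> *\<^sub>R c) $ i * partial i \<theta> (x + s *\<^sub>R c))) * h x"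
          by (simp add: algebra_simps sum_distrib_right sum_distrib_left)
        show "\<bar>?D x\<bar> \<le> L * (norm (\<tau> *\<^sub>R c))\<^sup>2 / m * (\<eta> x * h x)"
        proof (cases "norm x \<le> r")
          case True
          have "\<bar>?D x\<bar> \<le> L * (norm (\<tau> *\<^sub>R c))\<^sup>2 * h x"
            unfolding D abs_mult using L(2)[of "x + s *\<^sub>R c" "\<tau> *\<^sub>R c"] nn[of x]
            by (intro mult_mono) auto
          also have "\<dots> \<le> L * (norm (\<tau> *\<^sub>R c))\<^sup>2 * (\<eta> x / m * h x)"
            using \<eta>m[OF True] m nn[of x] L(1) by (intro mult_left_mono) (auto simp: field_simps mult_right_mono)
          finally show ?thesis by simp
        next
          case False
          have far: "norm (x + q *\<^sub>R c) > R" if "\<bar>q\<bar> \<le> \<bar>s\<bar> + 1" for q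
          proof -
            have "norm (q *\<^sub>R c) \<le> (\<bar>s\<bar> + 1) * norm c" using that by (simp add: mult_right_mono)
            moreover have "norm x \<le> norm (x + q *\<^sub>R c) + norm (q *\<^sub>R c)"
              using norm_triangle_ineq4[of "x + q *\<^sub>R c" "q *\<^sub>R c"] by simp
            ultimately show ?thesis using False unfolding r_def by linarith
          qed
          have "partial i \<theta> (x + s *\<^sub>R c) = 0" for i
            by (rule partial_vanishing[where R = R]) (use R far[of s] in auto)
          then have "?D x = 0" using R[OF far[of s]] R[OF far[of "s + \<tau>"]] \<tau> by simp
          then show ?thesis using L(1) m \<eta>0[of x] nn[of x] by simp
        qed
      qed
      moreover have "(\<integral>x. L * (norm (\<tau> *\<^sub>R c))\<^sup>2 / m * (\<eta> x * h x) \<partial>lborel) =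
          L * (norm (\<tau> *\<^sub>R c))\<^sup>2 / m * I"
        unfolding I_def by (rule integral_mult_right_zero)
      moreover have "L * (norm (\<tau> *\<^sub>R c))\<^sup>2 / m * I = (L * (norm c)\<^sup>2 / m * I) * \<tau>\<^sup>2"
        by (simp add: power_mult_distrib)
      ultimately show ?thesis by (simp only:)
    qed
    then show ?thesis by blast
  qed
  from quadratic_increments_imp_const[OF this, of 1 0]
  show ?thesis by (simp add: g_def)
qed

text \<open>The measure with density \<open>h\<close> has translation invariant values on boxes, as
  limits of integrals of \<open>box_bump\<close>. Hence it is a multiple of Lebesgue measure, and
  densities are unique almost everywhere.\<close>

lemma weak_gradient_zero_const:
  fixes h :: "real^'d \<Rightarrow> real"
  assumes int: "\<And>\<theta>. smooth_bump \<theta> \<Longrightarrow> integrable lborel (\<lambda>x. \<theta> x * h x)"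
    and nn: "\<And>x. h x \<ge> 0"
    and meas [measurable]: "h \<in> borel_measurable borel"
    and zero: "\<And>\<theta> i. smooth_bump \<theta> \<Longrightarrow> (\<integral>x. partial i \<theta> x * h x \<partial>lborel) = 0"
  shows "\<exists>\<kappa>\<ge>0. AE x in lborel. h x = \<kappa>"
proof -
  define N where "N = density lborel (\<lambda>x. ennreal (h x))"
  have boxint: "integrable lborel (\<lambda>x. indicator (box l u) x * h x)" for l u :: "real^'d"
  proof -
    obtain r where r: "r > 0" "\<And>x. x \<in> box l u \<Longrightarrow> norm x \<le> r"
      using bounded_box[of l u] by (meson bounded_pos)
    \<comment> \<open>A positive lower bound of the radial bump on the box, so that local
      integrability follows from integrability against that bump.\<close>
    define m where "m = flat_exp 0 ((r + 1)\<^sup>2 - r\<^sup>2)"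
    have m: "m > 0" using r by (simp add: m_def flat_pos power2_eq_square algebra_simps)
    show ?thesis
    proof (rule Bochner_Integration.integrable_bound)
      show "integrable lborel (\<lambda>x. (1 / m) * (radial_bump 0 (r + 1) x * h x))"
        using r by (intro integrable_mult_right int smooth_bump_radial) auto
      have "\<bar>indicator (box l u) x * h x\<bar> \<le> \<bar>(1 / m) * (radial_bump 0 (r + 1) x * h x)\<bar>" for x
      proof (cases "x \<in> box l u")
        case True
        have "radial_bump 0 (r + 1) x \<ge> m"
          unfolding radial_bump_def m_def using r(2)[OF True]
          by (intro flat_mono) (simp add: power_mono)
        from mult_right_mono[OF this nn[of x]]
        show ?thesis using True m nn[of x] radial_bump_nonneg[of 0 "r + 1" x]
          by (simp add: field_simps abs_mult)
      qed simp
      then show "AE x in lborel. norm (indicator (box l u) x * h x) \<le> norm ((1 / m) * (radial_bump 0 (r + 1) x * h x))"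
        by simp
    qed measurable
  qed
  have Nbox: "emeasure N (box l u) = ennreal (\<integral>x. indicator (box l u) x * h x \<partial>lborel)" for l u
  proof -
    have "emeasure N (box l u) = (\<integral>\<^sup>+x. ennreal (indicator (box l u) x * h x) \<partial>lborel)"
      unfolding N_def
      by (subst emeasure_density) (auto intro!: nn_integral_cong simp: indicator_def)
    also have "\<dots> = ennreal (\<integral>x. indicator (box l u) x * h x \<partial>lborel)"
      using nn by (intro nn_integral_eq_integral boxint) simp
    finally show ?thesis .
  qed
  have lim: "(\<lambda>n. \<integral>x. box_bump l u n x * h x \<partial>lborel) \<longlonglongrightarrow> (\<integral>x. indicator (box l u) x * h x \<partial>lborel)"
    for l u :: "real^'d"
  proof (rule integral_dominated_convergence[where w = "\<lambda>x. indicator (box l u) x * h x"])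
    show "integrable lborel (\<lambda>x. indicator (box l u) x * h x)" by (rule boxint)
    have [measurable]: "box_bump l u n \<in> borel_measurable borel" for n
      by (intro C_inf_borel_measurable smooth_bump_C_inf smooth_bump_box)
    show "(\<lambda>x. box_bump l u n x * h x) \<in> borel_measurable lborel" for n by measurable
    show "AE x in lborel. (\<lambda>n. box_bump l u n x * h x) \<longlonglongrightarrow> indicator (box l u) x * h x"
      by (intro AE_I2 tendsto_mult box_bump_tendsto tendsto_const)
    show "AE x in lborel. norm (box_bump l u n x * h x) \<le> indicator (box l u) x * h x" for n
      using box_bump_bounds[of l u n] nn by (auto simp: abs_mult intro!: mult_right_mono)
  qed measurable
  have "N = density lborel (\<lambda>_. emeasure N (box 0 One))"
  proof (rule translation_invariant_eq_scaled_lborel)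
    show "emeasure N (box (l + c) (u + c)) = emeasure N (box l u)" for l u c
    proof -
      have "box_bump (l + c) (u + c) n (x + c) = box_bump l u n x" for n x
        by (simp add: box_bump_def)
      then have "(\<integral>x. box_bump (l + c) (u + c) n x * h x \<partial>lborel) = (\<integral>x. box_bump l u n x * h x \<partial>lborel)" for n
        using weak_gradient_zero_translate[OF int nn zero smooth_bump_box, of "l + c" "u + c" n c] by simp
      then show ?thesis
        unfolding Nbox using LIMSEQ_unique[OF lim[of "l + c" "u + c"]] lim[of l u] by simp
    qed
  qed (auto simp: N_def Nbox[unfolded N_def])
  moreover define \<kappa> where "\<kappa> = (\<integral>x. indicator (box 0 One) x * h x \<partial>lborel)"
  ultimately have "density lborel (\<lambda>x. ennreal (h x)) = density lborel (\<lambda>_. ennreal \<kappa>)"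
    by (simp add: N_def Nbox[unfolded N_def])
  then have "AE x in lborel. ennreal (h x) = ennreal \<kappa>"
    by (subst (asm) sigma_finite_measure.density_unique_iff[OF sigma_finite_lborel]) auto
  moreover have "\<kappa> \<ge> 0" unfolding \<kappa>_def using nn by (intro integral_nonneg_AE) auto
  ultimately show ?thesis using nn by (intro exI[of _ \<kappa>]) auto
qed

text \<open>The equation speaks about integrals only. If the curl did not vanish at x, one of its
  components would keep its sign on a ball around x; a bump supported there would make its integral
  against the positive density nonzero, although the weak equation makes it zero.\<close>

lemma weak_log_gradient_imp_gibbs:
  fixes v :: "real^'d \<Rightarrow> real^'d" and \<rho> :: "real^'d \<Rightarrow> real"
  assumes v: "C_inf v" and \<rho>: "integrable lborel \<rho>" "\<And>x. \<rho> x > 0"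
    and weak: "\<And>\<phi> i. smooth_bump \<phi> \<Longrightarrow> (\<integral>x. (v x $ i * \<phi> x + partial i \<phi> x) * \<rho> x \<partial>lborel) = 0"
  shows "\<exists>U \<kappa>. C_inf U \<and> (\<forall>i x. partial i U x = - v x $ i) \<and> (AE x in lborel. \<rho> x = \<kappa> * exp (- U x))"
proof -
  have meas [measurable]: "\<rho> \<in> borel_measurable borel" using \<rho>(1) by auto
  have C: "C_inf (\<lambda>x. v x $ i)" for i by (intro C_inf_nth v)
  have pv: "partial i (\<lambda>x. v x $ k) x = partial i v x $ k" for i k x
    by (rule partial_nth_commute[OF C_inf_differentiable[OF v]])
  have curl: "partial i v x $ j = partial j v x $ i" for i j x
  proof (rule ccontr)
    assume ne: "partial i v x $ j \<noteq> partial j v x $ i"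
    define w where "w y = partial i v y $ j - partial j v y $ i" for y
    have Cw: "C_inf w" unfolding w_def[abs_def] by (intro C_inf_intros v)
    have "isCont w x" by (intro differentiable_imp_continuous_within C_inf_differentiable Cw)
    moreover have "w x \<noteq> 0" using ne by (simp add: w_def)
    ultimately obtain r where r: "r > 0" "\<And>y. dist y x < r \<Longrightarrow> \<bar>w y - w x\<bar> < \<bar>w x\<bar>"
      unfolding continuous_at_eps_delta dist_real_def by (metis zero_less_abs_iff)
    have sgn: "w x * w y > 0" if "y \<in> ball x r" for y
      using r(2)[of y] that by (auto simp: dist_commute abs_if zero_less_mult_iff split: if_splits)
    define \<phi> where "\<phi> = radial_bump x r"
    have \<phi>: "smooth_bump \<phi>" unfolding \<phi>_def by (rule smooth_bump_radial[OF r(1)])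
    let ?I = "\<lambda>f. \<integral>x. f x * \<rho> x \<partial>lborel"
    \<comment> \<open>The equation is tested with \<open>v $ l * \<phi>\<close> in direction k and
      with \<open>partial k \<phi>\<close> in direction l; subtracting removes the term containing
      \<open>v $ l * partial k \<phi>\<close>. The right-hand side is symmetric in k and l, because
      second derivatives of a radial bump commute.\<close>
    have eq: "?I (\<lambda>y. partial k v y $ l * \<phi> y) = ?I (\<lambda>y. partial l (partial k \<phi>) y) - ?I (\<lambda>y. v y $ k * v y $ l * \<phi> y)" for k l
    proof -
      have b: "smooth_bump (\<lambda>y. v y $ l * \<phi> y)" by (intro smooth_bump_mult \<phi> C)
      have p: "partial k (\<lambda>y. v y $ l * \<phi> y) y = partial k v y $ l * \<phi> y + v y $ l * partial k \<phi> y" for y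
        by (subst partial_mult) (auto simp: pv intro!: C_inf_differentiable C smooth_bump_C_inf \<phi>)
      note ib = smooth_bump_integrable_mult[OF _ \<rho>(1)]
      have i1: "integrable lborel (\<lambda>y. (v y $ k * (v y $ l * \<phi> y)) * \<rho> y)"
        by (intro ib smooth_bump_mult \<phi> C)
      have i2: "integrable lborel (\<lambda>y. (partial k v y $ l * \<phi> y) * \<rho> y)"
        by (intro ib smooth_bump_mult \<phi> C_inf_nth C_inf_partial v)
      have i3: "integrable lborel (\<lambda>y. (v y $ l * partial k \<phi> y) * \<rho> y)"
        by (intro ib smooth_bump_mult smooth_bump_partial \<phi> C)
      have i4: "integrable lborel (\<lambda>y. partial l (partial k \<phi>) y * \<rho> y)"
        by (intro ib smooth_bump_partial \<phi>)
      have "0 = (\<integral>y. (v y $ k * (v y $ l * \<phi> y) + (partial k v y $ l * \<phi> y + v y $ l * partial k \<phi> y)) * \<rho> y \<partial>lborel)"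
        using weak[OF b, of k] by (simp add: p)
      also have "\<dots> = (\<integral>y. (v y $ k * (v y $ l * \<phi> y)) * \<rho> y + ((partial k v y $ l * \<phi> y) * \<rho> y + (v y $ l * partial k \<phi> y) * \<rho> y) \<partial>lborel)"
        by (simp add: distrib_right)
      also have "\<dots> = ?I (\<lambda>y. v y $ k * (v y $ l * \<phi> y)) + (?I (\<lambda>y. partial k v y $ l * \<phi> y) + ?I (\<lambda>y. v y $ l * partial k \<phi> y))"
        using i1 i2 i3 by simp
      finally have e1: "0 = ?I (\<lambda>y. v y $ k * (v y $ l * \<phi> y)) + (?I (\<lambda>y. partial k v y $ l * \<phi> y) + ?I (\<lambda>y. v y $ l * partial k \<phi> y))" .
      have "0 = (\<integral>y. (v y $ l * partial k \<phi> y + partial l (partial k \<phi>) y) * \<rho> y \<partial>lborel)"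
        using weak[OF smooth_bump_partial[OF \<phi>], of l k] by simp
      also have "\<dots> = (\<integral>y. (v y $ l * partial k \<phi> y) * \<rho> y + partial l (partial k \<phi>) y * \<rho> y \<partial>lborel)"
        by (simp add: distrib_right)
      also have "\<dots> = ?I (\<lambda>y. v y $ l * partial k \<phi> y) + ?I (\<lambda>y. partial l (partial k \<phi>) y)"
        using i3 i4 by simp
      finally have e2: "0 = ?I (\<lambda>y. v y $ l * partial k \<phi> y) + ?I (\<lambda>y. partial l (partial k \<phi>) y)" .
      show ?thesis using e1 e2 by (simp add: mult_ac)
    qed
    have ii: "integrable lborel (\<lambda>y. (partial k v y $ l * \<phi> y) * \<rho> y)" for k l
      by (intro smooth_bump_integrable_mult[OF _ \<rho>(1)] smooth_bump_mult \<phi> C_inf_nth C_inf_partial v)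
    have "?I (\<lambda>y. w y * \<phi> y) = ?I (\<lambda>y. partial i v y $ j * \<phi> y) - ?I (\<lambda>y. partial j v y $ i * \<phi> y)"
      using ii[of i j] ii[of j i] by (simp add: w_def left_diff_distrib)
    also have "\<dots> = 0"
      unfolding eq by (simp add: \<phi>_def partial_radial_bump_commute[of i j] mult_ac)
    finally have "?I (\<lambda>y. w y * \<phi> y) = 0" .
    \<comment> \<open>The constant factor \<open>w x\<close> makes the integrand nonnegative,
      whatever the sign of the curl.\<close>
    then have "(\<integral>y. w x * ((w y * \<phi> y) * \<rho> y) \<partial>lborel) = 0" by simp
    moreover have "integrable lborel (\<lambda>y. w x * ((w y * \<phi> y) * \<rho> y))"
      by (intro integrable_mult_right smooth_bump_integrable_mult[OF _ \<rho>(1)] smooth_bump_mult \<phi> Cw)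
    moreover have "0 \<le> w x * ((w y * \<phi> y) * \<rho> y)" for y
    proof (cases "y \<in> ball x r")
      case True
      have "0 \<le> (w x * w y) * \<phi> y * \<rho> y"
        using sgn[OF True] \<rho>(2)[of y] radial_bump_nonneg[of x r y] by (simp add: \<phi>_def)
      then show ?thesis by (simp add: mult_ac)
    next
      case False
      then have "\<phi> y = 0" using radial_bump_pos[OF r(1), of x y] radial_bump_nonneg[of x r y] by (simp add: \<phi>_def)
      then show ?thesis by simp
    qed
    ultimately have "AE y in lborel. w x * ((w y * \<phi> y) * \<rho> y) = 0"
      by (subst (asm) integral_nonneg_eq_0_iff_AE) auto
    from AE_lborel_open_imp_ex[OF this open_ball[of x r]]
    obtain y where y: "y \<in> ball x r" "w x * ((w y * \<phi> y) * \<rho> y) = 0"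
      using r(1) by auto
    then show False
      using sgn[OF y(1)] radial_bump_pos[OF r(1), of x y] \<rho>(2)[of y] by (auto simp: \<phi>_def)
  qed
  obtain U where U: "C_inf U" "\<And>i x. partial i U x = - v x $ i"
    using curl_free_has_potential[OF v curl] by blast
  \<comment> \<open>\<open>h\<close> is the quotient of the density by exp(-U). For the test
    function exp(U) \<theta> the term with v cancels the derivative of exp(U), and what remains of
    the weak equation is that \<open>h\<close> has weak gradient 0.\<close>
  define h where "h x = exp (U x) * \<rho> x" for x
  have CE: "C_inf (\<lambda>x. exp (U x))" by (intro C_inf_exp U)
  have pE: "partial i (\<lambda>x. exp (U x)) x = - v x $ i * exp (U x)" for i x
    by (subst partial_compose[OF C_inf_differentiable[OF U(1)] DERIV_exp]) (simp add: U)
  have "\<exists>\<kappa>\<ge>0. AE x in lborel. h x = \<kappa>"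
  proof (rule weak_gradient_zero_const)
    show "integrable lborel (\<lambda>x. \<theta> x * h x)" if "smooth_bump \<theta>" for \<theta>
      using smooth_bump_integrable_mult[OF smooth_bump_mult[OF that CE] \<rho>(1)]
      by (simp add: h_def mult_ac)
    show "0 \<le> h x" for x using \<rho>(2)[of x] by (simp add: h_def)
    have [measurable]: "U \<in> borel_measurable borel" by (intro C_inf_borel_measurable U)
    show "h \<in> borel_measurable borel" unfolding h_def by measurable
    show "(\<integral>x. partial i \<theta> x * h x \<partial>lborel) = 0" if "smooth_bump \<theta>" for \<theta> i
    proof -
      have "partial i (\<lambda>x. exp (U x) * \<theta> x) x = - v x $ i * exp (U x) * \<theta> x + exp (U x) * partial i \<theta> x" for x
        by (subst partial_mult) (auto simp: pE intro!: C_inf_differentiable CE smooth_bump_C_inf that)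
      then show ?thesis
        using weak[OF smooth_bump_mult[OF that CE], of i] by (simp add: h_def mult_ac)
    qed
  qed
  then obtain \<kappa> where "AE x in lborel. h x = \<kappa>" by blast
  then have "AE x in lborel. \<rho> x = \<kappa> * exp (- U x)"
    by eventually_elim (auto simp: h_def exp_minus field_simps)
  then show ?thesis using U by blast
qed

section \<open>The weak zero-flux equation\<close>

text \<open>Under the potential condition this is - grad U, hence the gradient of the logarithm of
  the Gibbs density; this explains the name.\<close>

definition log_gradient :: "(real^'d \<Rightarrow> real^'d) \<Rightarrow> real^'d^'d \<Rightarrow> real^'d \<Rightarrow> real^'d" where
  "log_gradient b \<sigma> x = 2 *\<^sub>R (matrix_inv (\<sigma> ** transpose \<sigma>) *v b x)"

abbreviation diffusion :: "real^'d^'d \<Rightarrow> real^'d^'d" where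
  "diffusion \<sigma> \<equiv> \<sigma> ** transpose \<sigma>"

lemma diffusion_sym: "diffusion \<sigma> $ i $ k = diffusion \<sigma> $ k $ i"
  by (simp add: matrix_matrix_mult_def transpose_def mult.commute)

lemma invertible_diffusion: "invertible \<sigma> \<Longrightarrow> invertible (diffusion \<sigma>)" for \<sigma> :: "real^'d^'d"
  by (simp add: invertible_mult transpose_invertible)

lemma matrix_inv_inverse:
  fixes A :: "real^'n^'n"
  assumes "invertible A"
  shows "A ** matrix_inv A = mat 1" "matrix_inv A ** A = mat 1"
  using someI_ex[OF assms[unfolded invertible_def]] by (auto simp: matrix_inv_def)

lemma diffusion_log_gradient:
  fixes \<sigma> :: "real^'d^'d"
  assumes "invertible \<sigma>"
  shows "diffusion \<sigma> *v log_gradient b \<sigma> x = 2 *\<^sub>R b x"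
proof -
  have "diffusion \<sigma> *v (matrix_inv (diffusion \<sigma>) *v b x) = b x"
    using matrix_inv_inverse(1)[OF invertible_diffusion[OF assms]] by (simp add: matrix_vector_mul_assoc)
  then show ?thesis
    unfolding log_gradient_def
    by (simp add: matrix_vector_mult_scaleR)
qed

lemma C_inf_log_gradient: "C_inf b \<Longrightarrow> C_inf (log_gradient b \<sigma>)"
proof -
  assume b: "C_inf b"
  have "bounded_linear (\<lambda>y. 2 *\<^sub>R (matrix_inv (diffusion \<sigma>) *v y))"
    by (intro bounded_linear_intros matrix_vector_mul_bounded_linear)
  from C_inf_bounded_linear[OF this b] show ?thesis
    by (simp add: log_gradient_def[abs_def])
qed

lemma has_density_facts:
  fixes X :: "'w \<Rightarrow> real^'d"
  assumes "prob_space M" "has_density M X \<rho>"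
  shows "\<rho> \<in> borel_measurable borel" "integrable lborel \<rho>" "(\<integral>x. \<rho> x \<partial>lborel) = 1" "\<And>x. 0 \<le> \<rho> x"
proof -
  interpret prob_space M by fact
  have nn: "\<And>x. 0 \<le> \<rho> x" and d: "distributed M lborel X (\<lambda>x. ennreal (\<rho> x))"
    using assms(2) by (auto simp: has_density_def)
  have "(\<lambda>x. ennreal (\<rho> x)) \<in> borel_measurable borel"
    using distributed_borel_measurable[OF d] by simp
  \<comment> \<open>The real density is recovered from its extended version; nonnegativity makes
    this lossless.\<close>
  then have "(\<lambda>x. enn2real (ennreal (\<rho> x))) \<in> borel_measurable borel" by measurable
  then show m: "\<rho> \<in> borel_measurable borel" using nn by simp
  have "prob_space (density lborel (\<lambda>x. ennreal (\<rho> x)))"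
    using prob_space_distr[OF distributed_measurable[OF d]] distributed_distr_eq_density[OF d] by simp
  then have "emeasure (density lborel (\<lambda>x. ennreal (\<rho> x))) UNIV = 1"
    using prob_space.emeasure_space_1 by fastforce
  then have "(\<integral>\<^sup>+x. ennreal (\<rho> x) \<partial>lborel) = 1"
    using m by (subst (asm) emeasure_density) auto
  then have "has_bochner_integral lborel \<rho> 1"
    using m nn by (intro has_bochner_integral_nn_integral) auto
  then show "integrable lborel \<rho>" "(\<integral>x. \<rho> x \<partial>lborel) = 1" by (auto simp: has_bochner_integral_iff)
  show "\<And>x. 0 \<le> \<rho> x" by (rule nn)
qed

lemma has_density_unique:
  fixes X :: "'w \<Rightarrow> real^'d"
  assumes "prob_space M" "has_density M X \<rho>" "has_density M X \<rho>'"
  shows "AE x in lborel. \<rho> x = \<rho>' x"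
proof -
  note f = has_density_facts[OF assms(1,2)] and f' = has_density_facts[OF assms(1,3)]
  have "density lborel (\<lambda>x. ennreal (\<rho> x)) = density lborel (\<lambda>x. ennreal (\<rho>' x))"
    using assms(2,3) by (metis distributed_distr_eq_density has_density_def)
  then have "AE x in lborel. ennreal (\<rho> x) = ennreal (\<rho>' x)"
    using f(1) f'(1) by (subst (asm) sigma_finite_measure.density_unique_iff[OF sigma_finite_lborel]) auto
  then show ?thesis using f(4) f'(4) by auto
qed

text \<open>Twice the i-th component of the flux, integrated against \<phi> with the derivative
  moved from the density to the test function. In this form it makes sense for a density that is
  merely integrable.\<close>

definition weak_zero_flux :: "(real^'d \<Rightarrow> real^'d) \<Rightarrow> real^'d^'d \<Rightarrow> (real^'d \<Rightarrow> real) \<Rightarrow> bool" where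
  "weak_zero_flux b \<sigma> \<rho> \<longleftrightarrow> (\<forall>\<phi> i. smooth_bump \<phi> \<longrightarrow>
     (\<integral>x. (2 * b x $ i * \<phi> x + (\<Sum>k\<in>UNIV. diffusion \<sigma> $ i $ k * partial k \<phi> x)) * \<rho> x \<partial>lborel) = 0)"

lemma potential_conditionI:
  assumes "\<And>x. U differentiable (at x)" "\<And>i x. partial i U x = - log_gradient b \<sigma> x $ i"
    and "integrable lborel (\<lambda>x. exp (- U x))"
    and "AE x in lborel. \<rho> x = 1 / (\<integral>y. exp (- U y) \<partial>lborel) * exp (- U x)"
  shows "potential_condition b \<sigma> \<rho>"
proof -
  have "- grad U x = log_gradient b \<sigma> x" for x
    by (simp add: vec_eq_iff grad_def assms(2))
  then show ?thesis
    unfolding potential_condition_def using assms by (auto simp: log_gradient_def)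
qed

text \<open>\<open>U\<close> is assumed differentiable only, but its gradient is a linear image of
  the smooth drift, so \<open>U\<close> is smooth.\<close>

lemma potential_conditionE:
  assumes "potential_condition b \<sigma> \<rho>" "C_inf b"
  obtains U where "C_inf U" "\<And>i x. partial i U x = - log_gradient b \<sigma> x $ i"
    "integrable lborel (\<lambda>x. exp (- U x))"
    "AE x in lborel. \<rho> x = 1 / (\<integral>y. exp (- U y) \<partial>lborel) * exp (- U x)"
proof -
  obtain U where U: "\<And>x. U differentiable (at x)" "\<And>x. - grad U x = log_gradient b \<sigma> x"
    "integrable lborel (\<lambda>x. exp (- U x))"
    "AE x in lborel. \<rho> x = 1 / (\<integral>y. exp (- U y) \<partial>lborel) * exp (- U x)"
    using assms(1) unfolding potential_condition_def log_gradient_def by blast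
  have p: "partial i U x = - log_gradient b \<sigma> x $ i" for i x
    using U(2)[of x, symmetric] by (simp add: grad_def)
  have "C_inf U"
  proof (rule C_infI[OF U(1)])
    show "C_inf (partial i U)" for i
      unfolding p[abs_def] by (intro C_inf_minus C_inf_nth C_inf_log_gradient assms)
  qed
  with that p U show ?thesis by blast
qed

text \<open>Multiplying the vector of weak equations by the inverse diffusion matrix decouples the
  derivatives: component i becomes an equation for \<open>log_gradient b \<sigma> x $ i\<close> and
  \<open>partial i \<phi>\<close> alone.\<close>

lemma weak_zero_flux_imp_potential:
  fixes b :: "real^'d \<Rightarrow> real^'d"
  assumes b: "C_inf b" and \<sigma>: "invertible \<sigma>" and "weak_zero_flux b \<sigma> \<rho>"
    and \<rho>: "integrable lborel \<rho>" "(\<integral>x. \<rho> x \<partial>lborel) = 1" "\<And>x. \<rho> x > 0"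
  shows "potential_condition b \<sigma> \<rho>"
proof -
  let ?a = "diffusion \<sigma>" and ?A = "matrix_inv (diffusion \<sigma>)"
  have Aa: "(\<Sum>k\<in>UNIV. ?A $ i $ k * ?a $ k $ j) = (if i = j then 1 else 0)" for i j
    using matrix_inv_inverse(2)[OF invertible_diffusion[OF \<sigma>]]
    by (simp add: matrix_matrix_mult_def mat_def vec_eq_iff)
  have "\<exists>U \<kappa>. C_inf U \<and> (\<forall>i x. partial i U x = - log_gradient b \<sigma> x $ i) \<and>
      (AE x in lborel. \<rho> x = \<kappa> * exp (- U x))"
  proof (rule weak_log_gradient_imp_gibbs[OF C_inf_log_gradient[OF b] \<rho>(1,3)])
    fix \<phi> :: "real^'d \<Rightarrow> real" and i assume \<phi>: "smooth_bump \<phi>"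
    let ?f = "\<lambda>k x. (2 * b x $ k * \<phi> x + (\<Sum>j\<in>UNIV. ?a $ k $ j * partial j \<phi> x)) * \<rho> x"
    have "smooth_bump (\<lambda>x. 2 * b x $ k * \<phi> x)" for k
      by (intro smooth_bump_mult \<phi> C_inf_intros b)
    moreover have "smooth_bump (\<lambda>x. \<Sum>j\<in>S. ?a $ k $ j * partial j \<phi> x)" for k S
    proof (induction S rule: infinite_finite_induct)
      case (insert j S)
      then show ?case by (auto intro!: smooth_bump_add smooth_bump_mult smooth_bump_partial \<phi> C_inf_const)
    qed (auto simp: smooth_bump_def C_inf_const)
    ultimately have int: "integrable lborel (?f k)" for k
      by (intro smooth_bump_integrable_mult smooth_bump_add \<rho>)
    have "(log_gradient b \<sigma> x $ i * \<phi> x + partial i \<phi> x) * \<rho> x = (\<Sum>k\<in>UNIV. ?A $ i $ k * ?f k x)" for x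
    proof -
      have "(\<Sum>k\<in>UNIV. ?A $ i $ k * (\<Sum>j\<in>UNIV. ?a $ k $ j * partial j \<phi> x)) =
          (\<Sum>k\<in>UNIV. \<Sum>j\<in>UNIV. ?A $ i $ k * ?a $ k $ j * partial j \<phi> x)"
        by (simp add: sum_distrib_left mult.assoc)
      also have "\<dots> = (\<Sum>j\<in>UNIV. (\<Sum>k\<in>UNIV. ?A $ i $ k * ?a $ k $ j) * partial j \<phi> x)"
        by (subst sum.swap) (simp add: sum_distrib_right)
      also have "\<dots> = partial i \<phi> x"
        by (simp add: Aa if_distrib[where f = "\<lambda>c. c * _"] cong: if_cong)
      finally have 1: "(\<Sum>k\<in>UNIV. ?A $ i $ k * (\<Sum>j\<in>UNIV. ?a $ k $ j * partial j \<phi> x)) = partial i \<phi> x" .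
      have 2: "(\<Sum>k\<in>UNIV. ?A $ i $ k * (2 * b x $ k * \<phi> x)) = log_gradient b \<sigma> x $ i * \<phi> x"
        by (simp add: log_gradient_def matrix_vector_mult_def sum_distrib_left sum_distrib_right mult_ac)
      have "(\<Sum>k\<in>UNIV. ?A $ i $ k * ?f k x) =
          ((\<Sum>k\<in>UNIV. ?A $ i $ k * (2 * b x $ k * \<phi> x)) +
           (\<Sum>k\<in>UNIV. ?A $ i $ k * (\<Sum>j\<in>UNIV. ?a $ k $ j * partial j \<phi> x))) * \<rho> x"
        unfolding sum.distrib[symmetric] sum_distrib_right by (simp add: algebra_simps)
      then show ?thesis unfolding 1 2 by simp
    qed
    then have "(\<integral>x. (log_gradient b \<sigma> x $ i * \<phi> x + partial i \<phi> x) * \<rho> x \<partial>lborel) =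
        (\<integral>x. (\<Sum>k\<in>UNIV. ?A $ i $ k * ?f k x) \<partial>lborel)" by simp
    also have "\<dots> = (\<Sum>k\<in>UNIV. ?A $ i $ k * (\<integral>x. ?f k x \<partial>lborel))"
      by (subst Bochner_Integration.integral_sum) (auto intro!: integrable_mult_right int)
    also have "\<dots> = 0"
      using assms(3) \<phi> unfolding weak_zero_flux_def by simp
    finally show "(\<integral>x. (log_gradient b \<sigma> x $ i * \<phi> x + partial i \<phi> x) * \<rho> x \<partial>lborel) = 0" .
  qed
  then obtain U \<kappa> where U: "C_inf U" "\<And>i x. partial i U x = - log_gradient b \<sigma> x $ i"
    and ae: "AE x in lborel. \<rho> x = \<kappa> * exp (- U x)" by blast
  \<comment> \<open>A single point where the identity holds shows that \<kappa> is positive; total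
    mass 1 then makes \<kappa> the reciprocal of the partition function.\<close>
  obtain x0 where "\<rho> x0 = \<kappa> * exp (- U x0)"
    using AE_lborel_open_imp_ex[OF ae open_UNIV] by auto
  then have \<kappa>: "\<kappa> > 0" using \<rho>(3)[of x0] by (simp add: zero_less_mult_iff)
  have [measurable]: "U \<in> borel_measurable borel" by (intro C_inf_borel_measurable U)
  have ae': "AE x in lborel. 1 / \<kappa> * \<rho> x = exp (- U x)"
    using ae by eventually_elim (use \<kappa> in auto)
  have "integrable lborel (\<lambda>x. 1 / \<kappa> * \<rho> x)" using \<rho>(1) by simp
  then have int: "integrable lborel (\<lambda>x. exp (- U x))"
    by (rule integrable_cong_AE_imp) (use ae' in \<open>auto elim: eventually_mono\<close>)
  have "(\<integral>x. exp (- U x) \<partial>lborel) = (\<integral>x. 1 / \<kappa> * \<rho> x \<partial>lborel)"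
    using ae' \<rho>(1) by (intro integral_cong_AE) (auto elim: eventually_mono)
  then have "1 / (\<integral>x. exp (- U x) \<partial>lborel) = \<kappa>" using \<rho>(2) \<kappa> by simp
  with ae have "AE x in lborel. \<rho> x = 1 / (\<integral>y. exp (- U y) \<partial>lborel) * exp (- U x)" by simp
  then show ?thesis
    using U int by (intro potential_conditionI[of U]) (auto intro: C_inf_differentiable)
qed

lemma partial_cmult:
  fixes f :: "real^'d \<Rightarrow> real"
  shows "f differentiable (at x) \<Longrightarrow> partial i (\<lambda>y. f y * c) x = partial i f x * c"
  using partial_bounded_linear[OF bounded_linear_mult_left] by blast

text \<open>As the diffusion matrix is constant and maps \<open>log_gradient\<close> to twice the
  drift, the flux is - 1/2 times this matrix applied to grad \<rho> - \<rho>
  \<open>log_gradient\<close>; the matrix is injective.\<close>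

lemma prob_flux_zero_iff:
  fixes \<rho> :: "real^'d \<Rightarrow> real"
  assumes \<sigma>: "invertible \<sigma>" and \<rho>: "\<rho> differentiable (at x)"
  shows "prob_flux b \<sigma> \<rho> x = 0 \<longleftrightarrow> (\<forall>i. partial i \<rho> x = \<rho> x * log_gradient b \<sigma> x $ i)"
proof -
  have "prob_flux b \<sigma> \<rho> x = - (1/2) *\<^sub>R (diffusion \<sigma> *v grad \<rho> x) + \<rho> x *\<^sub>R b x"
    unfolding prob_flux_def
    by (simp add: partial_cmult[OF \<rho>] matrix_vector_mult_def grad_def mult.commute)
  also have "\<dots> = - (1/2) *\<^sub>R (diffusion \<sigma> *v grad \<rho> x - \<rho> x *\<^sub>R (2 *\<^sub>R b x))"
    by (simp add: scaleR_diff_right)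
  also have "\<dots> = - (1/2) *\<^sub>R (diffusion \<sigma> *v (grad \<rho> x - \<rho> x *\<^sub>R log_gradient b \<sigma> x))"
    by (simp only: diffusion_log_gradient[OF \<sigma>, symmetric] matrix_vector_mult_diff_distrib
        matrix_vector_mult_scaleR[symmetric])
  finally have "prob_flux b \<sigma> \<rho> x = 0 \<longleftrightarrow> diffusion \<sigma> *v (grad \<rho> x - \<rho> x *\<^sub>R log_gradient b \<sigma> x) = 0"
    by simp
  also have "\<dots> \<longleftrightarrow> grad \<rho> x - \<rho> x *\<^sub>R log_gradient b \<sigma> x = 0"
  proof -
    have "\<exists>B. B ** diffusion \<sigma> = mat 1"
      using matrix_inv_inverse(2)[OF invertible_diffusion[OF \<sigma>]] by blast
    then have "\<forall>y. diffusion \<sigma> *v y = 0 \<longrightarrow> y = 0" by (simp only: matrix_left_invertible_ker)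
    then show ?thesis by auto
  qed
  finally show ?thesis by (simp add: vec_eq_iff grad_def)
qed

lemma continuous_on_unit_interval_bounded:
  fixes f :: "real \<Rightarrow> real"
  assumes "continuous_on {0..1} f"
  shows "\<exists>K. \<forall>s\<in>{0..1}. \<bar>f s\<bar> \<le> K"
  using compact_imp_bounded[OF compact_continuous_image[OF assms compact_Icc]]
  by (simp add: bounded_iff)

text \<open>Gronwall with the integrating factor exp(K s): the product with f is
  nondecreasing.\<close>

lemma linear_ode_pos:
  fixes f :: "real \<Rightarrow> real"
  assumes "\<And>s. (f has_real_derivative f' s) (at s)" "\<And>s. s \<in> {0..1} \<Longrightarrow> f' s \<ge> - K * f s" "f 0 > 0"
  shows "f 1 > 0"
proof -
  have "exp (K * 0) * f 0 \<le> exp (K * 1) * f 1"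
  proof (rule DERIV_nonneg_imp_nondecreasing[of 0 1 "\<lambda>s. exp (K * s) * f s"])
    fix s :: real assume s: "0 \<le> s" "s \<le> 1"
    have "((\<lambda>s. exp (K * s) * f s) has_real_derivative (exp (K * s) * (f' s + K * f s))) (at s)"
      by (auto intro!: derivative_eq_intros assms simp: algebra_simps)
    moreover have "exp (K * s) * (f' s + K * f s) \<ge> 0" using assms(2)[of s] s by simp
    ultimately show "\<exists>y. ((\<lambda>s. exp (K * s) * f s) has_real_derivative y) (at s) \<and> 0 \<le> y" by blast
  qed simp
  then have "0 < exp K * f 1" using assms(3) by simp
  then show ?thesis by (simp add: zero_less_mult_iff)
qed

text \<open>At time 0 the vanishing flux reads grad \<rho> = \<rho> \<open>log_gradient\<close> for
  the differentiable version \<rho>, and U = - ln \<rho> solves the problem once \<rho> is positive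
  everywhere. This has to be shown, as positivity is assumed for \<open>\<rho>0\<close>, with which
  \<rho> agrees only almost everywhere.\<close>

lemma zero_flux_imp_potential:
  fixes b :: "real^'d \<Rightarrow> real^'d"
  assumes M: "prob_space M" and b: "C_inf b" and \<sigma>: "invertible \<sigma>"
    and d0: "has_density M (q 0) \<rho>0" and pos: "\<And>x. \<rho>0 x > 0" and "zero_flux M b \<sigma> q"
  shows "potential_condition b \<sigma> \<rho>0"
proof -
  obtain \<rho> where d: "has_density M (q 0) \<rho>" and diff: "\<And>x. \<rho> differentiable (at x)"
    and z: "\<And>x. prob_flux b \<sigma> \<rho> x = 0"
    using assms(6) unfolding zero_flux_def by (metis order_refl)
  have p: "partial i \<rho> x = \<rho> x * log_gradient b \<sigma> x $ i" for i x
    using z prob_flux_zero_iff[OF \<sigma> diff] by blast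
  note \<rho> = has_density_facts[OF M d]
  have ae: "AE x in lborel. \<rho>0 x = \<rho> x" by (rule has_density_unique[OF M d0 d])
  \<comment> \<open>One point of agreement suffices: along the segment from \<open>x1\<close> to any
    x the density solves a linear differential equation with bounded coefficient, so positivity
    propagates.\<close>
  obtain x1 where "\<rho>0 x1 = \<rho> x1" using AE_lborel_open_imp_ex[OF ae open_UNIV] by auto
  then have x1: "\<rho> x1 > 0" using pos[of x1] by simp
  have \<rho>pos: "\<rho> x > 0" for x
  proof -
    let ?h = "x - x1"
    have cont: "continuous_on S (log_gradient b \<sigma>)" for S
      by (intro C_inf_continuous C_inf_log_gradient b)
    have "continuous_on {0..1} (\<lambda>s. ?h \<bullet> log_gradient b \<sigma> (x1 + s *\<^sub>R ?h))"
      by (intro continuous_intros continuous_on_compose2[OF cont[of UNIV]]) auto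
    from continuous_on_unit_interval_bounded[OF this]
    obtain K where K: "\<And>s. s \<in> {0..1} \<Longrightarrow> \<bar>?h \<bullet> log_gradient b \<sigma> (x1 + s *\<^sub>R ?h)\<bar> \<le> K"
      by blast
    have "\<rho> (x1 + 1 *\<^sub>R ?h) > 0"
    proof (rule linear_ode_pos[where f = "\<lambda>s. \<rho> (x1 + s *\<^sub>R ?h)" and K = K])
      show "((\<lambda>s. \<rho> (x1 + s *\<^sub>R ?h)) has_real_derivative
          \<rho> (x1 + s *\<^sub>R ?h) * (?h \<bullet> log_gradient b \<sigma> (x1 + s *\<^sub>R ?h))) (at s)" for s
      proof -
        have "(\<Sum>i\<in>UNIV. ?h $ i * partial i \<rho> (x1 + s *\<^sub>R ?h)) =
            \<rho> (x1 + s *\<^sub>R ?h) * (?h \<bullet> log_gradient b \<sigma> (x1 + s *\<^sub>R ?h))"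
          by (simp add: p inner_vec_def sum_distrib_left mult_ac)
        then show ?thesis using has_real_derivative_line[OF diff, where x = x1 and s = s and h = ?h] by (simp only:)
      qed
      show "- K * \<rho> (x1 + s *\<^sub>R ?h) \<le> \<rho> (x1 + s *\<^sub>R ?h) * (?h \<bullet> log_gradient b \<sigma> (x1 + s *\<^sub>R ?h))"
        if "s \<in> {0..1}" for s
      proof -
        have "- K \<le> ?h \<bullet> log_gradient b \<sigma> (x1 + s *\<^sub>R ?h)" using K[OF that] by simp
        from mult_right_mono[OF this \<rho>(4)] show ?thesis by (simp add: mult.commute)
      qed
    qed (use x1 in simp)
    then show ?thesis by simp
  qed
  show ?thesis
  \<comment> \<open>Since \<rho> integrates to 1, this choice of U has partition function 1.\<close>
  proof (rule potential_conditionI[of "\<lambda>x. - ln (\<rho> x)"])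
    have D: "((\<lambda>t. - ln t) has_real_derivative - (1 / \<rho> x)) (at (\<rho> x))" for x
      using \<rho>pos[of x] by (auto intro!: derivative_eq_intros)
    show "(\<lambda>x. - ln (\<rho> x)) differentiable (at x)" for x
    proof -
      have "(\<lambda>t. - ln t) differentiable (at (\<rho> x))" using D by (metis real_differentiable_def)
      from differentiable_chain_at[OF diff this] show ?thesis by (simp add: o_def)
    qed
    show "partial i (\<lambda>x. - ln (\<rho> x)) x = - log_gradient b \<sigma> x $ i" for i x
      using \<rho>pos[of x] by (subst partial_compose[OF diff D]) (simp add: p)
    show "integrable lborel (\<lambda>x. exp (- (- ln (\<rho> x))))" using \<rho>(2) \<rho>pos by simp
    show "AE x in lborel. \<rho>0 x = 1 / (\<integral>y. exp (- (- ln (\<rho> y))) \<partial>lborel) * exp (- (- ln (\<rho> x)))"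
      using ae \<rho>(3) \<rho>pos by simp
  qed
qed

section \<open>Symmetry of the generator\<close>

lemma smooth_bump_sum:
  fixes h :: "'a \<Rightarrow> real^'d \<Rightarrow> real"
  assumes "\<And>i. smooth_bump (h i)"
  shows "smooth_bump (\<lambda>x. \<Sum>i\<in>S. h i x)"
proof (induction S rule: infinite_finite_induct)
  case (insert i S)
  then show ?case using smooth_bump_add[OF assms[of i] insert.IH] by simp
qed (auto simp: smooth_bump_def C_inf_const)

lemma C_inf_generator:
  assumes "C_inf b" "C_inf f"
  shows "C_inf (generator b \<sigma> f)"
  unfolding generator_def[abs_def] grad_def inner_vec_def inner_real_def vec_lambda_beta
  by (intro C_inf_intros assms)

lemma smooth_bump_generator:
  assumes "C_inf b" "smooth_bump f"
  shows "smooth_bump (generator b \<sigma> f)"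
proof -
  obtain R where f: "C_inf f" "\<And>x. norm x > R \<Longrightarrow> f x = 0"
    using assms(2) by (auto simp: smooth_bump_def)
  have "generator b \<sigma> f x = 0" if "norm x > R" for x
  proof -
    have "partial i f x = 0" "partial i (partial k f) x = 0" for i k
      using partial_vanishing[OF f(2) that] partial_vanishing[OF partial_vanishing[OF f(2)] that] by auto
    then show ?thesis by (simp add: generator_def grad_def inner_vec_def)
  qed
  then show ?thesis using C_inf_generator[OF assms(1) f(1)] unfolding smooth_bump_def by blast
qed

text \<open>The first-order part is a derivation, so the defect in the product rule comes from the
  second-order part. It is the carre du champ; the two mixed sums coincide by symmetry of the
  diffusion matrix, which turns the factor 1/2 into 1.\<close>

lemma generator_mult:
  fixes f g :: "real^'d \<Rightarrow> real"
  assumes f: "C_inf f" and g: "C_inf g"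
  shows "generator b \<sigma> (\<lambda>x. f x * g x) x = f x * generator b \<sigma> g x + g x * generator b \<sigma> f x +
    (\<Sum>i\<in>UNIV. \<Sum>k\<in>UNIV. diffusion \<sigma> $ i $ k * (partial i f x * partial k g x))"
proof -
  note D = C_inf_differentiable
  have p1: "partial i (\<lambda>x. f x * g x) = (\<lambda>x. partial i f x * g x + f x * partial i g x)" for i
    by (intro ext partial_mult D f g)
  have p2: "partial i (partial k (\<lambda>x. f x * g x)) x =
      partial i (partial k f) x * g x + partial k f x * partial i g x +
      (partial i f x * partial k g x + f x * partial i (partial k g) x)" for i k
    unfolding p1 by (simp add: partial_add partial_mult D C_inf_intros f g)
  let ?a = "diffusion \<sigma>"
  let ?S = "\<lambda>F. \<Sum>i\<in>UNIV. \<Sum>k\<in>UNIV. ?a $ i $ k * F i k"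
  have sw: "?S (\<lambda>i k. partial k f x * partial i g x) = ?S (\<lambda>i k. partial i f x * partial k g x)"
    by (subst sum.swap) (simp add: diffusion_sym[of \<sigma>])
  have "?S (\<lambda>i k. partial i (partial k (\<lambda>x. f x * g x)) x) =
     ?S (\<lambda>i k. partial i (partial k f) x) * g x + ?S (\<lambda>i k. partial k f x * partial i g x) +
     (?S (\<lambda>i k. partial i f x * partial k g x) + f x * ?S (\<lambda>i k. partial i (partial k g) x))"
    unfolding p2 by (simp add: distrib_left sum.distrib sum_distrib_left sum_distrib_right mult_ac)
  moreover have "b x \<bullet> grad (\<lambda>x. f x * g x) x = (b x \<bullet> grad f x) * g x + f x * (b x \<bullet> grad g x)"
    by (simp add: grad_def p1 inner_vec_def distrib_left sum.distrib sum_distrib_left sum_distrib_right mult_ac)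
  ultimately show ?thesis
    unfolding generator_def sw by (simp add: algebra_simps)
qed

text \<open>The fields are integrable but need not have compact support. Against a cut-off of scale
  n the divergence theorem leaves the fields paired with the gradient of the cut-off, which is of
  order 1 / n uniformly.\<close>

lemma divergence_integral_zero:
  fixes F :: "'d::finite \<Rightarrow> real^'d \<Rightarrow> real"
  assumes F: "\<And>i. C_inf (F i)" "\<And>i. integrable lborel (F i)"
    and div: "integrable lborel (\<lambda>x. \<Sum>i\<in>UNIV. partial i (F i) x)"
  shows "(\<integral>x. (\<Sum>i\<in>UNIV. partial i (F i) x) \<partial>lborel) = 0"
proof -
  define q where "q n x = 1 - (norm (x - 0))\<^sup>2 / (real (Suc n))\<^sup>2" for n and x :: "real^'d"
  define cut where "cut n x = flat_exp 0 (q n x)" for n x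
  have q_C: "C_inf (q n)" for n
  proof -
    have "C_inf (\<lambda>x::real^'d. 1 - (norm (x - 0))\<^sup>2 * (1 / (real (Suc n))\<^sup>2))"
      by (intro C_inf_diff C_inf_mult C_inf_const C_inf_norm_sq)
    then show ?thesis by (simp add: q_def[abs_def])
  qed
  have cut_C: "C_inf (cut n)" for n unfolding cut_def[abs_def] by (intro C_inf_flat q_C)
  have q_neg: "q n x \<le> 0" if "norm x > real (Suc n)" for n x
  proof -
    have "(real (Suc n))\<^sup>2 \<le> (norm x)\<^sup>2" using that by (intro power_mono) auto
    then show ?thesis by (simp add: q_def divide_simps)
  qed
  have cut_van: "cut n x = 0" if "norm x > real (Suc n)" for n x
    using q_neg[OF that] by (simp add: cut_def flat_nonpos)
  have q_p: "partial i (q n) x = - 2 * x $ i / (real (Suc n))\<^sup>2" for i n x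
  proof -
    have "((\<lambda>x. 1 - (x \<bullet> x) * c) has_derivative (\<lambda>h. - (2 * (x \<bullet> h) * c))) (at x)" for c
      by (auto intro!: derivative_eq_intros simp: inner_commute)
    from this[of "1 / (real (Suc n))\<^sup>2"]
    have "(q n has_derivative (\<lambda>h. - (2 * (x \<bullet> h) * (1 / (real (Suc n))\<^sup>2)))) (at x)"
      by (simp add: q_def[abs_def] power2_norm_eq_inner)
    from partial_eqI[OF this] show ?thesis by (simp add: inner_axis)
  qed
  have cut_p: "partial i (cut n) x = flat_exp (Suc 0) (q n x) * (- 2 * x $ i / (real (Suc n))\<^sup>2)" for i n x
    unfolding cut_def[abs_def]
    by (subst partial_compose[OF C_inf_differentiable[OF q_C] DERIV_flat]) (simp add: q_p)
  obtain C where C: "\<And>t. t \<le> 1 \<Longrightarrow> \<bar>flat_exp (Suc 0) t\<bar> \<le> C"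
    using flat_bounded_above by blast
  have C0: "C \<ge> 0" using C[of 0] by simp
  \<comment> \<open>On the support of the cut-off a coordinate is at most n + 1, and one of the two
    factors n + 1 in the denominator cancels.\<close>
  have cut_pb: "\<bar>partial i (cut n) x\<bar> \<le> 2 * C / real (Suc n)" for i n x
  proof (cases "norm x > real (Suc n)")
    case True
    then show ?thesis using q_neg[OF True] C0 by (simp add: cut_p flat_nonpos)
  next
    case False
    have "\<bar>x $ i\<bar> \<le> real (Suc n)" using component_le_norm_cart[of x i] False by linarith
    then have "\<bar>- 2 * x $ i / (real (Suc n))\<^sup>2\<bar> \<le> 2 / real (Suc n)"
      by (simp add: abs_mult divide_simps power2_eq_square mult_left_mono)
    moreover have "\<bar>flat_exp (Suc 0) (q n x)\<bar> \<le> C"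
      by (intro C) (simp add: q_def)
    ultimately have "\<bar>partial i (cut n) x\<bar> \<le> C * (2 / real (Suc n))"
      unfolding cut_p abs_mult by (intro mult_mono C0) auto
    then show ?thesis by (simp add: mult.commute)
  qed
  have cut_b: "\<bar>cut n x\<bar> \<le> 1" for n x using flat_bounds[of "q n x"] by (simp add: cut_def)
  have [measurable]: "F i \<in> borel_measurable borel" "partial i (F i) \<in> borel_measurable borel"
    "cut n \<in> borel_measurable borel" "partial i (cut n) \<in> borel_measurable borel" for i n
    by (auto intro!: C_inf_borel_measurable C_inf_partial F cut_C)
  let ?D = "\<lambda>x. \<Sum>i\<in>UNIV. partial i (F i) x"
  have one: "(\<integral>x. cut n x * ?D x \<partial>lborel) = - (\<Sum>i\<in>UNIV. \<integral>x. partial i (cut n) x * F i x \<partial>lborel)" for n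
  proof -
    have b: "smooth_bump (cut n)" unfolding smooth_bump_def using cut_C cut_van by blast
    have i1: "integrable lborel (\<lambda>x. partial i (cut n) x * F i x)" for i
      by (intro integrable_bounded_mult[OF F(2) _ cut_pb]) simp
    have bF: "smooth_bump (\<lambda>x. F i x * cut n x)" for i by (intro smooth_bump_mult b F)
    have i2: "integrable lborel (partial i (\<lambda>x. F i x * cut n x))" for i
      using smooth_bump_partial[OF bF] integrable_vanishing unfolding smooth_bump_def by blast
    have i3: "(\<integral>x. partial i (\<lambda>x. F i x * cut n x) x \<partial>lborel) = 0" for i
      using bF integral_partial_zero unfolding smooth_bump_def by blast
    have eq: "cut n x * ?D x = (\<Sum>i\<in>UNIV. partial i (\<lambda>x. F i x * cut n x) x - partial i (cut n) x * F i x)" for x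
    proof -
      have "partial i (\<lambda>x. F i x * cut n x) x = partial i (F i) x * cut n x + F i x * partial i (cut n) x" for i
        by (intro partial_mult C_inf_differentiable F cut_C)
      then show ?thesis by (simp add: sum_distrib_left mult.commute)
    qed
    have "(\<integral>x. cut n x * ?D x \<partial>lborel) =
        (\<Sum>i\<in>UNIV. \<integral>x. partial i (\<lambda>x. F i x * cut n x) x - partial i (cut n) x * F i x \<partial>lborel)"
      unfolding eq by (intro Bochner_Integration.integral_sum Bochner_Integration.integrable_diff i1 i2)
    also have "\<dots> = (\<Sum>i\<in>UNIV. - (\<integral>x. partial i (cut n) x * F i x \<partial>lborel))"
      by (intro sum.cong refl, subst Bochner_Integration.integral_diff) (auto simp: i1 i2 i3)
    finally show ?thesis by (simp add: sum_negf)
  qed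
  have "(\<lambda>n. - (\<Sum>i\<in>UNIV. \<integral>x. partial i (cut n) x * F i x \<partial>lborel)) \<longlonglongrightarrow> - (\<Sum>i\<in>(UNIV::'d set). 0)"
  proof (intro tendsto_minus tendsto_sum)
    fix i :: 'd
    show "(\<lambda>n. \<integral>x. partial i (cut n) x * F i x \<partial>lborel) \<longlonglongrightarrow> 0"
    proof (rule Lim_null_comparison)
      show "(\<lambda>n. 2 * C / real (Suc n) * (\<integral>x. \<bar>F i x\<bar> \<partial>lborel)) \<longlonglongrightarrow> 0"
        by (intro tendsto_mult_left_zero LIMSEQ_Suc lim_const_over_n)
      have "\<bar>\<integral>x. partial i (cut n) x * F i x \<partial>lborel\<bar> \<le> (\<integral>x. 2 * C / real (Suc n) * \<bar>F i x\<bar> \<partial>lborel)" for n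
      proof (rule integral_abs_bound_integral)
        show "integrable lborel (\<lambda>x. partial i (cut n) x * F i x)"
          by (rule integrable_bounded_mult[OF F(2) _ cut_pb]) simp
        show "integrable lborel (\<lambda>x. 2 * C / real (Suc n) * \<bar>F i x\<bar>)"
          by (intro integrable_mult_right integrable_abs F(2))
        show "\<bar>partial i (cut n) x * F i x\<bar> \<le> 2 * C / real (Suc n) * \<bar>F i x\<bar>" for x
          unfolding abs_mult by (intro mult_right_mono cut_pb) simp
      qed
      then show "\<forall>\<^sub>F n in sequentially. norm (\<integral>x. partial i (cut n) x * F i x \<partial>lborel) \<le>
          2 * C / real (Suc n) * (\<integral>x. \<bar>F i x\<bar> \<partial>lborel)" by simp
    qed
  qed
  then have lim0: "(\<lambda>n. \<integral>x. cut n x * ?D x \<partial>lborel) \<longlonglongrightarrow> 0" unfolding one by simp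
  \<comment> \<open>The cut-offs converge to \<open>flat_exp 0 1\<close>, that is exp(-1), instead
    of 1. A nonzero constant is as good, because the limit is compared with 0.\<close>
  have lim1: "(\<lambda>n. \<integral>x. cut n x * ?D x \<partial>lborel) \<longlonglongrightarrow> (\<integral>x. exp (- 1) * ?D x \<partial>lborel)"
  proof (rule integral_dominated_convergence[where w = "\<lambda>x. \<bar>?D x\<bar>"])
    show "integrable lborel (\<lambda>x. \<bar>?D x\<bar>)" using div by simp
    show "AE x in lborel. norm (cut n x * ?D x) \<le> \<bar>?D x\<bar>" for n
      using cut_b by (auto simp: abs_mult intro!: mult_left_le_one_le)
    have "(\<lambda>n. cut n x) \<longlonglongrightarrow> exp (- 1)" for x
    proof -
      have "(\<lambda>n. 1 - (norm (x - 0))\<^sup>2 * (inverse (real (Suc n)))\<^sup>2) \<longlonglongrightarrow> 1 - (norm (x - 0))\<^sup>2 * 0\<^sup>2"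
        by (intro tendsto_intros LIMSEQ_inverse_real_of_nat)
      then have "(\<lambda>n. q n x) \<longlonglongrightarrow> 1" by (simp add: q_def divide_inverse power_inverse)
      moreover have "isCont (flat_exp 0) 1" using continuous_on_flat[of UNIV 0] by (simp add: continuous_on_eq_continuous_at)
      ultimately have "(\<lambda>n. flat_exp 0 (q n x)) \<longlonglongrightarrow> flat_exp 0 1"
        by (rule isCont_tendsto_compose[rotated])
      then show ?thesis by (simp add: cut_def flat_0)
    qed
    then show "AE x in lborel. (\<lambda>n. cut n x * ?D x) \<longlonglongrightarrow> exp (- 1) * ?D x"
      by (intro AE_I2 tendsto_mult tendsto_const)
  qed measurable
  from LIMSEQ_unique[OF lim0 lim1] show ?thesis by simp
qed

text \<open>The difference of the two integrands is a divergence: that of half the diffusion matrix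
  applied to \<phi>2 grad \<phi>1 - \<phi>1 grad \<phi>2, times the density. This field contains no
  drift and is therefore integrable for bounded functions with bounded derivatives; its divergence
  is integrable because both integrands are assumed to be.\<close>

lemma potential_imp_symmetric:
  fixes b :: "real^'d \<Rightarrow> real^'d"
  assumes b: "C_inf b" and \<sigma>: "invertible \<sigma>" and "potential_condition b \<sigma> \<rho>0"
  shows "symmetric_wrt b \<sigma> \<rho>0"
  unfolding symmetric_wrt_def
proof (intro allI impI, elim conjE)
  fix \<phi>1 \<phi>2 :: "real^'d \<Rightarrow> real"
  assume "C_b_inf \<phi>1" "C_b_inf \<phi>2"
    and int1: "integrable lborel (\<lambda>x. generator b \<sigma> \<phi>1 x * \<phi>2 x * \<rho>0 x)"
    and int2: "integrable lborel (\<lambda>x. generator b \<sigma> \<phi>2 x * \<phi>1 x * \<rho>0 x)"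
  then have C: "C_inf \<phi>1" "C_inf \<phi>2" and bd: "bounded (range (iter_partial is \<phi>1))" "bounded (range (iter_partial is \<phi>2))" for "is"
    by (auto simp: C_b_inf_def)
  obtain U where U: "C_inf U" "\<And>i x. partial i U x = - log_gradient b \<sigma> x $ i"
    and Ui: "integrable lborel (\<lambda>x. exp (- U x))"
    and ae: "AE x in lborel. \<rho>0 x = 1 / (\<integral>y. exp (- U y) \<partial>lborel) * exp (- U x)"
    using potential_conditionE[OF assms(3) b] by blast
  define Z where "Z = 1 / (\<integral>y. exp (- U y) \<partial>lborel)"
  define \<rho> where "\<rho> x = Z * exp (- U x)" for x
  have ae\<rho>: "AE x in lborel. \<rho>0 x = \<rho> x" using ae by (simp add: \<rho>_def Z_def)
  have \<rho>C: "C_inf \<rho>" unfolding \<rho>_def[abs_def] by (intro C_inf_intros U)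
  have \<rho>i: "integrable lborel \<rho>" unfolding \<rho>_def[abs_def] using Ui by simp
  have \<rho>p: "partial i \<rho> x = \<rho> x * log_gradient b \<sigma> x $ i" for i x
  proof -
    have "((\<lambda>t. Z * exp (- t)) has_real_derivative - (Z * exp (- U x))) (at (U x))"
      by (auto intro!: derivative_eq_intros)
    from partial_compose[OF C_inf_differentiable[OF U(1)] this]
    show ?thesis by (simp add: \<rho>_def[abs_def] U)
  qed
  let ?a = "diffusion \<sigma>"
  define G where "G i x = (\<Sum>j\<in>UNIV. ?a $ i $ j * (\<phi>2 x * partial j \<phi>1 x - \<phi>1 x * partial j \<phi>2 x))" for i x
  define F where "F i x = 1/2 * G i x * \<rho> x" for i x
  note D = C_inf_differentiable
  have GC: "C_inf (G i)" for i unfolding G_def[abs_def] by (intro C_inf_intros C)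
  have FC: "C_inf (F i)" for i unfolding F_def[abs_def] by (intro C_inf_intros GC \<rho>C)
  have Gb: "\<exists>K. \<forall>x. \<bar>G i x\<bar> \<le> K" for i
  proof -
    have b1: "bounded (range \<phi>1)" "bounded (range \<phi>2)" using bd[of "[]"] by auto
    have b2: "bounded (range (partial j \<phi>1))" "bounded (range (partial j \<phi>2))" for j
      using bd[of "[j]"] by auto
    have m: "bounded (range (\<lambda>x. f x * g x))" if fg: "bounded (range f)" "bounded (range g)" for f g :: "real^'d \<Rightarrow> real"
    proof -
      obtain K L where KL: "\<And>x. \<bar>f x\<bar> \<le> K" "\<And>x. \<bar>g x\<bar> \<le> L"
        using fg unfolding bounded_iff by auto
      have "\<bar>f x * g x\<bar> \<le> K * L" for x
        unfolding abs_mult using KL[of x] by (intro mult_mono) auto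
      then show ?thesis unfolding bounded_iff by auto
    qed
    have d: "bounded (range (\<lambda>x. f x - g x))" if fg: "bounded (range f)" "bounded (range g)" for f g :: "real^'d \<Rightarrow> real"
      using bounded_minus_comp[OF fg] .
    have s: "bounded (range (\<lambda>x. \<Sum>j\<in>S. f j x))" if "\<And>j. bounded (range (f j))" for f :: "'d \<Rightarrow> real^'d \<Rightarrow> real" and S
      using that by (induction S rule: infinite_finite_induct) (auto intro: bounded_plus_comp)
    have "bounded (range (G i))" unfolding G_def[abs_def]
      by (intro s m d b1 b2) auto
    then show ?thesis unfolding bounded_iff by auto
  qed
  have Fi: "integrable lborel (F i)" for i
  proof -
    obtain K where K: "\<And>x. \<bar>G i x\<bar> \<le> K" using Gb by blast
    have "integrable lborel (\<lambda>x. G i x * \<rho> x)"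
      using C_inf_borel_measurable[OF GC] by (intro integrable_bounded_mult[OF \<rho>i _ K]) simp
    then show ?thesis unfolding F_def[abs_def] by (simp add: mult.assoc)
  qed
  let ?L = "\<lambda>x. generator b \<sigma> \<phi>1 x * \<phi>2 x - generator b \<sigma> \<phi>2 x * \<phi>1 x"
  have div: "(\<Sum>i\<in>UNIV. partial i (F i) x) = ?L x * \<rho> x" for x
  proof -
    have pG: "partial i (G i) x = (\<Sum>j\<in>UNIV. ?a $ i $ j *
        ((partial i \<phi>2 x * partial j \<phi>1 x + \<phi>2 x * partial i (partial j \<phi>1) x) -
         (partial i \<phi>1 x * partial j \<phi>2 x + \<phi>1 x * partial i (partial j \<phi>2) x)))" for i
    proof -
      have "(G i has_derivative (\<lambda>h. \<Sum>j\<in>UNIV. ?a $ i $ j *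
         ((\<phi>2 x * frechet_derivative (partial j \<phi>1) (at x) h + frechet_derivative \<phi>2 (at x) h * partial j \<phi>1 x) -
          (\<phi>1 x * frechet_derivative (partial j \<phi>2) (at x) h + frechet_derivative \<phi>1 (at x) h * partial j \<phi>2 x)))) (at x)"
        unfolding G_def[abs_def]
        by (intro has_derivative_sum has_derivative_mult_right has_derivative_diff has_derivative_mult
            D[unfolded frechet_derivative_works] C_inf_partial C)
      from partial_eqI[OF this] show ?thesis by (simp add: partial_def algebra_simps)
    qed
    have pF: "partial i (F i) x = 1/2 * (partial i (G i) x * \<rho> x + G i x * (\<rho> x * log_gradient b \<sigma> x $ i))" for i
    proof -
      have "partial i (\<lambda>x. (1/2 * G i x) * \<rho> x) x = partial i (\<lambda>x. 1/2 * G i x) x * \<rho> x + 1/2 * G i x * partial i \<rho> x"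
        by (intro partial_mult D C_inf_intros GC \<rho>C)
      moreover have "partial i (\<lambda>x. 1/2 * G i x) x = 1/2 * partial i (G i) x"
        by (intro partial_bounded_linear[OF bounded_linear_mult_right] D GC)
      ultimately show ?thesis by (simp add: F_def[abs_def] \<rho>p algebra_simps)
    qed
    let ?S = "\<lambda>F. \<Sum>i\<in>UNIV. \<Sum>k\<in>UNIV. ?a $ i $ k * F i k"
    have sw: "?S (\<lambda>i k. partial i \<phi>2 x * partial k \<phi>1 x) = ?S (\<lambda>i k. partial i \<phi>1 x * partial k \<phi>2 x)"
      by (subst sum.swap) (simp add: diffusion_sym[of \<sigma>] mult.commute)
    have "(\<Sum>i\<in>UNIV. partial i (G i) x) =
      ?S (\<lambda>i k. partial i \<phi>2 x * partial k \<phi>1 x) + \<phi>2 x * ?S (\<lambda>i k. partial i (partial k \<phi>1) x) -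
      (?S (\<lambda>i k. partial i \<phi>1 x * partial k \<phi>2 x) + \<phi>1 x * ?S (\<lambda>i k. partial i (partial k \<phi>2) x))"
      unfolding pG by (simp add: right_diff_distrib distrib_left sum.distrib sum_subtractf sum_distrib_left mult_ac)
    then have 1: "(\<Sum>i\<in>UNIV. partial i (G i) x) =
      \<phi>2 x * ?S (\<lambda>i k. partial i (partial k \<phi>1) x) - \<phi>1 x * ?S (\<lambda>i k. partial i (partial k \<phi>2) x)"
      unfolding sw by simp
    \<comment> \<open>Differentiating the density produces \<open>log_gradient\<close>, and the
      diffusion matrix turns it into 2 b: this supplies the drift terms of the generator.\<close>
    have "(\<Sum>i\<in>UNIV. G i x * log_gradient b \<sigma> x $ i) =
        (\<Sum>j\<in>UNIV. (\<Sum>i\<in>UNIV. ?a $ j $ i * log_gradient b \<sigma> x $ i) * (\<phi>2 x * partial j \<phi>1 x - \<phi>1 x * partial j \<phi>2 x))"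
      unfolding G_def sum_distrib_right by (subst sum.swap) (simp add: diffusion_sym[of \<sigma>] mult_ac)
    also have "\<dots> = (\<Sum>j\<in>UNIV. 2 * b x $ j * (\<phi>2 x * partial j \<phi>1 x - \<phi>1 x * partial j \<phi>2 x))"
      using diffusion_log_gradient[OF \<sigma>, of b x] by (simp add: vec_eq_iff matrix_vector_mult_def)
    also have "\<dots> = 2 * (\<phi>2 x * (b x \<bullet> grad \<phi>1 x) - \<phi>1 x * (b x \<bullet> grad \<phi>2 x))"
      by (simp add: inner_vec_def grad_def sum_distrib_left sum_subtractf right_diff_distrib mult_ac)
    finally have 2: "(\<Sum>i\<in>UNIV. G i x * log_gradient b \<sigma> x $ i) =
      2 * (\<phi>2 x * (b x \<bullet> grad \<phi>1 x) - \<phi>1 x * (b x \<bullet> grad \<phi>2 x))" .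
    have "(\<Sum>i\<in>UNIV. partial i (F i) x) =
        1/2 * ((\<Sum>i\<in>UNIV. partial i (G i) x) + (\<Sum>i\<in>UNIV. G i x * log_gradient b \<sigma> x $ i)) * \<rho> x"
      unfolding pF by (simp add: distrib_right distrib_left sum.distrib sum_distrib_left sum_distrib_right mult_ac)
    then show ?thesis unfolding 1 2 generator_def by (simp add: algebra_simps)
  qed
  have gm [measurable]: "generator b \<sigma> f \<in> borel_measurable borel" if "C_inf f" for f
    by (intro C_inf_borel_measurable C_inf_generator b that)
  have [measurable]: "\<rho> \<in> borel_measurable borel" "\<phi>1 \<in> borel_measurable borel" "\<phi>2 \<in> borel_measurable borel"
    by (auto intro!: C_inf_borel_measurable \<rho>C C)
  have [measurable]: "generator b \<sigma> \<phi>1 \<in> borel_measurable borel" "generator b \<sigma> \<phi>2 \<in> borel_measurable borel"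
    using gm C by auto
  have j1: "integrable lborel (\<lambda>x. generator b \<sigma> \<phi>1 x * \<phi>2 x * \<rho> x)"
    by (rule integrable_cong_AE_imp[OF int1]) (use ae\<rho> in \<open>auto elim: eventually_mono\<close>)
  have j2: "integrable lborel (\<lambda>x. generator b \<sigma> \<phi>2 x * \<phi>1 x * \<rho> x)"
    by (rule integrable_cong_AE_imp[OF int2]) (use ae\<rho> in \<open>auto elim: eventually_mono\<close>)
  have "integrable lborel (\<lambda>x. generator b \<sigma> \<phi>1 x * \<phi>2 x * \<rho> x - generator b \<sigma> \<phi>2 x * \<phi>1 x * \<rho> x)"
    using j1 j2 by simp
  then have "integrable lborel (\<lambda>x. \<Sum>i\<in>UNIV. partial i (F i) x)"
    unfolding div by (simp add: left_diff_distrib)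
  from divergence_integral_zero[OF FC Fi this]
  have "(\<integral>x. generator b \<sigma> \<phi>1 x * \<phi>2 x * \<rho> x - generator b \<sigma> \<phi>2 x * \<phi>1 x * \<rho> x \<partial>lborel) = 0"
    unfolding div by (simp add: left_diff_distrib)
  then have eq: "(\<integral>x. generator b \<sigma> \<phi>1 x * \<phi>2 x * \<rho> x \<partial>lborel) = (\<integral>x. generator b \<sigma> \<phi>2 x * \<phi>1 x * \<rho> x \<partial>lborel)"
    using j1 j2 by simp
  have "(\<integral>x. generator b \<sigma> \<phi>1 x * \<phi>2 x * \<rho>0 x \<partial>lborel) = (\<integral>x. generator b \<sigma> \<phi>1 x * \<phi>2 x * \<rho> x \<partial>lborel)"
    using int1 by (intro integral_cong_AE) (use ae\<rho> in \<open>auto elim: eventually_mono\<close>)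
  also note eq
  also have "(\<integral>x. generator b \<sigma> \<phi>2 x * \<phi>1 x * \<rho> x \<partial>lborel) = (\<integral>x. generator b \<sigma> \<phi>2 x * \<phi>1 x * \<rho>0 x \<partial>lborel)"
    using int2 by (intro integral_cong_AE) (use ae\<rho> in \<open>auto elim: eventually_mono\<close>)
  finally show "(\<integral>x. generator b \<sigma> \<phi>1 x * \<phi>2 x * \<rho>0 x \<partial>lborel) = (\<integral>x. generator b \<sigma> \<phi>2 x * \<phi>1 x * \<rho>0 x \<partial>lborel)" .
qed

text \<open>Each iterated partial derivative is a constant of modulus at most 1 times a later member
  of the sequence; the constant becomes 0 as soon as an index differs from \<open>m\<close>.\<close>

lemma C_b_inf_coordinate_compose:
  fixes g :: "nat \<Rightarrow> real \<Rightarrow> real"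
  assumes g: "\<And>k t. (g k has_real_derivative g (Suc k) t) (at t)" and K: "\<And>k t. \<bar>g k t\<bar> \<le> 1"
  shows "C_b_inf (\<lambda>x::real^'d. g k (x $ m))"
proof -
  have iter: "\<exists>c j. \<bar>c\<bar> \<le> 1 \<and> iter_partial is (\<lambda>x::real^'d. g k (x $ m)) = (\<lambda>x. c * g j (x $ m))" for "is"
  proof (induction "is")
    case Nil
    show ?case by (rule exI[of _ 1]) auto
  next
    case (Cons i "is")
    then obtain c j where c: "\<bar>c\<bar> \<le> 1" "iter_partial is (\<lambda>x::real^'d. g k (x $ m)) = (\<lambda>x. c * g j (x $ m))"
      by blast
    have "partial i (\<lambda>x::real^'d. c * g j (x $ m)) x = (if i = m then c else 0) * g (Suc j) (x $ m)" for x
    proof -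
      have D: "((\<lambda>t. c * g j t) has_real_derivative c * g (Suc j) (x $ m)) (at (x $ m))"
        by (intro DERIV_cmult g)
      show ?thesis
        using partial_compose[OF C_inf_differentiable[OF C_inf_coordinate] D, of i]
        by (simp add: partial_nth)
    qed
    then have "iter_partial (i # is) (\<lambda>x::real^'d. g k (x $ m)) = (\<lambda>x. (if i = m then c else 0) * g (Suc j) (x $ m))"
      by (simp add: c fun_eq_iff)
    moreover have "\<bar>if i = m then c else 0\<bar> \<le> 1" using c(1) by simp
    ultimately show ?case by blast
  qed
  have "bounded (range (iter_partial is (\<lambda>x::real^'d. g k (x $ m))))" for "is"
  proof -
    obtain c j where c: "\<bar>c\<bar> \<le> 1" "iter_partial is (\<lambda>x::real^'d. g k (x $ m)) = (\<lambda>x. c * g j (x $ m))"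
      using iter[of "is"] by blast
    have "\<bar>c * g j t\<bar> \<le> 1" for t unfolding abs_mult using c(1) K[of j t] by (simp add: mult_le_one)
    then show ?thesis unfolding c bounded_iff by auto
  qed
  moreover have "C_inf (\<lambda>x::real^'d. g k (x $ m))"
    by (rule C_inf_compose[where g = g, OF g C_inf_coordinate])
  ultimately show ?thesis by (simp add: C_b_inf_def)
qed

text \<open>Shifting the argument by pi / 2 differentiates the sine, so one formula covers sine,
  cosine and all their derivatives.\<close>

definition sin_seq :: "nat \<Rightarrow> real \<Rightarrow> real" where
  "sin_seq k t = sin (t + real k * (pi / 2))"

lemma DERIV_sin_seq: "(sin_seq k has_real_derivative sin_seq (Suc k) t) (at t)"
proof -
  have "sin (t + real (Suc k) * (pi / 2)) = sin ((t + real k * (pi / 2)) + pi / 2)"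
    by (rule arg_cong[where f = sin]) (simp add: field_simps)
  also have "\<dots> = cos (t + real k * (pi / 2))"
    by (subst sin_add) simp
  finally show ?thesis
    unfolding sin_seq_def[abs_def] by (auto intro!: derivative_eq_intros)
qed

text \<open>Testing with \<open>\<phi> cos (x\<^sub>m)\<close> against \<open>sin (x\<^sub>m)\<close> and with \<open>\<phi> sin (x\<^sub>m)\<close> against \<open>cos (x\<^sub>m)\<close>
  replaces the unbounded test function \<open>x\<^sub>m\<close>.\<close>

lemma symmetric_imp_weak_zero_flux:
  fixes b :: "real^'d \<Rightarrow> real^'d"
  assumes b: "C_inf b" and \<rho>: "integrable lborel \<rho>" and sym: "symmetric_wrt b \<sigma> \<rho>"
  shows "weak_zero_flux b \<sigma> \<rho>"
  unfolding weak_zero_flux_def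
proof (intro allI impI)
  fix \<phi> :: "real^'d \<Rightarrow> real" and m assume \<phi>: "smooth_bump \<phi>"
  let ?a = "diffusion \<sigma>" and ?L = "generator b \<sigma>"
  let ?I = "\<lambda>f. \<integral>x. f x * \<rho> x \<partial>lborel"
  note D = C_inf_differentiable
  have Cb: "C_b_inf f" if "smooth_bump f" for f :: "real^'d \<Rightarrow> real"
    using that C_b_inf_vanishing unfolding smooth_bump_def by blast
  have bi: "integrable lborel (\<lambda>x. f x * \<rho> x)" if "smooth_bump f" for f
    by (rule smooth_bump_integrable_mult[OF that \<rho>])
  \<comment> \<open>One function of compact support makes both integrals exist, so the conditional
    form of the symmetry applies.\<close>
  have s: "?I (\<lambda>x. ?L f x * g x) = ?I (\<lambda>x. ?L g x * f x)" if f: "smooth_bump f" and g: "C_b_inf g" for f g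
  proof -
    have gC: "C_inf g" using g by (simp add: C_b_inf_def)
    have "integrable lborel (\<lambda>x. (g x * ?L f x) * \<rho> x)"
      by (intro bi smooth_bump_mult gC smooth_bump_generator b f)
    moreover have "integrable lborel (\<lambda>x. (?L g x * f x) * \<rho> x)"
      by (intro bi smooth_bump_mult C_inf_generator b f gC)
    ultimately have i: "integrable lborel (\<lambda>x. ?L f x * g x * \<rho> x)" "integrable lborel (\<lambda>x. ?L g x * f x * \<rho> x)"
      by (simp_all only: mult.commute[of "?L f _" "g _"])
    show ?thesis using sym[unfolded symmetric_wrt_def, rule_format, of f g] Cb[OF f] g i by blast
  qed
  have L1: "?L (\<lambda>x. 1) x = 0" for x
    by (simp add: generator_def grad_def inner_vec_def)
  \<comment> \<open>Symmetry against the constant 1, which the generator annihilates: the density is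
    infinitesimally invariant.\<close>
  have inv: "?I (?L f) = 0" if f: "smooth_bump f" for f
  proof -
    have "C_b_inf (\<lambda>x::real^'d. 1 :: real)"
    proof -
      have "iter_partial is (\<lambda>x::real^'d. 1 :: real) = (\<lambda>x. 1) \<or> iter_partial is (\<lambda>x::real^'d. 1 :: real) = (\<lambda>x. 0)" for "is"
        by (induction "is") auto
      then have "bounded (range (iter_partial is (\<lambda>x::real^'d. 1 :: real)))" for "is"
      proof -
        assume a: "\<And>is. iter_partial is (\<lambda>x::real^'d. 1 :: real) = (\<lambda>x. 1) \<or> iter_partial is (\<lambda>x::real^'d. 1 :: real) = (\<lambda>x. 0)"
        show ?thesis using a[of "is"] by (elim disjE) (auto simp: bounded_iff intro: exI[of _ 1] exI[of _ 0])
      qed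
      then show ?thesis by (simp add: C_b_inf_def C_inf_const)
    qed
    from s[OF f this] show ?thesis by (simp add: L1)
  qed
  define \<Gamma> where "\<Gamma> f g x = (\<Sum>i\<in>UNIV. \<Sum>k\<in>UNIV. ?a $ i $ k * (partial i f x * partial k g x))" for f g :: "real^'d \<Rightarrow> real" and x
  \<comment> \<open>The product rule for f g is integrated: the left-hand side vanishes by
    \<open>inv\<close>, and symmetry identifies the two terms with the generator, leaving a
    first-order expression in f.\<close>
  have E: "?I (\<lambda>x. 2 * f x * ?L g x + \<Gamma> f g x) = 0" if f: "smooth_bump f" and g: "C_b_inf g" for f g
  proof -
    have gC: "C_inf g" using g by (simp add: C_b_inf_def)
    have fC: "C_inf f" by (rule smooth_bump_C_inf[OF f])
    have b1: "smooth_bump (\<lambda>x. ?L g x * f x)" by (intro smooth_bump_mult C_inf_generator b f gC)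
    have b2: "smooth_bump (\<lambda>x. g x * ?L f x)" by (intro smooth_bump_mult smooth_bump_generator b f gC)
    have b3: "smooth_bump (?L (\<lambda>x. g x * f x))" by (intro smooth_bump_generator smooth_bump_mult b f gC)
    have eq: "?L (\<lambda>x. g x * f x) x = f x * ?L g x + g x * ?L f x + \<Gamma> f g x" for x
      using generator_mult[OF fC gC, of b \<sigma> x] by (simp add: \<Gamma>_def mult.commute)
    have "(\<lambda>x. (2 * f x * ?L g x + \<Gamma> f g x) * \<rho> x) =
       (\<lambda>x. (?L (\<lambda>x. g x * f x) x * \<rho> x + (?L g x * f x) * \<rho> x) - (g x * ?L f x) * \<rho> x)"
      by (rule ext, subst eq) (simp add: algebra_simps)
    then have "?I (\<lambda>x. 2 * f x * ?L g x + \<Gamma> f g x) =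
        ?I (?L (\<lambda>x. g x * f x)) + ?I (\<lambda>x. ?L g x * f x) - ?I (\<lambda>x. g x * ?L f x)"
      using bi[OF b1] bi[OF b2] bi[OF b3] by simp
    also have "?I (?L (\<lambda>x. g x * f x)) = 0" by (intro inv smooth_bump_mult f gC)
    also have "?I (\<lambda>x. g x * ?L f x) = ?I (\<lambda>x. ?L g x * f x)" using s[OF f g] by (simp add: mult.commute)
    finally show ?thesis by simp
  qed
  let ?s = "\<lambda>x::real^'d. sin (x $ m)" and ?c = "\<lambda>x::real^'d. cos (x $ m)"
  have sCb: "C_b_inf ?s" and cCb: "C_b_inf ?c"
  proof -
    have "C_b_inf (\<lambda>x::real^'d. sin_seq k (x $ m))" for k
      by (rule C_b_inf_coordinate_compose[where g = sin_seq, OF DERIV_sin_seq]) (simp add: sin_seq_def)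
    from this[of 0] this[of 1] show "C_b_inf ?s" "C_b_inf ?c"
      by (simp_all add: sin_seq_def sin_add)
  qed
  have sC: "C_inf ?s" and cC: "C_inf ?c" using sCb cCb by (auto simp: C_b_inf_def)
  have pc: "partial i (\<lambda>x. c * ?s x) = (\<lambda>x. if i = m then c * ?c x else 0)"
    "partial i (\<lambda>x. c * ?c x) = (\<lambda>x. if i = m then - c * ?s x else 0)" for i c
  proof -
    have "((\<lambda>t. c * sin t) has_real_derivative c * cos t) (at t)"
      "((\<lambda>t. c * cos t) has_real_derivative - c * sin t) (at t)" for t
      by (auto intro!: derivative_eq_intros)
    note d = this
    have "partial i (\<lambda>x::real^'d. c * ?s x) x = c * ?c x * partial i (\<lambda>x. x $ m) x"
      "partial i (\<lambda>x::real^'d. c * ?c x) x = - c * ?s x * partial i (\<lambda>x. x $ m) x" for x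
      by (rule partial_compose[OF D[OF C_inf_coordinate] d(1)],
          rule partial_compose[OF D[OF C_inf_coordinate] d(2)])
    then show "partial i (\<lambda>x. c * ?s x) = (\<lambda>x. if i = m then c * ?c x else 0)"
      "partial i (\<lambda>x. c * ?c x) = (\<lambda>x. if i = m then - c * ?s x else 0)"
      by (auto simp: fun_eq_iff partial_nth)
  qed
  have p: "partial i ?s = (\<lambda>x. (if i = m then 1 else 0) * ?c x)" "partial i ?c = (\<lambda>x. (if i = m then - 1 else 0) * ?s x)" for i
    using pc[of i 1] by (auto simp: fun_eq_iff)
  have p2: "partial i (partial k ?s) x = (if i = m \<and> k = m then - ?s x else 0)"
    "partial i (partial k ?c) x = (if i = m \<and> k = m then - ?c x else 0)" for i k x
    unfolding p pc by auto
  have dm: "(\<Sum>k\<in>UNIV. f k * (if k = m then c else 0)) = f m * c" for f :: "'d \<Rightarrow> real" and c :: real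
    by (simp add: if_distrib[where f = "\<lambda>c. _ * c"] cong: if_cong)
  have dd: "(\<Sum>i\<in>UNIV. \<Sum>k\<in>UNIV. ?a $ i $ k * (if i = m \<and> k = m then c else 0)) = ?a $ m $ m * c" for c :: real
  proof -
    have "(\<Sum>k\<in>UNIV. ?a $ i $ k * (if i = m \<and> k = m then c else 0)) = (if i = m then ?a $ m $ m * c else 0)" for i
      using dm[of "\<lambda>k. ?a $ i $ k" c] by auto
    then show ?thesis by simp
  qed
  have Ls: "?L ?s x = b x $ m * ?c x - 1/2 * (?a $ m $ m * ?s x)" for x
    unfolding generator_def p2 dd unfolding grad_def inner_vec_def p
    by (simp add: if_distrib[where f = "\<lambda>c. _ * c"] if_distrib[where f = "\<lambda>c. c * _"] cong: if_cong)
  have Lc: "?L ?c x = - b x $ m * ?s x - 1/2 * (?a $ m $ m * ?c x)" for x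
    unfolding generator_def p2 dd unfolding grad_def inner_vec_def p
    by (simp add: if_distrib[where f = "\<lambda>c. _ * c"] if_distrib[where f = "\<lambda>c. c * _"] cong: if_cong)
  have \<phi>C: "C_inf \<phi>" by (rule smooth_bump_C_inf[OF \<phi>])
  let ?fc = "\<lambda>x. ?c x * \<phi> x" and ?fs = "\<lambda>x. ?s x * \<phi> x"
  have pfc: "partial i ?fc x = (if i = m then - 1 else 0) * ?s x * \<phi> x + ?c x * partial i \<phi> x"
    and pfs: "partial i ?fs x = (if i = m then 1 else 0) * ?c x * \<phi> x + ?s x * partial i \<phi> x" for i x
    by (subst partial_mult[OF D[OF cC] D[OF \<phi>C]], simp add: p)
       (subst partial_mult[OF D[OF sC] D[OF \<phi>C]], simp add: p)
  \<comment> \<open>The identity for the pair of \<phi> cos and sin minus the one for the pair of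
    \<phi> sin and cos: the squares add up to 1, and the terms in which \<phi> is not differentiated
    cancel.\<close>
  have \<Gamma>1: "\<Gamma> ?fc ?s x - \<Gamma> ?fs ?c x = (\<Sum>k\<in>UNIV. ?a $ m $ k * partial k \<phi> x)" for x
  proof -
    have "partial i ?fc x * partial k ?s x - partial i ?fs x * partial k ?c x =
        (if k = m then partial i \<phi> x else 0)" for i k
    proof -
      have "(- d * s * f + c * p) * (e * c) - (d * c * f + s * p) * (- e * s) = e * p * (s\<^sup>2 + c\<^sup>2)"
        for d e s c f p :: real by (simp add: algebra_simps power2_eq_square)
      from this[of "if i = m then 1 else 0" "?s x" "\<phi> x" "?c x" "partial i \<phi> x" "if k = m then 1 else 0"]
      show ?thesis unfolding pfc pfs p by (auto split: if_splits)
    qed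
    then have "\<Gamma> ?fc ?s x - \<Gamma> ?fs ?c x = (\<Sum>i\<in>UNIV. \<Sum>k\<in>UNIV. ?a $ i $ k * (if k = m then partial i \<phi> x else 0))"
      unfolding \<Gamma>_def by (simp add: sum_subtractf[symmetric] right_diff_distrib[symmetric])
    also have "\<dots> = (\<Sum>i\<in>UNIV. ?a $ m $ i * partial i \<phi> x)"
      unfolding dm by (simp add: diffusion_sym[of \<sigma>])
    finally show ?thesis .
  qed
  \<comment> \<open>Here the second-order contributions of sine and cosine cancel and the drift
    terms add up.\<close>
  have L2: "2 * ?fc x * ?L ?s x - 2 * ?fs x * ?L ?c x = 2 * b x $ m * \<phi> x" for x
  proof -
    have "2 * (c * f) * (\<beta> * c - 1/2 * (A * s)) - 2 * (s * f) * (- \<beta> * s - 1/2 * (A * c)) = 2 * \<beta> * f * (s\<^sup>2 + c\<^sup>2)"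
      for c f \<beta> A s :: real by (simp add: algebra_simps power2_eq_square)
    from this[of "?c x" "\<phi> x" "b x $ m" "?a $ m $ m" "?s x"]
    show ?thesis unfolding Ls Lc by simp
  qed
  have bc: "smooth_bump ?fc" "smooth_bump ?fs" by (intro smooth_bump_mult \<phi> cC sC)+
  have bT: "smooth_bump (\<lambda>x. 2 * f x * ?L g x + \<Gamma> f g x)" if f: "smooth_bump f" and g: "C_inf g" for f g
  proof -
    have "smooth_bump (\<lambda>x. (2 * ?L g x) * f x)"
      by (intro smooth_bump_mult f C_inf_intros C_inf_generator b g)
    moreover have "smooth_bump (\<lambda>x. \<Sum>i\<in>UNIV. \<Sum>k\<in>UNIV. (?a $ i $ k * partial k g x) * partial i f x)"
      by (intro smooth_bump_sum smooth_bump_mult smooth_bump_partial f C_inf_intros g)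
    ultimately have "smooth_bump (\<lambda>x. (2 * ?L g x) * f x + (\<Sum>i\<in>UNIV. \<Sum>k\<in>UNIV. (?a $ i $ k * partial k g x) * partial i f x))"
      by (rule smooth_bump_add)
    then show ?thesis by (simp add: \<Gamma>_def mult_ac)
  qed
  have "(2 * b x $ m * \<phi> x + (\<Sum>k\<in>UNIV. ?a $ m $ k * partial k \<phi> x)) * \<rho> x =
      (2 * ?fc x * ?L ?s x + \<Gamma> ?fc ?s x) * \<rho> x - (2 * ?fs x * ?L ?c x + \<Gamma> ?fs ?c x) * \<rho> x" for x
    by (simp only: left_diff_distrib[symmetric] add_diff_add L2 \<Gamma>1)
  then have "?I (\<lambda>x. 2 * b x $ m * \<phi> x + (\<Sum>k\<in>UNIV. ?a $ m $ k * partial k \<phi> x)) =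
      (\<integral>x. (2 * ?fc x * ?L ?s x + \<Gamma> ?fc ?s x) * \<rho> x - (2 * ?fs x * ?L ?c x + \<Gamma> ?fs ?c x) * \<rho> x \<partial>lborel)"
    by (simp only:)
  also have "\<dots> = ?I (\<lambda>x. 2 * ?fc x * ?L ?s x + \<Gamma> ?fc ?s x) - ?I (\<lambda>x. 2 * ?fs x * ?L ?c x + \<Gamma> ?fs ?c x)"
    by (intro Bochner_Integration.integral_diff bi bT bc sC cC)
  also have "\<dots> = 0" using E[OF bc(1) sCb] E[OF bc(2) cCb] by simp
  finally show "?I (\<lambda>x. 2 * b x $ m * \<phi> x + (\<Sum>k\<in>UNIV. ?a $ m $ k * partial k \<phi> x)) = 0" .
qed

section \<open>Brownian increments and the Euler scheme\<close>

lemma prod_Basis_cart: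
  fixes F :: "real^'d \<Rightarrow> 'a::comm_monoid_mult"
  shows "(\<Prod>b\<in>Basis. F b) = (\<Prod>i\<in>UNIV. F (axis i 1))"
proof -
  have "bij_betw (\<lambda>i. axis i 1) (UNIV :: 'd set) (Basis :: (real^'d) set)"
    by (auto simp: bij_betw_def inj_on_def axis_eq_axis Basis_vec_def)
  from prod.reindex_bij_betw[OF this, of F] show ?thesis by simp
qed

lemma has_bochner_integral_lborel_prod:
  fixes f :: "'d::finite \<Rightarrow> real \<Rightarrow> real"
  assumes "\<And>i. integrable lborel (f i)"
  shows "integrable lborel (\<lambda>x::real^'d. \<Prod>i\<in>UNIV. f i (x $ i))"
    and "(\<integral>x. (\<Prod>i\<in>UNIV. f i ((x :: real^'d) $ i)) \<partial>lborel) = (\<Prod>i\<in>UNIV. \<integral>t. f i t \<partial>lborel)"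
proof -
  interpret product_sigma_finite "\<lambda>_::real^'d. lborel :: real measure" ..
  \<comment> \<open>The inverse of the map from an index to its basis vector; Lebesgue measure is an
    image of a product indexed by basis vectors.\<close>
  define idx where "idx b = (THE i. b = axis i (1::real))" for b :: "real^'d"
  have idx [simp]: "idx (axis i 1) = i" for i
    unfolding idx_def by (rule the_equality) (auto simp: axis_eq_axis)
  define T where "T g = (\<Sum>b\<in>Basis. g b *\<^sub>R b)" for g :: "real^'d \<Rightarrow> real"
  have [measurable]: "T \<in> (\<Pi>\<^sub>M b\<in>Basis. lborel) \<rightarrow>\<^sub>M borel"
    unfolding T_def[abs_def] by measurable
  have lb: "lborel = distr (\<Pi>\<^sub>M b\<in>Basis. lborel) borel T"
    unfolding T_def[abs_def] by (rule lborel_eq)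
  have T: "T g $ i = g (axis i 1)" for g i
  proof -
    have "axis i 1 \<in> (Basis :: (real^'d) set)" by (auto simp: Basis_vec_def)
    from inner_sum_left_Basis[OF this, of g] show ?thesis by (simp only: T_def inner_axis) simp
  qed
  have [measurable]: "f i \<in> borel_measurable borel" for i using assms[of i] by auto
  have eq: "(\<Prod>i\<in>UNIV. f i (T g $ i)) = (\<Prod>b\<in>Basis. f (idx b) (g b))" for g
    by (simp add: T prod_Basis_cart)
  have "integrable (\<Pi>\<^sub>M b\<in>Basis. lborel) (\<lambda>g. \<Prod>b\<in>Basis. f (idx b) (g b))"
    by (intro product_integrable_prod assms) auto
  then show "integrable lborel (\<lambda>x::real^'d. \<Prod>i\<in>UNIV. f i (x $ i))"
    by (subst lb, subst integrable_distr_eq) (auto simp: eq)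
  show "(\<integral>x. (\<Prod>i\<in>UNIV. f i ((x :: real^'d) $ i)) \<partial>lborel) = (\<Prod>i\<in>UNIV. \<integral>t. f i t \<partial>lborel)"
  proof -
    have "(\<integral>g. (\<Prod>b\<in>Basis. f (idx b) (g b)) \<partial>(\<Pi>\<^sub>M b\<in>Basis. lborel)) = (\<Prod>b\<in>Basis. \<integral>t. f (idx b) t \<partial>lborel)"
      by (intro product_integral_prod assms) auto
    then show ?thesis
      by (subst lb, subst integral_distr) (simp_all add: eq prod_Basis_cart[of "\<lambda>b. integral\<^sup>L lborel (f (idx b))"])
  qed
qed

section \<open>Moments of Brownian increments\<close>

lemma integrable_normal_power: "0 < r \<Longrightarrow> integrable lborel (\<lambda>x. normal_density 0 r x * x ^ k)"
  using integrable_normal_moment[of r 0 k] by simp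

lemma integral_normal_powers:
  assumes "0 < r"
  shows "(\<integral>x. normal_density 0 r x * x ^ 0 \<partial>lborel) = 1"
    "(\<integral>x. normal_density 0 r x * x ^ 1 \<partial>lborel) = 0"
    "(\<integral>x. normal_density 0 r x * x ^ 2 \<partial>lborel) = r\<^sup>2"
    "(\<integral>x. normal_density 0 r x * x ^ 4 \<partial>lborel) = 3 * r ^ 4"
proof -
  have "fact (4::nat) = (24 :: real)" "fact (2::nat) = (2 :: real)" by (simp_all add: fact_numeral)
  then show "(\<integral>x. normal_density 0 r x * x ^ 0 \<partial>lborel) = 1"
    "(\<integral>x. normal_density 0 r x * x ^ 1 \<partial>lborel) = 0"
    "(\<integral>x. normal_density 0 r x * x ^ 2 \<partial>lborel) = r\<^sup>2"
    "(\<integral>x. normal_density 0 r x * x ^ 4 \<partial>lborel) = 3 * r ^ 4"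
    using integral_normal_moment_even[OF assms, of 0 0] integral_normal_moment_odd[OF assms, of 0 0]
      integral_normal_moment_even[OF assms, of 0 1] integral_normal_moment_even[OF assms, of 0 2]
    by (simp_all add: power_divide power_mult[symmetric])
qed

lemma prod_single_power: "(\<Prod>k\<in>(UNIV::'i::finite set). (x k :: real) ^ (if k = i then m else 0)) = x i ^ m"
proof -
  have "(\<Prod>k\<in>(UNIV::'i set). x k ^ (if k = i then m else 0)) = (\<Prod>k\<in>UNIV. if k = i then x k ^ m else 1)"
    by (intro prod.cong) auto
  then show ?thesis by simp
qed

context brownian_motion
begin

text \<open>The density of an increment is a product over the coordinates, so mixed moments factor.
  Means, covariances and moments of the norm are obtained from suitable exponents
  \<open>n\<close>.\<close>

lemma increment_power_moments:
  assumes st: "0 \<le> s" "s < t"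
  shows "integrable M (\<lambda>\<omega>. \<Prod>i\<in>UNIV. (B t \<omega> - B s \<omega>) $ i ^ n i)"
    and "(\<integral>\<omega>. (\<Prod>i\<in>UNIV. (B t \<omega> - B s \<omega>) $ i ^ n i) \<partial>M) =
      (\<Prod>i\<in>UNIV. \<integral>x. normal_density 0 (sqrt (t - s)) x * x ^ n i \<partial>lborel)"
proof -
  let ?r = "sqrt (t - s)"
  let ?f = "\<lambda>x::real^'d. \<Prod>i\<in>UNIV. normal_density 0 ?r (x $ i)"
  let ?g = "\<lambda>x::real^'d. \<Prod>i\<in>UNIV. x $ i ^ n i"
  have r: "?r > 0" using st by simp
  note D = gaussian_increments_B[OF st]
  have [measurable]: "?g \<in> borel_measurable borel" by measurable
  have fg: "?f x * ?g x = (\<Prod>i\<in>UNIV. normal_density 0 ?r (x $ i) * x $ i ^ n i)" for x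
    by (simp add: prod.distrib)
  have nn: "0 \<le> ?f x" for x by (intro prod_nonneg) simp
  have "integrable lborel (\<lambda>x. ?f x * ?g x)"
    unfolding fg by (intro has_bochner_integral_lborel_prod integrable_normal_power r)
  then show "integrable M (\<lambda>\<omega>. \<Prod>i\<in>UNIV. (B t \<omega> - B s \<omega>) $ i ^ n i)"
    using distributed_integrable[OF D, of ?g] nn by simp
  have "(\<integral>\<omega>. ?g (B t \<omega> - B s \<omega>) \<partial>M) = (\<integral>x. ?f x * ?g x \<partial>lborel)"
    using distributed_integral[OF D, of ?g] nn by simp
  also have "\<dots> = (\<Prod>i\<in>UNIV. \<integral>x. normal_density 0 ?r x * x ^ n i \<partial>lborel)"
    unfolding fg by (intro has_bochner_integral_lborel_prod integrable_normal_power r)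
  finally show "(\<integral>\<omega>. (\<Prod>i\<in>UNIV. (B t \<omega> - B s \<omega>) $ i ^ n i) \<partial>M) =
      (\<Prod>i\<in>UNIV. \<integral>x. normal_density 0 ?r x * x ^ n i \<partial>lborel)" by simp
qed

lemma increment_single_moments:
  assumes st: "0 \<le> s" "s < t"
  shows "integrable M (\<lambda>\<omega>. (B t \<omega> - B s \<omega>) $ i ^ m)"
    and "(\<integral>\<omega>. (B t \<omega> - B s \<omega>) $ i ^ m \<partial>M) = (\<integral>x. normal_density 0 (sqrt (t - s)) x * x ^ m \<partial>lborel)"
proof -
  let ?n = "\<lambda>k. if k = i then m else 0"
  show "integrable M (\<lambda>\<omega>. (B t \<omega> - B s \<omega>) $ i ^ m)"
    using increment_power_moments(1)[OF st, of ?n] by (simp only: prod_single_power)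
  have "(\<Prod>k\<in>UNIV. \<integral>x. normal_density 0 (sqrt (t - s)) x * x ^ ?n k \<partial>lborel) =
      (\<Prod>k\<in>UNIV. if k = i then \<integral>x. normal_density 0 (sqrt (t - s)) x * x ^ m \<partial>lborel else 1)"
    using integral_normal_powers(1)[of "sqrt (t - s)"] st by (intro prod.cong) auto
  then show "(\<integral>\<omega>. (B t \<omega> - B s \<omega>) $ i ^ m \<partial>M) = (\<integral>x. normal_density 0 (sqrt (t - s)) x * x ^ m \<partial>lborel)"
    using increment_power_moments(2)[OF st, of ?n] unfolding prod_single_power by simp
qed

lemma increment_covariance:
  assumes st: "0 \<le> s" "s < t"
  shows "integrable M (\<lambda>\<omega>. (B t \<omega> - B s \<omega>) $ i * (B t \<omega> - B s \<omega>) $ j)"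
    and "(\<integral>\<omega>. (B t \<omega> - B s \<omega>) $ i * (B t \<omega> - B s \<omega>) $ j \<partial>M) = (if i = j then t - s else 0)"
proof -
  \<comment> \<open>The sum of two unit multi-indices; for i = j it has the entry 2, so both cases
    come from one formula.\<close>
  let ?n = "\<lambda>k. (if k = i then 1 else 0) + (if k = j then 1 else 0) :: nat"
  have p: "(\<Prod>k\<in>UNIV. (x k :: real) ^ ?n k) = x i * x j" for x
    unfolding power_add prod.distrib prod_single_power by simp
  show "integrable M (\<lambda>\<omega>. (B t \<omega> - B s \<omega>) $ i * (B t \<omega> - B s \<omega>) $ j)"
    using increment_power_moments(1)[OF st, of ?n] by (simp only: p)
  have E: "(\<integral>\<omega>. (B t \<omega> - B s \<omega>) $ i * (B t \<omega> - B s \<omega>) $ j \<partial>M) =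
      (\<Prod>k\<in>UNIV. \<integral>x. normal_density 0 (sqrt (t - s)) x * x ^ ?n k \<partial>lborel)"
    using increment_power_moments(2)[OF st, of ?n] by (simp only: p)
  show "(\<integral>\<omega>. (B t \<omega> - B s \<omega>) $ i * (B t \<omega> - B s \<omega>) $ j \<partial>M) = (if i = j then t - s else 0)"
  proof (cases "i = j")
    case True
    then show ?thesis
      using increment_single_moments(2)[OF st, of i 2] integral_normal_powers(3)[of "sqrt (t - s)"] st
      by (simp add: power2_eq_square)
  next
    case False
    have "(\<integral>x. normal_density 0 (sqrt (t - s)) x * x ^ ?n i \<partial>lborel) = 0"
      using integral_normal_powers(2)[of "sqrt (t - s)"] st False by simp
    then have "(\<Prod>k\<in>UNIV. \<integral>x. normal_density 0 (sqrt (t - s)) x * x ^ ?n k \<partial>lborel) = 0"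
      by (intro prod_zero) auto
    then show ?thesis using E False by simp
  qed
qed

lemma increment_mean:
  assumes st: "0 \<le> s" "s < t"
  shows "integrable M (\<lambda>\<omega>. (B t \<omega> - B s \<omega>) $ i)" "(\<integral>\<omega>. (B t \<omega> - B s \<omega>) $ i \<partial>M) = 0"
  using increment_single_moments[OF st, of i 1] integral_normal_powers(2)[of "sqrt (t - s)"] st by simp_all

lemma increment_norm_sq:
  assumes st: "0 \<le> s" "s < t"
  shows "integrable M (\<lambda>\<omega>. (norm (B t \<omega> - B s \<omega>))\<^sup>2)"
    and "(\<integral>\<omega>. (norm (B t \<omega> - B s \<omega>))\<^sup>2 \<partial>M) = real CARD('d) * (t - s)"
  unfolding power2_norm_eq_inner inner_vec_def
  using increment_covariance[OF st] by (simp_all del: vector_minus_component)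

text \<open>By Cauchy-Schwarz the fourth power of the norm is at most d times the sum of the fourth
  powers of the coordinates. Each of these has mean 3 (t - s)^2, and there are d of them.\<close>

lemma increment_norm_fourth:
  assumes st: "0 \<le> s" "s < t"
  shows "integrable M (\<lambda>\<omega>. norm (B t \<omega> - B s \<omega>) ^ 4)"
    and "(\<integral>\<omega>. norm (B t \<omega> - B s \<omega>) ^ 4 \<partial>M) \<le> 3 * (real CARD('d))\<^sup>2 * (t - s)\<^sup>2"
proof -
  let ?S = "\<lambda>\<omega>. real CARD('d) * (\<Sum>i\<in>UNIV. (B t \<omega> - B s \<omega>) $ i ^ 4)"
  have [measurable]: "B t \<in> borel_measurable M" "B s \<in> borel_measurable M"
    using st by (auto intro: measurable_B)
  have le: "norm x ^ 4 \<le> real CARD('d) * (\<Sum>i\<in>UNIV. x $ i ^ 4)" for x :: "real^'d"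
  proof -
    have "norm x ^ 4 = (\<Sum>i\<in>UNIV. (x $ i)\<^sup>2)\<^sup>2"
    proof -
      have "norm x ^ 4 = ((norm x)\<^sup>2)\<^sup>2" by (simp add: power_mult[symmetric])
      also have "(norm x)\<^sup>2 = (\<Sum>i\<in>UNIV. (x $ i)\<^sup>2)"
        unfolding power2_norm_eq_inner inner_vec_def by (simp add: power2_eq_square)
      finally show ?thesis .
    qed
    also have "\<dots> \<le> (\<Sum>i\<in>UNIV. ((x $ i)\<^sup>2)\<^sup>2) * real CARD('d)"
      by (rule sum_squared_le_sum_of_squares)
    finally show ?thesis by (simp add: power_mult[symmetric] mult.commute)
  qed
  have int: "integrable M ?S"
    by (intro integrable_mult_right Bochner_Integration.integrable_sum increment_single_moments st)
  have nn: "0 \<le> ?S \<omega>" for \<omega> by (intro mult_nonneg_nonneg sum_nonneg) auto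
  show i4: "integrable M (\<lambda>\<omega>. norm (B t \<omega> - B s \<omega>) ^ 4)"
    by (rule Bochner_Integration.integrable_bound[OF int])
       (use le nn in \<open>auto simp del: vector_minus_component\<close>)
  have "(\<integral>\<omega>. norm (B t \<omega> - B s \<omega>) ^ 4 \<partial>M) \<le> (\<integral>\<omega>. ?S \<omega> \<partial>M)"
    by (intro integral_mono i4 int le)
  also have "\<dots> = real CARD('d) * (\<Sum>i\<in>(UNIV::'d set). 3 * sqrt (t - s) ^ 4)"
    using increment_single_moments[OF st] integral_normal_powers(4)[of "sqrt (t - s)"] st
    by (simp del: vector_minus_component)
  also have "sqrt (t - s) ^ 4 = (t - s)\<^sup>2"
  proof -
    have "sqrt (t - s) ^ 4 = ((sqrt (t - s))\<^sup>2)\<^sup>2" by (simp add: power_mult[symmetric])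
    then show ?thesis using st by simp
  qed
  finally show "(\<integral>\<omega>. norm (B t \<omega> - B s \<omega>) ^ 4 \<partial>M) \<le> 3 * (real CARD('d))\<^sup>2 * (t - s)\<^sup>2"
    by (simp add: power2_eq_square mult_ac)
qed

end

section \<open>Pathwise convergence of the Euler scheme\<close>

text \<open>The noise enters as an arbitrary sequence, so the same recursion serves along a Brownian
  path and under a product of Gaussian laws.\<close>

primrec euler :: "(real^'d \<Rightarrow> real^'d) \<Rightarrow> real^'d^'d \<Rightarrow> real \<Rightarrow> real^'d \<Rightarrow> (nat \<Rightarrow> real^'d) \<Rightarrow> nat \<Rightarrow> real^'d" where
  "euler b \<sigma> \<delta> x \<xi> 0 = x"
| "euler b \<sigma> \<delta> x \<xi> (Suc k) = euler b \<sigma> \<delta> x \<xi> k + \<delta> *\<^sub>R b (euler b \<sigma> \<delta> x \<xi> k) + \<sigma> *v \<xi> k"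

text \<open>A deterministic discrete Gronwall argument along one path. The drift is Lipschitz only
  on balls, so the induction must at the same time keep the scheme within distance 1 of the
  solution, where one constant K applies.\<close>

lemma euler_converges:
  fixes p w :: "real \<Rightarrow> real^'d"
  assumes T: "T > 0" and p: "continuous_on {0..T} p"
    and b: "continuous_on UNIV b"
    and lip: "\<And>n::nat. n \<ge> 1 \<Longrightarrow>
      \<exists>K>0. \<forall>x y. norm x \<le> real n \<and> norm y \<le> real n \<longrightarrow> norm (b x - b y) \<le> K * norm (x - y)"
    and eq: "\<And>t. 0 \<le> t \<Longrightarrow> t \<le> T \<Longrightarrow> p t = p 0 + integral {0..t} (\<lambda>s. b (p s)) + \<sigma> *v w t"
    and e: "e > 0"
  shows "\<exists>N0\<ge>1. \<forall>N\<ge>N0. \<forall>k\<le>N. norm (euler b \<sigma> (T / real N) (p 0)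
    (\<lambda>k. w (real (Suc k) * (T / real N)) - w (real k * (T / real N))) k - p (real k * (T / real N))) \<le> e"
proof -
  have "compact (p ` {0..T})" by (intro compact_continuous_image p) auto
  then have "bounded (p ` {0..T})" by (rule compact_imp_bounded)
  then obtain R where R: "\<And>t. t \<in> {0..T} \<Longrightarrow> norm (p t) \<le> R"
    unfolding bounded_iff by blast
  \<comment> \<open>A ball that contains the path and everything within distance 1 of it.\<close>
  obtain n :: nat where n: "real n \<ge> R + 1" "n \<ge> 1"
    using real_arch_simple[of "max (R + 1) 1"] by auto
  obtain K where K: "K > 0" "\<And>x y. norm x \<le> real n \<Longrightarrow> norm y \<le> real n \<Longrightarrow> norm (b x - b y) \<le> K * norm (x - y)"
    using lip[OF n(2)] by blast
  \<comment> \<open>The cap 1 keeps the scheme inside that ball.\<close>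
  define \<epsilon> where "\<epsilon> = min e 1"
  have \<epsilon>: "\<epsilon> > 0" "\<epsilon> \<le> e" "\<epsilon> \<le> 1" using e by (auto simp: \<epsilon>_def)
  \<comment> \<open>The local error \<eta> is amplified at most by (1 + \<delta> K)^N, which does
    not exceed exp(K T).\<close>
  define \<eta> where "\<eta> = \<epsilon> / exp (K * T)"
  have \<eta>: "\<eta> > 0" using \<epsilon> by (simp add: \<eta>_def)
  have "uniformly_continuous_on {0..T} p"
    by (intro compact_uniformly_continuous p) auto
  then obtain d where d: "d > 0" "\<And>s t. s \<in> {0..T} \<Longrightarrow> t \<in> {0..T} \<Longrightarrow> dist s t < d \<Longrightarrow> dist (p s) (p t) < \<eta>"
    unfolding uniformly_continuous_on_def using \<eta> by metis
  obtain N0 :: nat where N0: "real N0 > T / d" using reals_Archimedean2 by blast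
  have bp: "continuous_on S (\<lambda>s. b (p s))" if "S \<subseteq> {0..T}" for S
    by (rule continuous_on_compose2[OF b continuous_on_subset[OF p that]]) auto
  have main: "norm (euler b \<sigma> (T / real N) (p 0)
    (\<lambda>k. w (real (Suc k) * (T / real N)) - w (real k * (T / real N))) k - p (real k * (T / real N)))
      \<le> \<eta> * ((1 + T / real N * K) ^ k - 1)" and
    main2: "\<eta> * ((1 + T / real N * K) ^ k - 1) \<le> \<epsilon>"
    if N: "N \<ge> max N0 1" and k: "k \<le> N" for N k
  proof -
    define \<delta> where "\<delta> = T / real N"
    have N1: "real N > 0" using N by simp
    have \<delta>: "\<delta> > 0" "\<delta> * real N = T" using T N1 by (auto simp: \<delta>_def)
    have \<delta>d: "\<delta> < d"
    proof -
      have "T / d < real N" using N0 N by linarith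
      then show ?thesis using d(1) N1 by (simp add: \<delta>_def field_simps)
    qed
    let ?X = "euler b \<sigma> \<delta> (p 0) (\<lambda>k. w (real (Suc k) * \<delta>) - w (real k * \<delta>))"
    have grow: "\<eta> * ((1 + \<delta> * K) ^ k - 1) \<le> \<epsilon>" if "k \<le> N" for k
    proof -
      have "(1 + \<delta> * K) ^ k \<le> (1 + \<delta> * K) ^ N"
        using that \<delta> K by (intro power_increasing) auto
      also have "\<dots> \<le> exp (\<delta> * K) ^ N"
        using \<delta> K by (intro power_mono exp_ge_add_one_self) auto
      also have "\<dots> = exp (K * T)"
        by (simp add: exp_of_nat_mult[symmetric] \<delta>(2)[symmetric] mult_ac)
      finally have "\<eta> * ((1 + \<delta> * K) ^ k - 1) \<le> \<eta> * exp (K * T)"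
        using \<eta> by (intro mult_left_mono) auto
      then show ?thesis by (simp add: \<eta>_def)
    qed
    have "norm (?X k - p (real k * \<delta>)) \<le> \<eta> * ((1 + \<delta> * K) ^ k - 1)" if "k \<le> N" for k
      using that
    proof (induction k)
      case (Suc k)
      then have IH: "norm (?X k - p (real k * \<delta>)) \<le> \<eta> * ((1 + \<delta> * K) ^ k - 1)" and k: "k \<le> N" by auto
      let ?s = "real k * \<delta>" and ?t = "real (Suc k) * \<delta>"
      have "?t \<le> real N * \<delta>" using Suc.prems \<delta>(1) by (intro mult_right_mono) auto
      then have st: "0 \<le> ?s" "?s \<le> ?t" "?t \<le> T" "?s \<le> T" "?t - ?s = \<delta>"
        using \<delta> by (auto simp: mult.commute algebra_simps)
      have ps: "norm (p ?s) \<le> real n" using R[of ?s] st n by simp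
      have Xn: "norm (?X k) \<le> real n"
        using norm_triangle_sub[of "?X k" "p ?s"] IH grow[OF k] R[of ?s] st n \<epsilon> by simp
      have "integral {0..?s} (\<lambda>s. b (p s)) + integral {?s..?t} (\<lambda>s. b (p s)) = integral {0..?t} (\<lambda>s. b (p s))"
        using st by (intro Henstock_Kurzweil_Integration.integral_combine integrable_continuous_real bp) auto
      then have "p ?t - p ?s = integral {?s..?t} (\<lambda>s. b (p s)) + (\<sigma> *v w ?t - \<sigma> *v w ?s)"
        using eq[of ?t] eq[of ?s] st by (simp add: algebra_simps)
      \<comment> \<open>The noise is additive and cancels in the difference; only the error of
        freezing the drift at the left end of the step remains.\<close>
      then have "?X (Suc k) - p ?t = (?X k - p ?s) + \<delta> *\<^sub>R (b (?X k) - b (p ?s)) -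
          (integral {?s..?t} (\<lambda>s. b (p s)) - \<delta> *\<^sub>R b (p ?s))"
        by (simp add: matrix_vector_mult_diff_distrib algebra_simps)
      also have "integral {?s..?t} (\<lambda>s. b (p s)) - \<delta> *\<^sub>R b (p ?s) = integral {?s..?t} (\<lambda>s. b (p s) - b (p ?s))"
      proof -
        have "integral {?s..?t} (\<lambda>s. b (p s) - b (p ?s)) =
            integral {?s..?t} (\<lambda>s. b (p s)) - integral {?s..?t} (\<lambda>s. b (p ?s))"
          using st by (intro Henstock_Kurzweil_Integration.integral_diff integrable_continuous_real bp continuous_on_const) auto
        then show ?thesis using st by simp
      qed
      finally have dec: "?X (Suc k) - p ?t = (?X k - p ?s) + \<delta> *\<^sub>R (b (?X k) - b (p ?s)) -
          integral {?s..?t} (\<lambda>s. b (p s) - b (p ?s))" .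
      have I: "norm (integral {?s..?t} (\<lambda>s. b (p s) - b (p ?s))) \<le> (K * \<eta>) * (?t - ?s)"
      proof (rule integral_bound)
        show "continuous_on {?s..?t} (\<lambda>s. b (p s) - b (p ?s))"
          using st by (intro continuous_intros bp) auto
        fix r assume r: "r \<in> {?s..?t}"
        have "?s \<le> r" "r \<le> ?t" using r by auto
        with st \<delta>d have r': "r \<in> {0..T}" "?s \<in> {0..T}" "dist r ?s < d"
          unfolding dist_real_def atLeastAtMost_iff by linarith+
        then have "dist (p r) (p ?s) < \<eta>" by (rule d)
        then have "norm (p r - p ?s) \<le> \<eta>" by (simp add: dist_norm)
        moreover have "norm (b (p r) - b (p ?s)) \<le> K * norm (p r - p ?s)"
          using R[OF r'(1)] n ps by (intro K) auto
        ultimately show "norm (b (p r) - b (p ?s)) \<le> K * \<eta>"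
          using K(1) by (meson mult_left_mono order_trans less_imp_le)
      qed (use st in auto)
      have J: "norm (\<delta> *\<^sub>R (b (?X k) - b (p ?s))) \<le> \<delta> * (K * norm (?X k - p ?s))"
        using K(2)[OF Xn ps] \<delta>(1) by simp
      have "norm (?X (Suc k) - p ?t) \<le> norm (?X k - p ?s) + \<delta> * (K * norm (?X k - p ?s)) + K * \<eta> * \<delta>"
      proof -
        have "norm (u + v' - i) \<le> norm u + norm v' + norm i" for u v' i :: "real^'d"
          using norm_triangle_ineq4[of "u + v'" i] norm_triangle_ineq[of u v'] by linarith
        from this[of "?X k - p ?s" "\<delta> *\<^sub>R (b (?X k) - b (p ?s))" "integral {?s..?t} (\<lambda>s. b (p s) - b (p ?s))"]
        show ?thesis unfolding dec using I[unfolded st(5)] J by linarith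
      qed
      also have "\<dots> = (1 + \<delta> * K) * norm (?X k - p ?s) + K * \<eta> * \<delta>" by (simp add: algebra_simps)
      also have "\<dots> \<le> (1 + \<delta> * K) * (\<eta> * ((1 + \<delta> * K) ^ k - 1)) + K * \<eta> * \<delta>"
        using \<delta> K IH by (intro add_right_mono mult_left_mono) auto
      also have "\<dots> = \<eta> * ((1 + \<delta> * K) ^ Suc k - 1)" by (simp add: algebra_simps)
      finally show ?case .
    qed simp
    from this[OF k] grow[OF k] show "norm (euler b \<sigma> (T / real N) (p 0)
      (\<lambda>k. w (real (Suc k) * (T / real N)) - w (real k * (T / real N))) k - p (real k * (T / real N)))
      \<le> \<eta> * ((1 + T / real N * K) ^ k - 1)" "\<eta> * ((1 + T / real N * K) ^ k - 1) \<le> \<epsilon>"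
      unfolding \<delta>_def by blast+
  qed
  show ?thesis
  proof (intro exI[of _ "max N0 1"] conjI allI impI)
    fix N k :: nat assume "max N0 1 \<le> N" "k \<le> N"
    from main[OF this] main2[OF this] \<epsilon>(2) show "norm (euler b \<sigma> (T / real N) (p 0)
      (\<lambda>k. w (real (Suc k) * (T / real N)) - w (real k * (T / real N))) k - p (real k * (T / real N))) \<le> e"
      by linarith
  qed simp
qed

section \<open>Densities of the Euler scheme\<close>

definition gauss :: "real \<Rightarrow> real^'d \<Rightarrow> real" where
  "gauss \<delta> z = (\<Prod>i\<in>UNIV. normal_density 0 (sqrt \<delta>) (z $ i))"

lemma gauss_measurable [measurable]: "gauss \<delta> \<in> borel_measurable borel"
  unfolding gauss_def[abs_def] by measurable

lemma gauss_nonneg: "0 \<le> gauss \<delta> z"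
  unfolding gauss_def by (intro prod_nonneg) simp

lemma matrix_vector_measurable [measurable]: "(\<lambda>x. (A :: real^'d^'e) *v x) \<in> borel \<rightarrow>\<^sub>M borel"
  by (intro borel_measurable_continuous_onI linear_continuous_on matrix_vector_mul_bounded_linear)

lemma matrix_inv_cancel:
  fixes \<sigma> :: "real^'d^'d"
  assumes "invertible \<sigma>"
  shows "\<sigma> *v (matrix_inv \<sigma> *v x) = x" "matrix_inv \<sigma> *v (\<sigma> *v x) = x"
  using matrix_inv_inverse[OF assms] by (simp_all add: matrix_vector_mul_assoc)

text \<open>The image of Lebesgue measure under an invertible matrix is translation invariant, and
  finite on boxes because the inverse matrix maps boxes to bounded sets. This avoids the
  determinant.\<close>

lemma distr_lborel_matrix:
  fixes \<sigma> :: "real^'d^'d"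
  assumes "invertible \<sigma>"
  shows "\<exists>\<kappa>. distr lborel borel ((*v) \<sigma>) = density lborel (\<lambda>_. \<kappa>)"
proof -
  let ?N = "distr lborel borel ((*v) \<sigma>)" and ?A = "matrix_inv \<sigma>"
  have em: "emeasure ?N (box l u) = emeasure lborel ((*v) \<sigma> -` box l u)" for l u
    by (subst emeasure_distr) auto
  have "?N = density lborel (\<lambda>_. emeasure ?N (box 0 One))"
  proof (rule translation_invariant_eq_scaled_lborel)
    fix l u c :: "real^'d"
    have "bounded ((*v) ?A ` box l u)"
      by (intro bounded_linear_image bounded_box matrix_vector_mul_bounded_linear)
    moreover have "(*v) \<sigma> -` box l u \<subseteq> (*v) ?A ` box l u"
    proof
      fix x assume "x \<in> (*v) \<sigma> -` box l u"
      then show "x \<in> (*v) ?A ` box l u"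
        by (intro image_eqI[of _ _ "\<sigma> *v x"]) (auto simp: matrix_inv_cancel[OF assms])
    qed
    ultimately have "bounded ((*v) \<sigma> -` box l u)" by (rule bounded_subset)
    then obtain R where "\<forall>x\<in>(*v) \<sigma> -` box l u. norm x \<le> R"
      unfolding bounded_iff by (elim exE)
    then have "(*v) \<sigma> -` box l u \<subseteq> cball 0 R" by (auto simp: mem_cball_0)
    then have "emeasure lborel ((*v) \<sigma> -` box l u) \<le> emeasure lborel (cball (0::real^'d) R)"
      by (intro emeasure_mono) auto
    then show "emeasure ?N (box l u) < \<infinity>"
      unfolding em using emeasure_lborel_cball_finite by (rule order_le_less_trans)
    have "(*v) \<sigma> -` box (l + c) (u + c) = (+) (- (?A *v c)) -` ((*v) \<sigma> -` box l u)"
      by (auto simp: matrix_vector_right_distrib matrix_vector_mult_diff_distrib matrix_inv_cancel[OF assms] box_def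
          inner_diff_left inner_add_left algebra_simps)
    moreover have "emeasure lborel ((+) d -` S) = emeasure lborel S" if S: "S \<in> sets borel" for d and S :: "(real^'d) set"
    proof -
      have "emeasure lborel S = emeasure (distr lborel borel ((+) d)) S" by (simp add: lborel_distr_plus)
      also have "\<dots> = emeasure lborel ((+) d -` S)" using S by (subst emeasure_distr) auto
      finally show ?thesis by simp
    qed
    moreover have "(*v) \<sigma> -` box l u \<in> sets borel"
      using measurable_sets[OF matrix_vector_measurable[of \<sigma>], of "box l u"] by simp
    ultimately show "emeasure ?N (box (l + c) (u + c)) = emeasure ?N (box l u)"
      unfolding em by simp
  qed simp
  then show ?thesis by blast
qed

text \<open>This is the inverse of the absolute value of the determinant; only its existence matters,
  since the same factor occurs forwards and backwards in time.\<close>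

definition lborel_scale :: "real^'d^'d \<Rightarrow> ennreal" where
  "lborel_scale \<sigma> = (SOME \<kappa>. distr lborel borel ((*v) \<sigma>) = density lborel (\<lambda>_. \<kappa>))"

text \<open>The density in y of one Euler step from x, obtained by solving y = x + \<delta> b(x) +
  \<sigma> z for the Gaussian innovation z.\<close>

definition euler_kernel :: "(real^'d \<Rightarrow> real^'d) \<Rightarrow> real^'d^'d \<Rightarrow> real \<Rightarrow> real^'d \<Rightarrow> real^'d \<Rightarrow> ennreal" where
  "euler_kernel b \<sigma> \<delta> x y = lborel_scale \<sigma> * ennreal (gauss \<delta> (matrix_inv \<sigma> *v (y - x - \<delta> *\<^sub>R b x)))"

lemma euler_kernel_measurable [measurable]:
  assumes [measurable]: "b \<in> borel_measurable borel"
  shows "(\<lambda>(x, y). euler_kernel b \<sigma> \<delta> x y) \<in> borel_measurable (borel \<Otimes>\<^sub>M borel)"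
  unfolding euler_kernel_def by measurable

lemma nn_integral_euler_step:
  fixes g :: "real^'d \<Rightarrow> ennreal"
  assumes \<sigma>: "invertible \<sigma>" and [measurable]: "g \<in> borel_measurable borel"
  shows "(\<integral>\<^sup>+z. g (x + \<delta> *\<^sub>R b x + \<sigma> *v z) \<partial>density lborel (\<lambda>z. ennreal (gauss \<delta> z))) =
    (\<integral>\<^sup>+y. g y * euler_kernel b \<sigma> \<delta> x y \<partial>lborel)"
proof -
  let ?a = "x + \<delta> *\<^sub>R b x" and ?A = "matrix_inv \<sigma>"
  have sc: "distr lborel borel ((*v) \<sigma>) = density lborel (\<lambda>_. lborel_scale \<sigma>)"
    unfolding lborel_scale_def by (rule someI_ex[OF distr_lborel_matrix[OF \<sigma>]])
  let ?h = "\<lambda>y. g (?a + y) * ennreal (gauss \<delta> (?A *v y))"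
  have "(\<integral>\<^sup>+z. g (?a + \<sigma> *v z) \<partial>density lborel (\<lambda>z. ennreal (gauss \<delta> z))) =
      (\<integral>\<^sup>+z. ?h (\<sigma> *v z) \<partial>lborel)"
    by (subst nn_integral_density) (auto simp: matrix_inv_cancel[OF \<sigma>] mult.commute)
  also have "\<dots> = (\<integral>\<^sup>+y. ?h y \<partial>distr lborel borel ((*v) \<sigma>))"
    by (subst nn_integral_distr) auto
  also have "\<dots> = (\<integral>\<^sup>+y. lborel_scale \<sigma> * ?h y \<partial>lborel)"
    unfolding sc by (subst nn_integral_density) auto
  also have "\<dots> = (\<integral>\<^sup>+y. lborel_scale \<sigma> * ?h (- ?a + y) \<partial>lborel)"
    by (rule nn_integral_lborel_translate[symmetric]) measurable
  also have "\<dots> = (\<integral>\<^sup>+y. g y * euler_kernel b \<sigma> \<delta> x y \<partial>lborel)"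
    by (intro nn_integral_cong) (simp add: euler_kernel_def algebra_simps)
  finally show ?thesis .
qed

text \<open>The restriction to \<open>{..N}\<close> makes the path a point of the finite product
  space in which its density is taken.\<close>

definition euler_path :: "(real^'d \<Rightarrow> real^'d) \<Rightarrow> real^'d^'d \<Rightarrow> real \<Rightarrow> nat \<Rightarrow> real^'d \<Rightarrow> (nat \<Rightarrow> real^'d) \<Rightarrow> nat \<Rightarrow> real^'d" where
  "euler_path b \<sigma> \<delta> N x \<xi> = (\<lambda>k\<in>{..N}. euler b \<sigma> \<delta> x \<xi> k)"

lemma euler_cong: "(\<And>j. j < k \<Longrightarrow> \<xi> j = \<xi>' j) \<Longrightarrow> euler b \<sigma> \<delta> x \<xi> k = euler b \<sigma> \<delta> x \<xi>' k"
  by (induction k) auto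

lemma euler_measurable:
  assumes [measurable]: "b \<in> borel_measurable borel"
  shows "k \<le> N \<Longrightarrow> (\<lambda>(x, \<xi>). euler b \<sigma> \<delta> x \<xi> k) \<in> borel_measurable (borel \<Otimes>\<^sub>M (\<Pi>\<^sub>M i\<in>{..<N}. borel))"
proof (induction k)
  case (Suc k)
  then have [measurable]: "(\<lambda>(x, \<xi>). euler b \<sigma> \<delta> x \<xi> k) \<in> borel_measurable (borel \<Otimes>\<^sub>M (\<Pi>\<^sub>M i\<in>{..<N}. borel))"
    by simp
  have [measurable]: "k \<in> {..<N}" using Suc.prems by simp
  show ?case by (simp add: split_beta') measurable
qed (simp add: split_beta')

lemma euler_path_measurable [measurable]:
  assumes "b \<in> borel_measurable borel"
  shows "(\<lambda>(x, \<xi>). euler_path b \<sigma> \<delta> N x \<xi>) \<in> (borel \<Otimes>\<^sub>M (\<Pi>\<^sub>M i\<in>{..<N}. borel)) \<rightarrow>\<^sub>M (\<Pi>\<^sub>M i\<in>{..N}. borel)"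
  unfolding euler_path_def split_beta'
  by (rule measurable_restrict) (use euler_measurable[OF assms] in \<open>auto simp: split_beta'\<close>)

text \<open>The joint density of the N + 1 points of the scheme started with density
  \<open>f\<close>.\<close>

definition path_weight :: "(real^'d \<Rightarrow> ennreal) \<Rightarrow> (real^'d \<Rightarrow> real^'d) \<Rightarrow> real^'d^'d \<Rightarrow> real \<Rightarrow> nat \<Rightarrow> (nat \<Rightarrow> real^'d) \<Rightarrow> ennreal" where
  "path_weight f b \<sigma> \<delta> N p = f (p 0) * (\<Prod>k<N. euler_kernel b \<sigma> \<delta> (p k) (p (Suc k)))"

lemma path_weight_measurable [measurable]:
  assumes [measurable]: "b \<in> borel_measurable borel" "f \<in> borel_measurable borel"
  shows "path_weight f b \<sigma> \<delta> N \<in> borel_measurable (\<Pi>\<^sub>M i\<in>{..N}. borel)"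
proof -
  have 1: "(\<lambda>p. euler_kernel b \<sigma> \<delta> (p k) (p (Suc k))) \<in> borel_measurable (\<Pi>\<^sub>M i\<in>{..N}. borel)" if "k < N" for k
  proof -
    have [measurable]: "k \<in> {..N}" "Suc k \<in> {..N}" using that by auto
    show ?thesis by measurable
  qed
  have [measurable]: "0 \<in> {..N}" by simp
  show ?thesis unfolding path_weight_def[abs_def]
    by (intro borel_measurable_times_ennreal borel_measurable_prod_ennreal 1) auto
qed

lemma sets_PiM_lborel [measurable_cong]: "sets (\<Pi>\<^sub>M i\<in>I. lborel) = sets (\<Pi>\<^sub>M i\<in>I. borel)"
  by (rule sets_PiM_cong) auto

lemma sets_PiM_density [measurable_cong]: "sets (\<Pi>\<^sub>M i\<in>I. density lborel f) = sets (\<Pi>\<^sub>M i\<in>I. borel)"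
  by (rule sets_PiM_cong) auto

lemma product_prob_space_const: "prob_space N \<Longrightarrow> product_prob_space (\<lambda>_. N)"
  by (auto simp: product_prob_space_def product_prob_space_axioms_def product_sigma_finite_def
      intro: prob_space_imp_sigma_finite)

text \<open>Induction on the number of steps with G generalised: integrating out the last innovation
  on one side and the last point on the other leaves the same functional of the shorter
  path.\<close>

lemma euler_path_law:
  fixes b :: "real^'d \<Rightarrow> real^'d" and f :: "real^'d \<Rightarrow> ennreal"
  assumes \<sigma>: "invertible \<sigma>" and b [measurable]: "b \<in> borel_measurable borel"
    and f [measurable]: "f \<in> borel_measurable borel"
    and D: "prob_space (density lborel (\<lambda>z::real^'d. ennreal (gauss \<delta> z)))"
  shows "G \<in> borel_measurable (\<Pi>\<^sub>M i\<in>{..N}. borel) \<Longrightarrow>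
    (\<integral>\<^sup>+x. f x * (\<integral>\<^sup>+\<xi>. G (euler_path b \<sigma> \<delta> N x \<xi>) \<partial>(\<Pi>\<^sub>M i\<in>{..<N}. density lborel (\<lambda>z. ennreal (gauss \<delta> z)))) \<partial>lborel) =
    (\<integral>\<^sup>+p. G p * path_weight f b \<sigma> \<delta> N p \<partial>(\<Pi>\<^sub>M i\<in>{..N}. lborel))"
proof (induction N arbitrary: G)
  case 0
  interpret L: product_sigma_finite "\<lambda>_::nat. lborel :: (real^'d) measure" ..
  note [measurable] = 0
  have e: "euler_path b \<sigma> \<delta> 0 x \<xi> = (\<lambda>k\<in>{0::nat}. x)" for x \<xi>
    by (auto simp: euler_path_def restrict_def)
  have [measurable]: "(\<lambda>x. \<lambda>k\<in>{0::nat}. x) \<in> borel \<rightarrow>\<^sub>M (\<Pi>\<^sub>M i\<in>{0::nat}. (borel :: (real^'d) measure))"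
    by (rule measurable_restrict) simp
  have [measurable]: "G \<in> borel_measurable (\<Pi>\<^sub>M i\<in>{0::nat}. borel)" using 0 by simp
  have "(\<integral>\<^sup>+p. G p * path_weight f b \<sigma> \<delta> 0 p \<partial>(\<Pi>\<^sub>M i\<in>{..0}. lborel)) =
      (\<integral>\<^sup>+p. (\<lambda>x. G (\<lambda>k\<in>{0::nat}. x) * f x) (p 0) \<partial>(\<Pi>\<^sub>M i\<in>{0::nat}. lborel))"
  proof -
    have "(\<integral>\<^sup>+p. G p * path_weight f b \<sigma> \<delta> 0 p \<partial>(\<Pi>\<^sub>M i\<in>{0::nat}. lborel)) =
        (\<integral>\<^sup>+p. (\<lambda>x. G (\<lambda>k\<in>{0::nat}. x) * f x) (p 0) \<partial>(\<Pi>\<^sub>M i\<in>{0::nat}. lborel))"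
    proof (rule nn_integral_cong)
      fix p :: "nat \<Rightarrow> real^'d" assume "p \<in> space (\<Pi>\<^sub>M i\<in>{0::nat}. lborel)"
      then have "p = (\<lambda>k\<in>{0::nat}. p 0)"
        by (auto simp: space_PiM PiE_def extensional_def restrict_def fun_eq_iff)
      then show "G p * path_weight f b \<sigma> \<delta> 0 p = (\<lambda>x. G (\<lambda>k\<in>{0::nat}. x) * f x) (p 0)"
        by (simp add: path_weight_def)
    qed
    then show ?thesis by simp
  qed
  also have "\<dots> = (\<integral>\<^sup>+x. G (\<lambda>k\<in>{0::nat}. x) * f x \<partial>lborel)"
    by (rule L.product_nn_integral_singleton) measurable
  finally show ?case
    by (simp add: e restrict_def PiM_empty nn_integral_count_space_finite mult.commute)
next
  case (Suc N)
  let ?D = "density lborel (\<lambda>z::real^'d. ennreal (gauss \<delta> z))"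
  interpret D: product_prob_space "\<lambda>_::nat. ?D" by (rule product_prob_space_const[OF D])
  interpret L: product_sigma_finite "\<lambda>_::nat. lborel :: (real^'d) measure" ..
  note [measurable] = Suc.prems
  \<comment> \<open>The functional obtained from G by averaging over the last point, given the
    previous one.\<close>
  define H where "H p = (\<integral>\<^sup>+y. G (p(Suc N := y)) * euler_kernel b \<sigma> \<delta> (p N) y \<partial>lborel)" for p
  have S: "{..Suc N} = insert (Suc N) {..N}" "{..<Suc N} = insert N {..<N}" by auto
  have upd [measurable]: "(\<lambda>(p, y). p(Suc N := y)) \<in> (\<Pi>\<^sub>M i\<in>{..N}. borel) \<Otimes>\<^sub>M borel \<rightarrow>\<^sub>M (\<Pi>\<^sub>M i\<in>{..Suc N}. (borel :: (real^'d) measure))"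
    unfolding S by (rule measurable_add_dim)
  have GU [measurable]: "(\<lambda>(p, y). G (p(Suc N := y))) \<in> borel_measurable ((\<Pi>\<^sub>M i\<in>{..N}. borel) \<Otimes>\<^sub>M borel)"
    using measurable_compose[OF upd Suc.prems] by (simp add: split_beta')
  have NN [measurable]: "N \<in> {..N}" by simp
  have HU: "(\<lambda>(p, y). G (p(Suc N := y)) * euler_kernel b \<sigma> \<delta> (p N) y) \<in> borel_measurable ((\<Pi>\<^sub>M i\<in>{..N}. borel) \<Otimes>\<^sub>M lborel)"
    by measurable
  have H [measurable]: "H \<in> borel_measurable (\<Pi>\<^sub>M i\<in>{..N}. borel)"
    unfolding H_def[abs_def] using lborel.borel_measurable_nn_integral[OF HU] by simp
  have inner: "(\<integral>\<^sup>+\<xi>. G (euler_path b \<sigma> \<delta> (Suc N) x \<xi>) \<partial>(\<Pi>\<^sub>M i\<in>{..<Suc N}. ?D)) =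
      (\<integral>\<^sup>+\<xi>. H (euler_path b \<sigma> \<delta> N x \<xi>) \<partial>(\<Pi>\<^sub>M i\<in>{..<N}. ?D))" for x
  proof -
    have m: "(\<lambda>\<xi>. G (euler_path b \<sigma> \<delta> (Suc N) x \<xi>)) \<in> borel_measurable (\<Pi>\<^sub>M i\<in>{..<Suc N}. ?D)"
    proof -
      have "(\<lambda>\<xi>. euler_path b \<sigma> \<delta> (Suc N) x \<xi>) \<in> (\<Pi>\<^sub>M i\<in>{..<Suc N}. borel) \<rightarrow>\<^sub>M (\<Pi>\<^sub>M i\<in>{..Suc N}. borel)"
        using measurable_compose[OF measurable_Pair1' euler_path_measurable[OF b, of \<sigma> \<delta> "Suc N"], of x] by simp
      from measurable_compose[OF this Suc.prems] show ?thesis by measurable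
    qed
    have "(\<integral>\<^sup>+\<xi>. G (euler_path b \<sigma> \<delta> (Suc N) x \<xi>) \<partial>(\<Pi>\<^sub>M i\<in>{..<Suc N}. ?D)) =
        (\<integral>\<^sup>+\<xi>. (\<integral>\<^sup>+z. G (euler_path b \<sigma> \<delta> (Suc N) x (\<xi>(N := z))) \<partial>?D) \<partial>(\<Pi>\<^sub>M i\<in>{..<N}. ?D))"
      using m unfolding S by (intro D.product_nn_integral_insert) auto
    also have "\<dots> = (\<integral>\<^sup>+\<xi>. H (euler_path b \<sigma> \<delta> N x \<xi>) \<partial>(\<Pi>\<^sub>M i\<in>{..<N}. ?D))"
    proof (rule nn_integral_cong)
      fix \<xi> :: "nat \<Rightarrow> real^'d"
      let ?p = "euler_path b \<sigma> \<delta> N x \<xi>"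
      have pN: "?p N = euler b \<sigma> \<delta> x \<xi> N" by (simp add: euler_path_def)
      have step: "euler_path b \<sigma> \<delta> (Suc N) x (\<xi>(N := z)) = ?p(Suc N := ?p N + \<delta> *\<^sub>R b (?p N) + \<sigma> *v z)" for z
      proof
        fix k
        have "euler b \<sigma> \<delta> x (\<xi>(N := z)) k = euler b \<sigma> \<delta> x \<xi> k" if "k \<le> N" for k
          using that by (intro euler_cong) auto
        then show "euler_path b \<sigma> \<delta> (Suc N) x (\<xi>(N := z)) k = (?p(Suc N := ?p N + \<delta> *\<^sub>R b (?p N) + \<sigma> *v z)) k"
          unfolding pN by (auto simp: euler_path_def restrict_def)
      qed
      have "?p \<in> space (\<Pi>\<^sub>M i\<in>{..N}. borel)"
        by (auto simp: euler_path_def space_PiM)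
      then have mG: "(\<lambda>y. G (?p(Suc N := y))) \<in> borel_measurable borel"
        using measurable_compose[OF measurable_Pair1' GU, of ?p] by simp
      show "(\<integral>\<^sup>+z. G (euler_path b \<sigma> \<delta> (Suc N) x (\<xi>(N := z))) \<partial>?D) = H ?p"
        unfolding step H_def by (rule nn_integral_euler_step[OF \<sigma> mG])
    qed
    finally show ?thesis .
  qed
  have "(\<integral>\<^sup>+p. G p * path_weight f b \<sigma> \<delta> (Suc N) p \<partial>(\<Pi>\<^sub>M i\<in>{..Suc N}. lborel)) =
      (\<integral>\<^sup>+p. (\<integral>\<^sup>+y. G (p(Suc N := y)) * path_weight f b \<sigma> \<delta> (Suc N) (p(Suc N := y)) \<partial>lborel) \<partial>(\<Pi>\<^sub>M i\<in>{..N}. lborel))"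
  proof -
    have "(\<lambda>p. G p * path_weight f b \<sigma> \<delta> (Suc N) p) \<in> borel_measurable (\<Pi>\<^sub>M i\<in>{..Suc N}. lborel)" by measurable
    then show ?thesis unfolding S by (intro L.product_nn_integral_insert) auto
  qed
  also have "\<dots> = (\<integral>\<^sup>+p. H p * path_weight f b \<sigma> \<delta> N p \<partial>(\<Pi>\<^sub>M i\<in>{..N}. lborel))"
  proof (rule nn_integral_cong)
    fix p :: "nat \<Rightarrow> real^'d" assume p: "p \<in> space (\<Pi>\<^sub>M i\<in>{..N}. lborel)"
    have w: "path_weight f b \<sigma> \<delta> (Suc N) (p(Suc N := y)) = path_weight f b \<sigma> \<delta> N p * euler_kernel b \<sigma> \<delta> (p N) y" for y
      by (simp add: path_weight_def mult.assoc)
    have "p \<in> space (\<Pi>\<^sub>M i\<in>{..N}. borel)" using p by (simp add: space_PiM)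
    then have "(\<lambda>y. G (p(Suc N := y)) * euler_kernel b \<sigma> \<delta> (p N) y) \<in> borel_measurable lborel"
      using measurable_compose[OF measurable_Pair1' HU, of p] by simp
    then have "(\<integral>\<^sup>+y. G (p(Suc N := y)) * euler_kernel b \<sigma> \<delta> (p N) y * path_weight f b \<sigma> \<delta> N p \<partial>lborel) =
        H p * path_weight f b \<sigma> \<delta> N p"
      unfolding H_def by (rule nn_integral_multc)
    then show "(\<integral>\<^sup>+y. G (p(Suc N := y)) * path_weight f b \<sigma> \<delta> (Suc N) (p(Suc N := y)) \<partial>lborel) = H p * path_weight f b \<sigma> \<delta> N p"
      unfolding w by (simp add: mult_ac)
  qed
  finally show ?case unfolding inner Suc.IH[OF H] by simp
qed

text \<open>Rectangles determine a product of sigma-finite measures. The statement is in terms of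
  sigma-algebras because the initial value is independent of the whole noise process, from which
  finitely many increments are then extracted.\<close>

lemma (in prob_space) indep_set_distr_pair:
  assumes X: "X \<in> M \<rightarrow>\<^sub>M S" and Y: "Y \<in> M \<rightarrow>\<^sub>M T" and ind: "indep_set \<A> \<B>"
    and "\<And>A. A \<in> sets S \<Longrightarrow> X -` A \<inter> space M \<in> \<A>" "\<And>A. A \<in> sets T \<Longrightarrow> Y -` A \<inter> space M \<in> \<B>"
  shows "distr M S X \<Otimes>\<^sub>M distr M T Y = distr M (S \<Otimes>\<^sub>M T) (\<lambda>\<omega>. (X \<omega>, Y \<omega>))"
proof (rule pair_measure_eqI)
  show "sigma_finite_measure (distr M S X)" "sigma_finite_measure (distr M T Y)"
    by (auto intro!: prob_space_imp_sigma_finite prob_space_distr X Y)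
  fix A C assume "A \<in> sets (distr M S X)" "C \<in> sets (distr M T Y)"
  then have A: "A \<in> sets S" and C: "C \<in> sets T" by simp_all
  have "prob ((X -` A \<inter> space M) \<inter> (Y -` C \<inter> space M)) = prob (X -` A \<inter> space M) * prob (Y -` C \<inter> space M)"
    by (rule indep_setD[OF ind]) (use assms(4,5) A C in auto)
  moreover have "(\<lambda>\<omega>. (X \<omega>, Y \<omega>)) -` (A \<times> C) \<inter> space M = (X -` A \<inter> space M) \<inter> (Y -` C \<inter> space M)" by auto
  ultimately show "emeasure (distr M S X) A * emeasure (distr M T Y) C =
      emeasure (distr M (S \<Otimes>\<^sub>M T) (\<lambda>\<omega>. (X \<omega>, Y \<omega>))) (A \<times> C)"
    using A C X Y by (simp add: emeasure_distr emeasure_eq_measure ennreal_mult)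
qed simp

context brownian_motion
begin

definition increments :: "real \<Rightarrow> 'w \<Rightarrow> nat \<Rightarrow> real^'d" where
  "increments \<delta> \<omega> k = B (real (Suc k) * \<delta>) \<omega> - B (real k * \<delta>) \<omega>"

lemma prob_space_gauss: "\<delta> > 0 \<Longrightarrow> prob_space (density lborel (\<lambda>z::real^'d. ennreal (gauss \<delta> z)))"
proof -
  assume d: "\<delta> > 0"
  then have D: "distributed M lborel (\<lambda>\<omega>. B \<delta> \<omega> - B 0 \<omega>) (\<lambda>z. ennreal (gauss \<delta> z))"
    using gaussian_increments_B[of 0 \<delta>] by (simp add: gauss_def)
  show ?thesis
    using prob_space_distr[OF distributed_measurable[OF D]] distributed_distr_eq_density[OF D] by simp
qed

lemma nn_integral_start_increments:
  assumes \<delta>: "\<delta> > 0" and N: "N \<ge> 1"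
    and q0 [measurable]: "q0 \<in> borel_measurable M"
    and ind: "indep_set (sets (vimage_algebra (space M) q0 borel)) (sets (process_algebra M B))"
    and dens: "has_density M q0 \<rho>"
    and G [measurable]: "G \<in> borel_measurable (borel \<Otimes>\<^sub>M (\<Pi>\<^sub>M i\<in>{..<N}. borel))"
  shows "(\<integral>\<^sup>+\<omega>. G (q0 \<omega>, \<lambda>k\<in>{..<N}. increments \<delta> \<omega> k) \<partial>M) =
    (\<integral>\<^sup>+x. ennreal (\<rho> x) * (\<integral>\<^sup>+\<xi>. G (x, \<xi>) \<partial>(\<Pi>\<^sub>M i\<in>{..<N}. density lborel (\<lambda>z. ennreal (gauss \<delta> z)))) \<partial>lborel)"
proof -
  let ?D = "density lborel (\<lambda>z::real^'d. ennreal (gauss \<delta> z))"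
  let ?P = "\<Pi>\<^sub>M i\<in>{..<N}. (borel :: (real^'d) measure)"
  define Y where "Y \<omega> = (\<lambda>k\<in>{..<N}. increments \<delta> \<omega> k)" for \<omega>
  interpret D: product_prob_space "\<lambda>_::nat. ?D"
    by (rule product_prob_space_const[OF prob_space_gauss[OF \<delta>]])
  have Bm [measurable]: "B (real k * \<delta>) \<in> borel_measurable M" for k
    using \<delta> by (intro measurable_B) simp
  have im [measurable]: "(\<lambda>\<omega>. increments \<delta> \<omega> k) \<in> borel_measurable M" for k
    unfolding increments_def by measurable
  have Ym [measurable]: "Y \<in> M \<rightarrow>\<^sub>M ?P"
    unfolding Y_def[abs_def] by (rule measurable_restrict) simp
  \<comment> \<open>The increments are measurable for the sigma-algebra generated by the noise
    alone; this is what independence of the initial value refers to.\<close>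
  have YA: "Y \<in> process_algebra M B \<rightarrow>\<^sub>M ?P"
  proof -
    let ?Q = "\<Pi>\<^sub>M t\<in>{0::real..}. (borel :: (real^'d) measure)"
    have "(\<lambda>\<omega>. \<lambda>t\<in>{0..}. B t \<omega>) \<in> process_algebra M B \<rightarrow>\<^sub>M ?Q"
      unfolding process_algebra_def by (rule measurable_vimage_algebra1) (auto simp: space_PiM)
    then have "(\<lambda>\<omega>. (\<lambda>t\<in>{0..}. B t \<omega>) (real k * \<delta>)) \<in> process_algebra M B \<rightarrow>\<^sub>M borel" for k
      by (rule measurable_compose) (use \<delta> in \<open>auto intro!: measurable_component_singleton\<close>)
    then have Bp: "B (real k * \<delta>) \<in> process_algebra M B \<rightarrow>\<^sub>M borel" for k
      using \<delta> by simp
    show ?thesis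
      unfolding Y_def[abs_def] increments_def
      by (intro measurable_restrict borel_measurable_diff Bp)
  qed
  have sp: "space (process_algebra M B) = space M" by (simp add: process_algebra_def)
  have iv: "distr M borel q0 \<Otimes>\<^sub>M distr M ?P Y = distr M (borel \<Otimes>\<^sub>M ?P) (\<lambda>\<omega>. (q0 \<omega>, Y \<omega>))"
  proof (rule indep_set_distr_pair[OF q0 Ym ind])
    show "q0 -` A \<inter> space M \<in> sets (vimage_algebra (space M) q0 borel)" if "A \<in> sets borel" for A
      using that by (rule in_vimage_algebra)
    show "Y -` A \<inter> space M \<in> sets (process_algebra M B)" if "A \<in> sets ?P" for A
      using measurable_sets[OF YA that] by (simp add: sp)
  qed
  have dq: "distr M borel q0 = density lborel (\<lambda>x. ennreal (\<rho> x))"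
  proof -
    have "distributed M lborel q0 (\<lambda>x. ennreal (\<rho> x))" using dens by (simp add: has_density_def)
    from distributed_distr_eq_density[OF this] show ?thesis by (simp cong: distr_cong)
  qed
  have dY: "distr M ?P Y = (\<Pi>\<^sub>M i\<in>{..<N}. ?D)"
  proof -
    have di: "distr M borel (\<lambda>\<omega>. increments \<delta> \<omega> k) = ?D" for k
    proof -
      have "distributed M lborel (\<lambda>\<omega>. B (real (Suc k) * \<delta>) \<omega> - B (real k * \<delta>) \<omega>)
          (\<lambda>x. ennreal (\<Prod>i\<in>UNIV. normal_density 0 (sqrt (real (Suc k) * \<delta> - real k * \<delta>)) (x $ i)))"
        using \<delta> by (intro gaussian_increments_B) auto
      moreover have "real (Suc k) * \<delta> - real k * \<delta> = \<delta>" by (simp add: algebra_simps)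
      ultimately have "distributed M lborel (\<lambda>\<omega>. increments \<delta> \<omega> k) (\<lambda>z. ennreal (gauss \<delta> z))"
        by (simp only: increments_def gauss_def)
      from distributed_distr_eq_density[OF this] show ?thesis by (simp cong: distr_cong)
    qed
    have "indep_vars (\<lambda>_. borel) (\<lambda>i \<omega>. B (real (Suc i) * \<delta>) \<omega> - B (real i * \<delta>) \<omega>) {..<N}"
      by (rule indep_increments_B[of "\<lambda>i. real i * \<delta>"]) (use \<delta> in \<open>auto intro: mult_right_mono\<close>)
    then have "indep_vars (\<lambda>_. borel) (\<lambda>i \<omega>. increments \<delta> \<omega> i) {..<N}"
      by (simp only: increments_def)
    \<comment> \<open>The characterisation of independence by product laws is applied with a
      nonempty index set, which is where N \<ge> 1 enters.\<close>
    then have "distr M ?P (\<lambda>\<omega>. \<lambda>i\<in>{..<N}. increments \<delta> \<omega> i) = (\<Pi>\<^sub>M i\<in>{..<N}. distr M borel (\<lambda>\<omega>. increments \<delta> \<omega> i))"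
      using N by (subst (asm) indep_vars_iff_distr_eq_PiM') (auto simp: lessThan_empty_iff)
    then show ?thesis by (simp add: Y_def[abs_def] di)
  qed
  have "distr M (borel \<Otimes>\<^sub>M ?P) (\<lambda>\<omega>. (q0 \<omega>, Y \<omega>)) = distr M borel q0 \<Otimes>\<^sub>M distr M ?P Y"
    using iv by simp
  then have J: "distr M (borel \<Otimes>\<^sub>M ?P) (\<lambda>\<omega>. (q0 \<omega>, Y \<omega>)) = density lborel (\<lambda>x. ennreal (\<rho> x)) \<Otimes>\<^sub>M (\<Pi>\<^sub>M i\<in>{..<N}. ?D)"
    by (simp add: dq dY)
  have rm [measurable]: "\<rho> \<in> borel_measurable borel"
    using has_density_facts(1)[OF prob_space_axioms dens] .
  have sf: "sigma_finite_measure (\<Pi>\<^sub>M i\<in>{..<N}. ?D)"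
    by (intro prob_space_imp_sigma_finite prob_space_PiM prob_space_gauss \<delta>)
  have "(\<integral>\<^sup>+\<omega>. G (q0 \<omega>, Y \<omega>) \<partial>M) = (\<integral>\<^sup>+z. G z \<partial>distr M (borel \<Otimes>\<^sub>M ?P) (\<lambda>\<omega>. (q0 \<omega>, Y \<omega>)))"
    by (subst nn_integral_distr) auto
  also have "\<dots> = (\<integral>\<^sup>+x. (\<integral>\<^sup>+\<xi>. G (x, \<xi>) \<partial>(\<Pi>\<^sub>M i\<in>{..<N}. ?D)) \<partial>density lborel (\<lambda>x. ennreal (\<rho> x)))"
    unfolding J by (rule sigma_finite_measure.nn_integral_fst[OF sf, symmetric]) measurable
  also have "\<dots> = (\<integral>\<^sup>+x. ennreal (\<rho> x) * (\<integral>\<^sup>+\<xi>. G (x, \<xi>) \<partial>(\<Pi>\<^sub>M i\<in>{..<N}. ?D)) \<partial>lborel)"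
  proof (rule nn_integral_density)
    have "G \<in> borel_measurable (lborel \<Otimes>\<^sub>M (\<Pi>\<^sub>M i\<in>{..<N}. ?D))" by measurable
    from sigma_finite_measure.borel_measurable_nn_integral_fst[OF sf this]
    show "(\<lambda>x. \<integral>\<^sup>+\<xi>. G (x, \<xi>) \<partial>(\<Pi>\<^sub>M i\<in>{..<N}. ?D)) \<in> borel_measurable lborel" .
  qed simp
  finally show ?thesis by (simp add: Y_def)
qed

end

section \<open>Time reversal of the Euler scheme\<close>

lemma gauss_eq:
  assumes "\<delta> > 0"
  shows "gauss \<delta> (z :: real^'d) = (1 / sqrt (2 * pi * \<delta>)) ^ CARD('d) * exp (- (norm z)\<^sup>2 / (2 * \<delta>))"
proof -
  have "gauss \<delta> z = (\<Prod>i\<in>UNIV. (1 / sqrt (2 * pi * \<delta>)) * exp (- (z $ i)\<^sup>2 / (2 * \<delta>)))"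
    unfolding gauss_def normal_density_def using assms by simp
  also have "\<dots> = (1 / sqrt (2 * pi * \<delta>)) ^ CARD('d) * exp (\<Sum>i\<in>UNIV. - (z $ i)\<^sup>2 / (2 * \<delta>))"
    by (simp only: prod.distrib prod_constant exp_sum finite)
  also have "(\<Sum>i\<in>UNIV. - (z $ i)\<^sup>2 / (2 * \<delta>)) = - (norm z)\<^sup>2 / (2 * \<delta>)"
    unfolding power2_norm_eq_inner inner_vec_def by (simp add: sum_divide_distrib sum_negf power2_eq_square)
  finally show ?thesis .
qed

lemma inner_matrix_transpose: "(transpose A *v x) \<bullet> y = x \<bullet> (A *v y)" for A :: "real^'n^'m"
  by (metis dot_lmul_matrix transpose_matrix_vector)

text \<open>The inverse of \<sigma> \<sigma>^T is the transposed inverse of \<sigma> times the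
  inverse of \<sigma>. Products of whitened vectors thus become products with
  \<open>log_gradient\<close>.\<close>

lemma inner_matrix_inv:
  fixes \<sigma> :: "real^'d^'d"
  assumes \<sigma>: "invertible \<sigma>"
  shows "(matrix_inv \<sigma> *v u) \<bullet> (matrix_inv \<sigma> *v w) = u \<bullet> (matrix_inv (diffusion \<sigma>) *v w)"
proof -
  let ?z = "matrix_inv (diffusion \<sigma>) *v w"
  have "w = \<sigma> *v (transpose \<sigma> *v ?z)"
    using matrix_inv_cancel(1)[OF invertible_diffusion[OF \<sigma>], of w] by (simp add: matrix_vector_mul_assoc matrix_mul_assoc)
  then have "matrix_inv \<sigma> *v w = transpose \<sigma> *v ?z"
    using matrix_inv_cancel(2)[OF \<sigma>] by metis
  then have "(matrix_inv \<sigma> *v u) \<bullet> (matrix_inv \<sigma> *v w) = (\<sigma> *v (matrix_inv \<sigma> *v u)) \<bullet> ?z"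
    using inner_matrix_transpose[of \<sigma> ?z "matrix_inv \<sigma> *v u"] by (simp add: inner_commute)
  then show ?thesis by (simp add: matrix_inv_cancel[OF \<sigma>])
qed

definition drift_energy :: "(real^'d \<Rightarrow> real^'d) \<Rightarrow> real^'d^'d \<Rightarrow> real^'d \<Rightarrow> real" where
  "drift_energy b \<sigma> x = (norm (matrix_inv \<sigma> *v b x))\<^sup>2"

text \<open>The logarithm of the kernel from y to x divided by the kernel from x to y. The first
  term is the trapezoidal rule along the step for minus the integral of
  \<open>log_gradient\<close>.\<close>

definition log_kernel_ratio :: "(real^'d \<Rightarrow> real^'d) \<Rightarrow> real^'d^'d \<Rightarrow> real \<Rightarrow> real^'d \<Rightarrow> real^'d \<Rightarrow> real" where
  "log_kernel_ratio b \<sigma> \<delta> x y =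
     - ((y - x) \<bullet> (log_gradient b \<sigma> x + log_gradient b \<sigma> y)) / 2 +
     \<delta> / 2 * (drift_energy b \<sigma> x - drift_energy b \<sigma> y)"

text \<open>Let h be the whitened step. Expanding |h + \<delta> bY|^2 and |h - \<delta> bx|^2 in the
  two exponents, the singular term |h|^2 / (2 \<delta>) cancels; the cross terms give the
  trapezoidal sum and the squares give the difference of energies.\<close>

lemma euler_kernel_reverse:
  fixes b :: "real^'d \<Rightarrow> real^'d"
  assumes \<sigma>: "invertible \<sigma>" and \<delta>: "\<delta> > 0"
  shows "euler_kernel b \<sigma> \<delta> y x = euler_kernel b \<sigma> \<delta> x y * ennreal (exp (log_kernel_ratio b \<sigma> \<delta> x y))"
proof -
  let ?A = "matrix_inv \<sigma>"
  define h where "h = ?A *v (y - x)"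
  define bx where "bx = ?A *v b x"
  define bY where "bY = ?A *v b y"
  have 1: "?A *v (y - x - \<delta> *\<^sub>R b x) = h - \<delta> *\<^sub>R bx"
    by (simp add: h_def bx_def matrix_vector_mult_diff_distrib matrix_vector_mult_scaleR)
  have "x - y - \<delta> *\<^sub>R b y = - ((y - x) + \<delta> *\<^sub>R b y)" by simp
  then have 2: "?A *v (x - y - \<delta> *\<^sub>R b y) = - (h + \<delta> *\<^sub>R bY)"
    by (simp only: h_def bY_def matrix_vector_mult_scaleR[symmetric] matrix_vector_right_distrib[symmetric])
       (simp add: matrix_vector_mult_diff_distrib matrix_vector_right_distrib)
  have hb: "2 * (h \<bullet> bx) = (y - x) \<bullet> log_gradient b \<sigma> x" "2 * (h \<bullet> bY) = (y - x) \<bullet> log_gradient b \<sigma> y"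
    unfolding h_def bx_def bY_def inner_matrix_inv[OF \<sigma>] log_gradient_def by simp_all
  have "- (norm (h + \<delta> *\<^sub>R bY))\<^sup>2 / (2 * \<delta>) =
      - (norm (h - \<delta> *\<^sub>R bx))\<^sup>2 / (2 * \<delta>) + (- (h \<bullet> bx + h \<bullet> bY) + \<delta> / 2 * ((norm bx)\<^sup>2 - (norm bY)\<^sup>2))"
    unfolding power2_norm_eq_inner using \<delta>
    by (simp add: inner_add_left inner_add_right inner_diff_left inner_diff_right inner_commute field_simps power2_eq_square)
  also have "- (h \<bullet> bx + h \<bullet> bY) + \<delta> / 2 * ((norm bx)\<^sup>2 - (norm bY)\<^sup>2) = log_kernel_ratio b \<sigma> \<delta> x y"
    using hb by (simp add: log_kernel_ratio_def drift_energy_def bx_def bY_def inner_add_right)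
  finally have "gauss \<delta> (?A *v (x - y - \<delta> *\<^sub>R b y)) =
      gauss \<delta> (?A *v (y - x - \<delta> *\<^sub>R b x)) * exp (log_kernel_ratio b \<sigma> \<delta> x y)"
    unfolding 1 2 gauss_eq[OF \<delta>] norm_minus_cancel by (simp only: exp_add mult.assoc)
  then show ?thesis
    by (simp add: euler_kernel_def ennreal_mult gauss_nonneg mult.assoc)
qed

definition reverse_path :: "nat \<Rightarrow> (nat \<Rightarrow> 'a) \<Rightarrow> nat \<Rightarrow> 'a" where
  "reverse_path N p = (\<lambda>k\<in>{..N}. p (N - k))"

lemma reverse_path_measurable [measurable]:
  "reverse_path N \<in> (\<Pi>\<^sub>M i\<in>{..N}. S) \<rightarrow>\<^sub>M (\<Pi>\<^sub>M i\<in>{..N}. S)"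
  unfolding reverse_path_def[abs_def] by (rule measurable_restrict) simp

lemma reverse_reverse_path: "p \<in> space (\<Pi>\<^sub>M i\<in>{..N}. S) \<Longrightarrow> reverse_path N (reverse_path N p) = p"
  by (auto simp: reverse_path_def space_PiM PiE_def extensional_def fun_eq_iff)

lemma distr_reverse_path:
  "distr (\<Pi>\<^sub>M i\<in>{..N}. lborel) (\<Pi>\<^sub>M i\<in>{..N}. lborel) (reverse_path N) = (\<Pi>\<^sub>M i\<in>{..N}. (lborel :: 'a::euclidean_space measure))"
proof -
  interpret L: product_sigma_finite "\<lambda>_::nat. lborel :: 'a measure" ..
  show ?thesis
  proof (rule L.PiM_eqI)
    fix A :: "nat \<Rightarrow> 'a set" assume A: "\<And>i. i \<in> {..N} \<Longrightarrow> A i \<in> sets lborel"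
    have eq: "reverse_path N -` Pi\<^sub>E {..N} A \<inter> space (\<Pi>\<^sub>M i\<in>{..N}. lborel) = Pi\<^sub>E {..N} (\<lambda>k. A (N - k))"
    proof (intro set_eqI iffI)
      fix p assume "p \<in> reverse_path N -` Pi\<^sub>E {..N} A \<inter> space (\<Pi>\<^sub>M i\<in>{..N}. lborel)"
      then have p: "reverse_path N p \<in> Pi\<^sub>E {..N} A" "p \<in> extensional {..N}"
        by (auto simp: space_PiM PiE_def)
      have "p k \<in> A (N - k)" if "k \<le> N" for k
        using PiE_mem[OF p(1), of "N - k"] that by (simp add: reverse_path_def)
      then show "p \<in> Pi\<^sub>E {..N} (\<lambda>k. A (N - k))"
        using p(2) by (auto simp: PiE_def)
    next
      fix p assume p: "p \<in> Pi\<^sub>E {..N} (\<lambda>k. A (N - k))"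
      have "p (N - k) \<in> A k" if "k \<le> N" for k
        using PiE_mem[OF p, of "N - k"] that by simp
      then have "reverse_path N p \<in> Pi\<^sub>E {..N} A"
        by (auto simp: reverse_path_def)
      moreover have "p \<in> space (\<Pi>\<^sub>M i\<in>{..N}. lborel)"
        using p by (auto simp: space_PiM PiE_def)
      ultimately show "p \<in> reverse_path N -` Pi\<^sub>E {..N} A \<inter> space (\<Pi>\<^sub>M i\<in>{..N}. lborel)" by simp
    qed
    have "emeasure (distr (\<Pi>\<^sub>M i\<in>{..N}. lborel) (\<Pi>\<^sub>M i\<in>{..N}. lborel) (reverse_path N)) (Pi\<^sub>E {..N} A) =
        emeasure (\<Pi>\<^sub>M i\<in>{..N}. lborel) (Pi\<^sub>E {..N} (\<lambda>k. A (N - k)))"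
      by (subst emeasure_distr) (use A in \<open>auto simp: eq intro!: sets_PiM_I_finite\<close>)
    also have "\<dots> = (\<Prod>k\<in>{..N}. emeasure lborel (A (N - k)))"
      by (rule L.emeasure_PiM) (use A in auto)
    also have "\<dots> = (\<Prod>k\<in>{..N}. emeasure lborel (A k))"
      by (rule prod.reindex_bij_witness[of _ "\<lambda>k. N - k" "\<lambda>k. N - k"]) auto
    finally show "emeasure (distr (\<Pi>\<^sub>M i\<in>{..N}. lborel) (\<Pi>\<^sub>M i\<in>{..N}. lborel) (reverse_path N)) (Pi\<^sub>E {..N} A) =
        (\<Prod>k\<in>{..N}. emeasure lborel (A k))" .
  qed auto
qed

text \<open>The logarithm of the weight of the reversed path over that of the path, for an initial
  density proportional to exp(-U). The ratio of initial densities is spread over the steps, so that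
  each summand is an error of the trapezoidal rule plus an energy difference.\<close>

definition path_log_ratio :: "(real^'d \<Rightarrow> real) \<Rightarrow> (real^'d \<Rightarrow> real^'d) \<Rightarrow> real^'d^'d \<Rightarrow> real \<Rightarrow> nat \<Rightarrow> (nat \<Rightarrow> real^'d) \<Rightarrow> real" where
  "path_log_ratio U b \<sigma> \<delta> N p =
     (\<Sum>k<N. U (p k) - U (p (Suc k)) + log_kernel_ratio b \<sigma> \<delta> (p k) (p (Suc k)))"

text \<open>Each summand is antisymmetric in its two points. Hence a bound on the absolute value of
  the ratio describes a set of paths that is invariant under reversal.\<close>

lemma path_log_ratio_reverse: "path_log_ratio U b \<sigma> \<delta> N (reverse_path N p) = - path_log_ratio U b \<sigma> \<delta> N p"
proof -
  let ?r = "\<lambda>x y. U x - U y + log_kernel_ratio b \<sigma> \<delta> x y"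
  have anti: "?r x y = - ?r y x" for x y
  proof -
    have eq: "(x - y) \<bullet> (log_gradient b \<sigma> y + log_gradient b \<sigma> x) = - ((y - x) \<bullet> (log_gradient b \<sigma> x + log_gradient b \<sigma> y))"
      by (simp add: inner_diff_left add.commute)
    show ?thesis unfolding log_kernel_ratio_def eq right_diff_distrib by linarith
  qed
  have "path_log_ratio U b \<sigma> \<delta> N (reverse_path N p) = (\<Sum>k<N. ?r (p (N - k)) (p (N - Suc k)))"
    unfolding path_log_ratio_def by (intro sum.cong) (auto simp: reverse_path_def)
  also have "\<dots> = (\<Sum>k<N. - ?r (p (N - Suc k)) (p (Suc (N - Suc k))))"
    by (intro sum.cong refl) (subst anti, auto simp: Suc_diff_Suc)
  also have "\<dots> = (\<Sum>k<N. - ?r (p k) (p (Suc k)))"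
    by (rule sum.nat_diff_reindex[of "\<lambda>k. - ?r (p k) (p (Suc k))"])
  also have "\<dots> = - (\<Sum>k<N. ?r (p k) (p (Suc k)))" by (rule sum_negf)
  finally show ?thesis by (simp only: path_log_ratio_def)
qed

lemma path_weight_reverse:
  fixes b :: "real^'d \<Rightarrow> real^'d" and U :: "real^'d \<Rightarrow> real"
  assumes \<sigma>: "invertible \<sigma>" and \<delta>: "\<delta> > 0" and Z: "Z \<ge> 0"
  defines "f \<equiv> \<lambda>x. ennreal (Z * exp (- U x))"
  shows "path_weight f b \<sigma> \<delta> N (reverse_path N p) =
    path_weight f b \<sigma> \<delta> N p * ennreal (exp (path_log_ratio U b \<sigma> \<delta> N p))"
proof -
  let ?K = "euler_kernel b \<sigma> \<delta>" and ?l = "log_kernel_ratio b \<sigma> \<delta>"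
  have "(\<Prod>k<N. ?K (reverse_path N p k) (reverse_path N p (Suc k))) =
      (\<Prod>k<N. ?K (p (Suc (N - Suc k))) (p (N - Suc k)))"
    by (intro prod.cong refl) (auto simp: reverse_path_def Suc_diff_Suc)
  also have "\<dots> = (\<Prod>k<N. ?K (p (Suc k)) (p k))"
    by (rule prod.nat_diff_reindex[of "\<lambda>k. ?K (p (Suc k)) (p k)"])
  also have "\<dots> = (\<Prod>k<N. ?K (p k) (p (Suc k)) * ennreal (exp (?l (p k) (p (Suc k)))))"
    by (intro prod.cong refl euler_kernel_reverse \<sigma> \<delta>)
  also have "\<dots> = (\<Prod>k<N. ?K (p k) (p (Suc k))) * ennreal (exp (\<Sum>k<N. ?l (p k) (p (Suc k))))"
    by (simp add: prod.distrib prod_ennreal exp_sum)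
  finally have 1: "(\<Prod>k<N. ?K (reverse_path N p k) (reverse_path N p (Suc k))) =
    (\<Prod>k<N. ?K (p k) (p (Suc k))) * ennreal (exp (\<Sum>k<N. ?l (p k) (p (Suc k))))" .
  \<comment> \<open>The initial density is now evaluated at the former end point; the telescoping
    sum converts it back to the former starting point.\<close>
  have "(\<Sum>k<N. U (p k) - U (p (Suc k))) = U (p 0) - U (p N)"
    by (rule sum_lessThan_telescope')
  then have "- U (p N) = - U (p 0) + (\<Sum>k<N. U (p k) - U (p (Suc k)))" by simp
  then have eN: "exp (- U (p N)) = exp (- U (p 0)) * exp (\<Sum>k<N. U (p k) - U (p (Suc k)))"
    by (simp only: exp_add)
  have "f (p N) = f (p 0) * ennreal (exp (\<Sum>k<N. U (p k) - U (p (Suc k))))"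
    unfolding f_def eN mult.assoc[symmetric] using Z by (intro ennreal_mult) auto
  moreover have "reverse_path N p 0 = p N" by (simp add: reverse_path_def)
  ultimately have "path_weight f b \<sigma> \<delta> N (reverse_path N p) =
      (f (p 0) * (\<Prod>k<N. ?K (p k) (p (Suc k)))) *
      (ennreal (exp (\<Sum>k<N. U (p k) - U (p (Suc k)))) * ennreal (exp (\<Sum>k<N. ?l (p k) (p (Suc k)))))"
    unfolding path_weight_def 1 by (simp add: mult_ac)
  also have "ennreal (exp (\<Sum>k<N. U (p k) - U (p (Suc k)))) * ennreal (exp (\<Sum>k<N. ?l (p k) (p (Suc k)))) =
      ennreal (exp (path_log_ratio U b \<sigma> \<delta> N p))"
    by (simp add: path_log_ratio_def sum.distrib exp_add ennreal_mult)
  finally show ?thesis by (simp add: path_weight_def)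
qed

lemma log_gradient_measurable: "b \<in> borel_measurable borel \<Longrightarrow> log_gradient b \<sigma> \<in> borel_measurable borel"
  for b :: "real^'d \<Rightarrow> real^'d"
  unfolding log_gradient_def[abs_def] by measurable

lemma path_log_ratio_measurable [measurable]:
  fixes b :: "real^'d \<Rightarrow> real^'d"
  assumes b [measurable]: "b \<in> borel_measurable borel" and U [measurable]: "U \<in> borel_measurable borel"
  shows "path_log_ratio U b \<sigma> \<delta> N \<in> borel_measurable (\<Pi>\<^sub>M i\<in>{..N}. borel)"
  unfolding path_log_ratio_def[abs_def]
proof (rule borel_measurable_sum)
  fix k assume "k \<in> {..<N}"
  then have [measurable]: "k \<in> {..N}" "Suc k \<in> {..N}" by auto
  note [measurable] = log_gradient_measurable[OF b]
  show "(\<lambda>p. U (p k) - U (p (Suc k)) + log_kernel_ratio b \<sigma> \<delta> (p k) (p (Suc k))) \<in> borel_measurable (\<Pi>\<^sub>M i\<in>{..N}. borel)"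
    unfolding log_kernel_ratio_def drift_energy_def by measurable
qed

lemma stay_measurable:
  fixes N :: nat
  shows "Measurable.pred (\<Pi>\<^sub>M i\<in>{..N}. borel) (\<lambda>p. \<forall>k\<le>N. norm (p k :: 'a::real_normed_vector) \<le> n)"
proof -
  let ?P = "\<Pi>\<^sub>M i\<in>{..N}. (borel :: 'a measure)"
  have "{p \<in> space ?P. \<forall>k\<in>{..N}. norm (p k) \<le> n} \<in> sets ?P"
  proof (rule sets.sets_Collect_finite_All)
    show "{p \<in> space ?P. norm (p k) \<le> n} \<in> sets ?P" if "k \<in> {..N}" for k
      using that by measurable
  qed simp
  then show ?thesis by (simp add: pred_def)
qed

text \<open>Reversal preserves the product Lebesgue measure and the set S, and multiplies the weight
  by the exponential of the log ratio, which is at most exp(\<epsilon>) on S.\<close>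

lemma nn_integral_reverse_le:
  fixes b :: "real^'d \<Rightarrow> real^'d" and U :: "real^'d \<Rightarrow> real" and \<Phi> :: "(nat \<Rightarrow> real^'d) \<Rightarrow> ennreal"
    and n \<epsilon> :: real
  assumes \<sigma>: "invertible \<sigma>" and \<delta>: "\<delta> > 0" and Z: "Z \<ge> 0"
    and b [measurable]: "b \<in> borel_measurable borel" and U [measurable]: "U \<in> borel_measurable borel"
    and \<Phi> [measurable]: "\<Phi> \<in> borel_measurable (\<Pi>\<^sub>M i\<in>{..N}. borel)"
  defines "f \<equiv> \<lambda>x. ennreal (Z * exp (- U x))"
    and "S \<equiv> {p. (\<forall>k\<le>N. norm (p k) \<le> n) \<and> \<bar>path_log_ratio U b \<sigma> \<delta> N p\<bar> \<le> \<epsilon>}"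
  shows "(\<integral>\<^sup>+p. \<Phi> (reverse_path N p) * indicator S p * path_weight f b \<sigma> \<delta> N p \<partial>(\<Pi>\<^sub>M i\<in>{..N}. lborel)) \<le>
    ennreal (exp \<epsilon>) * (\<integral>\<^sup>+p. \<Phi> p * indicator S p * path_weight f b \<sigma> \<delta> N p \<partial>(\<Pi>\<^sub>M i\<in>{..N}. lborel))"
proof -
  let ?P = "\<Pi>\<^sub>M i\<in>{..N}. (lborel :: (real^'d) measure)" and ?W = "path_weight f b \<sigma> \<delta> N"
    and ?R = "reverse_path N :: (nat \<Rightarrow> real^'d) \<Rightarrow> _"
  have [measurable]: "f \<in> borel_measurable borel" unfolding f_def by measurable
  have Sm [measurable]: "(indicator S :: _ \<Rightarrow> ennreal) \<in> borel_measurable (\<Pi>\<^sub>M i\<in>{..N}. (borel :: (real^'d) measure))"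
  proof -
    have [measurable]: "Measurable.pred (\<Pi>\<^sub>M i\<in>{..N}. (borel :: (real^'d) measure)) (\<lambda>p. \<forall>k\<le>N. norm (p k) \<le> n)"
      by (rule stay_measurable)
    have "Measurable.pred (\<Pi>\<^sub>M i\<in>{..N}. (borel :: (real^'d) measure)) (\<lambda>p. p \<in> S)"
      unfolding S_def mem_Collect_eq by measurable
    then show ?thesis by measurable
  qed
  have Srev: "indicator S (?R p) = (indicator S p :: ennreal)" for p
  proof -
    have "(\<forall>k\<le>N. norm (?R p k) \<le> n) \<longleftrightarrow> (\<forall>k\<le>N. norm (p k) \<le> n)"
    proof safe
      fix k assume a: "\<forall>k\<le>N. norm (?R p k) \<le> n" "k \<le> N"
      then have "norm (?R p (N - k)) \<le> n" by simp
      then show "norm (p k) \<le> n" using a(2) by (simp add: reverse_path_def)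
    qed (simp add: reverse_path_def)
    then show ?thesis by (simp add: indicator_def S_def path_log_ratio_reverse)
  qed
  have "(\<integral>\<^sup>+p. \<Phi> (?R p) * indicator S p * ?W p \<partial>?P) = (\<integral>\<^sup>+p. \<Phi> (?R p) * indicator S p * ?W p \<partial>distr ?P ?P ?R)"
    by (simp only: distr_reverse_path)
  also have "\<dots> = (\<integral>\<^sup>+p. \<Phi> (?R (?R p)) * indicator S (?R p) * ?W (?R p) \<partial>?P)"
    by (rule nn_integral_distr) measurable
  also have "\<dots> = (\<integral>\<^sup>+p. \<Phi> p * indicator S p * (?W p * ennreal (exp (path_log_ratio U b \<sigma> \<delta> N p))) \<partial>?P)"
    unfolding f_def by (intro nn_integral_cong) (simp only: reverse_reverse_path Srev path_weight_reverse[OF \<sigma> \<delta> Z])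
  also have "\<dots> \<le> (\<integral>\<^sup>+p. ennreal (exp \<epsilon>) * (\<Phi> p * indicator S p * ?W p) \<partial>?P)"
  proof (rule nn_integral_mono)
    fix p
    show "\<Phi> p * indicator S p * (?W p * ennreal (exp (path_log_ratio U b \<sigma> \<delta> N p))) \<le>
        ennreal (exp \<epsilon>) * (\<Phi> p * indicator S p * ?W p)"
    proof (cases "p \<in> S")
      case True
      then have "ennreal (exp (path_log_ratio U b \<sigma> \<delta> N p)) \<le> ennreal (exp \<epsilon>)"
        by (intro ennreal_leI) (auto simp: S_def)
      then have "\<Phi> p * indicator S p * (?W p * ennreal (exp (path_log_ratio U b \<sigma> \<delta> N p))) \<le>
          \<Phi> p * indicator S p * (?W p * ennreal (exp \<epsilon>))"
        by (intro mult_left_mono) auto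
      then show ?thesis by (simp only: mult_ac)
    qed simp
  qed
  also have "\<dots> = ennreal (exp \<epsilon>) * (\<integral>\<^sup>+p. \<Phi> p * indicator S p * ?W p \<partial>?P)"
    by (rule nn_integral_cmult) measurable
  finally show ?thesis .
qed

section \<open>The Langevin process and its Euler approximation\<close>

locale langevin = brownian_motion M B
  for M :: "'w measure" and B :: "real \<Rightarrow> 'w \<Rightarrow> real^'d" +
  fixes q :: "real \<Rightarrow> 'w \<Rightarrow> real^'d" and b :: "real^'d \<Rightarrow> real^'d" and \<sigma> :: "real^'d^'d"
    and \<rho>0 :: "real^'d \<Rightarrow> real"
  assumes C_inf_b: "C_inf b" and invertible_\<sigma>: "invertible \<sigma>"
    and solution: "langevin_solution M B b \<sigma> q"
    and density_0: "has_density M (q 0) \<rho>0"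
    and local_lipschitz: "\<And>n::nat. n \<ge> 1 \<Longrightarrow>
      \<exists>K>0. \<forall>x y. norm x \<le> real n \<and> norm y \<le> real n \<longrightarrow> norm (b x - b y) \<le> K * norm (x - y)"
begin

lemma q_measurable: "0 \<le> t \<Longrightarrow> q t \<in> borel_measurable M"
  using solution by (simp add: langevin_solution_def)

lemma q0_measurable [measurable]: "q 0 \<in> borel_measurable M"
  by (rule q_measurable) simp

lemma b_continuous: "continuous_on S b"
  by (rule C_inf_continuous[OF C_inf_b])

lemma b_measurable [measurable]: "b \<in> borel_measurable borel"
  by (intro borel_measurable_continuous_onI b_continuous)

lemma AE_solution:
  "AE \<omega> in M. continuous_on {0..} (\<lambda>t. q t \<omega>) \<and>
     (\<forall>t\<ge>0. q t \<omega> = q 0 \<omega> + integral {0..t} (\<lambda>s. b (q s \<omega>)) + \<sigma> *v B t \<omega>)"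
  using solution unfolding langevin_solution_def by auto

definition euler_sol :: "real \<Rightarrow> 'w \<Rightarrow> nat \<Rightarrow> real^'d" where
  "euler_sol \<delta> \<omega> = euler b \<sigma> \<delta> (q 0 \<omega>) (increments \<delta> \<omega>)"

lemma increments_measurable [measurable]: "0 \<le> \<delta> \<Longrightarrow> (\<lambda>\<omega>. increments \<delta> \<omega> k) \<in> borel_measurable M"
  unfolding increments_def by (intro borel_measurable_diff measurable_B) auto

lemma euler_sol_measurable [measurable]:
  assumes "0 \<le> \<delta>"
  shows "(\<lambda>\<omega>. euler_sol \<delta> \<omega> k) \<in> borel_measurable M"
proof (induction k)
  case 0
  show ?case by (simp add: euler_sol_def)
next
  case (Suc k)
  have [measurable]: "(\<lambda>\<omega>. increments \<delta> \<omega> k) \<in> borel_measurable M" "(\<lambda>\<omega>. euler_sol \<delta> \<omega> k) \<in> borel_measurable M"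
    using Suc increments_measurable[OF assms] by auto
  have "(\<lambda>\<omega>. euler_sol \<delta> \<omega> k + \<delta> *\<^sub>R b (euler_sol \<delta> \<omega> k) + \<sigma> *v increments \<delta> \<omega> k) \<in> borel_measurable M"
    by measurable
  then show ?case by (simp add: euler_sol_def)
qed

text \<open>\<open>f\<close> may be another version of the initial density. This allows the Gibbs
  formula to be used at every point, although it holds for \<open>\<rho>0\<close> only almost
  everywhere.\<close>

lemma nn_integral_euler_sol:
  fixes G :: "(nat \<Rightarrow> real^'d) \<Rightarrow> ennreal"
  assumes \<delta>: "\<delta> > 0" and N: "N \<ge> 1" and G [measurable]: "G \<in> borel_measurable (\<Pi>\<^sub>M i\<in>{..N}. borel)"
    and f [measurable]: "f \<in> borel_measurable borel" and ae: "AE x in lborel. ennreal (\<rho>0 x) = f x"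
  shows "(\<integral>\<^sup>+\<omega>. G (\<lambda>k\<in>{..N}. euler_sol \<delta> \<omega> k) \<partial>M) =
    (\<integral>\<^sup>+p. G p * path_weight f b \<sigma> \<delta> N p \<partial>(\<Pi>\<^sub>M i\<in>{..N}. lborel))"
proof -
  let ?D = "density lborel (\<lambda>z::real^'d. ennreal (gauss \<delta> z))"
  have eq: "euler_path b \<sigma> \<delta> N (q 0 \<omega>) (\<lambda>k\<in>{..<N}. increments \<delta> \<omega> k) = (\<lambda>k\<in>{..N}. euler_sol \<delta> \<omega> k)" for \<omega>
  proof
    fix k
    have "euler b \<sigma> \<delta> (q 0 \<omega>) (\<lambda>k\<in>{..<N}. increments \<delta> \<omega> k) k = euler_sol \<delta> \<omega> k" if "k \<le> N"
      unfolding euler_sol_def using that by (intro euler_cong) auto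
    then show "euler_path b \<sigma> \<delta> N (q 0 \<omega>) (\<lambda>k\<in>{..<N}. increments \<delta> \<omega> k) k = (\<lambda>k\<in>{..N}. euler_sol \<delta> \<omega> k) k"
      by (auto simp: euler_path_def)
  qed
  have m: "(\<lambda>z. G (euler_path b \<sigma> \<delta> N (fst z) (snd z))) \<in> borel_measurable (borel \<Otimes>\<^sub>M (\<Pi>\<^sub>M i\<in>{..<N}. borel))"
    using measurable_compose[OF euler_path_measurable[OF b_measurable] G] by (simp add: split_beta')
  have ind: "indep_set (sets (vimage_algebra (space M) (q 0) borel)) (sets (process_algebra M B))"
    using solution by (simp add: langevin_solution_def)
  have "(\<integral>\<^sup>+\<omega>. G (\<lambda>k\<in>{..N}. euler_sol \<delta> \<omega> k) \<partial>M) =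
      (\<integral>\<^sup>+x. ennreal (\<rho>0 x) * (\<integral>\<^sup>+\<xi>. G (euler_path b \<sigma> \<delta> N x \<xi>) \<partial>(\<Pi>\<^sub>M i\<in>{..<N}. ?D)) \<partial>lborel)"
    using nn_integral_start_increments[OF \<delta> N q0_measurable ind density_0 m] by (simp add: eq)
  also have "\<dots> = (\<integral>\<^sup>+x. f x * (\<integral>\<^sup>+\<xi>. G (euler_path b \<sigma> \<delta> N x \<xi>) \<partial>(\<Pi>\<^sub>M i\<in>{..<N}. ?D)) \<partial>lborel)"
    by (rule nn_integral_cong_AE) (use ae in \<open>auto elim: eventually_mono\<close>)
  also have "\<dots> = (\<integral>\<^sup>+p. G p * path_weight f b \<sigma> \<delta> N p \<partial>(\<Pi>\<^sub>M i\<in>{..N}. lborel))"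
    by (rule euler_path_law[OF invertible_\<sigma> b_measurable f prob_space_gauss[OF \<delta>] G])
  finally show ?thesis .
qed

lemma euler_sol_converges:
  assumes "T > 0"
  shows "AE \<omega> in M. \<forall>e>0. \<exists>N0\<ge>1. \<forall>N\<ge>N0. \<forall>k\<le>N. norm (euler_sol (T / real N) \<omega> k - q (real k * (T / real N)) \<omega>) \<le> e"
  using AE_solution
proof eventually_elim
  fix \<omega>
  assume s: "continuous_on {0..} (\<lambda>t. q t \<omega>) \<and>
     (\<forall>t\<ge>0. q t \<omega> = q 0 \<omega> + integral {0..t} (\<lambda>s. b (q s \<omega>)) + \<sigma> *v B t \<omega>)"
  show "\<forall>e>0. \<exists>N0\<ge>1. \<forall>N\<ge>N0. \<forall>k\<le>N. norm (euler_sol (T / real N) \<omega> k - q (real k * (T / real N)) \<omega>) \<le> e"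
  proof (intro allI impI)
    fix e :: real assume e: "e > 0"
    have c: "continuous_on {0..T} (\<lambda>t. q t \<omega>)"
      by (rule continuous_on_subset[OF conjunct1[OF s]]) auto
    have "\<exists>N0\<ge>1. \<forall>N\<ge>N0. \<forall>k\<le>N. norm (euler b \<sigma> (T / real N) (q 0 \<omega>)
        (\<lambda>k. B (real (Suc k) * (T / real N)) \<omega> - B (real k * (T / real N)) \<omega>) k - q (real k * (T / real N)) \<omega>) \<le> e"
      by (rule euler_converges[OF assms c b_continuous local_lipschitz _ e]) (use s in blast)+
    then show "\<exists>N0\<ge>1. \<forall>N\<ge>N0. \<forall>k\<le>N. norm (euler_sol (T / real N) \<omega> k - q (real k * (T / real N)) \<omega>) \<le> e"
      unfolding euler_sol_def increments_def[abs_def] .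
  qed
qed

end

text \<open>Here u is the size of a Gaussian increment, typically \<open>sqrt \<delta>\<close>. The
  odd and mixed powers are traded for even ones with weights in \<open>sqrt \<delta>\<close>, so
  that second and fourth moments suffice and every term has mean of order
  \<open>\<delta> * sqrt \<delta>\<close>.\<close>

lemma log_ratio_step_bound:
  fixes u s :: real
  assumes "0 < \<delta>" "\<delta> \<le> 1" "u \<ge> 0"
  shows "(\<delta> + u) ^ 3 + \<delta> * (\<delta> + u) \<le> 6 * \<delta> * sqrt \<delta> + 5 * sqrt \<delta> * u\<^sup>2 + 4 * u ^ 4 / sqrt \<delta>"
proof -
  define s where "s = sqrt \<delta>"
  have s: "0 < s" "s \<le> 1" "s\<^sup>2 = \<delta>" using assms by (auto simp: s_def)
  have "s * s \<le> s * 1" using s by (intro mult_left_mono) auto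
  then have \<delta>s: "\<delta> \<le> s" using s(3) unfolding power2_eq_square by linarith
  \<comment> \<open>One of the two terms on the right dominates, according to whether u is below or
    above \<open>sqrt \<delta>\<close>.\<close>
  have u: "u \<le> s + u\<^sup>2 / s"
  proof (cases "u \<le> s")
    case True
    then show ?thesis using s(1) by (simp add: add_increasing2)
  next
    case False
    then have "u * s \<le> u * u" using assms by (intro mult_left_mono) auto
    then have "u \<le> u\<^sup>2 / s" using s(1) by (simp add: pos_le_divide_eq power2_eq_square)
    then show ?thesis using s(1) by linarith
  qed
  have "u ^ 3 \<le> u\<^sup>2 * (s + u\<^sup>2 / s)"
    using mult_left_mono[OF u, of "u\<^sup>2"] by (simp add: power2_eq_square power3_eq_cube)
  then have u3: "u ^ 3 \<le> s * u\<^sup>2 + u ^ 4 / s"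
    by (simp add: algebra_simps power2_eq_square power4_eq_xxxx)
  have "\<delta> * u \<le> \<delta> * (s + u\<^sup>2 / s)" using u assms by (intro mult_left_mono) auto
  also have "\<dots> = \<delta> * s + s * u\<^sup>2" using s by (simp add: distrib_left) (simp add: s(3)[symmetric] power2_eq_square)
  finally have du: "\<delta> * u \<le> \<delta> * s + s * u\<^sup>2" .
  have d2: "\<delta> * \<delta> \<le> \<delta> * s" using \<delta>s assms by (intro mult_left_mono) auto
  have d3: "\<delta> ^ 3 \<le> \<delta> * s"
  proof -
    have "\<delta> ^ 3 = \<delta> * (\<delta> * \<delta>)" by (simp add: power3_eq_cube)
    also have "\<dots> \<le> \<delta> * (\<delta> * 1)" using assms by (intro mult_left_mono) auto
    finally show ?thesis using d2 by simp
  qed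
  have cube: "(\<delta> + u) ^ 3 \<le> 4 * \<delta> ^ 3 + 4 * u ^ 3"
  proof -
    have "4 * \<delta> ^ 3 + 4 * u ^ 3 - (\<delta> + u) ^ 3 = 3 * (\<delta> + u) * (\<delta> - u)\<^sup>2"
      by (simp add: power3_eq_cube power2_eq_square algebra_simps)
    moreover have "3 * (\<delta> + u) * (\<delta> - u)\<^sup>2 \<ge> 0" using assms by simp
    ultimately show ?thesis by linarith
  qed
  have "(\<delta> + u) ^ 3 + \<delta> * (\<delta> + u) \<le> 4 * (\<delta> * s) + 4 * (s * u\<^sup>2 + u ^ 4 / s) + (\<delta> * s + (\<delta> * s + s * u\<^sup>2))"
    using cube u3 du d2 d3 by (simp add: distrib_left)
  also have "\<dots> = 6 * \<delta> * s + 5 * s * u\<^sup>2 + 4 * u ^ 4 / s" by (simp add: algebra_simps)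
  finally show ?thesis by (simp add: s_def)
qed

text \<open>\<open>Z\<close> denotes the normalising factor, that is the reciprocal of the partition
  function.\<close>

locale gibbs_langevin = langevin +
  fixes U :: "real^'b \<Rightarrow> real" and Z :: real
  assumes C_inf_U: "C_inf U" and partial_U: "\<And>i x. partial i U x = - log_gradient b \<sigma> x $ i"
    and Z_nonneg: "Z \<ge> 0"
    and gibbs: "AE x in lborel. \<rho>0 x = Z * exp (- U x)"
begin

lemma U_measurable [measurable]: "U \<in> borel_measurable borel"
  by (intro C_inf_borel_measurable C_inf_U)

lemma C_inf_drift_energy: "C_inf (drift_energy b \<sigma>)"
proof -
  have A: "C_inf (\<lambda>x. matrix_inv \<sigma> *v b x)"
    by (intro C_inf_bounded_linear[OF matrix_vector_mul_bounded_linear] C_inf_b)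
  have "drift_energy b \<sigma> = (\<lambda>x. \<Sum>i\<in>UNIV. (matrix_inv \<sigma> *v b x) $ i * (matrix_inv \<sigma> *v b x) $ i)"
    by (auto simp: drift_energy_def power2_norm_eq_inner inner_vec_def fun_eq_iff)
  then show ?thesis by (simp only:) (intro C_inf_sum C_inf_mult C_inf_nth A)
qed

text \<open>On the ball the drift is bounded, so a step is at most a constant times \<delta> + |z|.
  The trapezoidal error is cubic in it, and the energy difference is linear in it with a factor
  \<delta>. The resulting bound depends on the innovation z only.\<close>

lemma step_log_ratio_bound:
  "\<exists>C\<ge>0. \<forall>\<delta> x z. 0 < \<delta> \<longrightarrow> \<delta> \<le> 1 \<longrightarrow> norm x \<le> R \<longrightarrow> norm (x + \<delta> *\<^sub>R b x + \<sigma> *v z) \<le> R \<longrightarrow>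
    \<bar>U x - U (x + \<delta> *\<^sub>R b x + \<sigma> *v z) + log_kernel_ratio b \<sigma> \<delta> x (x + \<delta> *\<^sub>R b x + \<sigma> *v z)\<bar> \<le>
      C * (6 * \<delta> * sqrt \<delta> + 5 * sqrt \<delta> * (norm z)\<^sup>2 + 4 * norm z ^ 4 / sqrt \<delta>)"
proof -
  obtain C1 where C1: "C1 \<ge> 0" "\<And>x h. norm x \<le> R \<Longrightarrow> norm (x + h) \<le> R \<Longrightarrow>
    \<bar>U (x + h) - U x - (\<Sum>i\<in>UNIV. h $ i * (partial i U x + partial i U (x + h))) / 2\<bar> \<le> C1 * norm h ^ 3"
    using C_inf_trapezoid[OF C_inf_U, of R] by blast
  obtain L where L: "L \<ge> 0" "\<And>x h. norm x \<le> R \<Longrightarrow> norm (x + h) \<le> R \<Longrightarrow>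
    \<bar>drift_energy b \<sigma> (x + h) - drift_energy b \<sigma> x\<bar> \<le> L * norm h"
    using C_inf_lipschitz_on_cball[OF C_inf_drift_energy, of R] by blast
  obtain K where K: "K \<ge> 0" "\<And>x. norm x \<le> R \<Longrightarrow> norm (b x) \<le> K"
    using C_inf_bounded_on_cball[OF C_inf_b, of R] by blast
  obtain S where S: "S > 0" "\<And>z. norm (\<sigma> *v z) \<le> S * norm z"
    using bounded_linear.pos_bounded[OF matrix_vector_mul_bounded_linear[of \<sigma>]] by (auto simp: mult.commute)
  define C3 where "C3 = max K S"
  have C3: "C3 \<ge> 0" "K \<le> C3" "S \<le> C3" using S by (auto simp: C3_def)
  define C where "C = C1 * C3 ^ 3 + L * C3"
  have C: "C1 * C3 ^ 3 \<ge> 0" "L * C3 \<ge> 0" using C1 C3 L by auto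
  have "\<bar>U x - U (x + \<delta> *\<^sub>R b x + \<sigma> *v z) + log_kernel_ratio b \<sigma> \<delta> x (x + \<delta> *\<^sub>R b x + \<sigma> *v z)\<bar> \<le>
      C * (6 * \<delta> * sqrt \<delta> + 5 * sqrt \<delta> * (norm z)\<^sup>2 + 4 * norm z ^ 4 / sqrt \<delta>)"
    if \<delta>: "0 < \<delta>" "\<delta> \<le> 1" and x: "norm x \<le> R" "norm (x + \<delta> *\<^sub>R b x + \<sigma> *v z) \<le> R" for \<delta> x z
  proof -
    define h where "h = \<delta> *\<^sub>R b x + \<sigma> *v z"
    have y: "x + \<delta> *\<^sub>R b x + \<sigma> *v z = x + h" by (simp add: h_def)
    have xh: "norm (x + h) \<le> R" using x(2) by (simp add: y)
    let ?u = "\<delta> + norm z"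
    have h: "norm h \<le> C3 * ?u"
    proof -
      have "norm h \<le> \<delta> * norm (b x) + S * norm z"
        unfolding h_def using \<delta> S(2)[of z] by (intro order_trans[OF norm_triangle_ineq]) auto
      also have "\<dots> \<le> \<delta> * C3 + C3 * norm z"
        using K(2)[OF x(1)] C3 \<delta> by (intro add_mono mult_mono mult_left_mono) auto
      finally show ?thesis by (simp add: algebra_simps)
    qed
    have lk: "log_kernel_ratio b \<sigma> \<delta> x (x + h) =
        (\<Sum>i\<in>UNIV. h $ i * (partial i U x + partial i U (x + h))) / 2 + \<delta> / 2 * (drift_energy b \<sigma> x - drift_energy b \<sigma> (x + h))"
    proof -
      have "(\<Sum>i\<in>UNIV. h $ i * (partial i U x + partial i U (x + h))) = - (h \<bullet> (log_gradient b \<sigma> x + log_gradient b \<sigma> (x + h)))"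
        by (simp add: partial_U inner_vec_def sum_negf[symmetric] distrib_left right_diff_distrib)
      then show ?thesis by (simp add: log_kernel_ratio_def)
    qed
    have "\<bar>U x - U (x + h) + log_kernel_ratio b \<sigma> \<delta> x (x + h)\<bar> \<le>
        \<bar>U (x + h) - U x - (\<Sum>i\<in>UNIV. h $ i * (partial i U x + partial i U (x + h))) / 2\<bar> +
        \<delta> / 2 * \<bar>drift_energy b \<sigma> (x + h) - drift_energy b \<sigma> x\<bar>"
    proof -
      have "\<delta> / 2 * \<bar>drift_energy b \<sigma> (x + h) - drift_energy b \<sigma> x\<bar> = \<bar>\<delta> / 2 * (drift_energy b \<sigma> x - drift_energy b \<sigma> (x + h))\<bar>"
        using \<delta> by (simp add: abs_mult abs_minus_commute)
      then show ?thesis unfolding lk by linarith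
    qed
    also have "\<dots> \<le> C1 * norm h ^ 3 + \<delta> * (L * norm h)"
      using C1(2)[OF x(1) xh] L(2)[OF x(1) xh] \<delta> by (intro add_mono mult_mono) auto
    also have "\<dots> \<le> C1 * (C3 * ?u) ^ 3 + \<delta> * (L * (C3 * ?u))"
      using h C1 L \<delta> by (intro add_mono mult_left_mono power_mono) auto
    also have "\<dots> = (C1 * C3 ^ 3) * ?u ^ 3 + (L * C3) * (\<delta> * ?u)"
      by (simp add: power_mult_distrib mult_ac)
    also have "\<dots> \<le> C * ?u ^ 3 + C * (\<delta> * ?u)"
      using C \<delta> unfolding C_def by (intro add_mono mult_right_mono) auto
    also have "\<dots> = C * (?u ^ 3 + \<delta> * ?u)" by (simp add: distrib_left)
    also have "\<dots> \<le> C * (6 * \<delta> * sqrt \<delta> + 5 * sqrt \<delta> * (norm z)\<^sup>2 + 4 * norm z ^ 4 / sqrt \<delta>)"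
      using C log_ratio_step_bound[OF \<delta>, of "norm z"] unfolding C_def by (intro mult_left_mono) auto
    finally show ?thesis by (simp add: y)
  qed
  moreover have "C \<ge> 0" using C by (simp add: C_def)
  ultimately show ?thesis by blast
qed

text \<open>Markov's inequality. While the scheme stays in the ball, each error is dominated by a
  function of the Gaussian increment alone, so plain moments of increments suffice and no
  conditioning on staying in the ball takes place.\<close>

lemma path_log_ratio_small:
  "\<exists>C\<ge>0. \<forall>N \<delta> \<epsilon>. 0 < \<delta> \<longrightarrow> \<delta> \<le> 1 \<longrightarrow> 0 < \<epsilon> \<longrightarrow>
    prob {\<omega>\<in>space M. (\<forall>k\<le>N. norm (euler_sol \<delta> \<omega> k) \<le> R) \<and> \<epsilon> < \<bar>path_log_ratio U b \<sigma> \<delta> N (euler_sol \<delta> \<omega>)\<bar>} \<le>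
      C * (real N * \<delta> * sqrt \<delta>) / \<epsilon>"
proof -
  obtain C where C: "C \<ge> 0" "\<And>\<delta> x z. 0 < \<delta> \<Longrightarrow> \<delta> \<le> 1 \<Longrightarrow> norm x \<le> R \<Longrightarrow> norm (x + \<delta> *\<^sub>R b x + \<sigma> *v z) \<le> R \<Longrightarrow>
    \<bar>U x - U (x + \<delta> *\<^sub>R b x + \<sigma> *v z) + log_kernel_ratio b \<sigma> \<delta> x (x + \<delta> *\<^sub>R b x + \<sigma> *v z)\<bar> \<le>
      C * (6 * \<delta> * sqrt \<delta> + 5 * sqrt \<delta> * (norm z)\<^sup>2 + 4 * norm z ^ 4 / sqrt \<delta>)"
    using step_log_ratio_bound[of R] by blast
  let ?d = "real CARD('b)"
  \<comment> \<open>With d the dimension, the three terms of the step bound have the means 6, 5 d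
    and 4 * 3 d^2, each times \<open>\<delta> * sqrt \<delta>\<close>; for the last one this is the
    bound on the fourth moment.\<close>
  define C' where "C' = C * (6 + 5 * ?d + 12 * ?d\<^sup>2)"
  have "prob {\<omega>\<in>space M. (\<forall>k\<le>N. norm (euler_sol \<delta> \<omega> k) \<le> R) \<and> \<epsilon> < \<bar>path_log_ratio U b \<sigma> \<delta> N (euler_sol \<delta> \<omega>)\<bar>} \<le>
      C' * (real N * \<delta> * sqrt \<delta>) / \<epsilon>" if \<delta>: "0 < \<delta>" "\<delta> \<le> 1" and \<epsilon>: "0 < \<epsilon>" for N \<delta> \<epsilon>
  proof -
    let ?A = "{\<omega>\<in>space M. (\<forall>k\<le>N. norm (euler_sol \<delta> \<omega> k) \<le> R) \<and> \<epsilon> < \<bar>path_log_ratio U b \<sigma> \<delta> N (euler_sol \<delta> \<omega>)\<bar>}"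
    let ?s = "\<lambda>k \<omega>. C * (6 * \<delta> * sqrt \<delta> + 5 * sqrt \<delta> * (norm (increments \<delta> \<omega> k))\<^sup>2 + 4 / sqrt \<delta> * norm (increments \<delta> \<omega> k) ^ 4)"
    let ?Y = "\<lambda>\<omega>. \<Sum>k<N. ?s k \<omega>"
    have st: "0 \<le> real k * \<delta>" "real k * \<delta> < real (Suc k) * \<delta>" for k using \<delta> by auto
    have df: "real (Suc k) * \<delta> - real k * \<delta> = \<delta>" for k by (simp add: algebra_simps)
    note m2 = increment_norm_sq[OF st, unfolded df, folded increments_def]
    note m4 = increment_norm_fourth[OF st, unfolded df, folded increments_def]
    have si: "integrable M (?s k)" for k
      by (intro integrable_mult_right Bochner_Integration.integrable_add m2 m4) simp
    have sE: "(\<integral>\<omega>. ?s k \<omega> \<partial>M) \<le> C' * (\<delta> * sqrt \<delta>)" for k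
    proof -
      have "(\<integral>\<omega>. ?s k \<omega> \<partial>M) = C * (6 * \<delta> * sqrt \<delta> + 5 * sqrt \<delta> * (?d * \<delta>) +
          4 / sqrt \<delta> * (\<integral>\<omega>. norm (increments \<delta> \<omega> k) ^ 4 \<partial>M))"
        using m2[of k] m4(1)[of k] by (simp add: prob_space)
      also have "\<dots> \<le> C * (6 * \<delta> * sqrt \<delta> + 5 * sqrt \<delta> * (?d * \<delta>) + 4 / sqrt \<delta> * (3 * ?d\<^sup>2 * \<delta>\<^sup>2))"
        using m4(2)[of k] C(1) \<delta> by (intro mult_left_mono add_left_mono) auto
      also have "4 / sqrt \<delta> * (3 * ?d\<^sup>2 * \<delta>\<^sup>2) = 12 * ?d\<^sup>2 * (\<delta> * sqrt \<delta>)"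
      proof -
        have "\<delta>\<^sup>2 / sqrt \<delta> = \<delta> * sqrt \<delta>"
          using \<delta>(1) by (simp add: power2_eq_square real_div_sqrt flip: times_divide_eq_right)
        moreover have "4 / sqrt \<delta> * (3 * ?d\<^sup>2 * \<delta>\<^sup>2) = 12 * ?d\<^sup>2 * (\<delta>\<^sup>2 / sqrt \<delta>)" by simp
        ultimately show ?thesis by simp
      qed
      finally show ?thesis by (simp add: C'_def algebra_simps)
    qed
    have Yi: "integrable M ?Y" by (intro Bochner_Integration.integrable_sum si)
    have YE: "(\<integral>\<omega>. ?Y \<omega> \<partial>M) \<le> C' * (real N * \<delta> * sqrt \<delta>)"
    proof -
      have "(\<integral>\<omega>. ?Y \<omega> \<partial>M) = (\<Sum>k<N. \<integral>\<omega>. ?s k \<omega> \<partial>M)"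
        by (intro Bochner_Integration.integral_sum si)
      also have "\<dots> \<le> (\<Sum>k<N. C' * (\<delta> * sqrt \<delta>))" by (intro sum_mono sE)
      finally show ?thesis by (simp add: mult_ac)
    qed
    have Y0: "?Y \<omega> \<ge> 0" for \<omega> using C(1) \<delta> by (intro sum_nonneg mult_nonneg_nonneg) auto
    have AY: "\<epsilon> * indicator ?A \<omega> \<le> ?Y \<omega>" for \<omega>
    proof (cases "\<omega> \<in> ?A")
      case True
      have "\<bar>path_log_ratio U b \<sigma> \<delta> N (euler_sol \<delta> \<omega>)\<bar> \<le> ?Y \<omega>"
        unfolding path_log_ratio_def
      proof (intro order_trans[OF sum_abs] sum_mono)
        fix k assume k: "k \<in> {..<N}"
        have XS: "euler_sol \<delta> \<omega> (Suc k) = euler_sol \<delta> \<omega> k + \<delta> *\<^sub>R b (euler_sol \<delta> \<omega> k) + \<sigma> *v increments \<delta> \<omega> k"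
          by (simp add: euler_sol_def)
        have "norm (euler_sol \<delta> \<omega> k) \<le> R" "norm (euler_sol \<delta> \<omega> (Suc k)) \<le> R" using True k by auto
        then show "\<bar>U (euler_sol \<delta> \<omega> k) - U (euler_sol \<delta> \<omega> (Suc k)) + log_kernel_ratio b \<sigma> \<delta> (euler_sol \<delta> \<omega> k) (euler_sol \<delta> \<omega> (Suc k))\<bar> \<le> ?s k \<omega>"
          using C(2)[OF \<delta>, of "euler_sol \<delta> \<omega> k" "increments \<delta> \<omega> k"] unfolding XS by simp
      qed
      moreover have "\<epsilon> < \<bar>path_log_ratio U b \<sigma> \<delta> N (euler_sol \<delta> \<omega>)\<bar>" using True by simp
      ultimately show ?thesis using True by simp
    next
      case False
      then show ?thesis using Y0[of \<omega>] by simp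
    qed
    have "\<epsilon> * prob A \<le> (\<integral>\<omega>. ?Y \<omega> \<partial>M)" if AY: "\<And>\<omega>. \<epsilon> * indicator A \<omega> \<le> ?Y \<omega>" for A
    proof (cases "A \<in> events")
      case True
      have i: "integrable M (\<lambda>\<omega>. \<epsilon> * indicator A \<omega>)"
        using True by (intro integrable_mult_right integrable_real_indicator) (auto simp: emeasure_eq_measure)
      have "\<epsilon> * prob A = (\<integral>\<omega>. \<epsilon> * indicator A \<omega> \<partial>M)" using True by simp
      also have "\<dots> \<le> (\<integral>\<omega>. ?Y \<omega> \<partial>M)"
        by (rule integral_mono[OF i Yi AY])
      finally show ?thesis .
    next
      \<comment> \<open>A set that is not an event has measure 0 by convention, so the bound holds
        for it as well and measurability of the set need not be discussed here.\<close>
      case False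
      then have "prob A = 0" by (rule measure_notin_sets)
      then show ?thesis using Y0 by (simp add: integral_nonneg_AE)
    qed
    from this[OF AY] have "\<epsilon> * prob ?A \<le> C' * (real N * \<delta> * sqrt \<delta>)"
      using YE by (rule order_trans)
    then show ?thesis using \<epsilon> by (simp only: pos_le_divide_eq mult.commute)
  qed
  moreover have "C' \<ge> 0" using C(1) by (simp add: C'_def)
  ultimately show ?thesis by blast
qed

end

section \<open>Continuous test functions determine finite-dimensional laws\<close>

text \<open>The distance to the complement is positive exactly on A. The whole space is excluded
  because \<open>infdist\<close> to the empty set is 0 by convention.\<close>

lemma tendsto_indicator_open:
  fixes A :: "'a::metric_space set"
  assumes "open A" "A \<noteq> UNIV"
  shows "(\<lambda>n. min 1 (real n * infdist z (- A))) \<longlonglongrightarrow> indicator A z"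
proof (cases "z \<in> A")
  case True
  have "closed (- A)" "- A \<noteq> {}" using assms by (auto simp: closed_def)
  then have "infdist z (- A) \<noteq> 0" using True by (simp add: in_closed_iff_infdist_zero[symmetric])
  then have i: "infdist z (- A) > 0" using infdist_nonneg[of z "- A"] by linarith
  obtain N :: nat where N: "real N > 1 / infdist z (- A)" using reals_Archimedean2 by blast
  have "min 1 (real n * infdist z (- A)) = 1" if "n \<ge> N" for n
  proof -
    have "real n > 1 / infdist z (- A)" using N that by linarith
    then have "real n * infdist z (- A) > 1" using i by (simp add: field_simps)
    then show ?thesis by simp
  qed
  then have "eventually (\<lambda>n. min 1 (real n * infdist z (- A)) = 1) sequentially"
    by (rule eventually_sequentiallyI)
  then have "(\<lambda>n. min 1 (real n * infdist z (- A))) \<longlonglongrightarrow> 1" by (rule tendsto_eventually)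
  then show ?thesis using True by simp
next
  case False
  then have "infdist z (- A) = 0" by simp
  then show ?thesis using False by simp
qed

context prob_space
begin

text \<open>The weights g and h carry the factors belonging to the other coordinates. Weighted
  push-forwards are finite measures; they agree on open sets by monotone approximation of
  indicators, and open sets are stable under intersection.\<close>

lemma expectation_eq_open_imp_borel:
  fixes x y :: "'a \<Rightarrow> 'b::metric_space" and g h :: "'a \<Rightarrow> real"
  assumes [measurable]: "x \<in> borel_measurable M" "y \<in> borel_measurable M" "g \<in> borel_measurable M" "h \<in> borel_measurable M"
    and g: "\<And>\<omega>. 0 \<le> g \<omega>" "\<And>\<omega>. g \<omega> \<le> 1" and h: "\<And>\<omega>. 0 \<le> h \<omega>" "\<And>\<omega>. h \<omega> \<le> 1"
    and eq: "\<And>f :: 'b \<Rightarrow> real. continuous_on UNIV f \<Longrightarrow> (\<And>z. 0 \<le> f z \<and> f z \<le> 1) \<Longrightarrow>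
      (\<integral>\<omega>. f (x \<omega>) * g \<omega> \<partial>M) = (\<integral>\<omega>. f (y \<omega>) * h \<omega> \<partial>M)"
    and S: "S \<in> sets borel"
  shows "(\<integral>\<omega>. indicator S (x \<omega>) * g \<omega> \<partial>M) = (\<integral>\<omega>. indicator S (y \<omega>) * h \<omega> \<partial>M)"
proof -
  define \<mu> where "\<mu> x g = distr (density M (\<lambda>\<omega>. ennreal (g \<omega>))) borel x" for x :: "'a \<Rightarrow> 'b" and g :: "'a \<Rightarrow> real"
  have \<mu>: "emeasure (\<mu> x g) A = ennreal (\<integral>\<omega>. indicator A (x \<omega>) * g \<omega> \<partial>M)"
    if [measurable]: "x \<in> borel_measurable M" "g \<in> borel_measurable M" "A \<in> sets borel"
      and g: "\<And>\<omega>. 0 \<le> g \<omega>" "\<And>\<omega>. g \<omega> \<le> 1" for x :: "'a \<Rightarrow> 'b" and g :: "'a \<Rightarrow> real" and A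
  proof -
    have "emeasure (\<mu> x g) A = emeasure (density M (\<lambda>\<omega>. ennreal (g \<omega>))) (x -` A \<inter> space M)"
      unfolding \<mu>_def by (subst emeasure_distr) auto
    also have "\<dots> = (\<integral>\<^sup>+\<omega>. ennreal (g \<omega>) * indicator (x -` A \<inter> space M) \<omega> \<partial>M)"
      by (rule emeasure_density) auto
    also have "\<dots> = (\<integral>\<^sup>+\<omega>. ennreal (indicator A (x \<omega>) * g \<omega>) \<partial>M)"
      by (intro nn_integral_cong) (auto simp: indicator_def)
    also have "\<dots> = ennreal (\<integral>\<omega>. indicator A (x \<omega>) * g \<omega> \<partial>M)"
    proof (rule nn_integral_eq_integral)
      show "integrable M (\<lambda>\<omega>. indicator A (x \<omega>) * g \<omega>)"
        by (rule integrable_const_bound[where B = 1]) (auto simp: indicator_def g)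
    qed (simp add: g)
    finally show ?thesis .
  qed
  have "\<mu> x g = \<mu> y h"
  proof (rule measure_eqI_generator_eq)
    show "Int_stable {A :: 'b set. open A}" by (auto simp: Int_stable_def)
    show "{A :: 'b set. open A} \<subseteq> Pow UNIV" by simp
    show "sets (\<mu> x g) = sigma_sets UNIV {A. open A}" "sets (\<mu> y h) = sigma_sets UNIV {A. open A}"
      by (simp_all add: \<mu>_def borel_def)
    show "range (\<lambda>_::nat. UNIV :: 'b set) \<subseteq> {A. open A}" "(\<Union>i::nat. UNIV :: 'b set) = UNIV" by auto
    show "emeasure (\<mu> x g) UNIV \<noteq> \<infinity>" by (subst \<mu>) (auto simp: g)
    fix A :: "'b set" assume "A \<in> {A. open A}"
    then have A: "open A" by simp
    then have Ab [measurable]: "A \<in> sets borel" by simp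
    have "(\<integral>\<omega>. indicator A (x \<omega>) * g \<omega> \<partial>M) = (\<integral>\<omega>. indicator A (y \<omega>) * h \<omega> \<partial>M)"
    proof (cases "A = UNIV")
      case True
      then show ?thesis using eq[of "\<lambda>_. 1"] by simp
    next
      case False
      let ?f = "\<lambda>n z. min 1 (real n * infdist z (- A))"
      have cf: "continuous_on UNIV (?f n)" for n by (intro continuous_intros)
      have [measurable]: "?f n \<in> borel_measurable borel" for n
        by (intro borel_measurable_continuous_onI cf)
      have fb: "0 \<le> ?f n z \<and> ?f n z \<le> 1" for n z by (simp add: infdist_nonneg)
      have lim: "(\<lambda>n. \<integral>\<omega>. ?f n (x \<omega>) * g \<omega> \<partial>M) \<longlonglongrightarrow> (\<integral>\<omega>. indicator A (x \<omega>) * g \<omega> \<partial>M)"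
        if [measurable]: "x \<in> borel_measurable M" "g \<in> borel_measurable M"
          and g: "\<And>\<omega>. 0 \<le> g \<omega>" "\<And>\<omega>. g \<omega> \<le> 1" for x :: "'a \<Rightarrow> 'b" and g :: "'a \<Rightarrow> real"
      proof (rule integral_dominated_convergence[where w = "\<lambda>_. 1"])
        show "AE \<omega> in M. (\<lambda>n. ?f n (x \<omega>) * g \<omega>) \<longlonglongrightarrow> indicator A (x \<omega>) * g \<omega>"
          by (intro AE_I2 tendsto_mult tendsto_indicator_open[OF A False] tendsto_const)
        show "AE \<omega> in M. norm (?f n (x \<omega>) * g \<omega>) \<le> 1" for n
        proof (rule AE_I2)
          fix \<omega>
          have "norm (?f n (x \<omega>) * g \<omega>) = ?f n (x \<omega>) * g \<omega>"
            using fb[of n "x \<omega>"] g(1)[of \<omega>] by (simp only: real_norm_def abs_mult abs_of_nonneg)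
          also have "\<dots> \<le> 1" using fb[of n "x \<omega>"] g by (intro mult_le_one) auto
          finally show "norm (?f n (x \<omega>) * g \<omega>) \<le> 1" .
        qed
        show "(\<lambda>\<omega>. ?f n (x \<omega>) * g \<omega>) \<in> borel_measurable M" for n
          by (intro borel_measurable_times measurable_compose[OF that(1)] borel_measurable_continuous_onI[OF cf] that(2))
        show "(\<lambda>\<omega>. indicator A (x \<omega>) * g \<omega>) \<in> borel_measurable M" by measurable
      qed simp
      have "(\<integral>\<omega>. ?f n (x \<omega>) * g \<omega> \<partial>M) = (\<integral>\<omega>. ?f n (y \<omega>) * h \<omega> \<partial>M)" for n
        by (rule eq[OF cf fb])
      with lim[of x g] lim[of y h] show ?thesis
        using g h LIMSEQ_unique by auto
    qed
    then show "emeasure (\<mu> x g) A = emeasure (\<mu> y h) A" by (simp add: \<mu> g h)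
  qed
  then have "emeasure (\<mu> x g) S = emeasure (\<mu> y h) S" by simp
  then have "ennreal (\<integral>\<omega>. indicator S (x \<omega>) * g \<omega> \<partial>M) = ennreal (\<integral>\<omega>. indicator S (y \<omega>) * h \<omega> \<partial>M)"
    using S by (simp add: \<mu> g h)
  then show ?thesis
    by (subst (asm) ennreal_inj) (auto intro!: integral_nonneg_AE simp: g h)
qed

lemma prob_eq_of_continuous_test_functions:
  fixes x y :: "'j \<Rightarrow> 'a \<Rightarrow> 'b::metric_space"
  assumes J: "finite J"
    and xm: "\<And>j. j \<in> J \<Longrightarrow> x j \<in> borel_measurable M" and ym: "\<And>j. j \<in> J \<Longrightarrow> y j \<in> borel_measurable M"
    and eq: "\<And>f :: 'j \<Rightarrow> 'b \<Rightarrow> real. (\<And>j. j \<in> J \<Longrightarrow> continuous_on UNIV (f j)) \<Longrightarrow> (\<And>j z. 0 \<le> f j z \<and> f j z \<le> 1) \<Longrightarrow>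
      (\<integral>\<omega>. (\<Prod>j\<in>J. f j (x j \<omega>)) \<partial>M) = (\<integral>\<omega>. (\<Prod>j\<in>J. f j (y j \<omega>)) \<partial>M)"
    and S: "\<And>j. j \<in> J \<Longrightarrow> S j \<in> sets borel"
  shows "prob {\<omega>\<in>space M. \<forall>j\<in>J. x j \<omega> \<in> S j} = prob {\<omega>\<in>space M. \<forall>j\<in>J. y j \<omega> \<in> S j}"
proof -
  \<comment> \<open>Test functions are exchanged for indicators one coordinate at a time; K is the
    set of coordinates already treated.\<close>
  have ext: "(\<integral>\<omega>. (\<Prod>j\<in>J. f j (x j \<omega>)) \<partial>M) = (\<integral>\<omega>. (\<Prod>j\<in>J. f j (y j \<omega>)) \<partial>M)"
    if "finite K" "K \<subseteq> J" "\<And>j. j \<in> K \<Longrightarrow> f j = indicator (S j)" "\<And>j. j \<in> J - K \<Longrightarrow> continuous_on UNIV (f j)"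
      "\<And>j z. 0 \<le> f j z \<and> f j z \<le> 1" for K and f :: "'j \<Rightarrow> 'b \<Rightarrow> real"
    using that
  proof (induction K arbitrary: f rule: finite_induct)
    case empty
    then show ?case by (intro eq) auto
  next
    case (insert k K)
    have k: "k \<in> J" using insert.prems by simp
    have [measurable]: "x k \<in> borel_measurable M" "y k \<in> borel_measurable M" using xm ym k by auto
    have fm: "f j \<in> borel_measurable borel" if "j \<in> J" for j
    proof (cases "j \<in> insert k K")
      case True
      then show ?thesis using insert.prems(2)[OF True] S[OF that] by simp
    next
      case False
      then show ?thesis using insert.prems(3) that by (intro borel_measurable_continuous_onI) auto
    qed
    have pm: "(\<lambda>\<omega>. \<Prod>j\<in>J - {k}. f j (z j \<omega>)) \<in> borel_measurable M" if "\<And>j. j \<in> J \<Longrightarrow> z j \<in> borel_measurable M" for z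
      using fm that by (intro borel_measurable_prod) (auto intro: measurable_compose)
    have p01: "0 \<le> (\<Prod>j\<in>J - {k}. f j (z j \<omega>))" "(\<Prod>j\<in>J - {k}. f j (z j \<omega>)) \<le> 1" for z :: "'j \<Rightarrow> 'a \<Rightarrow> 'b" and \<omega>
      using insert.prems(4) by (auto intro!: prod_nonneg prod_le_1)
    have split: "(\<Prod>j\<in>J. F j) = F k * (\<Prod>j\<in>J - {k}. F j)" for F :: "'j \<Rightarrow> real"
      using prod.remove[OF J k, of F] .
    have "(\<integral>\<omega>. indicator (S k) (x k \<omega>) * (\<Prod>j\<in>J - {k}. f j (x j \<omega>)) \<partial>M) =
        (\<integral>\<omega>. indicator (S k) (y k \<omega>) * (\<Prod>j\<in>J - {k}. f j (y j \<omega>)) \<partial>M)"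
    proof (rule expectation_eq_open_imp_borel)
      fix \<phi> :: "'b \<Rightarrow> real" assume \<phi>: "continuous_on UNIV \<phi>" "\<And>z. 0 \<le> \<phi> z \<and> \<phi> z \<le> 1"
      let ?f = "f(k := \<phi>)"
      have "(\<integral>\<omega>. (\<Prod>j\<in>J. ?f j (x j \<omega>)) \<partial>M) = (\<integral>\<omega>. (\<Prod>j\<in>J. ?f j (y j \<omega>)) \<partial>M)"
        by (rule insert.IH) (use insert.prems insert.hyps \<phi> in auto)
      moreover have "(\<Prod>j\<in>J. ?f j (z j \<omega>)) = \<phi> (z k \<omega>) * (\<Prod>j\<in>J - {k}. f j (z j \<omega>))" for z :: "'j \<Rightarrow> 'a \<Rightarrow> 'b" and \<omega>
        unfolding split by simp
      ultimately show "(\<integral>\<omega>. \<phi> (x k \<omega>) * (\<Prod>j\<in>J - {k}. f j (x j \<omega>)) \<partial>M) =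
          (\<integral>\<omega>. \<phi> (y k \<omega>) * (\<Prod>j\<in>J - {k}. f j (y j \<omega>)) \<partial>M)" by (simp only:)
    qed (use pm[OF xm] pm[OF ym] p01 S k in auto)
    then show ?case unfolding split using insert.prems(2)[of k] by simp
  qed
  have ind: "(\<Prod>j\<in>J. indicator (S j) (z j \<omega>) :: real) = indicator {\<omega>. \<forall>j\<in>J. z j \<omega> \<in> S j} \<omega>" for z :: "'j \<Rightarrow> 'a \<Rightarrow> 'b" and \<omega>
    using J by (induction J rule: finite_induct) (auto simp: indicator_def)
  have "(\<integral>\<omega>. (\<Prod>j\<in>J. indicator (S j) (x j \<omega>) :: real) \<partial>M) = (\<integral>\<omega>. (\<Prod>j\<in>J. indicator (S j) (y j \<omega>)) \<partial>M)"
    by (rule ext[OF J]) (auto simp: indicator_def)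
  then have "(\<integral>\<omega>. indicator {\<omega>. \<forall>j\<in>J. x j \<omega> \<in> S j} \<omega> \<partial>M) = (\<integral>\<omega>. indicator {\<omega>. \<forall>j\<in>J. y j \<omega> \<in> S j} \<omega> \<partial>M :: real)"
    unfolding ind .
  moreover have "{\<omega>. \<forall>j\<in>J. z j \<omega> \<in> S j} \<inter> space M = {\<omega>\<in>space M. \<forall>j\<in>J. z j \<omega> \<in> S j}" for z :: "'j \<Rightarrow> 'a \<Rightarrow> 'b"
    by auto
  ultimately show ?thesis by simp
qed

end

section \<open>Passage to the limit in the reversed scheme\<close>

context langevin
begin

lemma euler_sol_tendsto:
  fixes s :: "nat \<Rightarrow> nat"
  assumes T: "T > 0" and s: "\<And>N. s N \<le> N" and lim: "(\<lambda>N. real (s N) * (T / real N)) \<longlonglongrightarrow> \<tau>" and \<tau>: "\<tau> \<ge> 0"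
  shows "AE \<omega> in M. (\<lambda>N. euler_sol (T / real N) \<omega> (s N)) \<longlonglongrightarrow> q \<tau> \<omega>"
  using euler_sol_converges[OF T] AE_solution
proof eventually_elim
  case (elim \<omega>)
  have c: "continuous_on {0..} (\<lambda>t. q t \<omega>)" using elim(2) by blast
  have "(\<lambda>N. q (real (s N) * (T / real N)) \<omega>) \<longlonglongrightarrow> q \<tau> \<omega>"
    by (rule continuous_on_tendsto_compose[OF c lim]) (use \<tau> T in auto)
  moreover have "(\<lambda>N. euler_sol (T / real N) \<omega> (s N) - q (real (s N) * (T / real N)) \<omega>) \<longlonglongrightarrow> 0"
  proof (rule LIMSEQ_I)
    fix e :: real assume "e > 0"
    then have "e / 2 > 0" by simp
    then obtain N0 where "\<forall>N\<ge>N0. \<forall>k\<le>N. norm (euler_sol (T / real N) \<omega> k - q (real k * (T / real N)) \<omega>) \<le> e / 2"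
      using elim(1) by blast
    then have "norm (euler_sol (T / real N) \<omega> (s N) - q (real (s N) * (T / real N)) \<omega>) \<le> e / 2" if "N \<ge> N0" for N
      using s[of N] that by blast
    then have "norm (euler_sol (T / real N) \<omega> (s N) - q (real (s N) * (T / real N)) \<omega> - 0) < e" if "N \<ge> N0" for N
      using \<open>e > 0\<close> that by (simp add: le_less_trans[of _ "e / 2"])
    then show "\<exists>N0. \<forall>N\<ge>N0. norm (euler_sol (T / real N) \<omega> (s N) - q (real (s N) * (T / real N)) \<omega> - 0) < e" by blast
  qed
  ultimately show ?case
    using tendsto_add by fastforce
qed

text \<open>Rounding down to the grid serves t and T - t with the same index, as reversal of the
  scheme maps the index k to N - k.\<close>

lemma grid_times:
  assumes T: "T > 0" and t: "0 \<le> t" "t \<le> T"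
  defines "k \<equiv> \<lambda>N. nat \<lfloor>t * real N / T\<rfloor>"
  shows "k N \<le> N" "(\<lambda>N. real (k N) * (T / real N)) \<longlonglongrightarrow> t"
    "(\<lambda>N. real (N - k N) * (T / real N)) \<longlonglongrightarrow> T - t"
proof -
  have k1: "real (k N) \<le> t * real N / T" "t * real N / T - 1 \<le> real (k N)" for N
    unfolding k_def using T t by (simp_all add: of_nat_floor)
  show kN: "k N \<le> N" for N
  proof -
    have "t * real N / T \<le> real N" using T t by (simp add: field_simps mult_right_mono)
    then show ?thesis using k1(1)[of N] by linarith
  qed
  have lim0: "(\<lambda>N. t - T * (1 / real N)) \<longlonglongrightarrow> t - T * 0"
    by (intro tendsto_intros lim_1_over_n)
  show lim: "(\<lambda>N. real (k N) * (T / real N)) \<longlonglongrightarrow> t"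
  proof (rule tendsto_sandwich)
    show "eventually (\<lambda>N. t - T * (1 / real N) \<le> real (k N) * (T / real N)) sequentially"
    proof (rule eventually_sequentiallyI[of 1])
      fix N :: nat assume N: "1 \<le> N"
      have "(t * real N / T - 1) * (T / real N) \<le> real (k N) * (T / real N)"
        using k1(2) T by (intro mult_right_mono) auto
      moreover have "(t * real N / T - 1) * (T / real N) = t - T * (1 / real N)"
        using N T by (simp add: field_simps)
      ultimately show "t - T * (1 / real N) \<le> real (k N) * (T / real N)" by (simp only:)
    qed
    show "eventually (\<lambda>N. real (k N) * (T / real N) \<le> t) sequentially"
    proof (rule eventually_sequentiallyI[of 1])
      fix N :: nat assume N: "1 \<le> N"
      have "real (k N) * (T / real N) \<le> (t * real N / T) * (T / real N)"
        using k1(1) T by (intro mult_right_mono) auto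
      moreover have "(t * real N / T) * (T / real N) = t" using N T by simp
      ultimately show "real (k N) * (T / real N) \<le> t" by (simp only:)
    qed
  qed (use lim0 in auto)
  have "(\<lambda>N. T - real (k N) * (T / real N)) \<longlonglongrightarrow> T - t"
    by (intro tendsto_intros lim)
  then show "(\<lambda>N. real (N - k N) * (T / real N)) \<longlonglongrightarrow> T - t"
  proof (rule Lim_transform_eventually)
    show "eventually (\<lambda>N. T - real (k N) * (T / real N) = real (N - k N) * (T / real N)) sequentially"
      by (rule eventually_sequentiallyI[of 1]) (use kN in \<open>simp add: of_nat_diff left_diff_distrib diff_divide_distrib\<close>)
  qed
qed

text \<open>Boundedness is required at the grid times of all meshes at once. These times are
  countably many, which makes the event measurable, and the event does not depend on the mesh used
  for the scheme.\<close>

definition grid_bounded :: "real \<Rightarrow> nat \<Rightarrow> 'w set" where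
  "grid_bounded T n = {\<omega>\<in>space M. \<forall>N k. k \<le> N \<longrightarrow> norm (q (real k * (T / real N)) \<omega>) \<le> real n}"

lemma grid_bounded_events [measurable]:
  assumes "T > 0"
  shows "grid_bounded T n \<in> events"
proof -
  have [measurable]: "q (real k * (T / real N)) \<in> borel_measurable M" for k N
    using assms by (intro q_measurable) simp
  show ?thesis unfolding grid_bounded_def by measurable
qed

lemma grid_bounded_tendsto:
  assumes T: "T > 0"
  shows "(\<lambda>n. prob (grid_bounded T n)) \<longlonglongrightarrow> 1"
proof -
  have "incseq (grid_bounded T)"
  proof (rule incseq_SucI)
    show "grid_bounded T n \<subseteq> grid_bounded T (Suc n)" for n
      unfolding grid_bounded_def by (force intro: order_trans[of _ "real n"])
  qed
  then have "(\<lambda>n. prob (grid_bounded T n)) \<longlonglongrightarrow> prob (\<Union>n. grid_bounded T n)"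
    using grid_bounded_events[OF T] by (intro finite_Lim_measure_incseq) auto
  moreover have "AE \<omega> in M. \<omega> \<in> (\<Union>n. grid_bounded T n)"
    using AE_solution AE_space
  proof eventually_elim
    case (elim \<omega>)
    have "continuous_on {0..T} (\<lambda>t. q t \<omega>)"
      by (rule continuous_on_subset[OF conjunct1[OF elim(1)]]) auto
    then have "bounded ((\<lambda>t. q t \<omega>) ` {0..T})"
      by (intro compact_imp_bounded compact_continuous_image) auto
    then obtain K where K: "\<forall>x\<in>(\<lambda>t. q t \<omega>) ` {0..T}. norm x \<le> K"
      unfolding bounded_iff by (elim exE)
    obtain n :: nat where n: "K \<le> real n" using real_arch_simple by blast
    have "norm (q (real k * (T / real N)) \<omega>) \<le> real n" if "k \<le> N" for k N
    proof -
      \<comment> \<open>For N = 0 the grid time is 0, since division by zero gives 0.\<close>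
      have "real k * (T / real N) \<in> {0..T}"
        using that T by (cases "N = 0") (auto simp: field_simps mult_right_mono)
      then show ?thesis using K n by force
    qed
    then show ?case using elim(2) by (auto simp: grid_bounded_def)
  qed
  then have "prob (\<Union>n. grid_bounded T n) = 1"
    using grid_bounded_events[OF T] by (subst prob_eq_1) auto
  ultimately show ?thesis by simp
qed

end

context gibbs_langevin
begin

text \<open>On paths that stay in the ball and have a small log ratio, the comparison of weights
  applies. Elsewhere the test functions, having values in [0, 1], cost at most the probability of
  the exceptional events.\<close>

lemma euler_reversal_bound:
  fixes f :: "'j \<Rightarrow> real^'b \<Rightarrow> real"
  assumes \<delta>: "\<delta> > 0" and N: "N \<ge> 1" and \<epsilon>: "\<epsilon> > 0" and J: "finite J"
    and f: "\<And>j. j \<in> J \<Longrightarrow> continuous_on UNIV (f j)" "\<And>j z. 0 \<le> f j z \<and> f j z \<le> 1"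
    and k: "\<And>j. j \<in> J \<Longrightarrow> k j \<le> N"
  shows "(\<integral>\<omega>. (\<Prod>j\<in>J. f j (euler_sol \<delta> \<omega> (N - k j))) \<partial>M) \<le> exp \<epsilon> * (\<integral>\<omega>. (\<Prod>j\<in>J. f j (euler_sol \<delta> \<omega> (k j))) \<partial>M) +
    (prob {\<omega>\<in>space M. \<not> (\<forall>k\<le>N. norm (euler_sol \<delta> \<omega> k) \<le> R)} +
     prob {\<omega>\<in>space M. (\<forall>k\<le>N. norm (euler_sol \<delta> \<omega> k) \<le> R) \<and> \<epsilon> < \<bar>path_log_ratio U b \<sigma> \<delta> N (euler_sol \<delta> \<omega>)\<bar>})"
proof -
  let ?P = "\<Pi>\<^sub>M i\<in>{..N}. (borel :: (real^'b) measure)"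
  let ?r = "path_log_ratio U b \<sigma> \<delta> N"
  define S where "S = {p. (\<forall>k\<le>N. norm (p k) \<le> R) \<and> \<bar>?r p\<bar> \<le> \<epsilon>}"
  define \<Phi> where "\<Phi> p = ennreal (\<Prod>j\<in>J. f j (p (k j)))" for p
  let ?X = "\<lambda>\<omega>. \<lambda>k\<in>{..N}. euler_sol \<delta> \<omega> k"
  let ?g = "\<lambda>x. ennreal (Z * exp (- U x))"
  have [measurable]: "f j \<in> borel_measurable borel" if "j \<in> J" for j
    using f(1)[OF that] by (rule borel_measurable_continuous_onI)
  have Xm: "(\<lambda>\<omega>. euler_sol \<delta> \<omega> k) \<in> borel_measurable M" for k using \<delta> by simp
  have \<Phi>m [measurable]: "\<Phi> \<in> borel_measurable ?P"
    unfolding \<Phi>_def[abs_def]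
  proof (intro measurable_compose[OF _ measurable_ennreal] borel_measurable_prod)
    fix j assume j: "j \<in> J"
    then have "k j \<in> {..N}" using k by simp
    then have "(\<lambda>p. p (k j)) \<in> ?P \<rightarrow>\<^sub>M borel" by (rule measurable_component_singleton)
    then show "(\<lambda>p. f j (p (k j))) \<in> borel_measurable ?P"
      by (rule measurable_compose[OF _ borel_measurable_continuous_onI[OF f(1)[OF j]]])
  qed
  have [measurable]: "Measurable.pred ?P (\<lambda>p. \<forall>k\<le>N. norm (p k) \<le> R)" by (rule stay_measurable)
  have Spred [measurable]: "Measurable.pred ?P (\<lambda>p. p \<in> S)"
    unfolding S_def mem_Collect_eq by measurable
  have gae: "AE x in lborel. ennreal (\<rho>0 x) = ?g x" using gibbs by eventually_elim simp
  have key: "(\<integral>\<^sup>+\<omega>. \<Phi> (reverse_path N (?X \<omega>)) * indicator S (?X \<omega>) \<partial>M) \<le>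
      ennreal (exp \<epsilon>) * (\<integral>\<^sup>+\<omega>. \<Phi> (?X \<omega>) * indicator S (?X \<omega>) \<partial>M)"
  proof -
    have m1: "(\<lambda>p. \<Phi> (reverse_path N p) * indicator S p) \<in> borel_measurable ?P" by measurable
    have m2: "(\<lambda>p. \<Phi> p * indicator S p) \<in> borel_measurable ?P" by measurable
    have gm: "?g \<in> borel_measurable borel" by measurable
    show ?thesis
      unfolding nn_integral_euler_sol[OF \<delta> N m1 gm gae] nn_integral_euler_sol[OF \<delta> N m2 gm gae]
      unfolding S_def by (rule nn_integral_reverse_le[OF invertible_\<sigma> \<delta> Z_nonneg b_measurable U_measurable \<Phi>m])
  qed
  have rX: "?r (?X \<omega>) = ?r (euler_sol \<delta> \<omega>)" for \<omega>
    unfolding path_log_ratio_def by (intro sum.cong) auto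
  have SX: "?X \<omega> \<in> S \<longleftrightarrow> (\<forall>k\<le>N. norm (euler_sol \<delta> \<omega> k) \<le> R) \<and> \<bar>?r (euler_sol \<delta> \<omega>)\<bar> \<le> \<epsilon>" for \<omega>
    by (simp add: S_def rX)
  let ?F = "\<lambda>\<omega>. \<Prod>j\<in>J. f j (euler_sol \<delta> \<omega> (k j))" and ?Fr = "\<lambda>\<omega>. \<Prod>j\<in>J. f j (euler_sol \<delta> \<omega> (N - k j))"
  have \<Phi>X: "\<Phi> (?X \<omega>) = ennreal (?F \<omega>)" for \<omega>
    unfolding \<Phi>_def using k by (intro arg_cong[where f = ennreal] prod.cong) auto
  have \<Phi>rX: "\<Phi> (reverse_path N (?X \<omega>)) = ennreal (?Fr \<omega>)" for \<omega>
    unfolding \<Phi>_def reverse_path_def using k by (intro arg_cong[where f = ennreal] prod.cong) auto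
  have Fm: "?F \<in> borel_measurable M" "?Fr \<in> borel_measurable M"
    by (auto intro!: borel_measurable_prod measurable_compose[OF Xm] borel_measurable_continuous_onI f)
  have F01: "0 \<le> ?F \<omega>" "?F \<omega> \<le> 1" "0 \<le> ?Fr \<omega>" "?Fr \<omega> \<le> 1" for \<omega>
    using f(2) by (auto intro!: prod_nonneg prod_le_1)
  have Fi: "integrable M ?F" "integrable M ?Fr"
    using Fm F01 by (auto intro!: integrable_const_bound[where B = 1])
  define A where "A = {\<omega>\<in>space M. \<not> (\<forall>k\<le>N. norm (euler_sol \<delta> \<omega> k) \<le> R)}"
  define A' where "A' = {\<omega>\<in>space M. (\<forall>k\<le>N. norm (euler_sol \<delta> \<omega> k) \<le> R) \<and> \<epsilon> < \<bar>?r (euler_sol \<delta> \<omega>)\<bar>}"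
  have XP: "?X \<in> M \<rightarrow>\<^sub>M ?P" by (rule measurable_restrict) (rule Xm)
  have Am: "A \<in> events"
  proof -
    have eq: "(\<forall>k\<le>N. norm (?X \<omega> k) \<le> R) \<longleftrightarrow> (\<forall>k\<le>N. norm (euler_sol \<delta> \<omega> k) \<le> R)" for \<omega>
      by simp
    have "Measurable.pred M (\<lambda>\<omega>. \<forall>k\<le>N. norm (?X \<omega> k) \<le> R)"
      by (rule measurable_compose[OF XP stay_measurable])
    then have "Measurable.pred M (\<lambda>\<omega>. \<not> (\<forall>k\<le>N. norm (euler_sol \<delta> \<omega> k) \<le> R))"
      unfolding eq by (rule pred_intros_logic)
    then show ?thesis by (simp only: pred_def A_def)
  qed
  have Sm: "{\<omega>\<in>space M. ?X \<omega> \<in> S} \<in> events"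
    using measurable_compose[OF XP Spred] by (simp only: pred_def)
  have Bm: "A' \<in> events"
  proof -
    have "A' = space M - A - {\<omega>\<in>space M. ?X \<omega> \<in> S}" unfolding SX A_def A'_def by auto
    moreover have "space M - A - {\<omega>\<in>space M. ?X \<omega> \<in> S} \<in> events"
      by (intro sets.Diff sets.top Am Sm)
    ultimately show ?thesis by (simp only:)
  qed
  have "ennreal (\<integral>\<omega>. ?Fr \<omega> \<partial>M) = (\<integral>\<^sup>+\<omega>. ennreal (?Fr \<omega>) \<partial>M)"
    using Fi F01 by (intro nn_integral_eq_integral[symmetric]) auto
  also have "\<dots> \<le> (\<integral>\<^sup>+\<omega>. ennreal (?Fr \<omega>) * indicator S (?X \<omega>) + (indicator A \<omega> + indicator A' \<omega>) \<partial>M)"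
  proof (rule nn_integral_mono)
    fix \<omega> assume w: "\<omega> \<in> space M"
    show "ennreal (?Fr \<omega>) \<le> ennreal (?Fr \<omega>) * indicator S (?X \<omega>) + (indicator A \<omega> + indicator A' \<omega>)"
    proof (cases "?X \<omega> \<in> S")
      case False
      then have "\<omega> \<in> A \<or> \<omega> \<in> A'" using w by (auto simp: SX A_def A'_def)
      then have "1 \<le> (indicator A \<omega> + indicator A' \<omega> :: ennreal)"
        by (auto simp: indicator_def)
      have "ennreal (?Fr \<omega>) \<le> 1" using F01(4)[of \<omega>] by simp
      also note \<open>1 \<le> (indicator A \<omega> + indicator A' \<omega> :: ennreal)\<close>
      finally show ?thesis using False by simp
    qed simp
  qed
  also have "\<dots> = (\<integral>\<^sup>+\<omega>. ennreal (?Fr \<omega>) * indicator S (?X \<omega>) \<partial>M) + (\<integral>\<^sup>+\<omega>. indicator A \<omega> + indicator A' \<omega> \<partial>M)"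
  proof (rule nn_integral_add)
    show "(\<lambda>\<omega>. ennreal (?Fr \<omega>) * indicator S (?X \<omega>)) \<in> borel_measurable M"
      using Fm measurable_compose[OF XP, of "indicator S" "borel :: ennreal measure"] Spred by measurable
  qed (use Am Bm in measurable)
  also have "(\<integral>\<^sup>+\<omega>. indicator A \<omega> + indicator A' \<omega> \<partial>M) = ennreal (prob A + prob A')"
    using Am Bm by (subst nn_integral_add) (auto simp: emeasure_eq_measure)
  also have "(\<integral>\<^sup>+\<omega>. ennreal (?Fr \<omega>) * indicator S (?X \<omega>) \<partial>M) \<le> ennreal (exp \<epsilon>) * (\<integral>\<^sup>+\<omega>. ennreal (?F \<omega>) * indicator S (?X \<omega>) \<partial>M)"
    using key unfolding \<Phi>X \<Phi>rX .
  also have "(\<integral>\<^sup>+\<omega>. ennreal (?F \<omega>) * indicator S (?X \<omega>) \<partial>M) \<le> (\<integral>\<^sup>+\<omega>. ennreal (?F \<omega>) \<partial>M)"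
    by (intro nn_integral_mono) (auto simp: indicator_def)
  also have "(\<integral>\<^sup>+\<omega>. ennreal (?F \<omega>) \<partial>M) = ennreal (\<integral>\<omega>. ?F \<omega> \<partial>M)"
    using Fi F01 by (intro nn_integral_eq_integral) auto
  finally have "ennreal (\<integral>\<omega>. ?Fr \<omega> \<partial>M) \<le> ennreal (exp \<epsilon>) * ennreal (\<integral>\<omega>. ?F \<omega> \<partial>M) + ennreal (prob A + prob A')"
    by (simp add: add_right_mono mult_left_mono)
  also have "\<dots> = ennreal (exp \<epsilon> * (\<integral>\<omega>. ?F \<omega> \<partial>M) + (prob A + prob A'))"
    using F01 by (simp add: ennreal_mult[symmetric] ennreal_plus[symmetric] integral_nonneg_AE del: ennreal_plus)
  finally show ?thesis
    unfolding A_def[symmetric] A'_def[symmetric]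
    using F01 by (subst (asm) ennreal_le_iff) (auto intro!: add_nonneg_nonneg integral_nonneg_AE)
qed

end

lemma (in prob_space) prob_le_Int_compl:
  assumes "A \<in> events" "H \<in> events"
  shows "prob A \<le> prob (H \<inter> A) + (1 - prob H)"
proof -
  have "prob A \<le> prob ((H \<inter> A) \<union> (space M - H))"
    using assms sets.sets_into_space by (intro finite_measure_mono) auto
  also have "\<dots> \<le> prob (H \<inter> A) + prob (space M - H)"
    using assms by (intro measure_Un_le) auto
  finally show ?thesis using prob_compl[OF assms(2)] by simp
qed

context langevin
begin

lemma stay_event:
  assumes "0 \<le> \<delta>"
  shows "{\<omega>\<in>space M. \<not> (\<forall>k\<le>N. norm (euler_sol \<delta> \<omega> k) \<le> R)} \<in> events"
proof -
  have "{\<omega>\<in>space M. \<not> (\<forall>k\<le>N. norm (euler_sol \<delta> \<omega> k) \<le> R)} = (\<Union>k\<in>{..N}. {\<omega>\<in>space M. \<not> norm (euler_sol \<delta> \<omega> k) \<le> R})"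
    by blast
  also have "\<dots> \<in> events"
  proof (intro sets.finite_UN)
    fix k
    have [measurable]: "(\<lambda>\<omega>. euler_sol \<delta> \<omega> k) \<in> borel_measurable M" by (rule euler_sol_measurable[OF assms])
    show "{\<omega>\<in>space M. \<not> norm (euler_sol \<delta> \<omega> k) \<le> R} \<in> events" by measurable
  qed simp
  finally show ?thesis .
qed

text \<open>The scheme converges uniformly over the grid, almost surely. On
  \<open>grid_bounded T n\<close> it is therefore eventually within distance 1 of points of norm at
  most n, which gives the radius n + 1.\<close>

lemma grid_bounded_stay:
  assumes T: "T > 0"
  shows "(\<lambda>N. prob (grid_bounded T n \<inter> {\<omega>\<in>space M. \<not> (\<forall>k\<le>N. norm (euler_sol (T / real N) \<omega> k) \<le> real n + 1)})) \<longlonglongrightarrow> 0"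
proof -
  define A where "A N = {\<omega>\<in>space M. \<not> (\<forall>k\<le>N. norm (euler_sol (T / real N) \<omega> k) \<le> real n + 1)}" for N
  have A: "A N \<in> events" for N unfolding A_def using T by (intro stay_event) simp
  define H where "H N = grid_bounded T n \<inter> A N" for N
  have H [measurable]: "H N \<in> events" for N
    unfolding H_def by (intro sets.Int grid_bounded_events T A)
  have "(\<lambda>N. \<integral>\<omega>. indicator (H N) \<omega> \<partial>M) \<longlonglongrightarrow> (\<integral>\<omega>. (0::real) \<partial>M)"
  proof (rule integral_dominated_convergence[where w = "\<lambda>_. 1"])
    show "AE \<omega> in M. (\<lambda>N. indicator (H N) \<omega>) \<longlonglongrightarrow> (0::real)"
      using euler_sol_converges[OF T]
    proof eventually_elim
      case (elim \<omega>)
      then obtain N0 where N0: "\<And>N k. N \<ge> N0 \<Longrightarrow> k \<le> N \<Longrightarrow> norm (euler_sol (T / real N) \<omega> k - q (real k * (T / real N)) \<omega>) \<le> 1"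
        using zero_less_one by blast
      have "\<omega> \<notin> H N" if N: "N \<ge> N0" for N
      proof
        assume w: "\<omega> \<in> H N"
        have "norm (euler_sol (T / real N) \<omega> k) \<le> real n + 1" if k: "k \<le> N" for k
        proof -
          have "norm (q (real k * (T / real N)) \<omega>) \<le> real n"
            using w k unfolding H_def grid_bounded_def by blast
          then show ?thesis
            using N0[OF N k] norm_triangle_sub[of "euler_sol (T / real N) \<omega> k" "q (real k * (T / real N)) \<omega>"] by linarith
        qed
        then show False using w unfolding H_def A_def by blast
      qed
      then have "eventually (\<lambda>N. indicator (H N) \<omega> = (0::real)) sequentially"
        by (intro eventually_sequentiallyI[of N0]) simp
      then show ?case by (rule tendsto_eventually)
    qed
  qed auto
  then have "(\<lambda>N. prob (H N)) \<longlonglongrightarrow> 0" by (simp add: sets.Int_space_eq2[OF H])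
  then show ?thesis by (simp only: H_def A_def)
qed

end

context gibbs_langevin
begin

text \<open>Three limits in this order: N to infinity for a fixed ball and a fixed \<epsilon>, then
  the radius n to infinity, then \<epsilon> to 0. The constant of the log ratio estimate depends on
  the ball, so the first two cannot be exchanged.\<close>

lemma reversal_le:
  fixes f :: "'j \<Rightarrow> real^'b \<Rightarrow> real"
  assumes T: "T > 0" and J: "finite J" and t: "\<And>j. j \<in> J \<Longrightarrow> 0 \<le> t j \<and> t j \<le> T"
    and f: "\<And>j. j \<in> J \<Longrightarrow> continuous_on UNIV (f j)" "\<And>j z. 0 \<le> f j z \<and> f j z \<le> 1"
  shows "(\<integral>\<omega>. (\<Prod>j\<in>J. f j (q (T - t j) \<omega>)) \<partial>M) \<le> (\<integral>\<omega>. (\<Prod>j\<in>J. f j (q (t j) \<omega>)) \<partial>M)"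
proof -
  define k where "k j N = nat \<lfloor>t j * real N / T\<rfloor>" for j N
  define \<delta> where "\<delta> N = T / real N" for N
  have \<delta>0: "0 \<le> \<delta> N" for N using T by (simp add: \<delta>_def)
  have grid: "k j N \<le> N" "(\<lambda>N. real (k j N) * (T / real N)) \<longlonglongrightarrow> t j"
    "(\<lambda>N. real (N - k j N) * (T / real N)) \<longlonglongrightarrow> T - t j" if "j \<in> J" for j N
    unfolding k_def using t[OF that] by (intro grid_times[OF T]; simp)+
  have conv: "(\<lambda>N. \<integral>\<omega>. (\<Prod>j\<in>J. f j (euler_sol (\<delta> N) \<omega> (s j N))) \<partial>M) \<longlonglongrightarrow> (\<integral>\<omega>. (\<Prod>j\<in>J. f j (q (\<tau> j) \<omega>)) \<partial>M)"
    if s: "\<And>j N. j \<in> J \<Longrightarrow> s j N \<le> N" and lim: "\<And>j. j \<in> J \<Longrightarrow> (\<lambda>N. real (s j N) * (T / real N)) \<longlonglongrightarrow> \<tau> j"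
      and \<tau>: "\<And>j. j \<in> J \<Longrightarrow> \<tau> j \<ge> 0" for s \<tau>
  proof (rule integral_dominated_convergence[where w = "\<lambda>_. 1"])
    have fm: "f j \<in> borel_measurable borel" if "j \<in> J" for j
      using f(1)[OF that] by (rule borel_measurable_continuous_onI)
    show "(\<lambda>\<omega>. \<Prod>j\<in>J. f j (euler_sol (\<delta> N) \<omega> (s j N))) \<in> borel_measurable M" for N
      by (intro borel_measurable_prod measurable_compose[OF euler_sol_measurable[OF \<delta>0] fm])
    show "(\<lambda>\<omega>. \<Prod>j\<in>J. f j (q (\<tau> j) \<omega>)) \<in> borel_measurable M"
      by (intro borel_measurable_prod measurable_compose[OF q_measurable fm] \<tau>)
    have "AE \<omega> in M. \<forall>j\<in>J. (\<lambda>N. euler_sol (\<delta> N) \<omega> (s j N)) \<longlonglongrightarrow> q (\<tau> j) \<omega>"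
      unfolding AE_finite_all[OF J] \<delta>_def using euler_sol_tendsto[OF T s lim \<tau>] by blast
    then show "AE \<omega> in M. (\<lambda>N. \<Prod>j\<in>J. f j (euler_sol (\<delta> N) \<omega> (s j N))) \<longlonglongrightarrow> (\<Prod>j\<in>J. f j (q (\<tau> j) \<omega>))"
    proof eventually_elim
      case (elim \<omega>)
      show ?case
      proof (rule tendsto_prod)
        fix j assume j: "j \<in> J"
        then have "isCont (f j) (q (\<tau> j) \<omega>)"
          using f(1)[OF j] by (simp add: continuous_on_eq_continuous_at)
        moreover have "(\<lambda>N. euler_sol (\<delta> N) \<omega> (s j N)) \<longlonglongrightarrow> q (\<tau> j) \<omega>" using elim j by blast
        ultimately show "(\<lambda>N. f j (euler_sol (\<delta> N) \<omega> (s j N))) \<longlonglongrightarrow> f j (q (\<tau> j) \<omega>)"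
          by (rule isCont_tendsto_compose)
      qed
    qed
    have "\<bar>\<Prod>j\<in>J. f j (z j)\<bar> \<le> 1" for z
    proof -
      have "0 \<le> (\<Prod>j\<in>J. f j (z j))" "(\<Prod>j\<in>J. f j (z j)) \<le> 1"
        using f(2) by (auto intro!: prod_nonneg prod_le_1)
      then show ?thesis by simp
    qed
    then show "AE \<omega> in M. norm (\<Prod>j\<in>J. f j (euler_sol (\<delta> N) \<omega> (s j N))) \<le> 1" for N
      unfolding real_norm_def by (intro AE_I2)
  qed simp
  define a where "a = (\<integral>\<omega>. (\<Prod>j\<in>J. f j (q (T - t j) \<omega>)) \<partial>M)"
  define c where "c = (\<integral>\<omega>. (\<Prod>j\<in>J. f j (q (t j) \<omega>)) \<partial>M)"
  define aN where "aN N = (\<integral>\<omega>. (\<Prod>j\<in>J. f j (euler_sol (\<delta> N) \<omega> (N - k j N))) \<partial>M)" for N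
  define cN where "cN N = (\<integral>\<omega>. (\<Prod>j\<in>J. f j (euler_sol (\<delta> N) \<omega> (k j N))) \<partial>M)" for N
  have aN: "aN \<longlonglongrightarrow> a"
    unfolding aN_def[abs_def] a_def by (intro conv grid) (use t in auto)
  have cN: "cN \<longlonglongrightarrow> c"
    unfolding cN_def[abs_def] c_def by (intro conv grid) (use t in auto)
  have bound: "a \<le> exp \<epsilon> * c + (1 - prob (grid_bounded T n))" if \<epsilon>: "\<epsilon> > 0" for \<epsilon> n
  proof -
    obtain C where C: "C \<ge> 0" "\<And>N \<delta> \<epsilon>. 0 < \<delta> \<Longrightarrow> \<delta> \<le> 1 \<Longrightarrow> 0 < \<epsilon> \<Longrightarrow>
      prob {\<omega>\<in>space M. (\<forall>k\<le>N. norm (euler_sol \<delta> \<omega> k) \<le> real n + 1) \<and> \<epsilon> < \<bar>path_log_ratio U b \<sigma> \<delta> N (euler_sol \<delta> \<omega>)\<bar>} \<le>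
        C * (real N * \<delta> * sqrt \<delta>) / \<epsilon>"
      using path_log_ratio_small[of "real n + 1"] by blast
    define h where "h N = prob (grid_bounded T n \<inter> {\<omega>\<in>space M. \<not> (\<forall>k\<le>N. norm (euler_sol (T / real N) \<omega> k) \<le> real n + 1)})" for N
    have h: "h \<longlonglongrightarrow> 0" unfolding h_def by (rule grid_bounded_stay[OF T])
    \<comment> \<open>From here on the mesh T / N is at most 1, as the step estimates
      require.\<close>
    obtain N1 :: nat where N1: "real N1 \<ge> T" "N1 \<ge> 1"
      using real_arch_simple[of "max T 1"] by auto
    have ineq: "aN N \<le> exp \<epsilon> * cN N + (h N + (1 - prob (grid_bounded T n)) + C * (T * sqrt (T * (1 / real N))) / \<epsilon>)"
      if N: "N \<ge> N1" for N
    proof -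
      have N': "N \<ge> 1" "real N > 0" using N N1 by auto
      have d: "0 < \<delta> N" "\<delta> N \<le> 1" using N N' N1 T by (auto simp: \<delta>_def field_simps)
      let ?A = "{\<omega>\<in>space M. \<not> (\<forall>k\<le>N. norm (euler_sol (\<delta> N) \<omega> k) \<le> real n + 1)}"
      have "aN N \<le> exp \<epsilon> * cN N + (prob ?A +
        prob {\<omega>\<in>space M. (\<forall>k\<le>N. norm (euler_sol (\<delta> N) \<omega> k) \<le> real n + 1) \<and> \<epsilon> < \<bar>path_log_ratio U b \<sigma> (\<delta> N) N (euler_sol (\<delta> N) \<omega>)\<bar>})"
        unfolding aN_def cN_def
        by (intro euler_reversal_bound[OF d(1) N'(1) \<epsilon> J f] grid)
      also have "prob ?A \<le> h N + (1 - prob (grid_bounded T n))"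
      proof -
        have A: "?A \<in> events" by (rule stay_event[OF \<delta>0])
        from prob_le_Int_compl[OF this grid_bounded_events[OF T]]
        show ?thesis by (simp only: h_def \<delta>_def)
      qed
      also have "prob {\<omega>\<in>space M. (\<forall>k\<le>N. norm (euler_sol (\<delta> N) \<omega> k) \<le> real n + 1) \<and> \<epsilon> < \<bar>path_log_ratio U b \<sigma> (\<delta> N) N (euler_sol (\<delta> N) \<omega>)\<bar>}
        \<le> C * (real N * \<delta> N * sqrt (\<delta> N)) / \<epsilon>"
        by (rule C(2)[OF d \<epsilon>])
      also have "real N * \<delta> N * sqrt (\<delta> N) = T * sqrt (T * (1 / real N))"
        using N' by (simp add: \<delta>_def)
      finally show ?thesis by simp
    qed
    have "(\<lambda>N. exp \<epsilon> * cN N + (h N + (1 - prob (grid_bounded T n)) + C * (T * sqrt (T * (1 / real N))) / \<epsilon>)) \<longlonglongrightarrow>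
        exp \<epsilon> * c + (0 + (1 - prob (grid_bounded T n)) + C * (T * sqrt (T * 0)) / \<epsilon>)"
      using \<epsilon> by (intro tendsto_intros cN h lim_1_over_n) auto
    then have "a \<le> exp \<epsilon> * c + (0 + (1 - prob (grid_bounded T n)) + C * (T * sqrt (T * 0)) / \<epsilon>)"
      using ineq by (intro LIMSEQ_le[OF aN]) auto
    then show ?thesis by simp
  qed
  have "a \<le> exp \<epsilon> * c" if \<epsilon>: "\<epsilon> > 0" for \<epsilon>
  proof -
    have "(\<lambda>n. exp \<epsilon> * c + (1 - prob (grid_bounded T n))) \<longlonglongrightarrow> exp \<epsilon> * c + (1 - 1)"
      by (intro tendsto_intros grid_bounded_tendsto T)
    then have "a \<le> exp \<epsilon> * c + (1 - 1)"
      using bound[OF \<epsilon>] by (intro LIMSEQ_le_const) auto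
    then show ?thesis by simp
  qed
  \<comment> \<open>Now \<epsilon> tends to 0 along the sequence 1 / (n + 1).\<close>
  moreover have "(\<lambda>n. exp (inverse (real (Suc n))) * c) \<longlonglongrightarrow> exp 0 * c"
    by (intro tendsto_intros LIMSEQ_inverse_real_of_nat)
  ultimately have "a \<le> exp 0 * c"
    by (intro LIMSEQ_le_const) auto
  then show ?thesis by (simp add: a_def c_def)
qed

text \<open>The inequality for the times t and the inequality for the times T - t are converse to
  each other.\<close>

lemma reversal_prob_eq:
  fixes J :: "'j set"
  assumes T: "T > 0" and J: "finite J" and t: "\<And>j. j \<in> J \<Longrightarrow> 0 \<le> t j \<and> t j \<le> T"
    and S: "\<And>j. j \<in> J \<Longrightarrow> S j \<in> sets borel"
  shows "prob {\<omega>\<in>space M. \<forall>j\<in>J. q (T - t j) \<omega> \<in> S j} = prob {\<omega>\<in>space M. \<forall>j\<in>J. q (t j) \<omega> \<in> S j}"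
proof (rule prob_eq_of_continuous_test_functions[OF J])
  show "q (T - t j) \<in> borel_measurable M" "q (t j) \<in> borel_measurable M" if "j \<in> J" for j
    using t[OF that] by (auto intro: q_measurable)
  fix f :: "'j \<Rightarrow> real^'b \<Rightarrow> real"
  assume f: "\<And>j. j \<in> J \<Longrightarrow> continuous_on UNIV (f j)" "\<And>j z. 0 \<le> f j z \<and> f j z \<le> 1"
  have "(\<integral>\<omega>. (\<Prod>j\<in>J. f j (q (T - (T - t j)) \<omega>)) \<partial>M) \<le> (\<integral>\<omega>. (\<Prod>j\<in>J. f j (q (T - t j) \<omega>)) \<partial>M)"
    using t by (intro reversal_le[OF T J _ f, where t = "\<lambda>j. T - t j"]) auto
  moreover have "(\<integral>\<omega>. (\<Prod>j\<in>J. f j (q (T - t j) \<omega>)) \<partial>M) \<le> (\<integral>\<omega>. (\<Prod>j\<in>J. f j (q (t j) \<omega>)) \<partial>M)"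
    by (rule reversal_le[OF T J t f])
  ultimately show "(\<integral>\<omega>. (\<Prod>j\<in>J. f j (q (T - t j) \<omega>)) \<partial>M) = (\<integral>\<omega>. (\<Prod>j\<in>J. f j (q (t j) \<omega>)) \<partial>M)" by simp
qed (rule S)

text \<open>A time shift is the composition of two reversals: reversing on [0, T] and then on
  [0, T + \<tau>] sends t to t + \<tau>.\<close>

lemma reversible_q: "reversible M q"
  unfolding reversible_def
proof (intro conjI allI impI)
  show "stationary M q"
    unfolding stationary_def
  proof (intro allI impI)
    fix \<tau> :: real and n :: nat and t :: "nat \<Rightarrow> real" and S :: "nat \<Rightarrow> (real^'b) set"
    assume \<tau>: "0 \<le> \<tau>" and tS: "\<forall>j\<in>{1..n}. 0 \<le> t j \<and> S j \<in> sets borel"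
    \<comment> \<open>Any common bound of the times will do; the summand 1 makes it positive even if
      all of them are 0.\<close>
    define T where "T = 1 + (\<Sum>j\<in>{1..n}. t j)"
    have T: "T > 0" unfolding T_def using tS by (intro add_pos_nonneg sum_nonneg) auto
    have tT: "t j \<le> T" if "j \<in> {1..n}" for j
      using member_le_sum[of j "{1..n}" t] tS that by (simp add: T_def)
    have "prob {\<omega>\<in>space M. \<forall>j\<in>{1..n}. q (T - t j) \<omega> \<in> S j} = prob {\<omega>\<in>space M. \<forall>j\<in>{1..n}. q (t j) \<omega> \<in> S j}"
      using tS tT by (intro reversal_prob_eq T) auto
    moreover have "prob {\<omega>\<in>space M. \<forall>j\<in>{1..n}. q ((T + \<tau>) - (T - t j)) \<omega> \<in> S j} =
        prob {\<omega>\<in>space M. \<forall>j\<in>{1..n}. q (T - t j) \<omega> \<in> S j}"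
      using tS tT T \<tau> by (intro reversal_prob_eq) (auto simp: add_increasing2)
    moreover have "(T + \<tau>) - (T - t j) = t j + \<tau>" for j by simp
    ultimately show "prob {\<omega>\<in>space M. \<forall>j\<in>{1..n}. q (t j) \<omega> \<in> S j} =
        prob {\<omega>\<in>space M. \<forall>j\<in>{1..n}. q (t j + \<tau>) \<omega> \<in> S j}" by simp
  qed
  fix T :: real and n :: nat and t :: "nat \<Rightarrow> real" and S :: "nat \<Rightarrow> (real^'b) set"
  assume "0 < T" "\<forall>j\<in>{1..n}. 0 \<le> t j \<and> t j \<le> T \<and> S j \<in> sets borel"
  then show "prob {\<omega>\<in>space M. \<forall>j\<in>{1..n}. q (T - t j) \<omega> \<in> S j} = prob {\<omega>\<in>space M. \<forall>j\<in>{1..n}. q (t j) \<omega> \<in> S j}"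
    by (intro reversal_prob_eq) auto
qed

text \<open>Stationarity carries the Gibbs density to all times, so the flux is that of one smooth
  density independent of t.\<close>

lemma zero_flux_q: "zero_flux M b \<sigma> q"
proof -
  define \<rho> where "\<rho> x = Z * exp (- U x)" for x
  have \<rho>0: "0 \<le> \<rho> x" for x using Z_nonneg by (simp add: \<rho>_def)
  have dens: "has_density M (q t) \<rho>" if t: "t \<ge> 0" for t
    unfolding has_density_def distributed_def
  proof (intro conjI allI \<rho>0)
    show qm: "q t \<in> M \<rightarrow>\<^sub>M lborel" using q_measurable[OF t] by simp
    have [measurable]: "\<rho> \<in> borel_measurable borel" unfolding \<rho>_def[abs_def] by measurable
    show "(\<lambda>x. ennreal (\<rho> x)) \<in> borel_measurable lborel" by measurable
    have "distr M lborel (q t) = distr M lborel (q 0)"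
    proof (rule measure_eqI)
      fix A assume "A \<in> sets (distr M lborel (q t))"
      then have A: "A \<in> sets borel" by simp
      have "stationary M q" using reversible_q unfolding reversible_def by (rule conjunct1)
      from this[unfolded stationary_def, rule_format, of t 1 "\<lambda>_. 0" "\<lambda>_. A"]
      have "prob {\<omega>\<in>space M. q 0 \<omega> \<in> A} = prob {\<omega>\<in>space M. q t \<omega> \<in> A}"
        using t A by simp
      moreover have "{\<omega>\<in>space M. q s \<omega> \<in> A} = q s -` A \<inter> space M" for s by auto
      ultimately have "prob (q 0 -` A \<inter> space M) = prob (q t -` A \<inter> space M)" by simp
      then show "emeasure (distr M lborel (q t)) A = emeasure (distr M lborel (q 0)) A"
        using A qm by (simp add: emeasure_distr emeasure_eq_measure)
    qed simp
    also have "\<dots> = density lborel (\<lambda>x. ennreal (\<rho>0 x))"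
      using density_0 distributed_distr_eq_density unfolding has_density_def by blast
    also have "\<dots> = density lborel (\<lambda>x. ennreal (\<rho> x))"
    proof (rule density_cong)
      have "\<rho>0 \<in> borel_measurable borel" by (rule has_density_facts(1)[OF prob_space_axioms density_0])
      then show "(\<lambda>x. ennreal (\<rho>0 x)) \<in> borel_measurable lborel" by simp
      show "AE x in lborel. ennreal (\<rho>0 x) = ennreal (\<rho> x)"
        using gibbs by eventually_elim (simp add: \<rho>_def)
    qed measurable
    finally show "distr M lborel (q t) = density lborel (\<lambda>x. ennreal (\<rho> x))" .
  qed
  have D: "((\<lambda>u. Z * exp (- u)) has_real_derivative - (Z * exp (- U x))) (at (U x))" for x
    by (auto intro!: derivative_eq_intros)
  have "C_inf \<rho>" unfolding \<rho>_def[abs_def] by (intro C_inf_intros C_inf_U)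
  then have diff: "\<rho> differentiable (at x)" for x by (rule C_inf_differentiable)
  have "partial i \<rho> x = \<rho> x * log_gradient b \<sigma> x $ i" for i x
    using partial_compose[OF C_inf_differentiable[OF C_inf_U] D] by (simp add: \<rho>_def[abs_def] partial_U)
  then have flux: "prob_flux b \<sigma> \<rho> x = 0" for x
    by (simp add: prob_flux_zero_iff[OF invertible_\<sigma> diff])
  show ?thesis
    unfolding zero_flux_def
    by (rule exI[of _ "\<lambda>x t. \<rho> x"]) (use dens diff flux in auto)
qed

end

lemma (in langevin) potential_imp_reversible_zero_flux:
  assumes "potential_condition b \<sigma> \<rho>0"
  shows "reversible M q" "zero_flux M b \<sigma> q"
proof -
  obtain U where U: "C_inf U" "\<And>i x. partial i U x = - log_gradient b \<sigma> x $ i"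
    "AE x in lborel. \<rho>0 x = 1 / (\<integral>y. exp (- U y) \<partial>lborel) * exp (- U x)"
    using potential_conditionE[OF assms C_inf_b] by blast
  interpret gibbs_langevin M B q b \<sigma> \<rho>0 U "1 / (\<integral>y. exp (- U y) \<partial>lborel)"
    by unfold_locales (use U in \<open>auto intro!: integral_nonneg_AE\<close>)
  show "reversible M q" by (rule reversible_q)
  show "zero_flux M b \<sigma> q" by (rule zero_flux_q)
qed

section \<open>Short times\<close>

context brownian_motion
begin

text \<open>A dyadic time of level m + 1 either already belongs to level m or is one increment of
  level m + 1 away from such a time; hence each level contributes at most one increment.\<close>

lemma dyadic_chaining:
  fixes w :: "real \<Rightarrow> real^'d"
  assumes "\<And>m k. k < 2 ^ m \<Longrightarrow> norm (w (real (Suc k) * (t / 2 ^ m)) - w (real k * (t / 2 ^ m))) \<le> c * \<theta> ^ m"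
    and "c \<ge> 0" "\<theta> \<ge> 0" and "k \<le> 2 ^ m"
  shows "norm (w (real k * (t / 2 ^ m)) - w 0) \<le> (\<Sum>j\<le>m. c * \<theta> ^ j)"
  using assms(4)
proof (induction m arbitrary: k)
  case 0
  then consider "k = 0" | "k = 1" by fastforce
  then show ?case
  proof cases
    case 2
    then show ?thesis using assms(1)[of 0 0] by simp
  qed (use assms in simp)
next
  case (Suc m)
  have half: "real (2 * l) * (t / 2 ^ Suc m) = real l * (t / 2 ^ m)" for l by simp
  show ?case
  proof (cases "even k")
    case True
    then obtain l where l: "k = 2 * l" by (elim evenE)
    have "norm (w (real k * (t / 2 ^ Suc m)) - w 0) \<le> (\<Sum>j\<le>m. c * \<theta> ^ j)"
      unfolding l half using Suc.prems l by (intro Suc.IH) simp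
    also have "\<dots> \<le> (\<Sum>j\<le>Suc m. c * \<theta> ^ j)" using assms by simp
    finally show ?thesis .
  next
    case False
    then obtain l where l: "k = Suc (2 * l)" by (elim oddE) auto
    have l2: "2 * l < 2 ^ Suc m" "l \<le> 2 ^ m" using Suc.prems l by auto
    have "norm (w (real k * (t / 2 ^ Suc m)) - w 0) \<le>
        norm (w (real (Suc (2 * l)) * (t / 2 ^ Suc m)) - w (real (2 * l) * (t / 2 ^ Suc m))) + norm (w (real (2 * l) * (t / 2 ^ Suc m)) - w 0)"
      unfolding l using norm_triangle_ineq[of "w (real (Suc (2 * l)) * (t / 2 ^ Suc m)) - w (real (2 * l) * (t / 2 ^ Suc m))"
          "w (real (2 * l) * (t / 2 ^ Suc m)) - w 0"] by simp
    also have "\<dots> \<le> c * \<theta> ^ Suc m + (\<Sum>j\<le>m. c * \<theta> ^ j)"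
      using assms(1)[OF l2(1)] Suc.IH[OF l2(2)] unfolding half by (intro add_mono) (simp_all only:)
    also have "\<dots> = (\<Sum>j\<le>Suc m. c * \<theta> ^ j)" by simp
    finally show ?thesis .
  qed
qed

text \<open>Markov's inequality for the fourth power. A second moment would not be enough for the
  union bound over the increments of a level, nor for the order t^2 of the exceptional
  probability.\<close>

lemma increment_tail:
  assumes st: "0 \<le> s" "s < t" and a: "a > 0"
  shows "prob {\<omega>\<in>space M. a < norm (B t \<omega> - B s \<omega>)} \<le> 3 * (real CARD('d))\<^sup>2 * (t - s)\<^sup>2 / a ^ 4"
proof -
  note m = increment_norm_fourth[OF st]
  have [measurable]: "B t \<in> borel_measurable M" "B s \<in> borel_measurable M"
    using st by (auto intro: measurable_B)
  have A: "{\<omega>\<in>space M. a < norm (B t \<omega> - B s \<omega>)} \<in> events" by measurable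
  let ?I = "\<lambda>\<omega>. a ^ 4 * indicator {\<omega>\<in>space M. a < norm (B t \<omega> - B s \<omega>)} \<omega> :: real"
  have i: "integrable M ?I"
    using A by (intro integrable_mult_right integrable_real_indicator) (auto simp: emeasure_eq_measure)
  have "a ^ 4 * prob {\<omega>\<in>space M. a < norm (B t \<omega> - B s \<omega>)} = (\<integral>\<omega>. ?I \<omega> \<partial>M)"
    using A by simp
  also have "\<dots> \<le> (\<integral>\<omega>. norm (B t \<omega> - B s \<omega>) ^ 4 \<partial>M)"
  proof (rule integral_mono[OF i m(1)])
    show "?I \<omega> \<le> norm (B t \<omega> - B s \<omega>) ^ 4" for \<omega>
      using a by (auto simp: indicator_def intro!: power_mono)
  qed
  also note m(2)
  finally show ?thesis using a by (simp add: pos_le_divide_eq mult.commute)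
qed

text \<open>The ratio 9/10 serves two purposes: the thresholds are summable, with sum 10 c, and the
  union bound over the 2^m increments of level m decays like the m-th power of 1 / (2 (9/10)^4),
  which is less than 1.\<close>

definition chain_event :: "real \<Rightarrow> real \<Rightarrow> 'w set" where
  "chain_event t c = {\<omega>\<in>space M. \<forall>m k. k < 2 ^ m \<longrightarrow>
     norm (B (real (Suc k) * (t / 2 ^ m)) \<omega> - B (real k * (t / 2 ^ m)) \<omega>) \<le> c * (9 / 10) ^ m}"

text \<open>Level m has 2^m increments, each exceeding its threshold with probability of order (t /
  2^m)^2. The factor t^2 is common to all levels, and the remaining series is geometric.\<close>

lemma chain_event_prob:
  assumes c: "c > 0"
  shows "\<exists>C\<ge>0. \<forall>t>0. chain_event t c \<in> events \<and> 1 - prob (chain_event t c) \<le> C * t\<^sup>2"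
proof -
  let ?d = "3 * (real CARD('d))\<^sup>2"
  define r where "r = 1 / (2 * (9 / 10 :: real) ^ 4)"
  have r: "0 < r" "r < 1" by (auto simp: r_def power4_eq_xxxx)
  define C where "C = ?d / c ^ 4 * (1 / (1 - r))"
  have C: "C \<ge> 0" using r c by (simp add: C_def)
  have "chain_event t c \<in> events \<and> 1 - prob (chain_event t c) \<le> C * t\<^sup>2" if t: "t > 0" for t
  proof -
    define E where "E m k = {\<omega>\<in>space M. c * (9 / 10) ^ m < norm (B (real (Suc k) * (t / 2 ^ m)) \<omega> - B (real k * (t / 2 ^ m)) \<omega>)}" for m k
    have [measurable]: "B (real k * (t / 2 ^ m)) \<in> borel_measurable M" for k m
      using t by (intro measurable_B) simp
    have E: "E m k \<in> events" for m k unfolding E_def by measurable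
    have Em: "(\<Union>k\<in>{..<2 ^ m}. E m k) \<in> events" for m using E by (intro sets.finite_UN) auto
    have U: "(\<Union>m. \<Union>k\<in>{..<2 ^ m}. E m k) \<in> events" using Em by (intro sets.countable_UN) auto
    define Q where "Q m k \<omega> \<longleftrightarrow> norm (B (real (Suc k) * (t / 2 ^ m)) \<omega> - B (real k * (t / 2 ^ m)) \<omega>) \<le> c * (9 / 10) ^ m" for m k \<omega>
    have chQ: "chain_event t c = {\<omega>\<in>space M. \<forall>m k. k < 2 ^ m \<longrightarrow> Q m k \<omega>}"
      unfolding chain_event_def Q_def ..
    have EQ: "E m k = {\<omega>\<in>space M. \<not> Q m k \<omega>}" for m k
      unfolding E_def Q_def not_le ..
    have compl: "space M - chain_event t c = (\<Union>m. \<Union>k\<in>{..<2 ^ m}. E m k)"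
      unfolding chQ EQ by auto
    have "chain_event t c = space M - (\<Union>m. \<Union>k\<in>{..<2 ^ m}. E m k)"
      unfolding chQ EQ by auto
    then have ev: "chain_event t c \<in> events" using sets.compl_sets[OF U] by (simp only:)
    have pm: "prob (\<Union>k\<in>{..<2 ^ m}. E m k) \<le> ?d / c ^ 4 * t\<^sup>2 * r ^ m" for m
    proof -
      have "prob (\<Union>k\<in>{..<2 ^ m}. E m k) \<le> (\<Sum>k<2 ^ m. prob (E m k))"
        using E by (intro finite_measure_subadditive_finite) auto
      also have "\<dots> \<le> (\<Sum>k<(2 ^ m :: nat). ?d * (t / 2 ^ m)\<^sup>2 / (c * (9 / 10) ^ m) ^ 4)"
      proof (rule sum_mono)
        fix k
        have st: "0 \<le> real k * (t / 2 ^ m)" "real k * (t / 2 ^ m) < real (Suc k) * (t / 2 ^ m)"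
          using t by (auto simp: divide_strict_right_mono)
        have "real (Suc k) * z - real k * z = z" for z :: real by (simp add: algebra_simps)
        then have "real (Suc k) * (t / 2 ^ m) - real k * (t / 2 ^ m) = t / 2 ^ m" .
        then show "prob (E m k) \<le> ?d * (t / 2 ^ m)\<^sup>2 / (c * (9 / 10) ^ m) ^ 4"
          using increment_tail[OF st, of "c * (9 / 10) ^ m"] c unfolding E_def by simp
      qed
      also have "\<dots> = ?d / c ^ 4 * t\<^sup>2 * r ^ m"
      proof -
        have "(2::real) ^ m * (1 / 2 ^ m)\<^sup>2 = (1 / 2) ^ m" by (simp add: power2_eq_square power_divide)
        moreover have "((9 / 10 :: real) ^ m) ^ 4 = ((9 / 10) ^ 4) ^ m" by (simp only: power_mult[symmetric] mult.commute)
        moreover have "(1 / 2) ^ m / ((9 / 10 :: real) ^ 4) ^ m = r ^ m"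
          unfolding r_def power_divide[symmetric] by simp
        ultimately have rm: "2 ^ m * (1 / 2 ^ m)\<^sup>2 / ((9 / 10 :: real) ^ m) ^ 4 = r ^ m" by (simp only:)
        have alg: "u * (D * (t / v)\<^sup>2 / (c * x) ^ 4) = D / c ^ 4 * t\<^sup>2 * (u * (1 / v)\<^sup>2 / x ^ 4)" for u v D x :: real
          by (simp add: power_mult_distrib power_divide mult_ac)
        show ?thesis unfolding rm[symmetric] alg[symmetric] by simp
      qed
      finally show ?thesis .
    qed
    have sm: "summable (\<lambda>m. ?d / c ^ 4 * t\<^sup>2 * r ^ m)"
      using r by (intro summable_mult summable_geometric) auto
    have s2: "summable (\<lambda>m. prob (\<Union>k\<in>{..<2 ^ m}. E m k))"
      by (rule summable_comparison_test_ev[OF _ sm]) (use pm in auto)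
    have "1 - prob (chain_event t c) = prob (space M - chain_event t c)"
      using prob_compl[OF ev] by simp
    also have "\<dots> \<le> (\<Sum>m. prob (\<Union>k\<in>{..<2 ^ m}. E m k))"
      unfolding compl using Em s2 by (intro finite_measure_subadditive_countably) auto
    also have "\<dots> \<le> (\<Sum>m. ?d / c ^ 4 * t\<^sup>2 * r ^ m)"
      by (rule suminf_le[OF pm s2 sm])
    also have "\<dots> = ?d / c ^ 4 * t\<^sup>2 * (1 / (1 - r))"
      using r by (subst suminf_mult) (auto simp: suminf_geometric summable_geometric)
    also have "\<dots> = C * t\<^sup>2" by (simp add: C_def)
    finally show ?thesis using ev by blast
  qed
  with C show ?thesis by blast
qed

text \<open>Chaining controls the dyadic fractions of t, and continuity of the path extends the
  bound to all times. The factor 10 is the sum of the geometric series with ratio 9/10.\<close>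

lemma chain_event_bound:
  assumes t: "t > 0" and c: "c > 0" and w: "\<omega> \<in> chain_event t c" and cont: "continuous_on {0..} (\<lambda>s. B s \<omega>)"
    and s: "0 \<le> s" "s \<le> t"
  shows "norm (B s \<omega> - B 0 \<omega>) \<le> 10 * c"
proof -
  \<comment> \<open>Dyadic approximation of s from below.\<close>
  define k where "k m = nat \<lfloor>s * real (2 ^ m) / t\<rfloor>" for m :: nat
  have k: "k m \<le> 2 ^ m" for m
  proof -
    have "s * 2 ^ m / t \<le> 2 ^ m" using t s by (simp add: field_simps mult_right_mono)
    then show ?thesis unfolding k_def by (simp add: nat_le_iff floor_le_iff)
  qed
  have dy: "norm (B (real (k m) * (t / 2 ^ m)) \<omega> - B 0 \<omega>) \<le> 10 * c" for m
  proof -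
    have "norm (B (real (k m) * (t / 2 ^ m)) \<omega> - B 0 \<omega>) \<le> (\<Sum>j\<le>m. c * (9 / 10) ^ j)"
      by (rule dyadic_chaining[where w = "\<lambda>s. B s \<omega>"]) (use w c k in \<open>auto simp: chain_event_def\<close>)
    also have "\<dots> = c * (\<Sum>j\<le>m. (9 / 10) ^ j)" by (simp add: sum_distrib_left)
    also have "\<dots> \<le> c * 10"
    proof (rule mult_left_mono)
      have "(\<Sum>j\<le>m. (9 / 10 :: real) ^ j) = (1 - (9 / 10) ^ Suc m) / (1 - 9 / 10)"
        by (subst sum_gp0) simp
      also have "\<dots> \<le> 10" by simp
      finally show "(\<Sum>j\<le>m. (9 / 10 :: real) ^ j) \<le> 10" .
    qed (use c in simp)
    finally show ?thesis by simp
  qed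
  have lim: "(\<lambda>m. real (k m) * (t / 2 ^ m)) \<longlonglongrightarrow> s"
  proof (rule tendsto_sandwich)
    have "(\<lambda>m. s - t * (1 / 2) ^ m) \<longlonglongrightarrow> s - t * 0"
      by (intro tendsto_intros LIMSEQ_power_zero) simp
    then show "(\<lambda>m. s - t * (1 / 2) ^ m) \<longlonglongrightarrow> s" by simp
    have b: "s * 2 ^ m / t - 1 \<le> real (k m)" "real (k m) \<le> s * 2 ^ m / t" for m
      unfolding k_def using t s by (simp_all add: of_nat_floor)
    show "eventually (\<lambda>m. s - t * (1 / 2) ^ m \<le> real (k m) * (t / 2 ^ m)) sequentially"
    proof (rule always_eventually, rule allI)
      fix m
      have "(s * 2 ^ m / t - 1) * (t / 2 ^ m) \<le> real (k m) * (t / 2 ^ m)"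
        using b t by (intro mult_right_mono) auto
      moreover have "(s * 2 ^ m / t - 1) * (t / 2 ^ m) = s - t * (1 / 2) ^ m"
        using t by (simp add: field_simps power_divide)
      ultimately show "s - t * (1 / 2) ^ m \<le> real (k m) * (t / 2 ^ m)" by (simp only:)
    qed
    show "eventually (\<lambda>m. real (k m) * (t / 2 ^ m) \<le> s) sequentially"
    proof (rule always_eventually, rule allI)
      fix m
      have "real (k m) * (t / 2 ^ m) \<le> (s * 2 ^ m / t) * (t / 2 ^ m)"
        using b t by (intro mult_right_mono) auto
      moreover have "(s * 2 ^ m / t) * (t / 2 ^ m) = s" using t by simp
      ultimately show "real (k m) * (t / 2 ^ m) \<le> s" by (simp only:)
    qed
  qed simp
  have "(\<lambda>m. B (real (k m) * (t / 2 ^ m)) \<omega>) \<longlonglongrightarrow> B s \<omega>"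
    by (rule continuous_on_tendsto_compose[OF cont lim]) (use s t in auto)
  then have "(\<lambda>m. norm (B (real (k m) * (t / 2 ^ m)) \<omega> - B 0 \<omega>)) \<longlonglongrightarrow> norm (B s \<omega> - B 0 \<omega>)"
    by (intro tendsto_intros)
  then show ?thesis by (rule LIMSEQ_le_const2) (use dy in auto)
qed

end

section \<open>Confinement of paths over short times\<close>

text \<open>The infimum of the closed set where f is at least 1; the intermediate value theorem
  excludes a jump beyond 1 there.\<close>

lemma first_crossing:
  fixes f :: "real \<Rightarrow> real"
  assumes "continuous_on {u..s} f" "u \<le> s" "f u < 1" "f s \<ge> 1"
  shows "\<exists>x. u \<le> x \<and> x \<le> s \<and> f x = 1 \<and> (\<forall>r\<in>{u..x}. f r \<le> 1)"
proof -
  define D where "D = {r\<in>{u..s}. f r \<ge> 1}"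
  have cD: "closed D"
    unfolding D_def by (rule continuous_closed_preimage[OF assms(1) closed_atLeastAtMost closed_atLeast, of 1, unfolded vimage_def Int_def atLeast_iff mem_Collect_eq])
  have D: "s \<in> D" "bdd_below D" using assms by (auto simp: D_def bdd_below_def)
  define x where "x = Inf D"
  have xD: "x \<in> D" unfolding x_def using cD D by (intro closed_contains_Inf) auto
  have min: "x \<le> r" if "r \<in> D" for r unfolding x_def using D that by (intro cInf_lower) auto
  have x: "u \<le> x" "x \<le> s" "f x \<ge> 1" using xD by (auto simp: D_def)
  have "continuous_on {u..x} f" by (rule continuous_on_subset[OF assms(1)]) (use x in auto)
  then obtain y where y: "u \<le> y" "y \<le> x" "f y = 1"
    using IVT'[of f u 1 x] assms(3) x by auto
  then have "y \<in> D" using x by (auto simp: D_def)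
  with min y have "y = x" by force
  then have "f x = 1" using y by simp
  moreover have "f r \<le> 1" if "r \<in> {u..x}" for r
  proof (rule ccontr)
    assume "\<not> f r \<le> 1"
    then have "r \<in> D" using that x by (auto simp: D_def)
    with min that have "r = x" by force
    then show False using \<open>\<not> f r \<le> 1\<close> \<open>f x = 1\<close> by simp
  qed
  ultimately show ?thesis using x by blast
qed

text \<open>While the path is within distance 1 of p(u), it lies in the ball of radius R + 2, where
  the drift is bounded by K; its displacement is then at most K t + D < 1, so distance 1 is never
  reached. The reference time u is arbitrary, because the estimate is also used backwards from the
  final time.\<close>

lemma short_time_confinement:
  fixes p :: "real \<Rightarrow> real^'d" and b :: "real^'d \<Rightarrow> real^'d"
  assumes p: "continuous_on {0..t} p" and b: "continuous_on UNIV b"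
    and inc: "\<And>r s. 0 \<le> r \<Longrightarrow> r \<le> s \<Longrightarrow> s \<le> t \<Longrightarrow> norm (p s - p r) \<le> norm (integral {r..s} (\<lambda>u. b (p u))) + D"
    and K: "\<And>x. norm x \<le> R + 2 \<Longrightarrow> norm (b x) \<le> K" "K \<ge> 0"
    and small: "K * t + D < 1" and u: "u \<in> {0..t}" "norm (p u) \<le> R + 1" and s: "s \<in> {0..t}"
  shows "norm (p s - p u) \<le> K * t + D"
proof -
  have cont: "continuous_on {x..y} (\<lambda>u. b (p u))" if "0 \<le> x" "y \<le> t" for x y
    using that by (intro continuous_on_compose2[OF b] continuous_on_subset[OF p]) auto
  have step: "norm (p y - p x) \<le> K * t + D"
    if xy: "0 \<le> x" "x \<le> y" "y \<le> t" and bd: "\<And>r. r \<in> {x..y} \<Longrightarrow> norm (p r - p u) \<le> 1" for x y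
  proof -
    have "norm (integral {x..y} (\<lambda>u. b (p u))) \<le> K * (y - x)"
    proof (rule integral_bound[OF xy(2) cont[OF xy(1,3)]])
      fix r assume "r \<in> {x..y}"
      then have "norm (p r - p u) \<le> 1" by (rule bd)
      then have "norm (p r) \<le> R + 2" using u(2) norm_triangle_sub[of "p r" "p u"] by linarith
      then show "norm (b (p r)) \<le> K" by (rule K)
    qed
    also have "\<dots> \<le> K * t" using xy K(2) by (intro mult_left_mono) auto
    finally show ?thesis using inc[OF xy] by linarith
  qed
  have no_cross: "norm (p s - p u) < 1" if s: "s \<in> {0..t}" for s
  proof (rule ccontr)
    assume "\<not> norm (p s - p u) < 1"
    then have ge: "norm (p s - p u) \<ge> 1" by simp
    show False
    proof (cases "u \<le> s")
      case True
      have "continuous_on {u..s} (\<lambda>r. norm (p r - p u))"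
        using u s by (intro continuous_intros continuous_on_subset[OF p]) auto
      from first_crossing[OF this True _ ge] obtain x where
        x: "u \<le> x" "x \<le> s" "norm (p x - p u) = 1" "\<And>r. r \<in> {u..x} \<Longrightarrow> norm (p r - p u) \<le> 1" by auto
      have "norm (p x - p u) \<le> K * t + D" using x u s by (intro step) auto
      then show False using x small by simp
    next
      case False
      \<comment> \<open>Times before u are handled by running the path backwards from u.\<close>
      have "continuous_on {0..u - s} (\<lambda>r. norm (p (u - r) - p u))"
        using u s by (intro continuous_intros continuous_on_compose2[OF p]) auto
      from first_crossing[OF this] obtain x where
        x: "0 \<le> x" "x \<le> u - s" "norm (p (u - x) - p u) = 1" "\<And>r. r \<in> {0..x} \<Longrightarrow> norm (p (u - r) - p u) \<le> 1"
        using False ge by auto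
      have bd: "norm (p r - p u) \<le> 1" if "r \<in> {u - x..u}" for r
        using x(4)[of "u - r"] that by simp
      have "norm (p u - p (u - x)) \<le> K * t + D" using x u s bd by (intro step) auto
      then show False using x small by (simp add: norm_minus_commute)
    qed
  qed
  show ?thesis
  proof (cases "u \<le> s")
    case True
    then show ?thesis using u s by (intro step less_imp_le[OF no_cross]) auto
  next
    case False
    then have "norm (p u - p s) \<le> K * t + D" using u s by (intro step less_imp_le[OF no_cross]) auto
    then show ?thesis by (simp add: norm_minus_commute)
  qed
qed

section \<open>Independence of the noise and two-time reversibility\<close>

context langevin
begin

text \<open>The sigma-algebras generated by the two functions lie in those of the initial value and
  of the noise process, and independence passes to smaller sigma-algebras.\<close>

lemma indep_start_increment:
  assumes t: "t > 0" and g: "g \<in> borel_measurable borel" and h: "h \<in> borel_measurable borel"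
  shows "indep_var borel (\<lambda>\<omega>. g (q 0 \<omega>) :: real) borel (\<lambda>\<omega>. h (B t \<omega> - B 0 \<omega>))"
proof -
  have ind: "indep_set (sets (vimage_algebra (space M) (q 0) borel)) (sets (process_algebra M B))"
    using solution by (simp add: langevin_solution_def)
  have sp: "space (process_algebra M B) = space M" by (simp add: process_algebra_def)
  have Bt: "B s \<in> borel_measurable (process_algebra M B)" if "s \<ge> 0" for s
  proof -
    have "(\<lambda>\<omega>. \<lambda>t\<in>{0..}. B t \<omega>) \<in> process_algebra M B \<rightarrow>\<^sub>M (\<Pi>\<^sub>M t\<in>{0::real..}. borel)"
      unfolding process_algebra_def by (rule measurable_vimage_algebra1) (auto simp: space_PiM)
    then have "(\<lambda>\<omega>. (\<lambda>t\<in>{0..}. B t \<omega>) s) \<in> process_algebra M B \<rightarrow>\<^sub>M borel"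
      by (rule measurable_compose) (use that in \<open>auto intro!: measurable_component_singleton\<close>)
    then show ?thesis using that by simp
  qed
  have hB: "(\<lambda>\<omega>. h (B t \<omega> - B 0 \<omega>)) \<in> borel_measurable (process_algebra M B)"
    using t by (intro measurable_compose[OF _ h] borel_measurable_diff Bt) auto
  have q0: "q 0 \<in> borel_measurable (vimage_algebra (space M) (q 0) borel)"
    by (rule measurable_vimage_algebra1) auto
  have gq: "(\<lambda>\<omega>. g (q 0 \<omega>)) \<in> borel_measurable (vimage_algebra (space M) (q 0) borel)"
    by (rule measurable_compose[OF q0 g])
  show ?thesis
    unfolding indep_var_eq
  proof (intro conjI)
    have [measurable]: "B t \<in> borel_measurable M" "B 0 \<in> borel_measurable M" using t by (auto intro: measurable_B)
    show "(\<lambda>\<omega>. g (q 0 \<omega>)) \<in> borel_measurable M" by (rule measurable_compose[OF q0_measurable g])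
    show "(\<lambda>\<omega>. h (B t \<omega> - B 0 \<omega>)) \<in> borel_measurable M" by (rule measurable_compose[OF _ h]) measurable
    show "indep_set (sigma_sets (space M) {(\<lambda>\<omega>. g (q 0 \<omega>)) -` A \<inter> space M |A. A \<in> sets borel})
       (sigma_sets (space M) {(\<lambda>\<omega>. h (B t \<omega> - B 0 \<omega>)) -` A \<inter> space M |A. A \<in> sets borel})"
      unfolding indep_set_def
    proof (rule indep_sets_mono_sets[OF ind[unfolded indep_set_def]])
      fix i :: bool
      have "{(\<lambda>\<omega>. g (q 0 \<omega>)) -` A \<inter> space M |A. A \<in> sets borel} \<subseteq> sets (vimage_algebra (space M) (q 0) borel)"
        using measurable_sets[OF gq] by auto
      from sets.sigma_sets_subset[OF this]
      have 1: "sigma_sets (space M) {(\<lambda>\<omega>. g (q 0 \<omega>)) -` A \<inter> space M |A. A \<in> sets borel} \<subseteq> sets (vimage_algebra (space M) (q 0) borel)"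
        by simp
      have "{(\<lambda>\<omega>. h (B t \<omega> - B 0 \<omega>)) -` A \<inter> space M |A. A \<in> sets borel} \<subseteq> sets (process_algebra M B)"
        using measurable_sets[OF hB] by (auto simp: sp)
      from sets.sigma_sets_subset[OF this]
      have 2: "sigma_sets (space M) {(\<lambda>\<omega>. h (B t \<omega> - B 0 \<omega>)) -` A \<inter> space M |A. A \<in> sets borel} \<subseteq> sets (process_algebra M B)"
        by (simp add: sp)
      show "case_bool (sigma_sets (space M) {(\<lambda>\<omega>. g (q 0 \<omega>)) -` A \<inter> space M |A. A \<in> sets borel})
          (sigma_sets (space M) {(\<lambda>\<omega>. h (B t \<omega> - B 0 \<omega>)) -` A \<inter> space M |A. A \<in> sets borel}) i
        \<subseteq> case_bool (sets (vimage_algebra (space M) (q 0) borel)) (sets (process_algebra M B)) i"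
        using 1 2 by (cases i) auto
    qed
  qed
qed

lemma expectation_start:
  assumes "g \<in> borel_measurable borel"
  shows "(\<integral>\<omega>. g (q 0 \<omega>) \<partial>M) = (\<integral>x. g x * \<rho>0 x \<partial>lborel)"
proof -
  have d: "distributed M lborel (q 0) (\<lambda>x. ennreal (\<rho>0 x))" "\<And>x. 0 \<le> \<rho>0 x"
    using density_0 by (auto simp: has_density_def)
  show ?thesis
    using distributed_integral[OF d(1), of g] d(2) assms by (simp add: mult.commute)
qed

lemma smooth_bump_start_integrable:
  assumes "smooth_bump g"
  shows "integrable M (\<lambda>\<omega>. g (q 0 \<omega>))"
proof -
  obtain K where K: "\<And>x. \<bar>g x\<bar> \<le> K"
    using assms C_inf_bounded_vanishing[of g] unfolding smooth_bump_def real_norm_def by blast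
  have "(\<lambda>\<omega>. g (q 0 \<omega>)) \<in> borel_measurable M"
    by (intro measurable_compose[OF q0_measurable] C_inf_borel_measurable smooth_bump_C_inf assms)
  then show ?thesis by (intro integrable_const_bound[where B = K]) (use K in auto)
qed

lemma start_increment_moments:
  assumes t: "t > 0" and g: "smooth_bump g"
  defines "\<beta> \<equiv> \<lambda>\<omega>. B t \<omega> - B 0 \<omega>"
  shows "integrable M (\<lambda>\<omega>. g (q 0 \<omega>) * \<beta> \<omega> $ k)" "(\<integral>\<omega>. g (q 0 \<omega>) * \<beta> \<omega> $ k \<partial>M) = 0"
    "integrable M (\<lambda>\<omega>. g (q 0 \<omega>) * (\<beta> \<omega> $ k * \<beta> \<omega> $ l))"
    "(\<integral>\<omega>. g (q 0 \<omega>) * (\<beta> \<omega> $ k * \<beta> \<omega> $ l) \<partial>M) = (if k = l then t * (\<integral>x. g x * \<rho>0 x \<partial>lborel) else 0)"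
proof -
  have gm: "g \<in> borel_measurable borel" by (intro C_inf_borel_measurable smooth_bump_C_inf g)
  have 1: "indep_var borel (\<lambda>\<omega>. g (q 0 \<omega>)) borel (\<lambda>\<omega>. \<beta> \<omega> $ k)"
    unfolding \<beta>_def by (rule indep_start_increment[OF t gm]) measurable
  have 2: "indep_var borel (\<lambda>\<omega>. g (q 0 \<omega>)) borel (\<lambda>\<omega>. \<beta> \<omega> $ k * \<beta> \<omega> $ l)"
    unfolding \<beta>_def by (rule indep_start_increment[OF t gm, where h = "\<lambda>z. z $ k * z $ l"]) measurable
  note gi = smooth_bump_start_integrable[OF g]
  have m1: "integrable M (\<lambda>\<omega>. \<beta> \<omega> $ k)" "(\<integral>\<omega>. \<beta> \<omega> $ k \<partial>M) = 0"
    using increment_mean[OF order_refl t, of k] unfolding \<beta>_def by (simp_all del: vector_minus_component)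
  have m2: "integrable M (\<lambda>\<omega>. \<beta> \<omega> $ k * \<beta> \<omega> $ l)" "(\<integral>\<omega>. \<beta> \<omega> $ k * \<beta> \<omega> $ l \<partial>M) = (if k = l then t else 0)"
    using increment_covariance[OF order_refl t, of k l] unfolding \<beta>_def by (simp_all del: vector_minus_component)
  show "integrable M (\<lambda>\<omega>. g (q 0 \<omega>) * \<beta> \<omega> $ k)"
    by (rule indep_var_integrable[OF 1 gi m1(1)])
  show "(\<integral>\<omega>. g (q 0 \<omega>) * \<beta> \<omega> $ k \<partial>M) = 0"
    using indep_var_lebesgue_integral[OF 1 gi m1(1)] m1(2) by simp
  show "integrable M (\<lambda>\<omega>. g (q 0 \<omega>) * (\<beta> \<omega> $ k * \<beta> \<omega> $ l))"
    by (rule indep_var_integrable[OF 2 gi m2(1)])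
  show "(\<integral>\<omega>. g (q 0 \<omega>) * (\<beta> \<omega> $ k * \<beta> \<omega> $ l) \<partial>M) = (if k = l then t * (\<integral>x. g x * \<rho>0 x \<partial>lborel) else 0)"
    using indep_var_lebesgue_integral[OF 2 gi m2(1)] m2(2) expectation_start[OF gm] by (simp add: mult.commute)
qed

text \<open>Reversal on [0, t] with the two times 0 and t exchanges the end points on rectangles,
  and rectangles generate the product sigma-algebra.\<close>

lemma reversible_swap:
  assumes rev: "reversible M q" and t: "t > 0"
  shows "distr M (borel \<Otimes>\<^sub>M borel) (\<lambda>\<omega>. (q 0 \<omega>, q t \<omega>)) = distr M (borel \<Otimes>\<^sub>M borel) (\<lambda>\<omega>. (q t \<omega>, q 0 \<omega>))"
    (is "?D = ?D'")
proof -
  have [measurable]: "q t \<in> borel_measurable M" using t by (intro q_measurable) simp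
  let ?E = "{A \<times> C | A C. A \<in> sets (borel :: (real^'d) measure) \<and> C \<in> sets (borel :: (real^'d) measure)}"
  show ?thesis
  proof (rule measure_eqI_generator_eq)
    show "Int_stable ?E" by (rule Int_stable_pair_measure_generator)
    show "?E \<subseteq> Pow UNIV" by simp
    show "sets ?D = sigma_sets UNIV ?E" "sets ?D' = sigma_sets UNIV ?E"
      by (simp_all add: sets_pair_measure)
    show "range (\<lambda>_::nat. UNIV :: ((real^'d) \<times> (real^'d)) set) \<subseteq> ?E"
    proof -
      have "(UNIV :: ((real^'d) \<times> (real^'d)) set) = UNIV \<times> UNIV \<and> (UNIV :: (real^'d) set) \<in> sets borel \<and> (UNIV :: (real^'d) set) \<in> sets borel" by simp
      then have "(UNIV :: ((real^'d) \<times> (real^'d)) set) \<in> ?E" by (intro CollectI exI)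
      then show ?thesis by (simp only: image_constant_conv UNIV_not_empty if_False insert_subset empty_subsetI simp_thms)
    qed
    show "(\<Union>i::nat. UNIV :: ((real^'d) \<times> (real^'d)) set) = UNIV" by simp
    have "prob_space ?D" by (rule prob_space_distr) measurable
    then show "emeasure ?D UNIV \<noteq> \<infinity>" for i :: nat
      by (metis prob_space_def finite_measure.emeasure_finite infinity_ennreal_def)
    fix X assume "X \<in> ?E"
    then obtain A C where X: "X = A \<times> C" and AC [measurable]: "A \<in> sets borel" "C \<in> sets borel" by auto
    \<comment> \<open>Times and sets are indexed from 1, as in the definition of
      reversibility.\<close>
    let ?t = "\<lambda>j::nat. if j = 1 then 0 else t" and ?S = "\<lambda>j::nat. if j = 1 then A else C"
    have J: "{1..2::nat} = {1, 2}" by auto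
    have "prob {\<omega>\<in>space M. \<forall>j\<in>{1..2::nat}. q (t - ?t j) \<omega> \<in> ?S j} = prob {\<omega>\<in>space M. \<forall>j\<in>{1..2::nat}. q (?t j) \<omega> \<in> ?S j}"
      using rev[unfolded reversible_def, THEN conjunct2, rule_format, of t 2 ?t ?S] t AC by simp
    then have eq: "prob {\<omega>\<in>space M. q t \<omega> \<in> A \<and> q 0 \<omega> \<in> C} = prob {\<omega>\<in>space M. q 0 \<omega> \<in> A \<and> q t \<omega> \<in> C}"
      unfolding J by simp
    have [measurable]: "A \<times> C \<in> sets (borel \<Otimes>\<^sub>M borel)" by (rule pair_measureI[OF AC])
    have "emeasure ?D (A \<times> C) = emeasure M {\<omega>\<in>space M. q 0 \<omega> \<in> A \<and> q t \<omega> \<in> C}"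
      by (subst emeasure_distr) (measurable, rule arg_cong[where f = "emeasure M"], blast)
    moreover have "emeasure ?D' (A \<times> C) = emeasure M {\<omega>\<in>space M. q t \<omega> \<in> A \<and> q 0 \<omega> \<in> C}"
      by (subst emeasure_distr) (measurable, rule arg_cong[where f = "emeasure M"], blast)
    ultimately show "emeasure ?D X = emeasure ?D' X"
      unfolding X emeasure_eq_measure eq by (simp only:)
  qed
qed

lemma reversible_expectation_antisym:
  fixes F :: "real^'d \<Rightarrow> real^'d \<Rightarrow> real"
  assumes rev: "reversible M q" and t: "t > 0"
    and F: "(\<lambda>(x, y). F x y) \<in> borel_measurable (borel \<Otimes>\<^sub>M borel)" and anti: "\<And>x y. F y x = - F x y"
  shows "(\<integral>\<omega>. F (q 0 \<omega>) (q t \<omega>) \<partial>M) = 0"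
proof -
  have [measurable]: "q t \<in> borel_measurable M" using t by (intro q_measurable) simp
  have "(\<integral>\<omega>. F (q 0 \<omega>) (q t \<omega>) \<partial>M) = (\<integral>z. (\<lambda>(x, y). F x y) z \<partial>distr M (borel \<Otimes>\<^sub>M borel) (\<lambda>\<omega>. (q 0 \<omega>, q t \<omega>)))"
    using F by (subst integral_distr) auto
  also have "\<dots> = (\<integral>\<omega>. F (q t \<omega>) (q 0 \<omega>) \<partial>M)"
    unfolding reversible_swap[OF rev t] using F by (subst integral_distr) auto
  also have "\<dots> = - (\<integral>\<omega>. F (q 0 \<omega>) (q t \<omega>) \<partial>M)"
    by (subst anti) simp
  finally show ?thesis by simp
qed

end

section \<open>Expansion of the antisymmetric test function\<close>

text \<open>The part of order at most two in z of (y $ i - x $ i) (\<phi>(x) + \<phi>(y)) at y = x +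
  z.\<close>

definition quad_form :: "(real^'d \<Rightarrow> real) \<Rightarrow> 'd \<Rightarrow> real^'d \<Rightarrow> real^'d \<Rightarrow> real" where
  "quad_form \<phi> i x z = 2 * \<phi> x * z $ i + z $ i * (\<Sum>j\<in>UNIV. z $ j * partial j \<phi> x)"

text \<open>Clipping makes the antisymmetric test function bounded, so that no moments of the process are
  needed.\<close>

definition clip :: "real \<Rightarrow> real \<Rightarrow> real" where
  "clip r u = max (- r) (min r u)"

lemma smooth_bump_bounds:
  fixes \<phi> :: "real^'d \<Rightarrow> real"
  assumes "smooth_bump \<phi>"
  shows "\<exists>P\<ge>0. \<exists>G\<ge>0. (\<forall>x. \<bar>\<phi> x\<bar> \<le> P) \<and> (\<forall>x z. \<bar>\<Sum>j\<in>UNIV. z $ j * partial j \<phi> x\<bar> \<le> G * norm z)"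
proof -
  have bd: "\<exists>P\<ge>0. \<forall>x. \<bar>f x\<bar> \<le> P" if "smooth_bump f" for f :: "real^'d \<Rightarrow> real"
    using that C_inf_bounded_vanishing[of f] unfolding smooth_bump_def real_norm_def by blast
  obtain P where P: "P \<ge> 0" "\<And>x. \<bar>\<phi> x\<bar> \<le> P" using bd[OF assms] by blast
  have "\<forall>j. \<exists>P\<ge>0. \<forall>x. \<bar>partial j \<phi> x\<bar> \<le> P" using bd[OF smooth_bump_partial[OF assms]] by blast
  then obtain H where H: "\<And>j. H j \<ge> 0" "\<And>j x. \<bar>partial j \<phi> x\<bar> \<le> H j" by metis
  have "\<bar>partial j \<phi> x\<bar> \<le> (\<Sum>j\<in>UNIV. H j)" for j x
    by (rule order_trans[OF H(2)], rule member_le_sum) (auto simp: H(1))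
  then have "\<bar>\<Sum>j\<in>UNIV. z $ j * partial j \<phi> x\<bar> \<le> (real CARD('d) * (\<Sum>j\<in>UNIV. H j)) * norm z" for x z
    by (intro abs_sum_component_le)
  moreover have "real CARD('d) * (\<Sum>j\<in>UNIV. H j) \<ge> 0" using H(1) by (simp add: sum_nonneg)
  ultimately show ?thesis using P by blast
qed

lemma quad_form_bound:
  fixes \<phi> :: "real^'d \<Rightarrow> real"
  assumes "smooth_bump \<phi>"
  shows "\<exists>c\<ge>0. \<forall>x z. \<bar>quad_form \<phi> i x z\<bar> \<le> c * (norm z + (norm z)\<^sup>2)"
proof -
  obtain P G where P: "P \<ge> 0" "\<And>x. \<bar>\<phi> x\<bar> \<le> P" and G: "G \<ge> 0" "\<And>x z. \<bar>\<Sum>j\<in>UNIV. z $ j * partial j \<phi> x\<bar> \<le> G * norm z"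
    using smooth_bump_bounds[OF assms] by blast
  have "\<bar>quad_form \<phi> i x z\<bar> \<le> (2 * P + G) * (norm z + (norm z)\<^sup>2)" for x z
  proof -
    have "\<bar>quad_form \<phi> i x z\<bar> \<le> \<bar>2 * \<phi> x * z $ i\<bar> + \<bar>z $ i * (\<Sum>j\<in>UNIV. z $ j * partial j \<phi> x)\<bar>"
      unfolding quad_form_def by (rule abs_triangle_ineq)
    also have "\<dots> \<le> 2 * P * norm z + norm z * (G * norm z)"
      unfolding abs_mult using P G component_le_norm_cart[of z i]
      by (intro add_mono mult_mono) auto
    also have "\<dots> \<le> (2 * P + G) * (norm z + (norm z)\<^sup>2)"
      using P(1) G(1) by (simp add: algebra_simps power2_eq_square)
    finally show ?thesis .
  qed
  moreover have "2 * P + G \<ge> 0" using P G by simp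
  ultimately show ?thesis by blast
qed

text \<open>z is meant to be an approximation of the displacement y - x, with frozen drift. The
  error has two sources: the discrepancy y - x - z, and the Taylor remainder of \<phi> multiplied by
  the displacement, which is cubic.\<close>

lemma quad_form_expansion:
  fixes \<phi> :: "real^'d \<Rightarrow> real"
  assumes "smooth_bump \<phi>"
  shows "\<exists>c\<ge>0. \<forall>x y z. \<bar>(y $ i - x $ i) * (\<phi> y + \<phi> x) - quad_form \<phi> i x z\<bar>
    \<le> c * (norm (y - x - z) * (1 + norm (y - x) + norm z) + norm (y - x) ^ 3)"
proof -
  obtain P G where P: "P \<ge> 0" "\<And>x. \<bar>\<phi> x\<bar> \<le> P" and G: "G \<ge> 0" "\<And>x z. \<bar>\<Sum>j\<in>UNIV. z $ j * partial j \<phi> x\<bar> \<le> G * norm z"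
    using smooth_bump_bounds[OF assms] by blast
  obtain R where "\<And>x. norm x > R \<Longrightarrow> \<phi> x = 0" using assms by (auto simp: smooth_bump_def)
  from C_inf_taylor_vanishing[OF smooth_bump_C_inf[OF assms] this]
  obtain L where L: "L \<ge> 0" "\<And>x h. \<bar>\<phi> (x + h) - \<phi> x - (\<Sum>i\<in>UNIV. h $ i * partial i \<phi> x)\<bar> \<le> L * (norm h)\<^sup>2"
    by blast
  define c where "c = 2 * P + G + L"
  have c: "c \<ge> 0" "2 * P \<le> c" "G \<le> c" "L \<le> c" using P G L by (simp_all add: c_def)
  have "\<bar>(y $ i - x $ i) * (\<phi> y + \<phi> x) - quad_form \<phi> i x z\<bar>
    \<le> c * (norm (y - x - z) * (1 + norm (y - x) + norm z) + norm (y - x) ^ 3)" for x y z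
  proof -
    define h where "h = y - x"
    define s where "s = (\<lambda>v. \<Sum>j\<in>UNIV. v $ j * partial j \<phi> x)"
    define r where "r = \<phi> y - \<phi> x - s h"
    have qf: "quad_form \<phi> i x z = 2 * \<phi> x * z $ i + z $ i * s z" by (simp add: quad_form_def s_def)
    have sd: "s (h - z) = s h - s z" by (simp add: s_def algebra_simps sum_subtractf)
    have r: "\<bar>r\<bar> \<le> L * (norm h)\<^sup>2" using L(2)[of x h] by (simp add: r_def s_def h_def)
    have s: "\<bar>s v\<bar> \<le> G * norm v" for v unfolding s_def by (rule G)
    have comp: "\<bar>v $ i\<bar> \<le> norm v" for v :: "real^'d" by (rule component_le_norm_cart)
    \<comment> \<open>The quadratic form at h minus that at z is split so that every difference
      carries the factor h - z.\<close>
    have "(y $ i - x $ i) * (\<phi> y + \<phi> x) - quad_form \<phi> i x z =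
        2 * \<phi> x * (h - z) $ i + h $ i * r + ((h - z) $ i * s h + z $ i * s (h - z))"
      unfolding sd qf r_def by (simp add: h_def algebra_simps)
    also have "\<bar>\<dots>\<bar> \<le> (2 * \<bar>\<phi> x\<bar> * \<bar>(h - z) $ i\<bar> + \<bar>h $ i\<bar> * \<bar>r\<bar>) + (\<bar>(h - z) $ i\<bar> * \<bar>s h\<bar> + \<bar>z $ i\<bar> * \<bar>s (h - z)\<bar>)"
      by (intro order_trans[OF abs_triangle_ineq] add_mono) (simp_all add: abs_mult)
    also have "\<dots> \<le> (2 * P * norm (h - z) + norm h * (L * (norm h)\<^sup>2)) + (norm (h - z) * (G * norm h) + norm z * (G * norm (h - z)))"
      by (intro add_mono mult_mono mult_nonneg_nonneg comp r s) (use P G L in auto)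
    also have "\<dots> = 2 * P * norm (h - z) + L * norm h ^ 3 + G * (norm (h - z) * norm h) + G * (norm z * norm (h - z))"
      by (simp add: power2_eq_square power3_eq_cube)
    also have "\<dots> \<le> c * norm (h - z) + c * norm h ^ 3 + c * (norm (h - z) * norm h) + c * (norm z * norm (h - z))"
      by (intro add_mono mult_right_mono c) auto
    also have "\<dots> = c * (norm (h - z) * (1 + norm h + norm z) + norm h ^ 3)"
      by (simp add: algebra_simps)
    finally show ?thesis by (simp add: h_def)
  qed
  with c(1) show ?thesis by blast
qed

lemma clip_id: "\<bar>u\<bar> \<le> r \<Longrightarrow> clip r u = u"
  by (auto simp: clip_def)

lemma clip_bound: "0 \<le> r \<Longrightarrow> \<bar>clip r u\<bar> \<le> r"
  by (auto simp: clip_def)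

lemma quad_form_outside:
  assumes "C_inf \<phi>" "\<And>x. norm x > R \<Longrightarrow> \<phi> x = 0" "norm x > R"
  shows "quad_form \<phi> i x z = 0"
proof -
  have "partial j \<phi> x = 0" for j by (rule partial_vanishing[OF assms(2,3)])
  then show ?thesis using assms(2,3) by (simp add: quad_form_def)
qed

text \<open>The factor K t + 2 S \<eta> bounds the displacement of the path and can be made small;
  it multiplies t + |w(t)|^2, which has mean of order t for Brownian motion. This is the required
  remainder of order o(t).\<close>

lemma short_time_quad_form:
  fixes \<phi> :: "real^'d \<Rightarrow> real" and b :: "real^'d \<Rightarrow> real^'d" and \<sigma> :: "real^'d^'d"
  assumes \<phi>: "smooth_bump \<phi>" and R: "R \<ge> 0" "\<And>x. norm x > R \<Longrightarrow> \<phi> x = 0"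
    and b: "continuous_on UNIV b"
    and K: "K \<ge> 0" "\<And>x. norm x \<le> R + 2 \<Longrightarrow> norm (b x) \<le> K"
    and L: "L \<ge> 0" "\<And>x y. norm x \<le> R + 2 \<Longrightarrow> norm y \<le> R + 2 \<Longrightarrow> norm (b x - b y) \<le> L * norm (x - y)"
    and S: "S \<ge> 0" "\<And>z. norm (\<sigma> *v z) \<le> S * norm z"
  shows "\<exists>c\<ge>0. \<forall>t p w \<eta>. 0 < t \<longrightarrow> t \<le> 1 \<longrightarrow> 0 \<le> \<eta> \<longrightarrow> K * t + 2 * S * \<eta> < 1 \<longrightarrow>
    continuous_on {0..t} p \<longrightarrow> (\<forall>s\<in>{0..t}. p s = p 0 + integral {0..s} (\<lambda>u. b (p u)) + \<sigma> *v w s) \<longrightarrow>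
    (\<forall>s\<in>{0..t}. norm (w s) \<le> \<eta>) \<longrightarrow>
    \<bar>(clip (R + 2) (p t $ i) - clip (R + 2) (p 0 $ i)) * (\<phi> (p t) + \<phi> (p 0)) - quad_form \<phi> i (p 0) (t *\<^sub>R b (p 0) + \<sigma> *v w t)\<bar>
      \<le> c * (K * t + 2 * S * \<eta>) * (t + (norm (w t))\<^sup>2)"
proof -
  obtain c0 where c0: "c0 \<ge> 0" and exp: "\<And>x y z. \<bar>(y $ i - x $ i) * (\<phi> y + \<phi> x) - quad_form \<phi> i x z\<bar>
    \<le> c0 * (norm (y - x - z) * (1 + norm (y - x) + norm z) + norm (y - x) ^ 3)"
    using quad_form_expansion[OF \<phi>, of i] by blast
  define c where "c = c0 * (L * (3 + L) + 2 * K\<^sup>2 + 2 * S\<^sup>2)"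
  have c: "c \<ge> 0" using c0 L S by (simp add: c_def)
  have main: "\<bar>(clip (R + 2) (p t $ i) - clip (R + 2) (p 0 $ i)) * (\<phi> (p t) + \<phi> (p 0)) - quad_form \<phi> i (p 0) (t *\<^sub>R b (p 0) + \<sigma> *v w t)\<bar>
      \<le> c * (K * t + 2 * S * \<eta>) * (t + (norm (w t))\<^sup>2)"
    if t: "0 < t" "t \<le> 1" and \<eta>: "0 \<le> \<eta>" and C1: "K * t + 2 * S * \<eta> < 1"
      and p: "continuous_on {0..t} p" and eq: "\<And>s. s \<in> {0..t} \<Longrightarrow> p s = p 0 + integral {0..s} (\<lambda>u. b (p u)) + \<sigma> *v w s"
      and w: "\<And>s. s \<in> {0..t} \<Longrightarrow> norm (w s) \<le> \<eta>" for t p w \<eta>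
  proof -
    define C where "C = K * t + 2 * S * \<eta>"
    have C: "0 \<le> C" "C < 1" using C1 K S t \<eta> by (auto simp: C_def)
    have cb: "continuous_on {x..y} (\<lambda>u. b (p u))" if "0 \<le> x" "y \<le> t" for x y
      using that by (intro continuous_on_compose2[OF b] continuous_on_subset[OF p]) auto
    have inc: "norm (p s - p r) \<le> norm (integral {r..s} (\<lambda>u. b (p u))) + 2 * S * \<eta>" if "0 \<le> r" "r \<le> s" "s \<le> t" for r s
    proof -
      have "integral {0..s} (\<lambda>u. b (p u)) = integral {0..r} (\<lambda>u. b (p u)) + integral {r..s} (\<lambda>u. b (p u))"
        using that by (intro Henstock_Kurzweil_Integration.integral_combine[symmetric] integrable_continuous_real cb) auto
      then have "p s - p r = integral {r..s} (\<lambda>u. b (p u)) + \<sigma> *v (w s - w r)"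
        using eq[of s] eq[of r] that by (simp add: matrix_vector_mult_diff_distrib)
      then have "norm (p s - p r) \<le> norm (integral {r..s} (\<lambda>u. b (p u))) + norm (\<sigma> *v (w s - w r))"
        by (simp add: norm_triangle_ineq)
      also have "norm (\<sigma> *v (w s - w r)) \<le> S * norm (w s - w r)" by (rule S)
      also have "\<dots> \<le> S * (\<eta> + \<eta>)"
        using w[of s] w[of r] that S by (intro mult_left_mono order_trans[OF norm_triangle_ineq4] add_mono) auto
      finally show ?thesis by simp
    qed
    have conf: "norm (p s - p u) \<le> C" if "u \<in> {0..t}" "norm (p u) \<le> R + 1" "s \<in> {0..t}" for u s
      unfolding C_def by (rule short_time_confinement[OF p b inc K(2,1) C1 that])
    show ?thesis
    proof (cases "norm (p 0) \<le> R + 1")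
      case False
      then have z0: "\<phi> (p 0) = 0" and q0: "quad_form \<phi> i (p 0) z = 0" for z
        using R by (auto intro!: quad_form_outside[OF smooth_bump_C_inf[OF \<phi>] R(2)])
      \<comment> \<open>Both sides vanish for a path that starts far out. Were the end point in the
        ball of radius R, confinement backwards from time t would place the starting point in the
        ball of radius R + 1.\<close>
      have "norm (p t) > R"
      proof (rule ccontr)
        assume "\<not> norm (p t) > R"
        then have "norm (p 0 - p t) \<le> C" using t by (intro conf) auto
        then have "norm (p 0) \<le> R + 1"
          using norm_triangle_sub[of "p 0" "p t"] \<open>\<not> norm (p t) > R\<close> C by linarith
        then show False using False by simp
      qed
      then have "\<phi> (p t) = 0" by (rule R)
      then show ?thesis using z0 q0 c C t by (simp add: C_def[symmetric])
    next
      case True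
      have d: "norm (p s - p 0) \<le> C" if "s \<in> {0..t}" for s
        by (rule conf) (use that True t in auto)
      have ball: "norm (p s) \<le> R + 2" if "s \<in> {0..t}" for s
        using d[OF that] norm_triangle_sub[of "p s" "p 0"] True C by linarith
      have "\<bar>p t $ i\<bar> \<le> R + 2" "\<bar>p 0 $ i\<bar> \<le> R + 2"
        using ball[of t] ball[of 0] t by (auto intro: order_trans[OF component_le_norm_cart])
      \<comment> \<open>The whole path stays in the ball of radius R + 2, where clipping has no
        effect.\<close>
      then have cl: "clip (R + 2) (p t $ i) = p t $ i" "clip (R + 2) (p 0 $ i) = p 0 $ i"
        by (auto intro: clip_id)
      define z where "z = t *\<^sub>R b (p 0) + \<sigma> *v w t"
      have I: "integral {0..t} (\<lambda>u. b (p 0)) = t *\<^sub>R b (p 0)" using t by simp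
      have e: "p t - p 0 - z = integral {0..t} (\<lambda>u. b (p u) - b (p 0))"
        using eq[of t] t
        by (subst Henstock_Kurzweil_Integration.integral_diff) (auto simp: z_def I intro!: integrable_continuous_real cb)
      have e1: "norm (p t - p 0 - z) \<le> L * C * t"
      proof -
        have "norm (integral {0..t} (\<lambda>u. b (p u) - b (p 0))) \<le> L * C * (t - 0)"
        proof (rule integral_bound)
          fix u assume u: "u \<in> {0..t}"
          have "norm (b (p u) - b (p 0)) \<le> L * norm (p u - p 0)"
            using ball[OF u] ball[of 0] t by (intro L) auto
          also have "\<dots> \<le> L * C" using d[OF u] L by (intro mult_left_mono) auto
          finally show "norm (b (p u) - b (p 0)) \<le> L * C" .
        qed (use t in \<open>auto intro!: continuous_intros cb\<close>)
        then show ?thesis unfolding e by simp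
      qed
      have e2: "norm (p t - p 0) \<le> K * t + S * norm (w t)"
      proof -
        have "p t - p 0 = integral {0..t} (\<lambda>u. b (p u)) + \<sigma> *v w t" using eq[of t] t by simp
        then have "norm (p t - p 0) \<le> norm (integral {0..t} (\<lambda>u. b (p u))) + norm (\<sigma> *v w t)"
          by (simp add: norm_triangle_ineq)
        also have "\<dots> \<le> K * (t - 0) + S * norm (w t)"
          by (intro add_mono integral_bound S) (use t K ball in \<open>auto intro!: cb\<close>)
        finally show ?thesis by simp
      qed
      have dt: "norm (p t - p 0) \<le> C" using t by (intro d) auto
      have "L * (C * t) \<le> L * 1" using L C t by (intro mult_left_mono mult_le_one) auto
      then have LCt: "L * C * t \<le> L" by (simp add: mult_ac)
      have nz: "norm z \<le> C + L"
        using norm_triangle_ineq4[of "p t - p 0" "p t - p 0 - z"] e1 dt LCt by simp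
      have "(K * t + S * norm (w t))\<^sup>2 \<le> 2 * (K * t)\<^sup>2 + 2 * (S * norm (w t))\<^sup>2"
        using sum_squares_bound[of "K * t" "S * norm (w t)"] by (simp add: power2_sum)
      also have "\<dots> \<le> 2 * K\<^sup>2 * t + 2 * S\<^sup>2 * (norm (w t))\<^sup>2"
      proof -
        have "t\<^sup>2 \<le> t" using t by (simp add: power2_eq_square mult_left_le)
        then show ?thesis by (simp add: power_mult_distrib mult_left_mono)
      qed
      finally have sq: "(norm (p t - p 0))\<^sup>2 \<le> 2 * K\<^sup>2 * t + 2 * S\<^sup>2 * (norm (w t))\<^sup>2"
        using power_mono[OF e2 norm_ge_zero, of 2] by simp
      have "\<bar>(p t $ i - p 0 $ i) * (\<phi> (p t) + \<phi> (p 0)) - quad_form \<phi> i (p 0) z\<bar>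
        \<le> c0 * (norm (p t - p 0 - z) * (1 + norm (p t - p 0) + norm z) + norm (p t - p 0) ^ 3)" by (rule exp)
      also have "\<dots> \<le> c0 * ((L * C * t) * (1 + 1 + (1 + L)) + C * (2 * K\<^sup>2 * t + 2 * S\<^sup>2 * (norm (w t))\<^sup>2))"
      proof (intro mult_left_mono add_mono mult_mono e1 c0)
        show "norm (p t - p 0) \<le> 1" using dt C by simp
        show "norm z \<le> 1 + L" using nz C by simp
        have "norm (p t - p 0) ^ 3 = norm (p t - p 0) * (norm (p t - p 0))\<^sup>2" by (simp add: power2_eq_square power3_eq_cube)
        also have "\<dots> \<le> C * (2 * K\<^sup>2 * t + 2 * S\<^sup>2 * (norm (w t))\<^sup>2)"
          by (intro mult_mono dt sq) (use C in auto)
        finally show "norm (p t - p 0) ^ 3 \<le> C * (2 * K\<^sup>2 * t + 2 * S\<^sup>2 * (norm (w t))\<^sup>2)" .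
      qed (use L C t in auto)
      also have "\<dots> = c0 * C * (L * (3 + L) * t + 2 * K\<^sup>2 * t + 2 * S\<^sup>2 * (norm (w t))\<^sup>2)"
        by (simp add: algebra_simps)
      also have "\<dots> \<le> c0 * C * ((L * (3 + L) + 2 * K\<^sup>2 + 2 * S\<^sup>2) * (t + (norm (w t))\<^sup>2))"
        using c0 C L t by (intro mult_left_mono) (auto simp: algebra_simps)
      also have "\<dots> = c * C * (t + (norm (w t))\<^sup>2)" by (simp add: c_def mult_ac)
      finally show ?thesis by (simp add: cl z_def C_def)
    qed
  qed
  show ?thesis by (rule exI[of _ c], rule conjI[OF c]) (use main in blast)
qed

text \<open>Used on the exceptional event. A constant plus the fourth power of the increment is the
  convenient form: the event has probability of order t^2 and the fourth moment is of order
  t^2.\<close>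

lemma quad_form_crude_bound:
  fixes \<phi> :: "real^'d \<Rightarrow> real" and b :: "real^'d \<Rightarrow> real^'d" and \<sigma> :: "real^'d^'d"
  assumes \<phi>: "smooth_bump \<phi>" and R: "R \<ge> 0" "\<And>x. norm x > R \<Longrightarrow> \<phi> x = 0"
    and K: "K \<ge> 0" "\<And>x. norm x \<le> R \<Longrightarrow> norm (b x) \<le> K"
    and S: "S \<ge> 0" "\<And>z. norm (\<sigma> *v z) \<le> S * norm z"
  shows "\<exists>c\<ge>0. \<forall>t x y \<beta>. 0 < t \<longrightarrow> t \<le> 1 \<longrightarrow>
    \<bar>(clip (R + 2) (y $ i) - clip (R + 2) (x $ i)) * (\<phi> y + \<phi> x) - quad_form \<phi> i x (t *\<^sub>R b x + \<sigma> *v \<beta>)\<bar> \<le> c * (2 + norm \<beta> ^ 4)"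
proof -
  obtain c0 where c0: "c0 \<ge> 0" "\<And>x z. \<bar>quad_form \<phi> i x z\<bar> \<le> c0 * (norm z + (norm z)\<^sup>2)"
    using quad_form_bound[OF \<phi>] by blast
  obtain P where P: "P \<ge> 0" "\<And>x. \<bar>\<phi> x\<bar> \<le> P" using smooth_bump_bounds[OF \<phi>] by blast
  define a where "a = max K S"
  have a: "a \<ge> 0" "K \<le> a" "S \<le> a" using K by (auto simp: a_def)
  define c where "c = (2 * (R + 2)) * (2 * P) + c0 * (2 * a + 4 * a\<^sup>2)"
  have c: "c \<ge> 0" using c0 P a R by (simp add: c_def)
  have "\<bar>(clip (R + 2) (y $ i) - clip (R + 2) (x $ i)) * (\<phi> y + \<phi> x) - quad_form \<phi> i x (t *\<^sub>R b x + \<sigma> *v \<beta>)\<bar> \<le> c * (2 + norm \<beta> ^ 4)"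
    if t: "0 < t" "t \<le> 1" for t x y \<beta>
  proof -
    define n where "n = norm \<beta>"
    define m where "m = n ^ 4"
    have m: "m \<ge> 0" by (simp add: m_def)
    have n: "n \<ge> 0" "n \<le> 2 + m" "n\<^sup>2 \<le> 1 + m"
    proof -
      show n0: "n \<ge> 0" by (simp add: n_def)
      have "2 * n\<^sup>2 \<le> 1 + m" using zero_le_power2[of "n\<^sup>2 - 1"] by (simp add: m_def power2_diff power4_eq_xxxx power2_eq_square algebra_simps)
      moreover have "2 * n \<le> 1 + n\<^sup>2" using zero_le_power2[of "n - 1"] by (simp add: power2_diff)
      ultimately show "n \<le> 2 + m" "n\<^sup>2 \<le> 1 + m" using n0 m zero_le_power2[of n] by linarith+
    qed
    have "\<bar>(clip (R + 2) (y $ i) - clip (R + 2) (x $ i)) * (\<phi> y + \<phi> x)\<bar> \<le> (2 * (R + 2)) * (2 * P)"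
      unfolding abs_mult using clip_bound[of "R + 2" "y $ i"] clip_bound[of "R + 2" "x $ i"] P(2)[of x] P(2)[of y] R
      by (intro mult_mono) auto
    also have "\<dots> \<le> ((2 * (R + 2)) * (2 * P)) * (2 + m)"
      using mult_left_mono[of 1 "2 + m" "(2 * (R + 2)) * (2 * P)"] R P m by simp
    finally have 1: "\<bar>(clip (R + 2) (y $ i) - clip (R + 2) (x $ i)) * (\<phi> y + \<phi> x)\<bar> \<le> ((2 * (R + 2)) * (2 * P)) * (2 + m)" .
    have 2: "\<bar>quad_form \<phi> i x (t *\<^sub>R b x + \<sigma> *v \<beta>)\<bar> \<le> c0 * (2 * a + 4 * a\<^sup>2) * (2 + m)"
    proof (cases "norm x \<le> R")
      case True
      define z where "z = t *\<^sub>R b x + \<sigma> *v \<beta>"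
      have "norm z \<le> norm (t *\<^sub>R b x) + norm (\<sigma> *v \<beta>)" unfolding z_def by (rule norm_triangle_ineq)
      also have "\<dots> \<le> 1 * a + a * n"
      proof (rule add_mono)
        have "\<bar>t\<bar> * norm (b x) \<le> 1 * a" using t K(2)[OF True] a by (intro mult_mono) auto
        then show "norm (t *\<^sub>R b x) \<le> 1 * a" by simp
        show "norm (\<sigma> *v \<beta>) \<le> a * n"
          using S(2)[of \<beta>] mult_right_mono[OF a(3) n(1)] unfolding n_def by linarith
      qed
      finally have z: "norm z \<le> a * (1 + n)" by (simp add: algebra_simps)
      have "\<bar>quad_form \<phi> i x z\<bar> \<le> c0 * (norm z + (norm z)\<^sup>2)" by (rule c0)
      also have "\<dots> \<le> c0 * (a * (1 + n) + (a * (1 + n))\<^sup>2)"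
        using c0 z by (intro mult_left_mono add_mono power_mono) auto
      also have "\<dots> \<le> c0 * (a * (2 * (2 + m)) + a\<^sup>2 * (4 * (2 + m)))"
      proof -
        have "1 + n \<le> 2 * (2 + m)" using n(2) m by (simp add: algebra_simps)
        moreover have "(1 + n)\<^sup>2 \<le> 4 * (2 + m)"
        proof -
          have "2 * n \<le> 1 + n\<^sup>2" using zero_le_power2[of "n - 1"] by (simp add: power2_diff)
          then have "(1 + n)\<^sup>2 \<le> 2 + 2 * n\<^sup>2" by (simp add: power2_sum)
          then show ?thesis using n m unfolding distrib_left by linarith
        qed
        ultimately show ?thesis unfolding power_mult_distrib using c0 a
          by (intro mult_left_mono add_mono) auto
      qed
      also have "\<dots> = c0 * (2 * a + 4 * a\<^sup>2) * (2 + m)" by (simp add: algebra_simps)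
      finally show ?thesis by (simp add: z_def)
    next
      case False
      then have "quad_form \<phi> i x (t *\<^sub>R b x + \<sigma> *v \<beta>) = 0"
        by (intro quad_form_outside[OF smooth_bump_C_inf[OF \<phi>] R(2)]) auto
      then show ?thesis using c0 a n by simp
    qed
    show ?thesis unfolding c_def n_def[symmetric] m_def[symmetric] distrib_right
      using 1 2 by (intro order_trans[OF abs_triangle_ineq4] add_mono)
  qed
  with c show ?thesis by blast
qed

section \<open>First-order expansion of the expectation at time 0\<close>

context langevin
begin

text \<open>The quadratic form is a polynomial in the increment, with coefficients that are test
  functions of the independent initial value. Linear terms have mean 0, and the quadratic terms
  produce t times the diffusion matrix; together with the drift this is t times the weak
  flux.\<close>

lemma quad_form_expectation:
  fixes i :: 'd
  assumes t: "t > 0" and \<phi>: "smooth_bump \<phi>"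
  defines "Q \<equiv> \<lambda>\<omega>. quad_form \<phi> i (q 0 \<omega>) (t *\<^sub>R b (q 0 \<omega>) + \<sigma> *v (B t \<omega> - B 0 \<omega>))"
  shows "integrable M Q"
    and "(\<integral>\<omega>. Q \<omega> \<partial>M) =
      t * (\<integral>x. (2 * b x $ i * \<phi> x + (\<Sum>k\<in>UNIV. diffusion \<sigma> $ i $ k * partial k \<phi> x)) * \<rho>0 x \<partial>lborel) +
      t\<^sup>2 * (\<integral>x. (\<Sum>j\<in>UNIV. b x $ i * (b x $ j * partial j \<phi> x)) * \<rho>0 x \<partial>lborel)"
proof -
  define \<beta> where "\<beta> \<omega> = B t \<omega> - B 0 \<omega>" for \<omega>
  define g0 where "g0 x = 2 * b x $ i * \<phi> x" for x
  define h0 where "h0 x = (\<Sum>j\<in>UNIV. b x $ i * (b x $ j * partial j \<phi> x))" for x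
  \<comment> \<open>\<open>g1\<close> and \<open>g2\<close> collect the coefficients of the linear
    and quadratic monomials of the increment; summing \<open>g2 k k\<close> over k yields a row of
    the diffusion matrix paired with the gradient of \<phi>.\<close>
  define g1 where "g1 k x = 2 * \<sigma> $ i $ k * \<phi> x + t * (\<Sum>j\<in>UNIV. (b x $ i * \<sigma> $ j $ k + b x $ j * \<sigma> $ i $ k) * partial j \<phi> x)" for k x
  define g2 where "g2 k l x = (\<Sum>j\<in>UNIV. \<sigma> $ i $ k * \<sigma> $ j $ l * partial j \<phi> x)" for k l x
  note bi = C_inf_nth[OF C_inf_b]
  note d\<phi> = smooth_bump_partial[OF \<phi>]
  have sb: "smooth_bump g0" "smooth_bump h0" "smooth_bump (g1 k)" "smooth_bump (g2 k l)" for k l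
    unfolding g0_def[abs_def] h0_def[abs_def] g1_def[abs_def] g2_def[abs_def]
    by (intro smooth_bump_sum smooth_bump_add smooth_bump_cmult smooth_bump_mult d\<phi> \<phi> bi C_inf_mult C_inf_add C_inf_const)+
  have Q: "Q \<omega> = t * g0 (q 0 \<omega>) + t\<^sup>2 * h0 (q 0 \<omega>) + (\<Sum>k\<in>UNIV. g1 k (q 0 \<omega>) * \<beta> \<omega> $ k)
      + (\<Sum>k\<in>UNIV. \<Sum>l\<in>UNIV. g2 k l (q 0 \<omega>) * (\<beta> \<omega> $ k * \<beta> \<omega> $ l))" for \<omega>
  proof -
    define s where "s j = (\<Sum>k\<in>UNIV. \<sigma> $ j $ k * \<beta> \<omega> $ k)" for j
    define x where "x = q 0 \<omega>"
    have z: "(t *\<^sub>R b x + \<sigma> *v \<beta> \<omega>) $ j = t * b x $ j + s j" for j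
      by (simp add: s_def matrix_vector_mult_def)
    have A: "(\<Sum>k\<in>UNIV. g1 k x * \<beta> \<omega> $ k) = 2 * \<phi> x * s i + t * (\<Sum>j\<in>UNIV. (b x $ i * s j + b x $ j * s i) * partial j \<phi> x)"
    proof -
      have "(\<Sum>k\<in>UNIV. g1 k x * \<beta> \<omega> $ k) = (\<Sum>k\<in>UNIV. 2 * \<phi> x * (\<sigma> $ i $ k * \<beta> \<omega> $ k)) +
          (\<Sum>k\<in>UNIV. \<Sum>j\<in>UNIV. t * ((b x $ i * (\<sigma> $ j $ k * \<beta> \<omega> $ k) + b x $ j * (\<sigma> $ i $ k * \<beta> \<omega> $ k)) * partial j \<phi> x))"
        unfolding g1_def by (simp add: sum.distrib[symmetric] distrib_right sum_distrib_right sum_distrib_left algebra_simps)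
      also have "(\<Sum>k\<in>UNIV. 2 * \<phi> x * (\<sigma> $ i $ k * \<beta> \<omega> $ k)) = 2 * \<phi> x * s i"
        by (simp add: s_def sum_distrib_left)
      also have "(\<Sum>k\<in>UNIV. \<Sum>j\<in>UNIV. t * ((b x $ i * (\<sigma> $ j $ k * \<beta> \<omega> $ k) + b x $ j * (\<sigma> $ i $ k * \<beta> \<omega> $ k)) * partial j \<phi> x))
         = (\<Sum>j\<in>UNIV. t * ((b x $ i * s j + b x $ j * s i) * partial j \<phi> x))"
        by (subst sum.swap) (simp add: s_def sum_distrib_left sum_distrib_right sum.distrib algebra_simps)
      finally show ?thesis by (simp add: sum_distrib_left)
    qed
    have C: "(\<Sum>k\<in>UNIV. \<Sum>l\<in>UNIV. g2 k l x * (\<beta> \<omega> $ k * \<beta> \<omega> $ l)) = (\<Sum>j\<in>UNIV. s i * s j * partial j \<phi> x)"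
    proof -
      have "(\<Sum>k\<in>UNIV. \<Sum>l\<in>UNIV. g2 k l x * (\<beta> \<omega> $ k * \<beta> \<omega> $ l)) =
          (\<Sum>k\<in>UNIV. \<Sum>l\<in>UNIV. \<Sum>j\<in>UNIV. (\<sigma> $ i $ k * \<beta> \<omega> $ k) * (\<sigma> $ j $ l * \<beta> \<omega> $ l) * partial j \<phi> x)"
        unfolding g2_def sum_distrib_right by (intro sum.cong refl) (simp add: mult_ac)
      also have "\<dots> = (\<Sum>k\<in>UNIV. \<Sum>j\<in>UNIV. \<Sum>l\<in>UNIV. (\<sigma> $ i $ k * \<beta> \<omega> $ k) * (\<sigma> $ j $ l * \<beta> \<omega> $ l) * partial j \<phi> x)"
        by (intro sum.cong refl sum.swap)
      also have "\<dots> = (\<Sum>j\<in>UNIV. \<Sum>k\<in>UNIV. \<Sum>l\<in>UNIV. (\<sigma> $ i $ k * \<beta> \<omega> $ k) * (\<sigma> $ j $ l * \<beta> \<omega> $ l) * partial j \<phi> x)"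
        by (rule sum.swap)
      also have "\<dots> = (\<Sum>j\<in>UNIV. s i * s j * partial j \<phi> x)"
        by (simp only: s_def sum_product) (simp only: sum_distrib_right)
      finally show ?thesis .
    qed
    have "Q \<omega> = 2 * \<phi> x * (t * b x $ i + s i) + (t * b x $ i + s i) * (\<Sum>j\<in>UNIV. (t * b x $ j + s j) * partial j \<phi> x)"
      unfolding Q_def quad_form_def \<beta>_def[symmetric] x_def[symmetric] z ..
    also have "\<dots> = t * g0 x + t\<^sup>2 * h0 x + (2 * \<phi> x * s i + t * (\<Sum>j\<in>UNIV. (b x $ i * s j + b x $ j * s i) * partial j \<phi> x))
        + (\<Sum>j\<in>UNIV. s i * s j * partial j \<phi> x)"
      by (simp add: g0_def h0_def sum_distrib_left algebra_simps sum.distrib power2_eq_square)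
    finally show ?thesis by (simp only: A[unfolded x_def] C[unfolded x_def] x_def)
  qed
  note m = start_increment_moments[OF t, folded \<beta>_def]
  have i1: "integrable M (\<lambda>\<omega>. t * g0 (q 0 \<omega>))" "integrable M (\<lambda>\<omega>. t\<^sup>2 * h0 (q 0 \<omega>))"
    "integrable M (\<lambda>\<omega>. g1 k (q 0 \<omega>) * \<beta> \<omega> $ k)" "integrable M (\<lambda>\<omega>. g2 k l (q 0 \<omega>) * (\<beta> \<omega> $ k * \<beta> \<omega> $ l))" for k l
    using smooth_bump_start_integrable sb m by auto
  note ii = i1 Bochner_Integration.integrable_add Bochner_Integration.integrable_sum
  show "integrable M Q" unfolding Q by (intro ii)
  have E: "(\<integral>\<omega>. g (q 0 \<omega>) \<partial>M) = (\<integral>x. g x * \<rho>0 x \<partial>lborel)" if "smooth_bump g" for g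
    by (intro expectation_start C_inf_borel_measurable smooth_bump_C_inf that)
  have \<rho>i: "integrable lborel \<rho>0" by (rule has_density_facts(2)[OF prob_space_axioms density_0])
  have diag: "(\<Sum>k\<in>UNIV. g2 k k x) = (\<Sum>k\<in>UNIV. diffusion \<sigma> $ i $ k * partial k \<phi> x)" for x
    unfolding g2_def by (subst sum.swap) (simp add: matrix_matrix_mult_def transpose_def sum_distrib_right)
  have "(\<integral>\<omega>. Q \<omega> \<partial>M) = (\<integral>\<omega>. t * g0 (q 0 \<omega>) \<partial>M) + (\<integral>\<omega>. t\<^sup>2 * h0 (q 0 \<omega>) \<partial>M) + (\<Sum>k\<in>UNIV. \<integral>\<omega>. g1 k (q 0 \<omega>) * \<beta> \<omega> $ k \<partial>M)
      + (\<Sum>k\<in>UNIV. \<Sum>l\<in>UNIV. \<integral>\<omega>. g2 k l (q 0 \<omega>) * (\<beta> \<omega> $ k * \<beta> \<omega> $ l) \<partial>M)"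
    unfolding Q by (subst Bochner_Integration.integral_add Bochner_Integration.integral_sum; (intro ii)?)+ (rule refl)
  also have "\<dots> = t * (\<integral>x. g0 x * \<rho>0 x \<partial>lborel) + t\<^sup>2 * (\<integral>x. h0 x * \<rho>0 x \<partial>lborel) + t * (\<Sum>k\<in>UNIV. \<integral>x. g2 k k x * \<rho>0 x \<partial>lborel)"
    using m[OF sb(3)] m[OF sb(4)] by (simp add: E sb sum_distrib_left)
  also have "(\<Sum>k\<in>UNIV. \<integral>x. g2 k k x * \<rho>0 x \<partial>lborel) = (\<integral>x. (\<Sum>k\<in>UNIV. g2 k k x) * \<rho>0 x \<partial>lborel)"
    unfolding sum_distrib_right
    by (subst Bochner_Integration.integral_sum) (auto intro!: smooth_bump_integrable_mult sb \<rho>i)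
  also have "t * (\<integral>x. g0 x * \<rho>0 x \<partial>lborel) + t\<^sup>2 * (\<integral>x. h0 x * \<rho>0 x \<partial>lborel) + t * (\<integral>x. (\<Sum>k\<in>UNIV. g2 k k x) * \<rho>0 x \<partial>lborel)
    = t * ((\<integral>x. g0 x * \<rho>0 x \<partial>lborel) + (\<integral>x. (\<Sum>k\<in>UNIV. g2 k k x) * \<rho>0 x \<partial>lborel)) + t\<^sup>2 * (\<integral>x. h0 x * \<rho>0 x \<partial>lborel)"
    by (simp add: algebra_simps)
  also have "(\<integral>x. g0 x * \<rho>0 x \<partial>lborel) + (\<integral>x. (\<Sum>k\<in>UNIV. g2 k k x) * \<rho>0 x \<partial>lborel) = (\<integral>x. (g0 x + (\<Sum>k\<in>UNIV. g2 k k x)) * \<rho>0 x \<partial>lborel)"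
    unfolding distrib_right
    by (subst Bochner_Integration.integral_add) (auto intro!: smooth_bump_integrable_mult smooth_bump_sum sb \<rho>i)
  finally show "(\<integral>\<omega>. Q \<omega> \<partial>M) =
      t * (\<integral>x. (2 * b x $ i * \<phi> x + (\<Sum>k\<in>UNIV. diffusion \<sigma> $ i $ k * partial k \<phi> x)) * \<rho>0 x \<partial>lborel) +
      t\<^sup>2 * (\<integral>x. (\<Sum>j\<in>UNIV. b x $ i * (b x $ j * partial j \<phi> x)) * \<rho>0 x \<partial>lborel)"
    unfolding diag by (simp add: g0_def h0_def)
qed

text \<open>The antisymmetric function has mean 0 and its quadratic approximation has mean t I + t^2
  J, so |t I + t^2 J| is at most the mean error. Dividing by t, letting t and then \<eta> tend to 0
  gives I = 0.\<close>

lemma reversible_imp_weak_zero_flux: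
  assumes rev: "reversible M q"
  shows "weak_zero_flux b \<sigma> \<rho>0"
  unfolding weak_zero_flux_def
proof (intro allI impI)
  fix \<phi> :: "real^'d \<Rightarrow> real" and i :: 'd
  assume \<phi>: "smooth_bump \<phi>"
  define I where "I = (\<integral>x. (2 * b x $ i * \<phi> x + (\<Sum>k\<in>UNIV. diffusion \<sigma> $ i $ k * partial k \<phi> x)) * \<rho>0 x \<partial>lborel)"
  define J where "J = (\<integral>x. (\<Sum>j\<in>UNIV. b x $ i * (b x $ j * partial j \<phi> x)) * \<rho>0 x \<partial>lborel)"
  obtain R0 where R0: "\<And>x. norm x > R0 \<Longrightarrow> \<phi> x = 0" using \<phi> by (auto simp: smooth_bump_def)
  define R where "R = max 0 R0"
  have R: "R \<ge> 0" "\<And>x. norm x > R \<Longrightarrow> \<phi> x = 0" using R0 by (auto simp: R_def)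
  obtain K where K: "K \<ge> 0" "\<And>x. norm x \<le> R + 2 \<Longrightarrow> norm (b x) \<le> K"
    using C_inf_bounded_on_cball[OF C_inf_b, of "R + 2"] by blast
  \<comment> \<open>Lipschitz constants are provided for integer radii.\<close>
  have n: "real (nat \<lceil>R + 2\<rceil>) \<ge> R + 2" "nat \<lceil>R + 2\<rceil> \<ge> 1" using R(1) by linarith+
  obtain L where L0: "L > 0" "\<forall>x y. norm x \<le> real (nat \<lceil>R + 2\<rceil>) \<and> norm y \<le> real (nat \<lceil>R + 2\<rceil>) \<longrightarrow> norm (b x - b y) \<le> L * norm (x - y)"
    using local_lipschitz[OF n(2)] by blast
  have L: "L \<ge> 0" "\<And>x y. norm x \<le> R + 2 \<Longrightarrow> norm y \<le> R + 2 \<Longrightarrow> norm (b x - b y) \<le> L * norm (x - y)"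
    using L0 n(1) order_trans by (blast intro: less_imp_le)+
  obtain S where S: "S \<ge> 0" "\<And>z. norm (\<sigma> *v z) \<le> S * norm z"
    using bounded_linear.nonneg_bounded[OF matrix_vector_mul_bounded_linear[of \<sigma>]] by (auto simp: mult.commute)
  have b_cont: "continuous_on UNIV b" by (rule b_continuous)
  obtain c1 where c1: "c1 \<ge> 0" "\<And>t p w \<eta>. 0 < t \<Longrightarrow> t \<le> 1 \<Longrightarrow> 0 \<le> \<eta> \<Longrightarrow> K * t + 2 * S * \<eta> < 1 \<Longrightarrow>
    continuous_on {0..t} p \<Longrightarrow> (\<forall>s\<in>{0..t}. p s = p 0 + integral {0..s} (\<lambda>u. b (p u)) + \<sigma> *v w s) \<Longrightarrow>
    (\<forall>s\<in>{0..t}. norm (w s) \<le> \<eta>) \<Longrightarrow>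
    \<bar>(clip (R + 2) (p t $ i) - clip (R + 2) (p 0 $ i)) * (\<phi> (p t) + \<phi> (p 0)) - quad_form \<phi> i (p 0) (t *\<^sub>R b (p 0) + \<sigma> *v w t)\<bar>
      \<le> c1 * (K * t + 2 * S * \<eta>) * (t + (norm (w t))\<^sup>2)"
    using short_time_quad_form[where i = i, OF \<phi> R b_cont K L S] by blast
  have K': "norm (b x) \<le> K" if "norm x \<le> R" for x using K(2) that by simp
  obtain c2 where c2: "c2 \<ge> 0" "\<And>t x y \<beta>. 0 < t \<Longrightarrow> t \<le> 1 \<Longrightarrow>
    \<bar>(clip (R + 2) (y $ i) - clip (R + 2) (x $ i)) * (\<phi> y + \<phi> x) - quad_form \<phi> i x (t *\<^sub>R b x + \<sigma> *v \<beta>)\<bar> \<le> c2 * (2 + norm \<beta> ^ 4)"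
    using quad_form_crude_bound[where i = i and b = b and \<sigma> = \<sigma>, OF \<phi> R K(1) K' S] by meson
  define F where "F x y = (clip (R + 2) (y $ i) - clip (R + 2) (x $ i)) * (\<phi> y + \<phi> x)" for x y :: "real^'d"
  have [measurable]: "\<phi> \<in> borel_measurable borel" by (intro C_inf_borel_measurable smooth_bump_C_inf \<phi>)
  have F_meas: "(\<lambda>(x, y). F x y) \<in> borel_measurable (borel \<Otimes>\<^sub>M borel)"
  proof -
    have "(\<lambda>x::real^'d. clip (R + 2) (x $ i)) \<in> borel_measurable borel"
      unfolding clip_def by (intro borel_measurable_max borel_measurable_min borel_measurable_const C_inf_borel_measurable C_inf_coordinate)
    note [measurable] = measurable_compose[OF measurable_fst this] measurable_compose[OF measurable_snd this]
    show ?thesis unfolding F_def by measurable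
  qed
  obtain P where P: "P \<ge> 0" "\<And>x. \<bar>\<phi> x\<bar> \<le> P" using smooth_bump_bounds[OF \<phi>] by blast
  have F_bound: "\<bar>F x y\<bar> \<le> (2 * (R + 2)) * (2 * P)" for x y
    unfolding F_def abs_mult using clip_bound[of "R + 2" "y $ i"] clip_bound[of "R + 2" "x $ i"] P(2)[of x] P(2)[of y] R
    by (intro mult_mono) auto
  define d where "d = real CARD('d)"
  \<comment> \<open>The constant C of the exceptional event depends on \<eta>, so \<eta> is fixed
    first and t tends to 0 before \<eta> does.\<close>
  have step: "\<exists>C\<ge>0. \<forall>t. 0 < t \<longrightarrow> t \<le> 1 \<longrightarrow> K * t + 2 * S * \<eta> < 1 \<longrightarrow>
      \<bar>I + t * J\<bar> \<le> c1 * (K * t + 2 * S * \<eta>) * (1 + d) + c2 * (2 * C + 3 * d\<^sup>2) * t" if \<eta>: "\<eta> > 0" for \<eta>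
  proof -
    \<comment> \<open>On the event with threshold \<eta> / 10 the chaining bound is exactly
      \<eta>.\<close>
    obtain C where C: "C \<ge> 0" "\<And>t. t > 0 \<Longrightarrow> chain_event t (\<eta> / 10) \<in> events" "\<And>t. t > 0 \<Longrightarrow> 1 - prob (chain_event t (\<eta> / 10)) \<le> C * t\<^sup>2"
      using chain_event_prob[of "\<eta> / 10"] \<eta> by auto
    have "\<bar>I + t * J\<bar> \<le> c1 * (K * t + 2 * S * \<eta>) * (1 + d) + c2 * (2 * C + 3 * d\<^sup>2) * t"
      if t: "0 < t" "t \<le> 1" and small: "K * t + 2 * S * \<eta> < 1" for t
    proof -
      define \<Gamma> where "\<Gamma> = chain_event t (\<eta> / 10)"
      have \<Gamma>: "\<Gamma> \<in> events" "1 - prob \<Gamma> \<le> C * t\<^sup>2" using C t by (auto simp: \<Gamma>_def)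
      define \<beta> where "\<beta> \<omega> = B t \<omega> - B 0 \<omega>" for \<omega>
      define Q where "Q \<omega> = quad_form \<phi> i (q 0 \<omega>) (t *\<^sub>R b (q 0 \<omega>) + \<sigma> *v \<beta> \<omega>)" for \<omega>
      define E where "E = K * t + 2 * S * \<eta>"
      have E: "E \<ge> 0" using K S \<eta> t by (simp add: E_def)
      \<comment> \<open>A single integrable bound for both cases: the first summand comes from the
        good event and the second from the crude estimate, whose constant is charged only off the
        good event.\<close>
      define bd where "bd \<omega> = c1 * E * (t + (norm (\<beta> \<omega>))\<^sup>2) + c2 * (2 * indicator (space M - \<Gamma>) \<omega> + norm (\<beta> \<omega>) ^ 4)" for \<omega>
      have Q: "integrable M Q" "(\<integral>\<omega>. Q \<omega> \<partial>M) = t * I + t\<^sup>2 * J"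
        using quad_form_expectation[OF t(1) \<phi>, of i] unfolding Q_def[abs_def] \<beta>_def I_def J_def by blast+
      have [measurable]: "q t \<in> borel_measurable M" using t by (intro q_measurable) simp
      have "(\<lambda>\<omega>. (\<lambda>(x, y). F x y) (q 0 \<omega>, q t \<omega>)) \<in> borel_measurable M"
        by (rule measurable_compose[OF _ F_meas]) measurable
      then have "(\<lambda>\<omega>. F (q 0 \<omega>) (q t \<omega>)) \<in> borel_measurable M" by simp
      then have F: "integrable M (\<lambda>\<omega>. F (q 0 \<omega>) (q t \<omega>))"
        by (intro integrable_const_bound[where B = "(2 * (R + 2)) * (2 * P)"]) (use F_bound in auto)
      have F0: "(\<integral>\<omega>. F (q 0 \<omega>) (q t \<omega>) \<partial>M) = 0"
        by (rule reversible_expectation_antisym[OF rev t(1) F_meas]) (simp add: F_def algebra_simps)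
      have \<beta>: "integrable M (\<lambda>\<omega>. (norm (\<beta> \<omega>))\<^sup>2)" "(\<integral>\<omega>. (norm (\<beta> \<omega>))\<^sup>2 \<partial>M) = d * t"
        "integrable M (\<lambda>\<omega>. norm (\<beta> \<omega>) ^ 4)" "(\<integral>\<omega>. norm (\<beta> \<omega>) ^ 4 \<partial>M) \<le> 3 * d\<^sup>2 * t\<^sup>2"
        using increment_norm_sq[OF order_refl t(1)] increment_norm_fourth[OF order_refl t(1)] unfolding \<beta>_def d_def by simp_all
      have ind: "integrable M (indicator (space M - \<Gamma>) :: _ \<Rightarrow> real)"
        using \<Gamma>(1) by (intro integrable_real_indicator) (auto simp: emeasure_eq_measure)
      have bd: "integrable M bd" unfolding bd_def[abs_def]
        by (intro integrable_mult_right Bochner_Integration.integrable_add \<beta> ind integrable_const)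
      have "(\<integral>\<omega>. bd \<omega> \<partial>M) = c1 * E * (t + d * t) + c2 * (2 * (1 - prob \<Gamma>) + (\<integral>\<omega>. norm (\<beta> \<omega>) ^ 4 \<partial>M))"
        unfolding bd_def using \<beta> ind \<Gamma>(1) by (simp add: prob_space prob_compl)
      also have "\<dots> \<le> c1 * E * (t + d * t) + c2 * (2 * (C * t\<^sup>2) + 3 * d\<^sup>2 * t\<^sup>2)"
        using c2(1) \<Gamma>(2) \<beta>(4) by (intro add_left_mono mult_left_mono add_mono) auto
      also have "\<dots> = t * (c1 * E * (1 + d) + c2 * (2 * C + 3 * d\<^sup>2) * t)"
        by (simp add: algebra_simps power2_eq_square)
      finally have bd_le: "(\<integral>\<omega>. bd \<omega> \<partial>M) \<le> t * (c1 * E * (1 + d) + c2 * (2 * C + 3 * d\<^sup>2) * t)" .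
      have "AE \<omega> in M. \<bar>F (q 0 \<omega>) (q t \<omega>) - Q \<omega>\<bar> \<le> bd \<omega>"
        using AE_solution start_B continuous_B AE_space
      proof eventually_elim
        case (elim \<omega>)
        show ?case
        proof (cases "\<omega> \<in> \<Gamma>")
          case True
          have small_B: "\<forall>s\<in>{0..t}. norm (B s \<omega>) \<le> \<eta>"
          proof
            fix s assume "s \<in> {0..t}"
            then show "norm (B s \<omega>) \<le> \<eta>"
              using chain_event_bound[OF t(1), of "\<eta> / 10" \<omega> s] True elim(2,3) \<eta> by (simp add: \<Gamma>_def)
          qed
          have cont: "continuous_on {0..t} (\<lambda>s. q s \<omega>)"
            using elim(1) by (auto intro: continuous_on_subset)
          have eq: "\<forall>s\<in>{0..t}. q s \<omega> = q 0 \<omega> + integral {0..s} (\<lambda>u. b (q u \<omega>)) + \<sigma> *v B s \<omega>"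
            by (intro ballI elim(1)[THEN conjunct2, rule_format]) simp
          have "\<bar>F (q 0 \<omega>) (q t \<omega>) - quad_form \<phi> i (q 0 \<omega>) (t *\<^sub>R b (q 0 \<omega>) + \<sigma> *v B t \<omega>)\<bar> \<le> c1 * E * (t + (norm (B t \<omega>))\<^sup>2)"
            unfolding F_def E_def by (rule c1(2)[OF t less_imp_le[OF \<eta>] small cont eq small_B])
          then have "\<bar>F (q 0 \<omega>) (q t \<omega>) - Q \<omega>\<bar> \<le> c1 * E * (t + (norm (\<beta> \<omega>))\<^sup>2)"
            using elim(2) by (simp add: Q_def \<beta>_def)
          also have "\<dots> \<le> bd \<omega>" unfolding bd_def using c2(1) by simp
          finally show ?thesis .
        next
          case False
          then have "indicator (space M - \<Gamma>) \<omega> = (1 :: real)" using elim(4) by simp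
          moreover have "\<bar>F (q 0 \<omega>) (q t \<omega>) - Q \<omega>\<bar> \<le> c2 * (2 + norm (\<beta> \<omega>) ^ 4)"
            unfolding F_def Q_def by (rule c2(2)[OF t])
          moreover have "0 \<le> c1 * E * (t + (norm (\<beta> \<omega>))\<^sup>2)" using c1(1) E t by simp
          ultimately show ?thesis unfolding bd_def by simp
        qed
      qed
      then have "(\<integral>\<omega>. \<bar>F (q 0 \<omega>) (q t \<omega>) - Q \<omega>\<bar> \<partial>M) \<le> (\<integral>\<omega>. bd \<omega> \<partial>M)"
        using F Q bd by (intro integral_mono_AE integrable_abs Bochner_Integration.integrable_diff)
      moreover have "\<bar>t * I + t\<^sup>2 * J\<bar> \<le> (\<integral>\<omega>. \<bar>F (q 0 \<omega>) (q t \<omega>) - Q \<omega>\<bar> \<partial>M)"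
      proof -
        have "\<bar>\<integral>\<omega>. F (q 0 \<omega>) (q t \<omega>) - Q \<omega> \<partial>M\<bar> \<le> (\<integral>\<omega>. \<bar>F (q 0 \<omega>) (q t \<omega>) - Q \<omega>\<bar> \<partial>M)"
          by (rule integral_abs_bound)
        moreover have "(\<integral>\<omega>. F (q 0 \<omega>) (q t \<omega>) - Q \<omega> \<partial>M) = - (t * I + t\<^sup>2 * J)"
          using F Q F0 by simp
        ultimately show ?thesis by simp
      qed
      ultimately have "\<bar>t * I + t\<^sup>2 * J\<bar> \<le> t * (c1 * E * (1 + d) + c2 * (2 * C + 3 * d\<^sup>2) * t)"
        using bd_le by linarith
      moreover have "\<bar>t * I + t\<^sup>2 * J\<bar> = t * \<bar>I + t * J\<bar>"
      proof -
        have "t * I + t\<^sup>2 * J = t * (I + t * J)" by (simp add: algebra_simps power2_eq_square)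
        then show ?thesis using t by (simp add: abs_mult)
      qed
      ultimately show ?thesis using t by (simp add: E_def)
    qed
    with C(1) show ?thesis by blast
  qed
  \<comment> \<open>As t tends to 0 for fixed \<eta>, everything except a multiple of \<eta>
    disappears.\<close>
  have lim: "\<bar>I\<bar> \<le> c1 * (2 * S * \<eta>) * (1 + d)" if \<eta>: "\<eta> > 0" "2 * S * \<eta> < 1" for \<eta>
  proof -
    obtain C where C: "\<And>t. 0 < t \<Longrightarrow> t \<le> 1 \<Longrightarrow> K * t + 2 * S * \<eta> < 1 \<Longrightarrow>
      \<bar>I + t * J\<bar> \<le> c1 * (K * t + 2 * S * \<eta>) * (1 + d) + c2 * (2 * C + 3 * d\<^sup>2) * t"
      using step[OF \<eta>(1)] by blast
    have "((\<lambda>t. K * t + 2 * S * \<eta>) \<longlongrightarrow> K * 0 + 2 * S * \<eta>) (at_right 0)" by (intro tendsto_intros)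
    then have ev: "eventually (\<lambda>t. K * t + 2 * S * \<eta> < 1) (at_right 0)"
      using \<eta>(2) by (intro order_tendstoD(2)) auto
    have ev1: "eventually (\<lambda>t::real. 0 < t \<and> t \<le> 1) (at_right 0)"
      unfolding eventually_at_right_field by (intro exI[of _ 1]) auto
    have 1: "((\<lambda>t. \<bar>I + t * J\<bar>) \<longlongrightarrow> \<bar>I + 0 * J\<bar>) (at_right 0)" by (intro tendsto_intros)
    have 2: "((\<lambda>t. c1 * (K * t + 2 * S * \<eta>) * (1 + d) + c2 * (2 * C + 3 * d\<^sup>2) * t) \<longlongrightarrow>
        c1 * (K * 0 + 2 * S * \<eta>) * (1 + d) + c2 * (2 * C + 3 * d\<^sup>2) * 0) (at_right 0)" by (intro tendsto_intros)
    have "\<bar>I + 0 * J\<bar> \<le> c1 * (K * 0 + 2 * S * \<eta>) * (1 + d) + c2 * (2 * C + 3 * d\<^sup>2) * 0"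
      by (rule tendsto_le[OF trivial_limit_at_right_real 2 1])
         (use ev ev1 in eventually_elim, use C in blast)
    then show ?thesis by simp
  qed
  have "((\<lambda>\<eta>. 2 * S * \<eta>) \<longlongrightarrow> 2 * S * 0) (at_right 0)" by (intro tendsto_intros)
  then have ev: "eventually (\<lambda>\<eta>. 2 * S * \<eta> < 1) (at_right 0)" by (intro order_tendstoD(2)) auto
  have ev0: "eventually (\<lambda>\<eta>::real. 0 < \<eta>) (at_right 0)" by (rule eventually_at_right_less)
  have "((\<lambda>\<eta>. c1 * (2 * S * \<eta>) * (1 + d)) \<longlongrightarrow> c1 * (2 * S * 0) * (1 + d)) (at_right 0)" by (intro tendsto_intros)
  then have "\<bar>I\<bar> \<le> c1 * (2 * S * 0) * (1 + d)"
    by (rule tendsto_lowerbound[rotated 2, OF trivial_limit_at_right_real])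
       (use ev ev0 in eventually_elim, use lim in blast)
  then show "(\<integral>x. (2 * b x $ i * \<phi> x + (\<Sum>k\<in>UNIV. diffusion \<sigma> $ i $ k * partial k \<phi> x)) * \<rho>0 x \<partial>lborel) = 0"
    by (simp add: I_def)
qed

end

theorem theorem2p1:
  fixes M :: "'w measure"
    and B q :: "real \<Rightarrow> 'w \<Rightarrow> real^'d"
    and b :: "real^'d \<Rightarrow> real^'d"
    and \<sigma> :: "real^'d^'d"
    and \<rho>0 :: "real^'d \<Rightarrow> real"
  assumes "brownian_motion M B"
    and "C_inf b"
    and "invertible \<sigma>"
    and "langevin_solution M B b \<sigma> q"
    and "has_density M (q 0) \<rho>0"
    and "\<forall>x. \<rho>0 x > 0"
    and "\<forall>n::nat. n \<ge> 1 \<longrightarrow>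
      (\<exists>K>0. \<forall>x y. norm x \<le> real n \<and> norm y \<le> real n \<longrightarrow> norm (b x - b y) \<le> K * norm (x - y))"
    and "\<exists>C>0. \<forall>x. x \<bullet> b x \<le> C * (1 + (norm x)\<^sup>2)"
  shows "(reversible M q \<longleftrightarrow> symmetric_wrt b \<sigma> \<rho>0)
       \<and> (symmetric_wrt b \<sigma> \<rho>0 \<longleftrightarrow> zero_flux M b \<sigma> q)
       \<and> (zero_flux M b \<sigma> q \<longleftrightarrow> potential_condition b \<sigma> \<rho>0)"
proof -
  interpret brownian_motion M B by fact
  interpret langevin M B q b \<sigma> \<rho>0
    by unfold_locales (use assms in auto)
  note \<rho> = has_density_facts[OF prob_space_axioms assms(5)]
  have weak: "potential_condition b \<sigma> \<rho>0" if "weak_zero_flux b \<sigma> \<rho>0"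
    by (rule weak_zero_flux_imp_potential[OF assms(2,3) that \<rho>(2,3)]) (use assms(6) in auto)
  \<comment> \<open>All equivalences pass through the potential condition: each of the other three
    properties implies it, and it implies each of them.\<close>
  have "potential_condition b \<sigma> \<rho>0" if "reversible M q"
    by (rule weak[OF reversible_imp_weak_zero_flux[OF that]])
  moreover have "potential_condition b \<sigma> \<rho>0" if "symmetric_wrt b \<sigma> \<rho>0"
    by (rule weak[OF symmetric_imp_weak_zero_flux[OF assms(2) \<rho>(2) that]])
  moreover have "potential_condition b \<sigma> \<rho>0" if "zero_flux M b \<sigma> q"
    by (rule zero_flux_imp_potential[OF prob_space_axioms assms(2,3,5) _ that]) (use assms(6) in auto)
  moreover have "reversible M q" "zero_flux M b \<sigma> q" "symmetric_wrt b \<sigma> \<rho>0" if "potential_condition b \<sigma> \<rho>0"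
    by (rule potential_imp_reversible_zero_flux[OF that] potential_imp_symmetric[OF assms(2,3) that])+
  ultimately show ?thesis by blast
qed

end
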